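(* Let $\mu>0$, let $\phi:\mathbb R_+\to\mathbb R_+$ be locally bounded with $\int_0^\infty\phi(t)dt=1$ and $\int_0^\infty t\phi(t)dt=m<\infty$. For $T>1$ let $a_T\in(0,1)$ be given by $T(1-a_T)=1$, let $\phi^T=a_T\phi$, and let $\lambda^T$ be the intensity of the nearly unstable linear Hawkes process with empty history, $$\lambda^T_t=\mu+\iint_{(0,t)\times\mathbb R_+}\phi^T(t-s)\mathbf 1_{\{\theta\le\lambda^T_s\}}N(ds,d\theta),\qquad t\in[0,T].$$ Set $F^T=\iint_{[0,T]\times\mathbb R_+}\frac{\mathbf 1_{\{\theta\le\lambda^T_t\}}}{\sqrt{T\lambda^T_t}}(N(dt,d\theta)-dt\,d\theta)$ and let $G\sim\mathcal N(0,1)$. Then there exists $C>0$ such that for all $T>1$, $$\begin{aligned} d_W(F^T,G)\le{}&\frac{C}{\sqrt T}+\frac1T\mathbb E\Bigg[\int_0^T\sqrt{\lambda^T_t}\sqrt{\mathbb E_t\Big[\int_t^T\Big(1-\sqrt{\tfrac{\lambda^T_s}{\lambda^T_s\circ\varepsilon^+_{(t,0)}}}\Big)^2ds\Big]}\,dt\Bigg]\\ &+\frac1{T^{3/2}}\mathbb E\Bigg[\int_0^T\sqrt{\lambda^T_t}\;\mathbb E_t\Big[\int_t^T\Big(1-\sqrt{\tfrac{\lambda^T_s}{\lambda^T_s\circ\varepsilon^+_{(t,0)}}}\Big)^2ds\Big]dt\Bigg]\\ &+\frac2{T^{3/2}}\mathbb E\Bigg[\int_0^T\sqrt{\int_t^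T\Big(1-\sqrt{\tfrac{\lambda^T_s}{\lambda^T_s\circ\varepsilon^+_{(t,0)}}}\Big)^2ds}\;dt\Bigg].\end{aligned}$$
   Context: $\mathbb R_+=[0,\infty)$. $\Omega$ is the space of point configurations $\omega$ on $\mathbb R\times\mathbb R_+$, $N(B)(\omega)=\omega(B)$, and under $\mathbb P$ the measure $N$ is a Poisson random measure with intensity the Lebesgue measure $dt\,d\theta$. $\mathcal F^N_t=\sigma(N(\mathcal T\times B):\mathcal T\in\mathcal B((-\infty,t]),B\in\mathcal B(\mathbb R_+))$, $\mathbb F^N=(\mathcal F^N_t)_t$, $\mathbb E_t[\cdot]=\mathbb E[\cdot\mid\mathcal F^N_t]$. $\lambda^T$ is the unique $\mathbb F^N$-predictable solution of the displayed equation. Shift operator: $\varepsilon^+_{(t,\theta)}(\omega)(A)=\omega(A\setminus\{(t,\theta)\})+\mathbf 1_A(t,\theta)$. Wasserstein distance: $d_W(F,G)=\sup_u|\mathbb E[u(F)]-\mathbb E[u(G)]|$ over $1$-Lipschitz $u:\mathbb R\to\mathbb R$. *)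

theory Defs
  imports "HOL-Probability.Probability"
begin

section \<open>Point configurations on \<open>\<real> \<times> \<real>\<^sub>+\<close>\<close>

text \<open>Lebesgue measure \<open>dt d\<theta>\<close> on the half plane. Points are pairs \<open>(t, \<theta>)\<close>.\<close>

definition half_plane :: "(real \<times> real) measure" where
  "half_plane = restrict_space lborel (UNIV \<times> {0..})"

text \<open>A configuration is the counting measure \<open>\<Sum>z\<in>S. \<delta>\<^sub>z\<close> of a locally finite set \<open>S\<close> of points.\<close>

definition configs :: "(real \<times> real) measure set" where
  "configs = {\<omega>. sets \<omega> = sets half_plane \<and>
     (\<exists>S \<subseteq> UNIV \<times> {0..}. (\<forall>K. bounded K \<longrightarrow> finite (S \<inter> K)) \<and>
        (\<forall>B \<in> sets half_plane. emeasure \<omega> B = emeasure (count_space UNIV) (S \<inter> B)))}"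

definition config_algebra :: "(real \<times> real) measure measure" where
  "config_algebra = sigma configs
     {{\<omega> \<in> configs. emeasure \<omega> B \<in> U} | B U. B \<in> sets half_plane \<and> U \<in> sets borel}"

definition hist :: "real \<Rightarrow> (real \<times> real) measure measure" where
  "hist t = sigma configs
     {{\<omega> \<in> configs. emeasure \<omega> (A \<times> B) \<in> U} | A B U.
        A \<in> sets borel \<and> A \<subseteq> {..t} \<and> B \<in> sets borel \<and> B \<subseteq> {0..} \<and> U \<in> sets borel}"

definition add_point :: "real \<times> real \<Rightarrow> (real \<times> real) measure \<Rightarrow> (real \<times> real) measure" where
  "add_point z \<omega> = measure_of (space half_plane) (sets half_plane)
     (\<lambda>A. emeasure \<omega> (A - {z}) + indicator A z)"

text \<open>The canonical measure \<open>N(B)(\<omega>) = \<omega>(B)\<close> is a Poisson random measure with intensity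
  \<open>dt d\<theta>\<close> under \<open>P\<close>.\<close>

definition poisson_random_measure :: "(real \<times> real) measure measure \<Rightarrow> bool" where
  "poisson_random_measure P \<longleftrightarrow>
     prob_space P \<and> space P = configs \<and> sets P = sets config_algebra \<and>
     (\<forall>B \<in> sets half_plane. emeasure half_plane B < \<infinity> \<longrightarrow>
        (\<forall>k::nat. measure P {\<omega> \<in> space P. emeasure \<omega> B = of_nat k} =
           measure half_plane B ^ k / fact k * exp (- measure half_plane B))) \<and>
     (\<forall>(I :: nat set) B. finite I \<longrightarrow> B \<in> I \<rightarrow> sets half_plane \<longrightarrow> disjoint_family_on B I \<longrightarrow>
        prob_space.indep_vars P (\<lambda>_. borel) (\<lambda>i \<omega>. emeasure \<omega> (B i)) I)"

text \<open>\<open>\<integral>\<integral>\<^sub>A f(t,\<theta>) (N(dt,d\<theta>) - dt d\<theta>)\<close>, evaluated at \<open>\<omega>\<close>.\<close>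

definition compensated_integral ::
  "(real \<times> real) set \<Rightarrow> (real \<times> real \<Rightarrow> real) \<Rightarrow> (real \<times> real) measure \<Rightarrow> real" where
  "compensated_integral A f \<omega> = (LINT z:A|\<omega>. f z) - (LINT z:A|half_plane. f z)"

section \<open>Predictable processes and the Hawkes intensity\<close>

definition predictable_algebra :: "real \<Rightarrow> (real \<times> (real \<times> real) measure) measure" where
  "predictable_algebra T = sigma ({0..T} \<times> configs)
     ({{0} \<times> A | A. A \<in> sets (hist 0)} \<union>
      {{s<..t} \<times> A | s t A. 0 \<le> s \<and> s < t \<and> t \<le> T \<and> A \<in> sets (hist s)})"

text \<open>The path \<open>l\<close> satisfies the Hawkes equation along \<open>\<omega>\<close> (with \<open>\<nu>\<close> the baseline and \<open>\<psi>\<close> the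
  kernel). The integral is the Lebesgue integral of a nonnegative function; as \<open>l\<close> is real valued,
  the equation says in particular that it is finite.\<close>

definition hawkes_path ::
  "real \<Rightarrow> (real \<Rightarrow> real) \<Rightarrow> real \<Rightarrow> (real \<Rightarrow> real) \<Rightarrow> (real \<times> real) measure \<Rightarrow> bool" where
  "hawkes_path \<nu> \<psi> T l \<omega> \<longleftrightarrow> (\<forall>t\<in>{0..T}.
     ennreal (l t) = ennreal \<nu> +
       (\<integral>\<^sup>+(s, \<theta>) \<in> {0<..<t} \<times> {0..}. ennreal (\<psi> (t - s) * of_bool (\<theta> \<le> l s)) \<partial>\<omega>))"

text \<open>Configurations with a point on the line \<open>\<theta> = 0\<close> form a null set, so an equation that
  holds only almost surely leaves \<open>l\<^sub>s \<circ> \<epsilon>\<^sup>+\<^bsub>(t,0)\<^esub>\<close> undetermined. The Hawkes equation is an equation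
  along each configuration, and here it is also imposed along \<open>\<epsilon>\<^sup>+\<^bsub>(t,0)\<^esub> \<omega>\<close>, for almost
  every \<open>\<omega>\<close>. It cannot be imposed along every \<open>\<omega>\<close>, because there are configurations along which the
  thinned points accumulate.\<close>

definition hawkes_intensity ::
  "(real \<times> real) measure measure \<Rightarrow> real \<Rightarrow> (real \<Rightarrow> real) \<Rightarrow> real \<Rightarrow>
   (real \<Rightarrow> (real \<times> real) measure \<Rightarrow> real) \<Rightarrow> bool" where
  "hawkes_intensity P \<nu> \<psi> T l \<longleftrightarrow>
     (\<lambda>(t, \<omega>). l t \<omega>) \<in> borel_measurable (predictable_algebra T) \<and>
     (AE \<omega> in P. hawkes_path \<nu> \<psi> T (\<lambda>t. l t \<omega>) \<omega>) \<and>
     (\<forall>t\<in>{0..T}. AE \<omega> in P.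
        hawkes_path \<nu> \<psi> T (\<lambda>s. l s (add_point (t, 0) \<omega>)) (add_point (t, 0) \<omega>))"

definition shift_defect ::
  "(real \<Rightarrow> (real \<times> real) measure \<Rightarrow> real) \<Rightarrow> real \<Rightarrow> real \<Rightarrow> (real \<times> real) measure \<Rightarrow> real" where
  "shift_defect l T t \<omega> =
     (LBINT s:{t..T}. (1 - sqrt (l s \<omega> / l s (add_point (t, 0) \<omega>)))\<^sup>2)"

text \<open>\<open>Y t\<close> is a version of \<open>E[X t | hist t]\<close> for each \<open>t\<close>, with \<open>Y\<close> jointly measurable so that it
  may be integrated in time; the versions \<open>real_cond_exp\<close> chooses separately for each \<open>t\<close> need not be.\<close>

definition cond_exp_process ::
  "(real \<times> real) measure measure \<Rightarrow> real \<Rightarrow> (real \<Rightarrow> (real \<times> real) measure \<Rightarrow> real) \<Rightarrow>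
   (real \<Rightarrow> (real \<times> real) measure \<Rightarrow> real) \<Rightarrow> bool" where
  "cond_exp_process P T X Y \<longleftrightarrow>
     (\<lambda>(t, \<omega>). Y t \<omega>) \<in> borel_measurable (restrict_space borel {0..T} \<Otimes>\<^sub>M P) \<and>
     (\<forall>t\<in>{0..T}. AE \<omega> in P. Y t \<omega> = real_cond_exp P (hist t) (X t) \<omega>)"

section \<open>Wasserstein distance\<close>

text \<open>Bochner integrals of non-integrable functions are \<open>0\<close>, hence the guard: the distance is
  infinite unless both variables are integrable.\<close>

definition wasserstein ::
  "'a measure \<Rightarrow> ('a \<Rightarrow> real) \<Rightarrow> 'b measure \<Rightarrow> ('b \<Rightarrow> real) \<Rightarrow> ennreal" where
  "wasserstein M F M' G =
     (if integrable M F \<and> integrable M' G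
      then SUP u \<in> {u :: real \<Rightarrow> real. 1-lipschitz_on UNIV u}.
             ennreal \<bar>(LINT x|M. u (F x)) - (LINT y|M'. u (G y))\<bar>
      else \<infinity>)"

section \<open>Well-definedness\<close>

lemma space_half_plane: "space half_plane = UNIV \<times> {0..}"
  by (simp add: half_plane_def space_restrict_space)

lemma half_plane_set: "UNIV \<times> {0..} \<in> sets (borel :: (real \<times> real) measure)"
  by (simp add: borel_Times)

lemma sets_half_plane: "B \<in> sets half_plane \<longleftrightarrow> B \<in> sets borel \<and> B \<subseteq> UNIV \<times> {0..}"
  unfolding half_plane_def by (subst sets_restrict_space_iff) (auto simp: half_plane_set)

lemma space_config_algebra: "space config_algebra = configs"
  unfolding config_algebra_def by (rule space_measure_of) auto

lemma subalgebra_hist: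
  assumes "poisson_random_measure P"
  shows "subalgebra P (hist t)"
proof -
  let ?G = "{{\<omega> \<in> configs. emeasure \<omega> (A \<times> B) \<in> U} | A B U.
        A \<in> sets borel \<and> A \<subseteq> {..t} \<and> B \<in> sets borel \<and> B \<subseteq> {0..} \<and> U \<in> sets borel}"
  let ?H = "{{\<omega> \<in> configs. emeasure \<omega> B \<in> U} | B U. B \<in> sets half_plane \<and> U \<in> sets borel}"
  have GH: "?G \<subseteq> ?H"
  proof
    fix x assume "x \<in> ?G"
    then obtain A B U where x: "x = {\<omega> \<in> configs. emeasure \<omega> (A \<times> B) \<in> U}"
      and AB: "A \<in> sets borel" "B \<in> sets borel" "B \<subseteq> {0..}" "U \<in> sets borel" by auto
    have "A \<times> B \<in> sets half_plane"
      unfolding sets_half_plane using AB by (auto simp: borel_Times)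
    then show "x \<in> ?H" using x AB(4) by blast
  qed
  have "sets (hist t) = sigma_sets configs ?G" "sets config_algebra = sigma_sets configs ?H"
    "space (hist t) = configs"
    unfolding hist_def config_algebra_def by (auto intro!: sets_measure_of space_measure_of)
  then show ?thesis
    using assms sigma_sets_mono'[OF GH] by (auto simp: subalgebra_def poisson_random_measure_def)
qed

lemma
  assumes \<omega>: "\<omega> \<in> configs" and z: "z \<in> UNIV \<times> {0..}"
  shows emeasure_add_point:
      "\<And>A. A \<in> sets half_plane \<Longrightarrow> emeasure (add_point z \<omega>) A = emeasure \<omega> (A - {z}) + indicator A z"
    and add_point_configs: "add_point z \<omega> \<in> configs"
proof -
  have sets: "sets \<omega> = sets half_plane" using \<omega> by (simp add: configs_def)
  have sing: "{z} \<in> sets half_plane" using z by (simp add: sets_half_plane)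
  let ?f = "\<lambda>A. emeasure \<omega> (A - {z}) + indicator A z"
  have ca: "countably_additive (sets half_plane) ?f"
  proof (rule countably_additiveI)
    fix A :: "nat \<Rightarrow> _" assume A: "range A \<subseteq> sets half_plane" "disjoint_family A"
    have "(\<Sum>i. emeasure \<omega> (A i - {z})) = emeasure \<omega> (\<Union>i. A i - {z})"
      using A sing by (intro suminf_emeasure) (auto simp: sets disjoint_family_on_def)
    moreover have "(\<Sum>i. indicator (A i) z :: ennreal) = indicator (\<Union>i. A i) z"
      using A(2) by (rule suminf_indicator)
    moreover have "(\<Sum>i. ?f (A i)) = (\<Sum>i. emeasure \<omega> (A i - {z})) + (\<Sum>i. indicator (A i) z)"
      by (rule suminf_add[symmetric]) (rule summableI)+
    moreover have "(\<Union>i. A i - {z}) = (\<Union>i. A i) - {z}" by blast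
    ultimately show "(\<Sum>i. ?f (A i)) = ?f (\<Union>i. A i)" by presburger
  qed
  have sets': "sets (add_point z \<omega>) = sets half_plane"
    unfolding add_point_def by simp
  show em: "emeasure (add_point z \<omega>) A = ?f A" if "A \<in> sets half_plane" for A
    using sets.sigma_algebra_axioms _ ca that unfolding add_point_def
    by (rule emeasure_measure_of_sigma) (simp add: positive_def)
  obtain S where S: "S \<subseteq> UNIV \<times> {0..}" "\<And>K. bounded K \<Longrightarrow> finite (S \<inter> K)"
    "\<And>B. B \<in> sets half_plane \<Longrightarrow> emeasure \<omega> B = emeasure (count_space UNIV) (S \<inter> B)"
    using \<omega> by (auto simp: configs_def)
  have "emeasure (add_point z \<omega>) B = emeasure (count_space UNIV) (insert z S \<inter> B)"
    if B: "B \<in> sets half_plane" for B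
  proof (cases "z \<in> B")
    case True
    have "emeasure (count_space UNIV) (insert z S \<inter> B) =
        emeasure (count_space UNIV) ((S \<inter> (B - {z})) \<union> {z})"
      using True by (intro arg_cong[where f = "emeasure _"]) auto
    also have "\<dots> = emeasure (count_space UNIV) (S \<inter> (B - {z})) + emeasure (count_space UNIV) {z}"
      by (rule plus_emeasure[symmetric]) auto
    finally show ?thesis using True B sing by (simp add: em S(3) sets.Diff)
  next
    case False
    then have "insert z S \<inter> B = S \<inter> B" "B - {z} = B" by auto
    then show ?thesis using False B by (simp add: em S(3))
  qed
  moreover have "finite (insert z S \<inter> K)" if "bounded K" for K
    using S(2)[OF that] by (simp add: Int_insert_left)
  ultimately show "add_point z \<omega> \<in> configs"
    using S(1) z sets' unfolding configs_def by (intro CollectI conjI exI[of _ "insert z S"]) auto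
qed

end

theory Submission
	imports Defs
begin

text \<open>Write \<open>M\<^sub>t\<close> for the compensated integral over \<open>[0, t]\<close>. Its predictable bracket is the deterministic
	\<open>t/T\<close> and its jumps are \<open>1/\<surd>(T \<lambda>\<^sub>t)\<close>, so Lindeberg's method along the heat semigroup bounds the distance by
	\<open>C/\<surd>T\<close> plus a multiple of \<open>(1/\<surd>T) \<integral> E[1/\<surd>\<lambda>\<^sub>t]/(1 + T - t) dt\<close> over \<open>[T/2, T]\<close>. The law of the Poisson
	measure is invariant under time shifts, and discarding the points before time \<open>h\<close> lowers the intensity;
	hence \<open>E[1/\<surd>\<lambda>\<^sub>t]\<close> decreases in \<open>t\<close> and the integral is at most \<open>ln (1 + T) E[1/\<surd>\<lambda>\<^bsub>T/2\<^esub>]\<close>. The logarithm is paid for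
	by the first expectation on the right-hand side: adding the point \<open>(t, 0)\<close> raises \<open>\<lambda>\<^sub>s\<close> by at least
	\<open>a \<phi>(s - t)\<close>, which makes that term at least \<open>c E[1/\<lambda>\<^bsub>T/2\<^esub>\<^sup>2]\<close>, and Young's inequality applies.\<close>

text \<open>The third derivative of a Lipschitz function smoothed at scale \<open>s\<close> is of
  order \<open>1 / s\<^sup>2\<close>, not \<open>1 / s ^ 3\<close>. With a preliminary smoothing at
  scale \<open>1 / sqrt T\<close> the variance left at time \<open>t\<close> is
  \<open>(1 + T - t) / T\<close>; this is the origin of the weight and of the logarithm. The cube of
  a jump, integrated against the intensity, leaves \<open>1 / sqrt \<lambda>\<close>. A priori only
  \<open>\<lambda> \<ge> \<mu>\<close> bounds its mean, which would keep the logarithm. But the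
  lower bound of the first expectation contains \<open>1 / \<lambda>\<^sup>2\<close>, the fourth
  power of the same quantity, and this beats \<open>ln (1 + T)\<close> at a cost of order
  \<open>1 / sqrt T\<close>. Stochastic calculus is replaced by a grid: marks are cut at a height
  \<open>R\<close>, the predictable integrand is approximated by step functions, and the cells are
  added one at a time. All integrability rests on a bounded mean of the intensity. The equation
  alone does not give it, since thinned points might accumulate; it comes from Gronwall's inequality
  for truncated counts.\<close>

text \<open>Configurations are called \<open>w\<close>, the paper's \<open>\<omega>\<close>.\<close>

abbreviation bm :: "'a measure => ('a => 'b :: topological_space) set" where
	"bm \<equiv> borel_measurable"

abbreviation hp :: "(real \<times> real) measure" where
	"hp \<equiv> half_plane"

type_synonym config = "(real \<times> real) measure"

abbreviation PA :: "real => (real \<times> config) measure" where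
	"PA T \<equiv> predictable_algebra T"

section \<open>The heat semigroup\<close>

definition gauss :: "real measure" where
	"gauss = density lborel std_normal_density"

text \<open>The parameter \<open>t\<close> is a standard deviation, not the time
  \<open>t\<^sup>2\<close> of the heat flow. Scales therefore combine by adding squares, as in
  \<open>heat_semigroup\<close>.\<close>

definition heat :: "real => (real => real) => real => real" where
	"heat t f x = (LINT z|gauss. f (x + t * z))"

text \<open>The derivative of \<open>heat t f\<close> with the differentiation moved onto the
  Gaussian density, so that \<open>f\<close> itself may be rough.\<close>

definition hder :: "real => (real => real) => real => real" where
	"hder t f x = (LINT z|gauss. f (x + t * z) * z) / t"

text \<open>Covers the Lipschitz test functions and also the bounded functions that arise as
  derivatives of their smoothings; one integrability lemma then serves both.\<close>

definition lin_growth :: "(real => real) => bool" where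
	"lin_growth f \<longleftrightarrow> f \<in> bm borel & (\<exists>K\<ge>0. \<forall>x. \<bar>f x\<bar> <= K * (1 + \<bar>x\<bar>))"

section \<open>Moments and integrability of the standard Gaussian\<close>

lemma sets_gauss [measurable_cong, simp]: "sets gauss = sets borel"
	by (simp add: gauss_def)

lemma space_gauss [simp]: "space gauss = UNIV"
	by (simp add: gauss_def)

interpretation gauss: prob_space gauss
	unfolding gauss_def using prob_space_normal_density[of 1 0] by simp

lemma integral_gauss:
	"f \<in> bm borel ==> (LINT z|gauss. f z) = (LINT z|lborel. std_normal_density z * f z)"
	unfolding gauss_def by (subst integral_density) auto

lemma integrable_gauss:
	"f \<in> bm borel ==>
		integrable gauss f \<longleftrightarrow> integrable lborel (\<lambda>z. std_normal_density z * f z)" for f :: "real => real"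
	unfolding gauss_def by (subst integrable_density) auto

lemma gauss_shift_density:
	"std_normal_density (wt - c) = std_normal_density wt * exp (c * wt - c\<^sup>2 / 2)"
	by (simp add: std_normal_density_def exp_add[symmetric] power2_eq_square field_simps)

lemma gauss_exp_lin: "integrable gauss (\<lambda>z. exp (c * z))"
proof -
	\<comment> \<open>Completing the square: the tilted standard density is
	  \<open>exp (c\<^sup>2 / 2)\<close> times the normal density centred at \<open>c\<close>.\<close>
	have "integrable lborel (\<lambda>z. exp (c\<^sup>2 / 2) * normal_density c 1 z)"
		by (intro integrable_mult_right integrable_normal_density) simp
	also have "(\<lambda>z. exp (c\<^sup>2 / 2) * normal_density c 1 z) = (\<lambda>z. std_normal_density z * exp (c * z))"
		by (auto simp: fun_eq_iff normal_density_def std_normal_density_def exp_add[symmetric] power2_eq_square field_simps)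
	finally show ?thesis by (subst integrable_gauss) auto
qed

lemma gauss_exp_abs: "integrable gauss (\<lambda>z. exp (c * \<bar>z\<bar>))"
proof (rule Bochner_Integration.integrable_bound)
	show "integrable gauss (\<lambda>z. exp (c * z) + exp (- c * z))"
		by (intro Bochner_Integration.integrable_add gauss_exp_lin)
	have "norm (exp (c * \<bar>z\<bar>)) <= norm (exp (c * z) + exp (- c * z))" for z :: real
		by (cases "z >= 0") auto
	then show "AE z in gauss. norm (exp (c * \<bar>z\<bar>)) <= norm (exp (c * z) + exp (- c * z))" by simp
qed auto

lemma gauss_integrable_exp_bound:
	assumes [measurable]: "g \<in> bm borel" and "!!z. \<bar>g z\<bar> <= K * exp (c * \<bar>z\<bar>)"
	shows "integrable gauss g"
proof (rule Bochner_Integration.integrable_bound)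
	show "integrable gauss (\<lambda>z. K * exp (c * \<bar>z\<bar>))" using gauss_exp_abs by simp
	show "AE x in gauss. norm (g x) <= norm (K * exp (c * \<bar>x\<bar>))"
		using assms(2) by (intro AE_I2) (metis abs_ge_self order_trans real_norm_def)
qed auto

lemma one_plus_le_exp: "1 + \<bar>z\<bar> <= exp \<bar>z :: real\<bar>"
	by (rule exp_ge_add_one_self)

lemma gauss_moments:
	shows gauss_int_abs_pow: "integrable gauss (\<lambda>z. \<bar>z\<bar> ^ k)" and gauss_int_pow: "integrable gauss (\<lambda>z. z ^ k)"
		and gauss_mean: "(LINT z|gauss. z) = 0" and gauss_var: "(LINT z|gauss. z\<^sup>2) = 1"
		and gauss_abs1: "(LINT z|gauss. \<bar>z\<bar>) <= 1" and gauss_abs3: "(LINT z|gauss. \<bar>z\<bar> ^ 3) <= 2"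
proof -
	show "integrable gauss (\<lambda>z. \<bar>z\<bar> ^ k)" "integrable gauss (\<lambda>z. z ^ k)"
		using integrable_std_normal_moment_abs integrable_std_normal_moment by (auto simp: integrable_gauss)
	\<comment> \<open>The first and third absolute moments are \<open>sqrt (2 / pi)\<close> and
	  \<open>2 * sqrt (2 / pi)\<close>.\<close>
	have p: "sqrt (2 / pi) <= 1" using pi_ge_two by simp
	show "(LINT z|gauss. z) = 0" using integral_std_normal_moment_odd[of 0] by (simp add: integral_gauss)
	show "(LINT z|gauss. z\<^sup>2) = 1" using integral_std_normal_moment_even[of 1]
		by (simp add: integral_gauss fact_numeral)
	show "(LINT z|gauss. \<bar>z\<bar>) <= 1" using integral_std_normal_moment_abs_odd[of 0] p by (simp add: integral_gauss)
	show "(LINT z|gauss. \<bar>z\<bar> ^ 3) <= 2" using integral_std_normal_moment_abs_odd[of 1] p by (simp add: integral_gauss)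
qed

lemma gauss_int_id: "integrable gauss (\<lambda>z. z)" "integrable gauss (\<lambda>z. \<bar>z\<bar>)"
	using gauss_int_pow[of 1] gauss_int_abs_pow[of 1] by simp_all

lemma lin_growth_bounded:
	assumes "f \<in> bm borel" "!!x. \<bar>f x\<bar> <= B"
	shows "lin_growth f"
proof -
	have B: "0 <= B" using assms(2)[of 0] by linarith
	have "\<bar>f x\<bar> <= B * (1 + \<bar>x\<bar>)" for x
		using assms(2)[of x] B mult_left_mono[of 1 "1 + \<bar>x\<bar>" B] by auto
	then show ?thesis using assms(1) B by (auto simp: lin_growth_def)
qed

lemma lin_growth_lipschitz:
	assumes "1-lipschitz_on UNIV f"
	shows "lin_growth f"
proof -
	have c: "continuous_on UNIV f" using assms lipschitz_on_continuous_on by blast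
	have "\<bar>f x\<bar> <= (1 + \<bar>f 0\<bar>) * (1 + \<bar>x\<bar>)" for x
	proof -
		have "\<bar>f x - f 0\<bar> <= \<bar>x\<bar>" using lipschitz_onD[OF assms, of x 0] by (simp add: dist_real_def)
		then have "\<bar>f x\<bar> <= \<bar>f 0\<bar> + \<bar>x\<bar>" by linarith
		also have "... <= (1 + \<bar>f 0\<bar>) * (1 + \<bar>x\<bar>)" by (simp add: algebra_simps)
		finally show ?thesis .
	qed
	then show ?thesis using c unfolding lin_growth_def
		by (intro conjI borel_measurable_continuous_onI exI[of _ "1 + \<bar>f 0\<bar>"]) auto
qed

lemma lin_growth_affine_bound:
	fixes f :: "real => real"
	assumes K: "K >= 0" "!!x. \<bar>f x\<bar> <= K * (1 + \<bar>x\<bar>)" and t: "0 <= t"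
	shows "\<bar>f (x + t * z)\<bar> <= (K * (1 + \<bar>x\<bar> + t)) * exp \<bar>z\<bar>"
proof -
	have z: "\<bar>t * z\<bar> = t * \<bar>z\<bar>" using t by (simp add: abs_mult)
	have "\<bar>f (x + t * z)\<bar> <= K * (1 + \<bar>x + t * z\<bar>)" using K(2) .
	also have "... <= K * ((1 + \<bar>x\<bar> + t) * (1 + \<bar>z\<bar>))"
	proof (intro mult_left_mono K(1))
		have "1 + \<bar>x + t * z\<bar> <= 1 + \<bar>x\<bar> + t * \<bar>z\<bar>" using z abs_triangle_ineq[of x "t * z"] by linarith
		also have "... <= (1 + \<bar>x\<bar> + t) * (1 + \<bar>z\<bar>)" using t by (simp add: algebra_simps)
		finally show "1 + \<bar>x + t * z\<bar> <= (1 + \<bar>x\<bar> + t) * (1 + \<bar>z\<bar>)" .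
	qed
	also have "... <= (K * (1 + \<bar>x\<bar> + t)) * exp \<bar>z\<bar>"
		using K(1) t one_plus_le_exp[of z] by (simp add: mult.assoc mult_left_mono)
	finally show ?thesis .
qed

lemma lin_growth_integrable:
	assumes "lin_growth f" "0 <= t"
	shows "integrable gauss (\<lambda>z. f (x + t * z))" "integrable gauss (\<lambda>z. f (x + t * z) * z)"
proof -
	obtain K where [measurable]: "f \<in> bm borel" and K: "K >= 0" "!!x. \<bar>f x\<bar> <= K * (1 + \<bar>x\<bar>)"
		using assms(1) unfolding lin_growth_def by blast
	note b = lin_growth_affine_bound[where f = f, OF K assms(2)]
	show "integrable gauss (\<lambda>z. f (x + t * z))"
		using b[of x] by (intro gauss_integrable_exp_bound[where c = 1]) auto
	show "integrable gauss (\<lambda>z. f (x + t * z) * z)"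
	proof (intro gauss_integrable_exp_bound[where c = 2 and K = "K * (1 + \<bar>x\<bar> + t)"])
		fix z :: real
		have "\<bar>f (x + t * z) * z\<bar> <= (K * (1 + \<bar>x\<bar> + t) * exp \<bar>z\<bar>) * exp \<bar>z\<bar>"
			unfolding abs_mult using b[of x z] order_trans[OF _ one_plus_le_exp[of z], of "\<bar>z\<bar>"] by (intro mult_mono) auto
		then show "\<bar>f (x + t * z) * z\<bar> <= K * (1 + \<bar>x\<bar> + t) * exp (2 * \<bar>z\<bar>)"
			by (simp add: mult.assoc exp_add[symmetric])
	qed measurable
qed

section \<open>Smoothing: bounds, derivatives and the semigroup law\<close>

lemma heat_measurable [measurable]:
	assumes [measurable]: "f \<in> bm borel"
	shows "heat t f \<in> bm borel" "hder t f \<in> bm borel"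
	unfolding heat_def[abs_def] hder_def[abs_def] by measurable

text \<open>An average of translates keeps a Lipschitz constant. The second part is the price of
  smoothing: the displacement \<open>t * \<bar>z\<bar>\<close> has mean at most
  \<open>t\<close>.\<close>

lemma heat_lipschitz:
	assumes f: "1-lipschitz_on UNIV f" and t: "0 <= t"
	shows "1-lipschitz_on UNIV (heat t f)" "\<bar>heat t f x - f x\<bar> <= t"
proof -
	note i = lin_growth_integrable(1)[OF lin_growth_lipschitz[OF f] t]
	show "1-lipschitz_on UNIV (heat t f)"
	proof (rule lipschitz_onI)
		fix x y :: real
		have "\<bar>heat t f x - heat t f y\<bar> = \<bar>LINT z|gauss. f (x + t * z) - f (y + t * z)\<bar>"
			unfolding heat_def using i by simp
		also have "... <= (LINT z|gauss. \<bar>f (x + t * z) - f (y + t * z)\<bar>)"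
			using integral_norm_bound[of gauss "\<lambda>z. f (x + t * z) - f (y + t * z)"] by simp
		also have "... <= (LINT z|gauss. \<bar>x - y\<bar>)"
			using lipschitz_onD[OF f, of "x + t * z" "y + t * z" for z] i by (intro integral_mono) (auto simp: dist_real_def)
		finally show "dist (heat t f x) (heat t f y) <= 1 * dist x y"
			by (simp add: dist_real_def gauss.prob_space[simplified])
	qed simp
	have "\<bar>heat t f x - f x\<bar> = \<bar>LINT z|gauss. f (x + t * z) - f x\<bar>"
		unfolding heat_def using i by (simp add: gauss.prob_space[simplified])
	also have "... <= (LINT z|gauss. \<bar>f (x + t * z) - f x\<bar>)"
		using integral_norm_bound[of gauss "\<lambda>z. f (x + t * z) - f x"] by simp
	also have "... <= (LINT z|gauss. t * \<bar>z\<bar>)"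
		using lipschitz_onD[OF f, of "x + t * z" x for z] i t gauss_int_id
		by (intro integral_mono) (auto simp: dist_real_def abs_mult)
	also have "... <= t * 1" using mult_left_mono[OF gauss_abs1 t] by simp
	finally show "\<bar>heat t f x - f x\<bar> <= t" by simp
qed

text \<open>Since the mean of \<open>\<bar>z\<bar>\<close> is at most one, differentiating a
  smoothed bounded function costs a factor \<open>1 / t\<close>.\<close>

lemma heat_bound:
	assumes [measurable]: "f \<in> bm borel" and b: "!!x. \<bar>f x\<bar> <= B" and t: "0 < t"
	shows "\<bar>heat t f x\<bar> <= B" "\<bar>hder t f x\<bar> <= B / t"
proof -
	note i = lin_growth_integrable[OF lin_growth_bounded[OF assms(1) b], of t]
	have B: "0 <= B" using b[of 0] by linarith
	have "\<bar>heat t f x\<bar> <= (LINT z|gauss. \<bar>f (x + t * z)\<bar>)"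
		unfolding heat_def using integral_norm_bound[of gauss "\<lambda>z. f (x + t * z)"] by simp
	also have "... <= (LINT z|gauss. B)" using i t b by (intro integral_mono) auto
	finally show "\<bar>heat t f x\<bar> <= B" by (simp add: gauss.prob_space[simplified])
	have "\<bar>LINT z|gauss. f (x + t * z) * z\<bar> <= (LINT z|gauss. \<bar>f (x + t * z) * z\<bar>)"
		using integral_norm_bound[of gauss "\<lambda>z. f (x + t * z) * z"] by simp
	also have "... <= (LINT z|gauss. B * \<bar>z\<bar>)" 
		using i(2)[of x, THEN integrable_abs] t b gauss_int_id
		by (intro integral_mono) (auto simp: abs_mult mult_right_mono)
	also have "... <= B * 1" using mult_left_mono[OF gauss_abs1 B] by simp
	finally show "\<bar>hder t f x\<bar> <= B / t" unfolding hder_def using t by (simp add: divide_right_mono)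
qed

text \<open>Subtracting \<open>f x\<close>, which is harmless because \<open>gauss\<close> is centred, turns the Lipschitz bound
	into a bound independent of \<open>t\<close>.\<close>

lemma hder_lipschitz_bound:
	assumes f: "1-lipschitz_on UNIV f" and t: "0 < t"
	shows "\<bar>hder t f x\<bar> <= 1"
proof -
	note i = lin_growth_integrable[OF lin_growth_lipschitz[OF f], of t]
	have "(LINT z|gauss. f (x + t * z) * z) = (LINT z|gauss. f (x + t * z) * z - f x * z)"
		using i t gauss_int_id gauss_mean by simp
	also have "... = (LINT z|gauss. (f (x + t * z) - f x) * z)" by (simp add: left_diff_distrib)
	finally have "\<bar>LINT z|gauss. f (x + t * z) * z\<bar> <= (LINT z|gauss. \<bar>(f (x + t * z) - f x) * z\<bar>)"
		using integral_norm_bound[of gauss "\<lambda>z. (f (x + t * z) - f x) * z"] by simp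
	also have "... <= (LINT z|gauss. t * z\<^sup>2)"
	proof (intro integral_mono)
		show "integrable gauss (\<lambda>z. \<bar>(f (x + t * z) - f x) * z\<bar>)"
			using i t gauss_int_id unfolding left_diff_distrib by auto
		show "integrable gauss (\<lambda>z. t * z\<^sup>2)" using gauss_int_pow by simp
		fix z :: real
		have "\<bar>f (x + t * z) - f x\<bar> <= t * \<bar>z\<bar>"
			using lipschitz_onD[OF f, of "x + t * z" x] t by (simp add: dist_real_def abs_mult)
		then have "\<bar>f (x + t * z) - f x\<bar> * \<bar>z\<bar> <= t * \<bar>z\<bar> * \<bar>z\<bar>" by (rule mult_right_mono) simp
		then show "\<bar>(f (x + t * z) - f x) * z\<bar> <= t * z\<^sup>2" by (simp add: abs_mult power2_eq_square mult.assoc)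
	qed
	also have "... = t" using gauss_var by simp
	finally show ?thesis unfolding hder_def using t by simp
qed

text \<open>Cameron-Martin: the shift of the argument is moved onto the Gaussian density.\<close>

lemma heat_shift:
	assumes [measurable]: "f \<in> bm borel" and t: "t > 0"
	shows "heat t f (x + t * c) = (LINT z|gauss. f (x + t * z) * exp (c * z - c\<^sup>2 / 2))"
proof -
	have "heat t f (x + t * c) = (LINT z|lborel. std_normal_density z * f (x + t * c + t * z))"
		unfolding heat_def by (subst integral_gauss) auto
	also have "... = (LINT z|lborel. std_normal_density (z - c) * f (x + t * z))"
		by (subst lborel_integral_real_affine[of 1 _ "- c"]) (auto simp: algebra_simps)
	also have "... = (LINT z|lborel. std_normal_density z * (f (x + t * z) * exp (c * z - c\<^sup>2 / 2)))"
		unfolding gauss_shift_density by (simp add: mult_ac)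
	also have "... = (LINT z|gauss. f (x + t * z) * exp (c * z - c\<^sup>2 / 2))"
		by (subst integral_gauss) auto
	finally show ?thesis .
qed

lemma abs_exp_minus_one_le: "\<bar>exp wt - 1\<bar> <= \<bar>wt\<bar> * exp \<bar>wt :: real\<bar>"
proof (cases "wt >= 0")
	case True
	have "1 + (- wt) <= exp (- wt)" by (rule exp_ge_add_one_self)
	then have "exp wt * (1 - wt) <= exp wt * exp (- wt)" by (intro mult_left_mono) auto
	also have "... = 1" by (simp add: exp_minus)
	finally show ?thesis using True by (simp add: algebra_simps)
next
	case False
	have "\<bar>exp wt - 1\<bar> = 1 - exp wt" using False by simp
	also have "... <= \<bar>wt\<bar>" using exp_ge_add_one_self[of wt] False by linarith
	also have "... <= \<bar>wt\<bar> * exp \<bar>wt\<bar>" using mult_left_mono[of 1 "exp \<bar>wt\<bar>" "\<bar>wt\<bar>"] by simp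
	finally show ?thesis .
qed

text \<open>By \<open>heat_shift\<close> the increment of the argument acts on the exponential
  factor alone. Its difference quotient tends to \<open>z / t\<close> and is dominated by an
  exponential in \<open>\<bar>z\<bar>\<close> uniformly along the sequence, so \<open>f\<close>
  enters only through its growth.\<close>

lemma heat_has_derivative:
	assumes f: "lin_growth f" and t: "t > 0"
	shows "(heat t f has_field_derivative hder t f x) (at x)"
	unfolding has_field_derivative_iff tendsto_at_iff_sequentially
proof (intro allI impI)
	fix X :: "nat => real" assume X: "\<forall>i. X i \<in> UNIV - {x}" "X \<longlonglongrightarrow> x"
	obtain K where [measurable]: "f \<in> bm borel" and K: "K >= 0" "!!x. \<bar>f x\<bar> <= K * (1 + \<bar>x\<bar>)"
		using f unfolding lin_growth_def by blast
	\<comment> \<open>The increment in units of the noise scale: \<open>X i = x + t * c i\<close>, the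
	  form that \<open>heat_shift\<close> expects.\<close>
	define c where "c i = (X i - x) / t" for i
	have cne: "c i ~= 0" for i using X(1) t by (auto simp: c_def)
	have c0: "c \<longlonglongrightarrow> 0" unfolding c_def[abs_def] by (rule tendsto_eq_intros X(2) refl | use t in force)+
	have "Bseq c" using c0 by (intro convergent_imp_Bseq convergentI)
	then obtain C where C: "C > 0" "!!i. \<bar>c i\<bar> <= C" by (auto simp: Bseq_def)
	define s where "s i z = f (x + t * z) * ((exp (c i * z - (c i)\<^sup>2 / 2) - 1) / (c i * t))" for i z
	define wt where "wt z = (K * (1 + \<bar>x\<bar> + t) * exp \<bar>z\<bar>) * ((1 + C) * exp \<bar>z\<bar> * exp (C * \<bar>z\<bar> + C\<^sup>2) / t)" for z
	have w_eq: "wt z = (K * (1 + \<bar>x\<bar> + t) * (1 + C) / t * exp (C\<^sup>2)) * exp ((2 + C) * \<bar>z\<bar>)" for z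
	proof -
		have "exp \<bar>z\<bar> * exp \<bar>z\<bar> * exp (C * \<bar>z\<bar> + C\<^sup>2) = exp (C\<^sup>2) * exp ((2 + C) * \<bar>z\<bar>)"
			unfolding exp_add[symmetric] by (intro arg_cong[where f = exp]) (simp add: algebra_simps)
		moreover have "wt z = (K * (1 + \<bar>x\<bar> + t) * (1 + C) / t) * (exp \<bar>z\<bar> * exp \<bar>z\<bar> * exp (C * \<bar>z\<bar> + C\<^sup>2))"
			unfolding wt_def by simp
		ultimately show ?thesis by simp
	qed
	have "(heat t f (X i) - heat t f x) / (X i - x) = (LINT z|gauss. s i z)" for i
	proof -
		have Xi: "X i = x + t * c i" using t by (simp add: c_def)
		have i1: "integrable gauss (\<lambda>z. f (x + t * z) * exp (c i * z - (c i)\<^sup>2 / 2))"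
		proof (rule gauss_integrable_exp_bound[where K = "K * (1 + \<bar>x\<bar> + t)" and c = "1 + C"])
			fix z
			have "c i * z <= \<bar>c i * z\<bar>" by simp
			also have "... <= C * \<bar>z\<bar>" using C(2)[of i] unfolding abs_mult by (intro mult_right_mono) auto
			finally have "c i * z <= C * \<bar>z\<bar>" .
			then have "c i * z - (c i)\<^sup>2 / 2 <= C * \<bar>z\<bar>" using zero_le_power2[of "c i"] by linarith
			then have "exp (c i * z - (c i)\<^sup>2 / 2) <= exp (C * \<bar>z\<bar>)" by simp
			then have "\<bar>f (x + t * z) * exp (c i * z - (c i)\<^sup>2 / 2)\<bar> <= (K * (1 + \<bar>x\<bar> + t) * exp \<bar>z\<bar>) * exp (C * \<bar>z\<bar>)"
				unfolding abs_mult using lin_growth_affine_bound[where f = f, OF K, of t x z] t K(1)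
				by (intro mult_mono) auto
			then show "\<bar>f (x + t * z) * exp (c i * z - (c i)\<^sup>2 / 2)\<bar> <= K * (1 + \<bar>x\<bar> + t) * exp ((1 + C) * \<bar>z\<bar>)"
				by (simp add: mult.assoc exp_add[symmetric] distrib_right)
		qed measurable
		have i2: "integrable gauss (\<lambda>z. f (x + t * z))" using lin_growth_integrable[OF f] t by simp
		have "heat t f (X i) - heat t f x =
				(LINT z|gauss. f (x + t * z) * exp (c i * z - (c i)\<^sup>2 / 2) - f (x + t * z))"
			unfolding Xi heat_shift[OF \<open>f \<in> _\<close> t] using i1 i2 by (simp add: heat_def)
		also have "... = (LINT z|gauss. s i z * (c i * t))"
			using cne[of i] t by (intro Bochner_Integration.integral_cong) (auto simp: s_def field_simps)
		finally show ?thesis using cne[of i] t Xi by (simp add: field_simps)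
	qed
	moreover have "(\<lambda>i. LINT z|gauss. s i z) \<longlonglongrightarrow> (LINT z|gauss. f (x + t * z) * (z / t))"
	proof (rule integral_dominated_convergence[where w = wt])
		show "integrable gauss wt" unfolding w_eq using gauss_exp_abs by simp
		show "AE z in gauss. (\<lambda>i. s i z) \<longlonglongrightarrow> f (x + t * z) * (z / t)"
		proof (rule AE_I2)
			fix z :: real
			have "((\<lambda>d::real. exp (d * z - d\<^sup>2 / 2)) has_field_derivative z) (at 0)"
				by (auto intro!: derivative_eq_intros)
			then have "((\<lambda>d. (exp (d * z - d\<^sup>2 / 2) - 1) / d) \<longlongrightarrow> z) (at 0)"
				by (simp add: has_field_derivative_iff)
			then have "(\<lambda>i. (exp (c i * z - (c i)\<^sup>2 / 2) - 1) / c i) \<longlonglongrightarrow> z"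
				using c0 cne unfolding tendsto_at_iff_sequentially by (auto simp: o_def)
			then have "(\<lambda>i. f (x + t * z) * ((exp (c i * z - (c i)\<^sup>2 / 2) - 1) / c i / t)) \<longlonglongrightarrow> f (x + t * z) * (z / t)"
				by (intro tendsto_intros) (use t in auto)
			then show "(\<lambda>i. s i z) \<longlonglongrightarrow> f (x + t * z) * (z / t)" by (simp add: s_def)
		qed
		show "AE z in gauss. norm (s i z) <= wt z" for i
		proof (rule AE_I2)
			fix z :: real
			define e where "e = c i * z - (c i)\<^sup>2 / 2"
			have cc: "(c i)\<^sup>2 <= C * \<bar>c i\<bar>"
				using mult_right_mono[OF C(2)[of i], of "\<bar>c i\<bar>"] by (simp add: power2_eq_square)
			have "\<bar>e\<bar> <= \<bar>c i\<bar> * \<bar>z\<bar> + (c i)\<^sup>2 / 2"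
				unfolding e_def using abs_triangle_ineq4[of "c i * z" "(c i)\<^sup>2 / 2"] by (simp add: abs_mult)
			then have "\<bar>e\<bar> <= \<bar>c i\<bar> * \<bar>z\<bar> + C * \<bar>c i\<bar>" using cc zero_le_power2[of "c i"] by linarith
			then have e1: "\<bar>e\<bar> <= \<bar>c i\<bar> * (\<bar>z\<bar> + C)" by (simp add: algebra_simps)
			also have "... <= C * (\<bar>z\<bar> + C)" using C by (intro mult_right_mono) auto
			finally have e2: "\<bar>e\<bar> <= C * \<bar>z\<bar> + C\<^sup>2" by (simp add: algebra_simps power2_eq_square)
			have zC: "\<bar>z\<bar> + C <= (1 + C) * exp \<bar>z\<bar>"
			proof -
				have "\<bar>z\<bar> + C <= (1 + C) * (1 + \<bar>z\<bar>)" using C(1) by (simp add: algebra_simps)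
				also have "... <= (1 + C) * exp \<bar>z\<bar>" using C(1) one_plus_le_exp[of z] by (intro mult_left_mono) auto
				finally show ?thesis .
			qed
			\<comment> \<open>This bound is linear in \<open>e\<close>, hence in \<open>c i\<close>; dividing
			  by \<open>c i * t\<close> leaves a bound that does not depend on \<open>i\<close>.\<close>
			have "\<bar>exp e - 1\<bar> <= \<bar>e\<bar> * exp \<bar>e\<bar>" by (rule abs_exp_minus_one_le)
			also have "... <= (\<bar>c i\<bar> * ((1 + C) * exp \<bar>z\<bar>)) * exp (C * \<bar>z\<bar> + C\<^sup>2)"
				using e2 C(1) by (intro mult_mono order_trans[OF e1] mult_left_mono zC) auto
			finally have "\<bar>exp e - 1\<bar> / \<bar>c i * t\<bar> <= \<bar>c i\<bar> * ((1 + C) * exp \<bar>z\<bar>) * exp (C * \<bar>z\<bar> + C\<^sup>2) / \<bar>c i * t\<bar>"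
				by (rule divide_right_mono) simp
			also have "... = (1 + C) * exp \<bar>z\<bar> * exp (C * \<bar>z\<bar> + C\<^sup>2) / t"
				using cne[of i] t by (simp add: abs_mult)
			finally have b: "\<bar>(exp e - 1) / (c i * t)\<bar> <= (1 + C) * exp \<bar>z\<bar> * exp (C * \<bar>z\<bar> + C\<^sup>2) / t"
				by simp
			have "\<bar>f (x + t * z) * ((exp e - 1) / (c i * t))\<bar> <= wt z"
				unfolding abs_mult[of "f (x + t * z)"] wt_def
				using lin_growth_affine_bound[where f = f, OF K, of t x z] t K(1) b
				by (intro mult_mono) auto
			then show "norm (s i z) <= wt z" by (simp add: s_def e_def)
		qed
	qed (auto simp: s_def[abs_def] wt_def[abs_def])
	ultimately show "((\<lambda>y. (heat t f y - heat t f x) / (y - x)) \<circ> X) \<longlonglongrightarrow> hder t f x"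
		by (simp add: o_def hder_def)
qed

text \<open>The mean value inequality bounds all difference quotients of \<open>f\<close> by
  \<open>B\<close>, so the limit passes under the expectation. In \<open>heat_smooth\<close> this
  carries a derivative gained at an inner smoothing through the outer ones.\<close>

lemma heat_commute_derivative:
	assumes f: "lin_growth f" and df: "!!x. (f has_field_derivative g x) (at x)"
		and [measurable]: "g \<in> bm borel" and b: "!!x. \<bar>g x\<bar> <= B" and t: "t >= 0"
	shows "(heat t f has_field_derivative heat t g x) (at x)"
	unfolding has_field_derivative_iff tendsto_at_iff_sequentially
proof (intro allI impI)
	fix X :: "nat => real" assume X: "\<forall>i. X i \<in> UNIV - {x}" "X \<longlonglongrightarrow> x"
	have [measurable]: "f \<in> bm borel" using f by (auto simp: lin_growth_def)
	have lip: "\<bar>f u - f v\<bar> <= B * \<bar>u - v\<bar>" for u v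
		using field_differentiable_bound[of UNIV f g B u v] df b by auto
	define s where "s i z = (f (X i + t * z) - f (x + t * z)) / (X i - x)" for i z
	have "(heat t f (X i) - heat t f x) / (X i - x) = (LINT z|gauss. s i z)" for i
		unfolding heat_def s_def using lin_growth_integrable[OF f t] by simp
	moreover have "(\<lambda>i. LINT z|gauss. s i z) \<longlonglongrightarrow> (LINT z|gauss. g (x + t * z))"
	proof (rule integral_dominated_convergence[where w = "\<lambda>_. B"])
		show "AE z in gauss. (\<lambda>i. s i z) \<longlonglongrightarrow> g (x + t * z)"
		proof (rule AE_I2)
			fix z :: real
			have d: "((\<lambda>y. (f y - f (x + t * z)) / (y - (x + t * z))) \<longlongrightarrow> g (x + t * z)) (at (x + t * z))"
				using df[of "x + t * z"] by (simp add: has_field_derivative_iff)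
			have "(\<lambda>i. X i + t * z) \<longlonglongrightarrow> x + t * z" by (intro tendsto_intros X)
			then show "(\<lambda>i. s i z) \<longlonglongrightarrow> g (x + t * z)"
				using d[unfolded tendsto_at_iff_sequentially, rule_format, of "\<lambda>i. X i + t * z"] X(1)
				by (simp add: o_def s_def)
		qed
		show "AE z in gauss. norm (s i z) <= B" for i
			using lip[of "X i + t * z" "x + t * z" for z] X(1) by (auto simp: s_def divide_simps)
	qed (auto simp: s_def[abs_def])
	ultimately show "((\<lambda>y. (heat t f y - heat t f x) / (y - x)) \<circ> X) \<longlonglongrightarrow> heat t g x"
		by (simp add: o_def heat_def)
qed

lemma distributed_gauss: "distributed gauss lborel (\<lambda>z. z) std_normal_density"
	unfolding distributed_def by (auto simp: gauss_def distr_id2)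

lemma gauss_pair:
	shows "distr (gauss \<Otimes>\<^sub>M gauss) gauss fst = gauss" "distr (gauss \<Otimes>\<^sub>M gauss) gauss snd = gauss"
proof -
	show "distr (gauss \<Otimes>\<^sub>M gauss) gauss fst = gauss" by (rule gauss.distr_pair_fst)
	show "distr (gauss \<Otimes>\<^sub>M gauss) gauss snd = gauss"
	proof (rule measure_eqI)
		fix A assume "A \<in> sets (distr (gauss \<Otimes>\<^sub>M gauss) gauss snd)"
		then have A: "A \<in> sets gauss" by simp
		have "snd -` A Int space (gauss \<Otimes>\<^sub>M gauss) = UNIV \<times> A" by (auto simp: space_pair_measure)
		then show "emeasure (distr (gauss \<Otimes>\<^sub>M gauss) gauss snd) A = emeasure gauss A"
			using A gauss.emeasure_space_1
			by (simp add: emeasure_distr gauss.emeasure_pair_measure_Times)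
	qed simp
qed

text \<open>Variances of independent centred Gaussians add. The iterated integral is read as an
  expectation over two copies of \<open>gauss\<close>, whose coordinates are independent under the
  product measure.\<close>

lemma heat_semigroup:
	assumes f: "lin_growth f" and rs: "r > 0" "s > 0"
	shows "heat r (heat s f) x = heat (sqrt (r\<^sup>2 + s\<^sup>2)) f x"
proof -
	obtain K where [measurable]: "f \<in> bm borel" and K: "K >= 0" "!!x. \<bar>f x\<bar> <= K * (1 + \<bar>x\<bar>)"
		using f unfolding lin_growth_def by blast
	interpret gg: pair_prob_space gauss gauss ..
	let ?M = "gauss \<Otimes>\<^sub>M gauss"
	have dd: "distr ?M lborel fst = gauss" "distr ?M lborel snd = gauss" "distr ?M borel fst = gauss" "distr ?M borel snd = gauss"
		using gauss_pair by (simp_all cong: distr_cong)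
	have d1: "distributed ?M lborel fst std_normal_density"
		and d2: "distributed ?M lborel snd std_normal_density"
		unfolding distributed_def using dd by (auto simp: gauss_def[symmetric] cong: measurable_cong_sets)
	have ind: "gg.indep_var borel fst borel snd"
	proof -
		have "distr ?M borel fst \<Otimes>\<^sub>M distr ?M borel snd = ?M" using dd by simp
		moreover have "distr ?M (borel \<Otimes>\<^sub>M borel) (\<lambda>x. (fst x, snd x)) = ?M"
			unfolding prod.collapse by (rule distr_id2, rule sets_pair_measure_cong) (simp_all only: sets_gauss)
		ultimately show ?thesis unfolding gg.indep_var_distribution_eq by simp
	qed
	have D: "distributed ?M lborel (\<lambda>p. r * fst p + s * snd p) (normal_density 0 (sqrt (r\<^sup>2 + s\<^sup>2)))"
		using gg.add_indep_normal[OF gg.indep_var_compose[OF ind, of "\<lambda>x. r * x" borel "\<lambda>x. s * x" borel, unfolded o_def]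
				rs, of 0 0]
			gg.normal_density_affine[OF d1, of r 0] gg.normal_density_affine[OF d2, of s 0] rs by simp
	define q where "q = sqrt (r\<^sup>2 + s\<^sup>2)"
	have q: "q > 0" using rs by (simp add: q_def add_pos_pos)
	have Dq: "distributed gauss lborel (\<lambda>z. q * z) (normal_density 0 q)"
		using gauss.normal_density_affine[OF distributed_gauss, of q 0] q by simp
	have int: "integrable ?M (\<lambda>p. f (x + (r * fst p + s * snd p)))"
	proof (rule Bochner_Integration.integrable_bound)
		have "integrable ?M (\<lambda>p. \<bar>fst p\<bar>)" 
			using gauss_int_id(2) integrable_distr_eq[of fst ?M gauss "\<lambda>z. \<bar>z\<bar>"] by (simp add: gauss_pair)
		moreover have "integrable ?M (\<lambda>p. \<bar>snd p\<bar>)" 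
			using gauss_int_id(2) integrable_distr_eq[of snd ?M gauss "\<lambda>z. \<bar>z\<bar>"] by (simp add: gauss_pair)
		ultimately show "integrable ?M (\<lambda>p. K * (1 + \<bar>x\<bar> + r * \<bar>fst p\<bar> + s * \<bar>snd p\<bar>))"
			by simp
		show "AE p in ?M. norm (f (x + (r * fst p + s * snd p))) <= norm (K * (1 + \<bar>x\<bar> + r * \<bar>fst p\<bar> + s * \<bar>snd p\<bar>))"
		proof (rule AE_I2)
			fix p :: "real \<times> real"
			have "\<bar>x + (r * fst p + s * snd p)\<bar> <= \<bar>x\<bar> + r * \<bar>fst p\<bar> + s * \<bar>snd p\<bar>"
				using rs abs_triangle_ineq[of x "r * fst p + s * snd p"] abs_triangle_ineq[of "r * fst p" "s * snd p"]
				by (simp add: abs_mult)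
			then have "K * (1 + \<bar>x + (r * fst p + s * snd p)\<bar>) <= K * (1 + \<bar>x\<bar> + r * \<bar>fst p\<bar> + s * \<bar>snd p\<bar>)"
				using K(1) by (intro mult_left_mono) auto
			then show "norm (f (x + (r * fst p + s * snd p))) <= norm (K * (1 + \<bar>x\<bar> + r * \<bar>fst p\<bar> + s * \<bar>snd p\<bar>))"
				using K(2)[of "x + (r * fst p + s * snd p)"] by (simp add: abs_le_iff)
		qed
	qed measurable
	have "heat r (heat s f) x = (LINT y|gauss. LINT z|gauss. f (x + (r * y + s * z)))"
		by (simp add: heat_def add.assoc)
	also have "... = (LINT p|?M. f (x + (r * fst p + s * snd p)))"
		using gg.integral_fst[of "\<lambda>y z. f (x + (r * y + s * z))"] int by (simp add: case_prod_beta')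
	also have "... = (LINT wt|lborel. normal_density 0 q wt * f (x + wt))"
		using distributed_integral[OF D, of "\<lambda>wt. f (x + wt)"] by (simp add: q_def)
	also have "... = heat q f x"
		using distributed_integral[OF Dq, of "\<lambda>wt. f (x + wt)"] by (simp add: heat_def)
	finally show ?thesis by (simp add: q_def)
qed

section \<open>Taylor expansion of smoothed test functions\<close>

lemma taylor2_lipschitz:
	fixes v v1 v2 :: "real => real"
	assumes "!!x. (v has_field_derivative v1 x) (at x)" "!!x. (v1 has_field_derivative v2 x) (at x)"
		and "!!x. (v2 has_field_derivative v3 x) (at x)" "!!x. \<bar>v3 x\<bar> <= L"
	shows "\<bar>v (x + d) - v x - v1 x * d - v2 x * d\<^sup>2 / 2\<bar> <= L * \<bar>d\<bar> ^ 3"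
proof (cases "d = 0")
	case False
	define D where "D m = (if m = 0 then v else if m = Suc 0 then v1 else if m = 2 then v2 else v3)" for m
	have "\<forall>m t. m < 3 & min x (x+d) <= t & t <= max x (x+d) --> (D m has_field_derivative D (Suc m) t) (at t)"
		using assms(1-3) by (auto simp: D_def less_Suc_eq numeral_3_eq_3 numeral_2_eq_2)
	then obtain s where "v (x + d) = (\<Sum>m<3. D m x / fact m * (x + d - x) ^ m) + D 3 s / fact 3 * (x + d - x) ^ 3"
		using Taylor[of 3 D v "min x (x+d)" "max x (x+d)" x "x + d"] False
		by (auto simp: D_def)
	then have "v (x + d) - v x - v1 x * d - v2 x * d\<^sup>2 / 2 = v3 s * d ^ 3 / 6"
		by (simp add: D_def numeral_3_eq_3 numeral_2_eq_2 fact_numeral power2_eq_square)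
	then have "\<bar>v (x + d) - v x - v1 x * d - v2 x * d\<^sup>2 / 2\<bar> = \<bar>v3 s\<bar> * \<bar>d\<bar> ^ 3 / 6"
		by (simp only:) (simp add: abs_mult power_abs)
	\<comment> \<open>The factor \<open>1 / 6\<close> of the Lagrange remainder is given away.\<close>
	also have "... <= L * \<bar>d\<bar> ^ 3"
	proof -
		have "\<bar>v3 s\<bar> * \<bar>d\<bar> ^ 3 <= L * \<bar>d\<bar> ^ 3" using assms(4) by (intro mult_right_mono) auto
		moreover have "0 <= \<bar>v3 s\<bar> * \<bar>d\<bar> ^ 3" by simp
		ultimately show ?thesis by linarith
	qed
	finally show ?thesis .
qed simp

text \<open>Write \<open>heat s h\<close> as three successive smoothings at scale \<open>s / sqrt 3\<close>, each of which absorbs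
	one derivative.\<close>

lemma heat_smooth:
	assumes h: "1-lipschitz_on UNIV h" and s: "s > 0"
	obtains v1 v2 :: "real => real" where
		"v1 \<in> bm borel" "v2 \<in> bm borel"
		"!!x. \<bar>v1 x\<bar> <= 1" "!!x. \<bar>v2 x\<bar> <= 2 / s"
		"!!x d. \<bar>heat s h (x + d) - heat s h x - v1 x * d - v2 x * d\<^sup>2 / 2\<bar> <= 3 / s\<^sup>2 * \<bar>d\<bar> ^ 3"
		"!!x d. \<bar>v2 (x + d) - v2 x\<bar> <= 3 / s\<^sup>2 * \<bar>d\<bar>"
proof -
	define t where "t = s / sqrt 3"
	have t: "t > 0" using s by (simp add: t_def)
	have tt: "t\<^sup>2 = s\<^sup>2 / 3" by (simp add: t_def power_divide)
	have lh: "lin_growth h" using lin_growth_lipschitz[OF h] .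
	have lph: "1-lipschitz_on UNIV (heat t h)" using heat_lipschitz[OF h] t by simp
	have lpph: "1-lipschitz_on UNIV (heat t (heat t h))" using heat_lipschitz[OF lph] t by simp
	have [measurable]: "h \<in> bm borel" using lh by (simp add: lin_growth_def)
	have eq: "heat t (heat t (heat t h)) = heat s h"
	proof
		fix x
		have "heat t (heat t h) = heat (sqrt (t\<^sup>2 + t\<^sup>2)) h" using heat_semigroup[OF lh t t] by (simp add: fun_eq_iff)
		then have "heat t (heat t (heat t h)) x = heat t (heat (sqrt (t\<^sup>2 + t\<^sup>2)) h) x" by simp
		also have "... = heat (sqrt (t\<^sup>2 + (sqrt (t\<^sup>2 + t\<^sup>2))\<^sup>2)) h x"
			using t by (intro heat_semigroup lh) (auto simp: add_pos_pos)
		also have "sqrt (t\<^sup>2 + (sqrt (t\<^sup>2 + t\<^sup>2))\<^sup>2) = s" using s by (simp add: tt)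
		finally show "heat t (heat t (heat t h)) x = heat s h x" .
	qed
	\<comment> \<open>Only the second and third derivatives cost a factor \<open>1 / t\<close>; the
	  first is bounded by one because \<open>h\<close> is Lipschitz. Hence the order
	  \<open>1 / s\<^sup>2\<close>, which leads to a logarithm rather than a power of
	  \<open>T\<close>.\<close>
	define g where "g = hder t h"
	have [measurable]: "g \<in> bm borel" unfolding g_def by simp
	have gb: "\<bar>g x\<bar> <= 1" for x unfolding g_def by (rule hder_lipschitz_bound[OF h t])
	have lg: "lin_growth g" by (rule lin_growth_bounded[OF _ gb]) simp
	define p where "p = hder t g"
	have [measurable]: "p \<in> bm borel" unfolding p_def by simp
	have pb: "\<bar>p x\<bar> <= 1 / t" for x unfolding p_def by (rule heat_bound[OF _ gb t]) simp
	have lp: "lin_growth p" by (rule lin_growth_bounded[OF _ pb]) simp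
	have hg: "\<bar>heat t g x\<bar> <= 1" for x by (rule heat_bound(1)[OF _ gb t]) simp
	have lhg: "lin_growth (heat t g)" by (rule lin_growth_bounded[OF _ hg]) simp
	have d1: "(heat t h has_field_derivative g x) (at x)" for x
		unfolding g_def by (rule heat_has_derivative[OF lh t])
	have d2: "(heat t (heat t h) has_field_derivative heat t g x) (at x)" for x
		using t by (intro heat_commute_derivative[OF lin_growth_lipschitz[OF lph] d1 _ gb]) auto
	have d3: "(heat s h has_field_derivative heat t (heat t g) x) (at x)" for x
		unfolding eq[symmetric] using t by (intro heat_commute_derivative[OF lin_growth_lipschitz[OF lpph] d2 _ hg]) auto
	have d4: "(heat t g has_field_derivative p x) (at x)" for x
		unfolding p_def by (rule heat_has_derivative[OF lg t])
	have d5: "(heat t (heat t g) has_field_derivative heat t p x) (at x)" for x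
		using t by (intro heat_commute_derivative[OF lhg d4 _ pb]) auto
	have d6: "(heat t p has_field_derivative hder t p x) (at x)" for x
		by (rule heat_has_derivative[OF lp t])
	have b6: "\<bar>hder t p x\<bar> <= 3 / s\<^sup>2" for x
	proof -
		have "\<bar>hder t p x\<bar> <= 1 / t / t" by (rule heat_bound(2)[OF _ pb t]) simp
		also have "... = 1 / t\<^sup>2" by (simp add: power2_eq_square)
		finally show ?thesis unfolding tt by simp
	qed
	have "1 / t <= 2 / s"
		using s real_sqrt_le_mono[of 3 "4::real"] by (simp add: t_def field_simps)
	then have "\<bar>heat t p x\<bar> <= 2 / s" for x
		by (rule order_trans[rotated]) (rule heat_bound(1)[OF _ pb t], simp)
	moreover have "\<bar>heat t (heat t g) x\<bar> <= 1" for x by (rule heat_bound(1)[OF _ hg t]) simp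
	moreover have "\<bar>heat t p (x + d) - heat t p x\<bar> <= 3 / s\<^sup>2 * \<bar>d\<bar>" for x d :: real
		using field_differentiable_bound[OF convex_UNIV, of "heat t p" "hder t p" "3 / s\<^sup>2" "x + d" x] d6 b6 by auto
	ultimately show thesis
		using taylor2_lipschitz[OF d3 d5 d6 b6] by (intro that[of "heat t (heat t g)" "heat t p"]) auto
qed

section \<open>Counts of a Poisson random measure\<close>

text \<open>The information in the points of an arbitrary region \<open>C\<close>. Half planes in
  time are too coarse, because the cells of one time slab are revealed one after another.\<close>

definition hist_on :: "(real \<times> real) set => config measure" where
	"hist_on C = sigma configs {{w \<in> configs. emeasure w B \<in> U} | B U.
		 B \<in> sets hp & B \<subseteq> C & U \<in> sets borel}"

lemma space_hist_on [simp]: "space (hist_on C) = configs"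
	unfolding hist_on_def by (rule space_measure_of) auto

lemma sets_hist_on:
	"sets (hist_on C) = sigma_sets configs {{w \<in> configs. emeasure w B \<in> U} | B U.
		 B \<in> sets hp & B \<subseteq> C & U \<in> sets borel}"
	unfolding hist_on_def by (rule sets_measure_of) auto

lemma space_hist [simp]: "space (hist t) = configs"
	unfolding hist_def by (rule space_measure_of) auto

lemma measurable_hist_on:
	assumes "B \<in> sets hp" "B \<subseteq> C"
	shows "(\<lambda>w. emeasure w B) \<in> bm (hist_on C)"
proof (rule measurableI)
	fix U :: "ennreal set" assume "U \<in> sets borel"
	then have "{w \<in> configs. emeasure w B \<in> U} \<in> sets (hist_on C)"
		unfolding sets_hist_on using assms by (intro sigma_sets.Basic) blast
	also have "{w \<in> configs. emeasure w B \<in> U} = (\<lambda>w. emeasure w B) -` U Int space (hist_on C)" by auto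
	finally show "(\<lambda>w. emeasure w B) -` U Int space (hist_on C) \<in> sets (hist_on C)" .
qed simp

lemma hist_on_Collect:
	"B \<in> sets hp ==> B \<subseteq> C ==> U \<in> sets borel ==>
		{w \<in> configs. emeasure w B \<in> U} \<in> sets (hist_on C)"
	unfolding sets_hist_on by (intro sigma_sets.Basic) blast

lemma hist_on_mono: "C \<subseteq> D ==> sets (hist_on C) \<subseteq> sets (hist_on D)"
	unfolding sets_hist_on by (rule sigma_sets_mono') blast

lemma hist_le_hist_on: "sets (hist t) \<subseteq> sets (hist_on ({..t} \<times> UNIV))"
proof -
	have "sets (hist t) = sigma_sets configs {{w \<in> configs. emeasure w (A \<times> B) \<in> U} | A B U.
				A \<in> sets borel & A \<subseteq> {..t} & B \<in> sets borel & B \<subseteq> {0..} & U \<in> sets borel}"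
		unfolding hist_def by (rule sets_measure_of) auto
	also have "... \<subseteq> sets (hist_on ({..t} \<times> UNIV))"
		unfolding sets_hist_on
	proof (rule sigma_sets_mono', safe)
		fix A B :: "real set" and U :: "ennreal set"
		assume "A \<in> sets borel" "A \<subseteq> {..t}" "B \<in> sets borel" "B \<subseteq> {0..}" "U \<in> sets borel"
		then show "\<exists>B' U'. {w \<in> configs. emeasure w (A \<times> B) \<in> U} = {w \<in> configs. emeasure w B' \<in> U'} &
				B' \<in> sets hp & B' \<subseteq> {..t} \<times> UNIV & U' \<in> sets borel"
			by (intro exI[of _ "A \<times> B"] exI[of _ U]) (auto simp: sets_half_plane borel_Times)
	qed
	finally show ?thesis .
qed

lemma hist_mono: "s <= t ==> sets (hist s) \<subseteq> sets (hist t)"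
proof -
	assume "s <= t"
	have eq: "sets (hist t) = sigma_sets configs {{w \<in> configs. emeasure w (A \<times> B) \<in> U} | A B U.
				A \<in> sets borel & A \<subseteq> {..t} & B \<in> sets borel & B \<subseteq> {0..} & U \<in> sets borel}" for t
		unfolding hist_def by (rule sets_measure_of) auto
	have "A \<subseteq> {..t}" if "A \<subseteq> {..s}" for A using that \<open>s <= t\<close> by auto
	then show ?thesis unfolding eq by (intro sigma_sets_mono') blast
qed

lemma measurable_hist:
	assumes "A \<in> sets borel" "A \<subseteq> {..t}" "B \<in> sets borel" "B \<subseteq> {0..}"
	shows "(\<lambda>w. emeasure w (A \<times> B)) \<in> bm (hist t)"
proof (rule measurableI)
	fix U :: "ennreal set" assume "U \<in> sets borel"
	then have "{w \<in> configs. emeasure w (A \<times> B) \<in> U} \<in> sets (hist t)"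
	proof -
		assume U: "U \<in> sets borel"
		show ?thesis unfolding hist_def
		proof (subst sets_measure_of)
			show "{w \<in> configs. emeasure w (A \<times> B) \<in> U} \<in> sigma_sets configs
				{{w \<in> configs. emeasure w (A \<times> B) \<in> U} | A B U.
					A \<in> sets borel & A \<subseteq> {..t} & B \<in> sets borel & B \<subseteq> {0..} & U \<in> sets borel}"
				by (rule sigma_sets.Basic, rule CollectI, rule exI[of _ A], rule exI[of _ B], rule exI[of _ U]) (use U assms in simp)
		qed blast
	qed
	also have "{w \<in> configs. emeasure w (A \<times> B) \<in> U} = (\<lambda>w. emeasure w (A \<times> B)) -` U Int space (hist t)" by auto
	finally show "(\<lambda>w. emeasure w (A \<times> B)) -` U Int space (hist t) \<in> sets (hist t)" .
qed simp

section \<open>Finite counts and intersection-stable generators\<close>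

lemma configs_sets: "w \<in> configs ==> sets w = sets hp"
	by (simp add: configs_def)

lemma configs_space: "w \<in> configs ==> space w = UNIV \<times> {0..}"
	using sets_eq_imp_space_eq[of w hp] by (simp add: configs_def space_half_plane)

lemma configs_bounded:
	assumes "w \<in> configs" "bounded B" "B \<in> sets hp"
	shows "emeasure w B < \<infinity>" "\<exists>k::nat. emeasure w B = of_nat k"
proof -
	obtain S where "\<forall>K. bounded K --> finite (S Int K)"
		"\<forall>B\<in>sets hp. emeasure w B = emeasure (count_space UNIV) (S Int B)"
		using assms(1) by (auto simp: configs_def)
	then have S: "finite (S Int B)" "emeasure w B = emeasure (count_space UNIV) (S Int B)"
		using assms(2,3) by auto
	have "emeasure w B = of_nat (card (S Int B))"
		using S by (simp add: emeasure_count_space_finite)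
	then show "\<exists>k::nat. emeasure w B = of_nat k" "emeasure w B < \<infinity>" by (auto simp: of_nat_less_top)
qed

text \<open>The nonempty membership patterns index the atoms generated by the \<open>B i\<close>.
  Counts of overlapping sets thus become sums of counts of disjoint sets, for which independence is
  given.\<close>

lemma half_plane_atoms:
	fixes B :: "nat => (real \<times> real) set"
	assumes B: "!!i. i < n ==> B i \<in> sets hp"
	obtains m :: nat and A :: "nat => (real \<times> real) set" and K :: "nat => nat set" where
		"!!k. k < m ==> A k \<in> sets hp" "!!k. k < m ==> A k \<subseteq> (\<Union>i<n. B i)"
		"disjoint_family_on A {..<m}" "!!i. i < n ==> K i \<subseteq> {..<m}" "!!i. i < n ==> B i = (\<Union>k\<in>K i. A k)"
		"!!k. k < m ==> \<exists>i<n. A k \<subseteq> B i"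
proof -
	define Js where "Js = Pow {..<n} - {{}}"
	have "finite Js" by (simp add: Js_def)
	then obtain e where e: "bij_betw e {0..<card Js} Js" using ex_bij_betw_nat_finite by blast
	let ?m = "card Js"
	define A where "A k = {z. \<forall>i<n. z \<in> B i \<longleftrightarrow> i \<in> e k} Int (\<Union>i<n. B i)" for k
	have ek: "e k \<in> Js" if "k < ?m" for k using e that by (auto simp: bij_betw_def)
	have Aeq: "A k = (\<Inter>i\<in>{..<n}. if i \<in> e k then B i else UNIV \<times> {0..} - B i) Int (\<Union>i<n. B i)" for k
	proof -
		have "B i \<subseteq> UNIV \<times> {0..}" if "i < n" for i using B[OF that] by (simp add: sets_half_plane)
		then have "z \<in> UNIV \<times> {0..}" if "z \<in> (\<Union>i<n. B i)" for z using that by blast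
		moreover have "z \<in> (if i \<in> e k then B i else UNIV \<times> {0..} - B i) \<longleftrightarrow> (z \<in> B i \<longleftrightarrow> i \<in> e k)"
			if "z \<in> UNIV \<times> {0..}" for z i using that by simp
		ultimately show ?thesis unfolding A_def by (intro set_eqI) (simp only: Int_iff INT_iff mem_Collect_eq lessThan_iff, blast)
	qed
	show thesis
	proof (rule that[of ?m A "\<lambda>i. {k. k < ?m & i \<in> e k}"])
		fix k assume k: "k < ?m"
		have U: "(\<Union>i<n. B i) \<in> sets hp" using B by (intro sets.finite_UN) auto
		have sp: "UNIV \<times> {0..} \<in> sets hp" by (simp add: sets_half_plane borel_Times)
		show "A k \<in> sets hp"
		proof (cases "n = 0")
			case False
			then show ?thesis unfolding Aeq using B U sp
				by (intro sets.Int sets.finite_INT) auto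
		qed (simp add: A_def)
		show "A k \<subseteq> (\<Union>i<n. B i)" by (auto simp: A_def)
		obtain i where "i \<in> e k" "i < n" using ek[OF k] by (auto simp: Js_def)
		then show "\<exists>i<n. A k \<subseteq> B i" by (auto simp: A_def)
	next
		show "disjoint_family_on A {..<?m}"
			unfolding disjoint_family_on_def
		proof (intro ballI impI)
			fix k l assume kl: "k \<in> {..<?m}" "l \<in> {..<?m}" "k ~= l"
			then have "e k ~= e l" using e by (auto simp: bij_betw_def inj_on_def)
			moreover have "e k \<subseteq> {..<n}" "e l \<subseteq> {..<n}" using ek kl by (auto simp: Js_def)
			ultimately obtain i where "i < n" "(i \<in> e k) ~= (i \<in> e l)" by blast
			then show "A k Int A l = {}" by (auto simp: A_def)
		qed
	next
		fix i assume i: "i < n"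
		show "B i = (\<Union>k\<in>{k. k < ?m & i \<in> e k}. A k)"
		proof (intro equalityI subsetI)
			fix z assume z: "z \<in> B i"
			define J where "J = {j. j < n & z \<in> B j}"
			have "J \<in> Js" using z i by (auto simp: J_def Js_def)
			then have "J \<in> e ` {0..<?m}" using e by (simp add: bij_betw_def)
			then obtain k where "k < ?m" "e k = J" by auto
			then show "z \<in> (\<Union>k\<in>{k. k < ?m & i \<in> e k}. A k)"
				using z i by (auto simp: A_def J_def)
		qed (use i in \<open>auto simp: A_def\<close>)
	qed auto
qed

text \<open>Cylinders over finitely many counts can be intersected by concatenating their index
  ranges. Independence and equality of laws may therefore be tested on them.\<close>

lemma hist_on_pi_generator:
	defines "G C \<equiv> {{w \<in> configs. \<forall>i<n. emeasure w (B i) \<in> U i} | (n::nat) B U.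
		 \<forall>i<n. B i \<in> sets hp & B i \<subseteq> C & U i \<in> sets borel}"
	shows "Int_stable (G C)" "sets (hist_on C) = sigma_sets configs (G C)" "G C \<subseteq> Pow configs"
proof -
	show "Int_stable (G C)"
	proof (rule Int_stableI)
		fix a b assume "a \<in> G C" "b \<in> G C"
		then obtain n n' :: nat and B U B' U' where a: "a = {w \<in> configs. \<forall>i<n. emeasure w (B i) \<in> U i}"
			"\<forall>i<n. B i \<in> sets hp & B i \<subseteq> C & U i \<in> sets borel"
			and b: "b = {w \<in> configs. \<forall>i<n'. emeasure w (B' i) \<in> U' i}"
			"\<forall>i<n'. B' i \<in> sets hp & B' i \<subseteq> C & U' i \<in> sets borel"
			unfolding G_def by blast
		define D where "D i = (if i < n then B i else B' (i - n))" for i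
		define V where "V i = (if i < n then U i else U' (i - n))" for i
		have "(\<forall>i<n+n'. emeasure w (D i) \<in> V i) \<longleftrightarrow>
				(\<forall>i<n. emeasure w (B i) \<in> U i) & (\<forall>i<n'. emeasure w (B' i) \<in> U' i)" for w
		proof safe
			fix i assume *: "\<forall>i<n+n'. emeasure w (D i) \<in> V i"
			show "emeasure w (B i) \<in> U i" if "i < n" using *[rule_format, of i] that by (simp add: D_def V_def)
			show "emeasure w (B' i) \<in> U' i" if "i < n'" using *[rule_format, of "n + i"] that by (simp add: D_def V_def)
		qed (auto simp: D_def V_def)
		then have "a Int b = {w \<in> configs. \<forall>i<n+n'. emeasure w (D i) \<in> V i}" using a b by auto
		moreover have "\<forall>i<n+n'. D i \<in> sets hp & D i \<subseteq> C & V i \<in> sets borel"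
			using a b by (auto simp: D_def V_def)
		ultimately show "a Int b \<in> G C" unfolding G_def by blast
	qed
	show "G C \<subseteq> Pow configs" by (auto simp: G_def)
	show "sets (hist_on C) = sigma_sets configs (G C)"
	proof
		show "sets (hist_on C) \<subseteq> sigma_sets configs (G C)" unfolding sets_hist_on
		proof (rule sigma_sets_mono', safe)
			fix B and U :: "ennreal set" assume "B \<in> sets hp" "B \<subseteq> C" "U \<in> sets borel"
			then show "{w \<in> configs. emeasure w B \<in> U} \<in> G C" unfolding G_def
				by (intro CollectI exI[of _ "1::nat"] exI[of _ "\<lambda>_. B"] exI[of _ "\<lambda>_. U"]) auto
		qed
		have "G C \<subseteq> sets (hist_on C)"
		proof
			fix a assume "a \<in> G C"
			then obtain n B U where a: "a = {w \<in> configs. \<forall>i<(n::nat). emeasure w (B i) \<in> U i}"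
				"\<forall>i<n. B i \<in> sets hp & B i \<subseteq> C & U i \<in> sets borel" unfolding G_def by blast
			have "{w \<in> space (hist_on C). \<forall>i\<in>{..<n}. emeasure w (B i) \<in> U i} \<in> sets (hist_on C)"
				using a(2) by (intro sets.sets_Collect_finite_All) (auto intro!: hist_on_Collect)
			also have "{w \<in> space (hist_on C). \<forall>i\<in>{..<n}. emeasure w (B i) \<in> U i} = a" using a(1) by auto
			finally show "a \<in> sets (hist_on C)" .
		qed
		then show "sigma_sets configs (G C) \<subseteq> sets (hist_on C)"
			using sets.sigma_sets_subset[of "G C" "hist_on C"] by simp
	qed
qed

lemma emeasure_config_UN:
	assumes "w \<in> configs" "finite K" "disjoint_family_on A K" "!!k. k \<in> K ==> A k \<in> sets hp"
	shows "emeasure w (\<Union>k\<in>K. A k) = (\<Sum>k\<in>K. emeasure w (A k))"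
	using assms configs_sets[OF assms(1)] by (intro sum_emeasure[symmetric]) auto

section \<open>Independence and moments of Poisson counts\<close>

locale prm =
	fixes P :: "config measure"
	assumes prm: "poisson_random_measure P"
begin

sublocale prob_space P using prm by (simp add: poisson_random_measure_def)

lemma space_P: "space P = configs" and sets_P: "sets P = sets config_algebra"
	using prm by (simp_all add: poisson_random_measure_def)

lemma sets_P_hist_on: "sets P = sets (hist_on UNIV)"
	unfolding sets_P sets_hist_on config_algebra_def by (subst sets_measure_of) auto

lemma hist_on_subset: "sets (hist_on C) \<subseteq> sets P"
	unfolding sets_P_hist_on by (rule hist_on_mono) simp

lemma hist_subset: "sets (hist t) \<subseteq> sets P"
	using hist_le_hist_on hist_on_subset by blast

lemma measurable_from_hist_on: "f \<in> measurable (hist_on C) S ==> f \<in> measurable P S"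
	using measurable_mono[OF order_refl refl hist_on_subset[of C], of S] by (auto simp: space_P)

lemma measurable_count [measurable]:
	"B \<in> sets hp ==> (\<lambda>w. emeasure w B) \<in> bm P"
	using measurable_from_hist_on[OF measurable_hist_on[of B UNIV]] by simp

lemma indep_counts:
	"finite I ==> B \<in> I \<rightarrow> sets hp ==> disjoint_family_on B I ==>
		indep_vars (\<lambda>_. borel) (\<lambda>i w. emeasure w (B i)) (I :: nat set)"
	using prm by (auto simp: poisson_random_measure_def)

text \<open>Overlapping sets are split into atoms, so that the independence of the counts of disjoint sets
	applies.\<close>

lemma indep_var_hist_on:
	fixes f :: "config => real" and g :: "ennreal => real"
	assumes D: "D \<in> sets hp" "C Int D = {}" and f: "f \<in> bm (hist_on C)"
		and g: "g \<in> bm borel"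
	shows "indep_var borel f borel (\<lambda>w. g (emeasure w D))"
proof -
	define G where "G = {{w \<in> configs. \<forall>i<n. emeasure w (B i) \<in> U i} | (n::nat) B U.
		 \<forall>i<n. B i \<in> sets hp & B i \<subseteq> C & U i \<in> sets borel}"
	define H where "H = {(\<lambda>w. emeasure w D) -` V Int space P | V. V \<in> sets borel}"
	note G = hist_on_pi_generator[of C, folded G_def]
	have GP: "G \<subseteq> events"
		using G(2) hist_on_subset[of C] by (auto intro: sigma_sets.Basic)
	have HP: "H \<subseteq> events" using measurable_sets[OF measurable_count[OF D(1)]] by (auto simp: H_def)
	have "indep_set G H"
	proof (rule indep_setI[OF GP HP])
		fix a b assume "a \<in> G" "b \<in> H"
		then obtain n B U V where a: "a = {w \<in> configs. \<forall>i<(n::nat). emeasure w (B i) \<in> U i}"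
			"\<forall>i<n. B i \<in> sets hp & B i \<subseteq> C & U i \<in> sets borel"
			and b: "b = (\<lambda>w. emeasure w D) -` V Int space P" "V \<in> sets borel" unfolding G_def H_def by blast
		obtain m :: nat and A and K :: "nat => nat set" where A: "!!k. k < m ==> A k \<in> sets hp" "!!k. k < m ==> A k \<subseteq> (\<Union>i<n. B i)"
			"disjoint_family_on A {..<m}" "!!i. i < n ==> K i \<subseteq> {..<m}" "!!i. i < n ==> B i = (\<Union>k\<in>K i. A k)"
			using half_plane_atoms[of n B] a(2) by metis
		\<comment> \<open>\<open>D\<close> joins the atoms as index \<open>m\<close>, so that a single
		  application of \<open>indep_counts\<close> covers both groups.\<close>
		define A' where "A' k = (if k < m then A k else D)" for k
		have UB: "(\<Union>i<n. B i) Int D = {}" using a(2) D(2) by blast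
		have "disjoint_family_on A' {..m}"
			unfolding disjoint_family_on_def
		proof (intro ballI impI)
			fix k l assume kl: "k \<in> {..m}" "l \<in> {..m}" "k ~= l"
			consider "k < m" "l < m" | "k < m" "l = m" | "k = m" "l < m" using kl by fastforce
			then show "A' k Int A' l = {}"
			proof cases
				case 1 then show ?thesis using A(3) kl(3) by (simp add: A'_def disjoint_family_on_def)
			next
				case 2 then show ?thesis using A(2)[of k] UB by (auto simp: A'_def)
			next
				case 3 then show ?thesis using A(2)[of l] UB by (auto simp: A'_def)
			qed
		qed
		moreover have "A' \<in> {..m} \<rightarrow> sets hp" using A(1) D(1) by (auto simp: A'_def)
		ultimately have "indep_vars (\<lambda>_. borel) (\<lambda>i w. emeasure w (A' i)) {..m}" by (intro indep_counts) auto
		then have iv: "indep_var (PiM {..<m} (\<lambda>_. borel)) (\<lambda>w. restrict (\<lambda>i. emeasure w (A' i)) {..<m})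
				(PiM {m} (\<lambda>_. borel)) (\<lambda>w. restrict (\<lambda>i. emeasure w (A' i)) {m})"
			by (rule indep_var_restrict) auto
		define X where "X = {x \<in> space (PiM {..<m} (\<lambda>_. borel :: ennreal measure)). \<forall>i\<in>{..<n}. (\<Sum>k\<in>K i. x k) \<in> U i}"
		define Y where "Y = {x \<in> space (PiM {m} (\<lambda>_. borel :: ennreal measure)). x m \<in> V}"
		have X: "X \<in> sets (PiM {..<m} (\<lambda>_. borel))"
			unfolding X_def
		proof (rule sets.sets_Collect_finite_All)
			fix i assume i: "i \<in> {..<n}"
			have "(\<lambda>x. \<Sum>k\<in>K i. x k) \<in> bm (PiM {..<m} (\<lambda>_. borel :: ennreal measure))"
				using A(4)[of i] i by (intro borel_measurable_sum measurable_component_singleton) auto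
			from measurable_sets[OF this, of "U i"]
			have "(\<lambda>x. \<Sum>k\<in>K i. x k) -` U i Int space (PiM {..<m} (\<lambda>_. borel :: ennreal measure)) \<in> sets (PiM {..<m} (\<lambda>_. borel))"
				using a(2) i by blast
			moreover have "(\<lambda>x. \<Sum>k\<in>K i. x k) -` U i Int space (PiM {..<m} (\<lambda>_. borel :: ennreal measure))
					= {x \<in> space (PiM {..<m} (\<lambda>_. borel :: ennreal measure)). (\<Sum>k\<in>K i. x k) \<in> U i}" by blast
			ultimately show "{x \<in> space (PiM {..<m} (\<lambda>_. borel :: ennreal measure)). (\<Sum>k\<in>K i. x k) \<in> U i} \<in> sets (PiM {..<m} (\<lambda>_. borel))"
				by simp
		qed simp
		have Y: "Y \<in> sets (PiM {m} (\<lambda>_. borel))"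
		proof -
			have "(\<lambda>x. x m) -` V Int space (PiM {m} (\<lambda>_. borel :: ennreal measure)) \<in> sets (PiM {m} (\<lambda>_. borel))"
				using measurable_sets[OF measurable_component_singleton[of m "{m}" "\<lambda>_. borel :: ennreal measure"], of V] b(2)
				by simp
			moreover have "(\<lambda>x. x m) -` V Int space (PiM {m} (\<lambda>_. borel :: ennreal measure)) = Y" by (auto simp: Y_def)
			ultimately show ?thesis by simp
		qed
		have aX: "a = (\<lambda>w. restrict (\<lambda>i. emeasure w (A' i)) {..<m}) -` X Int space P"
		proof -
			have "emeasure w (B i) = (\<Sum>k\<in>K i. restrict (\<lambda>i. emeasure w (A' i)) {..<m} k)" if "w \<in> configs" "i < n" for w i
			proof -
				have "disjoint_family_on A (K i)" using A(3) A(4)[OF that(2)] disjoint_family_on_mono by blast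
				then have "emeasure w (B i) = (\<Sum>k\<in>K i. emeasure w (A k))"
					using that A(1) A(4)[OF that(2)] finite_subset[OF A(4)[OF that(2)]]
					by (subst A(5)) (auto intro!: emeasure_config_UN)
				also have "... = (\<Sum>k\<in>K i. restrict (\<lambda>i. emeasure w (A' i)) {..<m} k)"
					using A(4)[OF that(2)] by (intro sum.cong) (auto simp: A'_def)
				finally show ?thesis .
			qed
			then have "(\<forall>i<n. emeasure w (B i) \<in> U i) \<longleftrightarrow>
					(\<forall>i\<in>{..<n}. (\<Sum>k\<in>K i. restrict (\<lambda>i. emeasure w (A' i)) {..<m} k) \<in> U i)" if "w \<in> configs" for w
				using that by auto
			moreover have "restrict (\<lambda>i. emeasure w (A' i)) {..<m} \<in> space (PiM {..<m} (\<lambda>_. borel))" for w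
				by (simp add: space_PiM)
			ultimately show ?thesis unfolding a(1) X_def space_P by blast
		qed
		have bY: "b = (\<lambda>w. restrict (\<lambda>i. emeasure w (A' i)) {m}) -` Y Int space P"
			unfolding b(1) Y_def by (auto simp: A'_def space_PiM)
		show "prob (a Int b) = prob a * prob b"
		proof -
			have "a Int b = (\<lambda>w. (restrict (\<lambda>i. emeasure w (A' i)) {..<m}, restrict (\<lambda>i. emeasure w (A' i)) {m})) -` (X \<times> Y) Int space P"
				unfolding aX bY by auto
			then show ?thesis using indep_varD[OF iv X Y] unfolding aX bY by simp
		qed
	qed
	moreover have "Int_stable H"
	proof (rule Int_stableI)
		fix a b assume "a \<in> H" "b \<in> H"
		then obtain V W where "a = (\<lambda>w. emeasure w D) -` V Int space P" "b = (\<lambda>w. emeasure w D) -` W Int space P"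
			"V \<in> sets borel" "W \<in> sets borel" unfolding H_def by blast
		then show "a Int b \<in> H" unfolding H_def by (intro CollectI exI[of _ "V Int W"]) auto
	qed
	ultimately have ind: "indep_set (sigma_sets (space P) G) (sigma_sets (space P) H)"
		using G(1) by (intro indep_set_sigma_sets)
	show ?thesis unfolding indep_var_eq
	proof (intro conjI)
		show "f \<in> bm P" by (rule measurable_from_hist_on[OF f])
		show "(\<lambda>w. g (emeasure w D)) \<in> bm P"
			using measurable_compose[OF measurable_count[OF D(1)] g] .
		have "sigma_sets (space P) {f -` A Int space P |A. A \<in> sets borel} \<subseteq> sigma_sets (space P) G"
			using measurable_sets[OF f] G(2) by (intro sigma_sets_mono) (auto simp: space_P)
		moreover have "sigma_sets (space P) {(\<lambda>w. g (emeasure w D)) -` A Int space P |A. A \<in> sets borel}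
				\<subseteq> sigma_sets (space P) H"
		proof (rule sigma_sets_mono', safe)
			fix A :: "real set" assume "A \<in> sets borel"
			then have "g -` A \<in> sets borel" using measurable_sets[OF g, of A] by simp
			then show "(\<lambda>w. g (emeasure w D)) -` A Int space P \<in> H" unfolding H_def by blast
		qed
		ultimately show "indep_set (sigma_sets (space P) {f -` A Int space P |A. A \<in> sets borel})
				(sigma_sets (space P) {(\<lambda>w. g (emeasure w D)) -` A Int space P |A. A \<in> sets borel})"
			using ind unfolding indep_sets2_eq by (meson subset_iff)
	qed
qed

lemma expectation_mult_count:
	fixes f :: "config => real" and g :: "ennreal => real"
	assumes D: "D \<in> sets hp" "C Int D = {}" and f: "f \<in> bm (hist_on C)" "integrable P f"
		and g: "g \<in> bm borel" "integrable P (\<lambda>w. g (emeasure w D))"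
	shows "integrable P (\<lambda>w. f w * g (emeasure w D))"
		"expectation (\<lambda>w. f w * g (emeasure w D)) = expectation f * expectation (\<lambda>w. g (emeasure w D))"
proof -
	have "indep_var borel f borel (\<lambda>w. g (emeasure w D))"
		by (rule indep_var_hist_on[OF D f(1) g(1)])
	then show "integrable P (\<lambda>w. f w * g (emeasure w D))"
		"expectation (\<lambda>w. f w * g (emeasure w D)) = expectation f * expectation (\<lambda>w. g (emeasure w D))"
		using f(2) g(2) by (auto intro: indep_var_integrable indep_var_lebesgue_integral)
qed

lemma prob_count:
	assumes "D \<in> sets hp" "emeasure hp D < \<infinity>"
	shows "prob {w \<in> space P. emeasure w D = of_nat k} =
		measure hp D ^ k / fact k * exp (- measure hp D)"
	using prm assms by (auto simp: poisson_random_measure_def)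

text \<open>The Poisson weights sum to one and leave no mass for \<open>\<infinity>\<close>. A
  configuration excludes infinite counts only on bounded sets, while \<open>D\<close> merely has
  finite area.\<close>

lemma count_nat_AE:
	assumes D: "D \<in> sets hp" "emeasure hp D < \<infinity>"
	shows "AE w in P. \<exists>k::nat. emeasure w D = of_nat k"
proof -
	define a where "a = measure hp D"
	note [measurable] = measurable_count[OF D(1)]
	define E where "E k = {w \<in> space P. emeasure w D = of_nat k}" for k :: nat
	have E: "E k \<in> events" for k unfolding E_def by measurable
	have dis: "disjoint_family E" by (auto simp: disjoint_family_on_def E_def)
	have "(\<lambda>k. a ^ k / fact k * exp (- a)) sums (exp a * exp (- a))"
		using exp_converges[of a] by (intro sums_mult2) (simp add: field_simps)
	then have "(\<lambda>k. prob (E k)) sums 1"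
		unfolding E_def using prob_count[OF D] by (simp add: a_def exp_minus)
	moreover have "(\<lambda>k. prob (E k)) sums prob (\<Union>k. E k)"
		using E dis by (intro finite_measure_UNION) auto
	ultimately have "prob (\<Union>k. E k) = 1" by (rule sums_unique2[symmetric])
	then have "AE w in P. w \<in> (\<Union>k. E k)" using E by (subst prob_eq_1[symmetric]) auto
	then show ?thesis by eventually_elim (auto simp: E_def)
qed

lemma nn_integral_count:
	assumes D: "D \<in> sets hp" "emeasure hp D < \<infinity>"
		and g: "!!k::nat. 0 <= g (real k)" and [measurable]: "g \<in> bm borel"
		and s: "(\<lambda>k. g (real k) * (measure hp D ^ k / fact k * exp (- measure hp D))) sums c"
	shows "(\<integral>\<^sup>+w. ennreal (g (measure w D)) \<partial>P) = ennreal c"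
		"integrable P (\<lambda>w. g (measure w D))" "expectation (\<lambda>w. g (measure w D)) = c"
proof -
	note [measurable] = measurable_count[OF D(1)]
	define a where "a = measure hp D"
	have [measurable]: "(\<lambda>w. measure w D) \<in> bm P" unfolding measure_def by measurable
	define E where "E k = {w \<in> space P. emeasure w D = of_nat k}" for k :: nat
	have E [measurable]: "E k \<in> events" for k unfolding E_def by measurable
	have AEk: "AE w in P. ennreal (g (measure w D)) = (\<Sum>k. ennreal (g (real k)) * indicator (E k) w) & 0 <= g (measure w D)"
		using count_nat_AE[OF D] AE_space
	proof eventually_elim
		case (elim w)
		then obtain k where k: "emeasure w D = of_nat k" by blast
		have "(\<Sum>j. ennreal (g (real j)) * indicator (E j) w) = (\<Sum>j. if j = k then ennreal (g (real k)) else 0)"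
			using elim k by (intro suminf_cong) (auto simp: E_def indicator_def)
		also have "... = ennreal (g (real k))" by (subst suminf_finite[of "{k}"]) auto
		finally show ?case using k g by (simp add: measure_def)
	qed
	have c: "0 <= c" using s g by (intro sums_le[OF _ sums_zero s]) auto
	have "(\<integral>\<^sup>+w. ennreal (g (measure w D)) \<partial>P) = (\<integral>\<^sup>+w. (\<Sum>k. ennreal (g (real k)) * indicator (E k) w) \<partial>P)"
		using AEk by (intro nn_integral_cong_AE) auto
	also have "... = (\<Sum>k. \<integral>\<^sup>+w. ennreal (g (real k)) * indicator (E k) w \<partial>P)"
		by (rule nn_integral_suminf) simp
	also have "... = (\<Sum>k. ennreal (g (real k)) * emeasure P (E k))"
		by (simp only: nn_integral_cmult_indicator[OF E])
	also have "... = (\<Sum>k. ennreal (g (real k) * (a ^ k / fact k * exp (- a))))"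
		unfolding E_def emeasure_eq_measure prob_count[OF D] a_def ennreal_mult'[OF g] by simp
	also have "... = ennreal c"
		using s g unfolding a_def by (intro suminf_ennreal_eq) auto
	finally show eq: "(\<integral>\<^sup>+w. ennreal (g (measure w D)) \<partial>P) = ennreal c" .
	show int: "integrable P (\<lambda>w. g (measure w D))"
		using AEk by (intro integrableI_nonneg) (auto simp: eq)
	show "expectation (\<lambda>w. g (measure w D)) = c"
		using AEk c eq by (subst integral_eq_nn_integral) auto
qed

text \<open>The falling factorial turns \<open>fact k\<close> in the denominator into
  \<open>fact (k - r)\<close>, and an index shift leaves the exponential series. These are the
  factorial moments of the Poisson law; the ordinary ones are combinations of them.\<close>

lemma falling_moment_sums:
	"(\<lambda>k. (if r <= k then fact k / fact (k - r) else 0) * (a ^ k / fact k * exp (- a))) sums (a ^ r :: real)"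
proof -
	have "(\<lambda>k. a ^ r * (a ^ k / fact k * exp (- a))) sums (a ^ r * (exp a * exp (- a)))"
		using exp_converges[of a] by (intro sums_mult sums_mult2) (simp add: field_simps)
	then have "(\<lambda>k. (if r <= k + r then fact (k + r) / fact (k + r - r) else 0) * (a ^ (k + r) / fact (k + r) * exp (- a))) sums (a ^ r)"
		by (simp add: exp_minus power_add mult_ac)
	then show ?thesis by (subst (asm) sums_iff_shift) simp
qed

text \<open>For the third absolute central moment,
  \<open>\<bar>x - a\<bar> ^ 3 \<le> \<bar>x\<bar> ^ 3 + a ^ 3\<close> with \<open>x\<close> and
  \<open>a\<close> nonnegative gives \<open>2 * a ^ 3 + 3 * a\<^sup>2 + a\<close>. For
  \<open>a \<le> 1\<close> this is at most \<open>6 * a\<close>, a linear order in the area that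
  makes the remainders of all cells summable.\<close>

lemma count_moments:
	assumes D: "D \<in> sets hp" "emeasure hp D < \<infinity>"
	defines "a \<equiv> measure hp D"
	shows "integrable P (\<lambda>w. measure w D)" "expectation (\<lambda>w. measure w D) = a"
		"integrable P (\<lambda>w. (measure w D - a)\<^sup>2)" "expectation (\<lambda>w. (measure w D - a)\<^sup>2) = a"
		"integrable P (\<lambda>w. \<bar>measure w D - a\<bar> ^ 3)"
		"a <= 1 ==> expectation (\<lambda>w. \<bar>measure w D - a\<bar> ^ 3) <= 6 * a"
proof -
	note [measurable] = measurable_count[OF D(1)]
	have [measurable]: "(\<lambda>w. measure w D) \<in> bm P" unfolding measure_def by measurable
	have a0: "0 <= a" by (simp add: a_def)
	let ?p = "\<lambda>k. a ^ k / fact k * exp (- a)"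
	have e1: "(if 1 <= k then fact k / fact (k - 1) else 0) = real k" for k
		by (cases k) auto
	have e2: "(if 2 <= k then fact k / fact (k - 2) else 0) = real k * (real k - 1)" for k
	proof (cases "k < 2")
		case True then show ?thesis by (auto simp: less_Suc_eq numeral_2_eq_2)
	next
		case False
		then obtain j where "k = Suc (Suc j)" by (metis add_2_eq_Suc le_Suc_ex not_le)
		then show ?thesis by (simp add: field_simps)
	qed
	have e3: "(if 3 <= k then fact k / fact (k - 3) else 0) = real k * (real k - 1) * (real k - 2)" for k
	proof (cases "k < 3")
		case True then show ?thesis by (auto simp: less_Suc_eq numeral_3_eq_3)
	next
		case False
		then obtain j where "k = Suc (Suc (Suc j))" by (metis add_Suc less_eqE not_less numeral_3_eq_3 plus_nat.add_0)
		then show ?thesis by (simp add: field_simps)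
	qed
	have s1: "(\<lambda>k. real k * ?p k) sums a" using falling_moment_sums[of 1 a] unfolding e1 by simp
	have s2: "(\<lambda>k. real k * (real k - 1) * ?p k) sums a\<^sup>2" using falling_moment_sums[of 2 a] unfolding e2 .
	have s3: "(\<lambda>k. real k * (real k - 1) * (real k - 2) * ?p k) sums a ^ 3" using falling_moment_sums[of 3 a] unfolding e3 .
	have s0: "(\<lambda>k. ?p k) sums 1" using falling_moment_sums[of 0 a] by simp
	show "integrable P (\<lambda>w. measure w D)" "expectation (\<lambda>w. measure w D) = a"
		using nn_integral_count[OF D, of "\<lambda>x. x" a] s1 by (simp_all add: a_def)
	have "(\<lambda>k. real k * (real k - 1) * ?p k + (1 - 2 * a) * (real k * ?p k) + a\<^sup>2 * ?p k) sums (a\<^sup>2 + (1 - 2 * a) * a + a\<^sup>2 * 1)"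
		by (intro sums_add sums_mult s0 s1 s2)
	also have "(\<lambda>k. real k * (real k - 1) * ?p k + (1 - 2 * a) * (real k * ?p k) + a\<^sup>2 * ?p k) = (\<lambda>k. (real k - a)\<^sup>2 * ?p k)"
	proof
		fix k :: nat
		show "real k * (real k - 1) * ?p k + (1 - 2 * a) * (real k * ?p k) + a\<^sup>2 * ?p k = (real k - a)\<^sup>2 * ?p k"
			unfolding power2_eq_square by algebra
	qed
	also have "a\<^sup>2 + (1 - 2 * a) * a + a\<^sup>2 * 1 = a" by (simp add: power2_eq_square algebra_simps)
	finally have v: "(\<lambda>k. (real k - a)\<^sup>2 * ?p k) sums a" .
	show "integrable P (\<lambda>w. (measure w D - a)\<^sup>2)" "expectation (\<lambda>w. (measure w D - a)\<^sup>2) = a"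
		using nn_integral_count[OF D, of "\<lambda>x. (x - a)\<^sup>2" a] v by (simp_all add: a_def)
	have "(\<lambda>k. real k * (real k - 1) * (real k - 2) * ?p k + 3 * (real k * (real k - 1) * ?p k) + real k * ?p k + a ^ 3 * ?p k)
			sums (a ^ 3 + 3 * a\<^sup>2 + a + a ^ 3 * 1)"
		by (intro sums_add sums_mult s0 s1 s2 s3)
	also have "(\<lambda>k. real k * (real k - 1) * (real k - 2) * ?p k + 3 * (real k * (real k - 1) * ?p k) + real k * ?p k + a ^ 3 * ?p k)
			= (\<lambda>k. (\<bar>real k\<bar> ^ 3 + a ^ 3) * ?p k)"
	proof
		fix k :: nat
		show "real k * (real k - 1) * (real k - 2) * ?p k + 3 * (real k * (real k - 1) * ?p k) + real k * ?p k + a ^ 3 * ?p k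
			= (\<bar>real k\<bar> ^ 3 + a ^ 3) * ?p k"
			unfolding power3_eq_cube abs_of_nat by algebra
	qed
	finally have t: "(\<lambda>k. (\<bar>real k\<bar> ^ 3 + a ^ 3) * ?p k) sums (a ^ 3 + 3 * a\<^sup>2 + a + a ^ 3 * 1)" .
	have I: "integrable P (\<lambda>w. \<bar>measure w D\<bar> ^ 3 + a ^ 3)"
		"expectation (\<lambda>w. \<bar>measure w D\<bar> ^ 3 + a ^ 3) = a ^ 3 + 3 * a\<^sup>2 + a + a ^ 3 * 1"
		using nn_integral_count[OF D, of "\<lambda>x. \<bar>x\<bar> ^ 3 + a ^ 3"] t a0 by (simp_all add: a_def)
	have le: "\<bar>measure w D - a\<bar> ^ 3 <= \<bar>measure w D\<bar> ^ 3 + a ^ 3" for w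
	proof (cases "measure w D >= a")
		case True
		then have "\<bar>measure w D - a\<bar> ^ 3 <= \<bar>measure w D\<bar> ^ 3" using a0 by (intro power_mono) auto
		then show ?thesis using zero_le_power[OF a0, of 3] by linarith
	next
		case False
		then have "\<bar>measure w D - a\<bar> ^ 3 <= a ^ 3" by (intro power_mono) auto
		then show ?thesis using zero_le_power[OF abs_ge_zero, of "measure w D" 3] by linarith
	qed
	show i3: "integrable P (\<lambda>w. \<bar>measure w D - a\<bar> ^ 3)"
		by (rule Bochner_Integration.integrable_bound[OF I(1)]) (auto intro!: order_trans[OF le])
	assume a1: "a <= 1"
	have "expectation (\<lambda>w. \<bar>measure w D - a\<bar> ^ 3) <= a ^ 3 + 3 * a\<^sup>2 + a + a ^ 3 * 1"
		unfolding I(2)[symmetric] using le by (intro integral_mono i3 I(1))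
	moreover have "a ^ 3 <= a" "a\<^sup>2 <= a"
		using power_decreasing[of 1 3 a] power_decreasing[of 1 2 a] a0 a1 by simp_all
	ultimately show "expectation (\<lambda>w. \<bar>measure w D - a\<bar> ^ 3) <= 6 * a" by linarith
qed

end

section \<open>Predictable integrands and the Mecke formula\<close>

definition pred_gen :: "real => (real \<times> config) set set" where
	"pred_gen T = {{0} \<times> A | A. A \<in> sets (hist 0)} \<union>
			{{s<..t} \<times> A | s t A. 0 <= s & s < t & t <= T & A \<in> sets (hist s)}"

lemma pred_gen_cases [consumes 1]:
	assumes "a \<in> pred_gen T"
	obtains A where "a = {0} \<times> A" "A \<in> sets (hist 0)"
	| s t A where "a = {s<..t} \<times> A" "0 <= s" "s < t" "t <= T" "A \<in> sets (hist s)"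
	using assms by (auto simp: pred_gen_def)

lemma sets_hist_configs: "A \<in> sets (hist s) ==> A \<subseteq> configs"
	using sets.sets_into_space[of A "hist s"] by simp

lemma configs_in_hist: "configs \<in> sets (hist s)"
	using sets.top[of "hist s"] by simp

lemma pred_gen_subset: "0 <= T ==> pred_gen T \<subseteq> Pow ({0..T} \<times> configs)"
proof
	fix a assume T: "0 <= T" and "a \<in> pred_gen T"
	from this(2) show "a \<in> Pow ({0..T} \<times> configs)"
		by (cases rule: pred_gen_cases) (use T sets_hist_configs in \<open>force+\<close>)
qed

lemma predictable_alt:
	assumes "0 <= T"
	shows "space (PA T) = {0..T} \<times> configs"
		"sets (PA T) = sigma_sets ({0..T} \<times> configs) (pred_gen T)"
	unfolding predictable_algebra_def pred_gen_def[symmetric]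
	using pred_gen_subset[OF assms] by (auto intro!: space_measure_of sets_measure_of)

lemma pred_gen_empty: "{} \<in> pred_gen T"
	unfolding pred_gen_def by (rule UnI1) (auto intro!: exI[of _ "{}"])

lemma Int_stable_pred_gen: "Int_stable (pred_gen T)"
proof (rule Int_stableI)
	fix a b assume "a \<in> pred_gen T" "b \<in> pred_gen T"
	then show "a Int b \<in> pred_gen T"
	proof (cases a rule: pred_gen_cases)
		case (1 A)
		from \<open>b \<in> _\<close> show ?thesis
		proof (cases b rule: pred_gen_cases)
			case (1 B)
			have "a Int b = {0} \<times> (A Int B)" using 1 \<open>a = _\<close> by auto
			then show ?thesis using 1 \<open>A \<in> _\<close> unfolding pred_gen_def by blast
		next
			case (2 s t B)
			have "a Int b = {}" using 2 \<open>a = _\<close> by auto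
			then show ?thesis by (simp add: pred_gen_empty)
		qed
	next
		case (2 s t A)
		note A = 2
		from \<open>b \<in> _\<close> show ?thesis
		proof (cases b rule: pred_gen_cases)
			case (1 B)
			have "a Int b = {}" using 1 A by auto
			then show ?thesis by (simp add: pred_gen_empty)
		next
			case (2 s' t' B)
			have eq: "a Int b = {max s s'<..min t t'} \<times> (A Int B)" using 2 A by auto
			show ?thesis
			proof (cases "max s s' < min t t'")
				case True
				have "A Int B \<in> sets (hist (max s s'))"
					using A(5) 2(5) hist_mono[of s "max s s'"] hist_mono[of s' "max s s'"] by auto
				then show ?thesis unfolding eq pred_gen_def using True A 2
					by (intro UnI2 CollectI exI[of _ "max s s'"] exI[of _ "min t t'"] exI[of _ "A Int B"]) auto
			next
				case False
				then have "a Int b = {}" unfolding eq by auto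
				then show ?thesis by (simp add: pred_gen_empty)
			qed
		qed
	qed
qed

section \<open>Predictable integrands with a mark\<close>

abbreviation PB :: "real => ((real \<times> config) \<times> real) measure" where
	"PB T \<equiv> predictable_algebra T \<Otimes>\<^sub>M borel"

definition pb_gen :: "real => ((real \<times> config) \<times> real) set set" where
	"pb_gen T = {a \<times> {..c} | a c. a \<in> pred_gen T}"

lemma pb_alt:
	assumes T: "0 < T"
	shows "space (PB T) = ({0..T} \<times> configs) \<times> UNIV"
		"sets (PB T) = sigma_sets (({0..T} \<times> configs) \<times> UNIV) (pb_gen T)"
		"Int_stable (pb_gen T)" "pb_gen T \<subseteq> Pow (({0..T} \<times> configs) \<times> UNIV)"
proof -
	have T': "0 <= T" using T by simp
	note p = predictable_alt[OF T']
	show sp: "space (PB T) = ({0..T} \<times> configs) \<times> UNIV" by (simp add: space_pair_measure p)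
	show sub: "pb_gen T \<subseteq> Pow (({0..T} \<times> configs) \<times> UNIV)"
		using pred_gen_subset[OF T'] unfolding pb_gen_def by blast
	have "sets (PB T) = sets (sigma (space (PA T) \<times> space (borel :: real measure))
			{a \<times> b | a b. a \<in> pred_gen T & b \<in> range atMost})"
	\<comment> \<open>A countable cover by generators is required. Time 0 needs a generator of its own,
	  because the others are open on the left.\<close>
	proof (rule sets_pair_eq[where Ca = "{{0} \<times> configs, {0<..T} \<times> configs}" and Cb = "range (\<lambda>n::nat. {..real n})"])
		show "pred_gen T \<subseteq> Pow (space (PA T))" unfolding p by (rule pred_gen_subset[OF T'])
		show "sets (PA T) = sigma_sets (space (PA T)) (pred_gen T)" unfolding p ..
		show "{{0} \<times> configs, {0<..T} \<times> configs} \<subseteq> pred_gen T"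
			using T configs_in_hist unfolding pred_gen_def by blast
		show "\<Union> {{0} \<times> configs, {0<..T} \<times> configs} = space (PA T)" unfolding p using T by auto
		show "sets (borel :: real measure) = sigma_sets (space borel) (range atMost)"
			by (subst borel_eq_atMost) simp
		show "\<Union> (range (\<lambda>n::nat. {..real n})) = space borel" using real_arch_simple by auto
	qed auto
	also have "... = sigma_sets (({0..T} \<times> configs) \<times> UNIV) (pb_gen T)"
		unfolding p(1) space_borel
		by (subst sets_measure_of) (use sub in \<open>auto simp: pb_gen_def intro!: arg_cong[where f = "sigma_sets _"]\<close>)
	finally show "sets (PB T) = sigma_sets (({0..T} \<times> configs) \<times> UNIV) (pb_gen T)" .
	show "Int_stable (pb_gen T)"
	proof (rule Int_stableI)
		fix x y assume "x \<in> pb_gen T" "y \<in> pb_gen T"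
		then obtain a c b d where xy: "x = a \<times> {..c}" "y = b \<times> {..d}" "a \<in> pred_gen T" "b \<in> pred_gen T"
			unfolding pb_gen_def by blast
		have "x Int y = (a Int b) \<times> {..min c d}" using xy by auto
		moreover have "a Int b \<in> pred_gen T" using Int_stable_pred_gen xy by (auto simp: Int_stable_def)
		ultimately show "x Int y \<in> pb_gen T" unfolding pb_gen_def by blast
	qed
qed

definition pt :: "config => real \<times> real => (real \<times> config) \<times> real" where
	"pt w z = ((fst z, w), snd z)"

abbreviation ptint :: "_ => _ => _ => config => ennreal" where
	"ptint C M f w \<equiv> (\<integral>\<^sup>+z\<in>C. f (pt w z) \<partial>M)"

abbreviation rowint :: "_ => _ => config => real => ennreal" where
	"rowint R f w r \<equiv> (\<integral>\<^sup>+\<theta>\<in>{0<..R}. f (pt w (r, \<theta>)) \<partial>lborel)"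

abbreviation strip :: "real => (real \<times> real) set" where
	"strip T \<equiv> {0..T} \<times> {0..}"

lemma measurable_pred_section:
	assumes "0 <= T" "w \<in> configs"
	shows "(\<lambda>t. (t, w)) \<in> measurable (restrict_space borel {0..T}) (PA T)"
proof (rule measurable_sigma_sets[OF predictable_alt(2)[OF assms(1)] pred_gen_subset[OF assms(1)]])
	show "(\<lambda>t. (t, w)) \<in> space (restrict_space borel {0..T}) \<rightarrow> {0..T} \<times> configs"
		using assms by (auto simp: space_restrict_space)
	fix a assume "a \<in> pred_gen T"
	then show "(\<lambda>t. (t, w)) -` a Int space (restrict_space borel {0..T}) \<in> sets (restrict_space borel {0..T})"
	proof (cases rule: pred_gen_cases)
		case (1 A)
		have "(\<lambda>t. (t, w)) -` a Int space (restrict_space borel {0..T}) = (if w \<in> A then {0} else {})"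
			using 1 assms by (auto simp: space_restrict_space)
		then show ?thesis using assms by (auto simp: sets_restrict_space_iff)
	next
		case (2 s t A)
		have "(\<lambda>t. (t, w)) -` a Int space (restrict_space borel {0..T}) = (if w \<in> A then {s<..t} else {})"
			using 2 assms by (auto simp: space_restrict_space)
		moreover have "{s<..t} \<in> sets (restrict_space borel {0..T})"
			using 2 by (subst sets_restrict_space_iff) auto
		ultimately show ?thesis by simp
	qed
qed

lemma measurable_pred_fst: "0 <= T ==> fst \<in> bm (PA T)"
proof (rule borel_measurableI_le)
	fix c assume T: "0 <= T"
	have gen: "a \<in> pred_gen T ==> a \<in> sets (PA T)" for a
		unfolding predictable_alt(2)[OF T] by (rule sigma_sets.Basic)
	have 0: "{0} \<times> configs \<in> sets (PA T)"
		using configs_in_hist by (intro gen) (auto simp: pred_gen_def)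
	show "{x \<in> space (PA T). fst x <= c} \<in> sets (PA T)"
	proof (cases "0 < min c T")
		case True
		then have "{0<..min c T} \<times> configs \<in> sets (PA T)"
			using configs_in_hist[of 0] unfolding pred_gen_def
			by (intro gen[unfolded pred_gen_def] UnI2 CollectI exI[of _ 0] exI[of _ "min c T"] exI[of _ configs]) auto
		then have "{0} \<times> configs \<union> {0<..min c T} \<times> configs \<in> sets (PA T)" using 0 by blast
		also have "{0} \<times> configs \<union> {0<..min c T} \<times> configs = {x \<in> space (PA T). fst x <= c}"
			using True T by (auto simp: predictable_alt[OF T])
		finally show ?thesis .
	next
		case False
		then have "{x \<in> space (PA T). fst x <= c} = (if 0 <= c then {0} \<times> configs else {})"
			using T by (auto simp: predictable_alt[OF T])
		then show ?thesis using 0 by simp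
	qed
qed

lemma sets_half_planeI: "B \<in> sets borel ==> B \<subseteq> UNIV \<times> {0..} ==> B \<in> sets hp"
	by (simp add: sets_half_plane)

lemma half_plane_rect: "A \<in> sets borel ==> B \<in> sets borel ==> B \<subseteq> {0..} ==> A \<times> B \<in> sets hp"
	by (auto simp: sets_half_plane borel_Times)

lemma strip_sets: "strip T \<in> sets hp"
	by (rule half_plane_rect) auto

lemma measurable_half_plane [measurable_cong]: "sets hp = sets (restrict_space borel (UNIV \<times> {0..}))"
	by (auto simp: half_plane_def sets_restrict_space)

lemma measurable_pt:
	assumes T: "0 <= T" and w: "w \<in> configs"
	shows "pt w \<in> measurable (restrict_space hp (strip T)) (PB T)"
	unfolding pt_def
proof (rule measurable_Pair)
	have "fst \<in> measurable (restrict_space hp (strip T)) (restrict_space borel {0..T})"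
		by (rule measurable_restrict_space3[OF _ ]) 
			 (auto simp: half_plane_def intro!: measurable_restrict_space1 borel_measurable_continuous_onI continuous_intros)
	then show "(\<lambda>z. (fst z, w)) \<in> measurable (restrict_space hp (strip T)) (PA T)"
		using measurable_pred_section[OF T w] by (rule measurable_compose)
	show "snd \<in> bm (restrict_space hp (strip T))"
		by (auto simp: half_plane_def intro!: measurable_restrict_space1 borel_measurable_continuous_onI continuous_intros)
qed

lemma measurable_pt_strip:
	fixes f :: "_ => ennreal"
	assumes T: "0 <= T" and w: "w \<in> configs" and f: "f \<in> bm (PB T)"
	shows "(\<lambda>z. f (pt w z) * indicator (strip T) z) \<in> bm hp"
	using measurable_compose[OF measurable_pt[OF T w] f] strip_sets[of T]
	by (subst (asm) borel_measurable_restrict_space_iff_ennreal) (auto simp: space_half_plane Int_absorb1 Times_Int_Times)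

lemma emeasure_half_plane:
	"B \<in> sets hp ==> emeasure hp B = emeasure lborel B"
	unfolding half_plane_def using half_plane_set
	by (subst emeasure_restrict_space) (auto simp: sets_restrict_space_iff)

lemma emeasure_half_plane_rect:
	assumes "A \<in> sets borel" "B \<in> sets borel" "B \<subseteq> {0..}"
	shows "emeasure hp (A \<times> B) = emeasure lborel A * emeasure lborel B"
proof -
	have "emeasure hp (A \<times> B) = emeasure (lborel \<Otimes>\<^sub>M lborel) (A \<times> B)"
		using emeasure_half_plane[OF half_plane_rect[OF assms]] by (simp add: lborel_prod)
	then show ?thesis using assms by (simp add: lborel.emeasure_pair_measure_Times)
qed

lemma nn_integral_half_plane:
	fixes g :: "real \<times> real => ennreal"
	assumes g: "(\<lambda>z. g z * indicator (A \<times> {0..}) z) \<in> bm hp"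
	shows "(\<integral>\<^sup>+z\<in>A \<times> {0..}. g z \<partial>hp) = (\<integral>\<^sup>+t\<in>A. (\<integral>\<^sup>+\<theta>\<in>{0..}. g (t, \<theta>) \<partial>lborel) \<partial>lborel)"
proof -
	have m: "(\<lambda>z. g z * indicator (A \<times> {0..}) z * indicator (UNIV \<times> {0..}) z) \<in> bm borel"
		using g half_plane_set unfolding half_plane_def
		by (subst (asm) borel_measurable_restrict_space_iff_ennreal) auto
	also have "(\<lambda>z. g z * indicator (A \<times> {0..}) z * indicator (UNIV \<times> {0..}) z) = (\<lambda>z. g z * indicator (A \<times> {0..}) z)"
		by (auto simp: indicator_def)
	finally have m: "(\<lambda>z. g z * indicator (A \<times> {0..}) z) \<in> bm (lborel \<Otimes>\<^sub>M lborel)"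
		by (simp add: lborel_prod)
	have "(\<integral>\<^sup>+z\<in>A \<times> {0..}. g z \<partial>hp) = (\<integral>\<^sup>+z. g z * indicator (A \<times> {0..}) z \<partial>lborel)"
		unfolding half_plane_def using half_plane_set
		by (subst nn_integral_restrict_space) (auto intro!: nn_integral_cong simp: indicator_def)
	also have "... = (\<integral>\<^sup>+z. g z * indicator (A \<times> {0..}) z \<partial>(lborel \<Otimes>\<^sub>M lborel))" by (simp add: lborel_prod)
	also have "... = (\<integral>\<^sup>+t. (\<integral>\<^sup>+\<theta>. g (t, \<theta>) * indicator (A \<times> {0..}) (t, \<theta>) \<partial>lborel) \<partial>lborel)"
		using lborel.nn_integral_fst[OF m] by simp
	also have "... = (\<integral>\<^sup>+t\<in>A. (\<integral>\<^sup>+\<theta>\<in>{0..}. g (t, \<theta>) \<partial>lborel) \<partial>lborel)"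
		by (intro nn_integral_cong) (auto simp: indicator_def cong: nn_integral_cong)
	finally show ?thesis .
qed

text \<open>The cut at mark \<open>R\<close> keeps all counts finite, as the complement step of
  \<open>mecke_slice\<close> requires; \<open>mecke\<close> then lets the height grow.\<close>

definition slice :: "real => real => ((real \<times> config) \<times> real) set => config => (real \<times> real) set" where
	"slice T R E w = {z \<in> {0..T} \<times> {0..R}. pt w z \<in> E}"

lemma slice_sets:
	assumes T: "0 <= T" and w: "w \<in> configs" and E: "E \<in> sets (PB T)"
	shows "slice T R E w \<in> sets hp"
proof -
	have "pt w -` E Int space (restrict_space hp (strip T)) \<in> sets (restrict_space hp (strip T))"
		using measurable_sets[OF measurable_pt[OF T w] E] .
	then have "pt w -` E Int strip T \<in> sets hp"
		using strip_sets[of T] by (auto simp: sets_restrict_space_iff space_restrict_space space_half_plane Int_absorb1 Times_Int_Times)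
	moreover have "{0..T} \<times> {0..R} \<in> sets hp" by (rule half_plane_rect) auto
	ultimately have "(pt w -` E Int strip T) Int ({0..T} \<times> {0..R}) \<in> sets hp" by (rule sets.Int)
	also have "(pt w -` E Int strip T) Int ({0..T} \<times> {0..R}) = slice T R E w" by (auto simp: slice_def)
	finally show ?thesis .
qed

lemma bounded_rect: "bounded ({0..T} \<times> {0..R} :: (real \<times> real) set)"
	by (intro bounded_Times bounded_closed_interval)

section \<open>The Mecke formula for predictable integrands\<close>

context prm begin

text \<open>On a generator over \<open>{s<..t} \<times> A\<close> the event \<open>A\<close> depends
  on points up to time \<open>s\<close> and the count on later ones, so independence and the Poisson
  mean give the equality. The rest is induction over the sigma-algebra, starting from an
  intersection-stable generator.\<close>

lemma mecke_slice:
	assumes T: "0 < T" and E: "E \<in> sets (PB T)"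
	shows "(\<lambda>w. emeasure w (slice T R E w)) \<in> bm P &
		(\<lambda>w. emeasure hp (slice T R E w)) \<in> bm P &
		(\<integral>\<^sup>+w. emeasure w (slice T R E w) \<partial>P) = (\<integral>\<^sup>+w. emeasure hp (slice T R E w) \<partial>P)"
proof -
	have T': "0 <= T" using T by simp
	let ?X = "{0..T} \<times> {0..R} :: (real \<times> real) set"
	have X: "?X \<in> sets hp" by (rule half_plane_rect) auto
	have Xfin: "emeasure hp ?X < \<infinity>"
		by (subst emeasure_half_plane_rect) (auto simp: ennreal_mult_less_top emeasure_lborel_Icc_eq)
	note pb = pb_alt[OF T]
	have E': "E \<in> sigma_sets (({0..T} \<times> configs) \<times> UNIV) (pb_gen T)" using E pb by simp
	have inE: "A \<in> sets (PB T)" if "A \<in> sigma_sets (({0..T} \<times> configs) \<times> UNIV) (pb_gen T)" for A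
		using that pb by simp
	have gen: "(\<lambda>w. indicator A w * emeasure w D) \<in> bm P &
		 (\<lambda>w. indicator A w * emeasure hp D) \<in> bm P &
		 (\<integral>\<^sup>+w. indicator A w * emeasure w D \<partial>P) = (\<integral>\<^sup>+w. indicator A w * emeasure hp D \<partial>P)"
		if D: "D \<in> sets hp" "D \<subseteq> ?X" and A: "A \<in> sets (hist_on C)" and CD: "C Int D = {}" for A C D
	proof (intro conjI)
		have AP: "A \<in> events" using A hist_on_subset by blast
		show "(\<lambda>w. indicator A w * emeasure w D) \<in> bm P"
			using AP D by measurable
		show "(\<lambda>w. indicator A w * emeasure hp D) \<in> bm P"
			using AP by measurable
		have Dfin: "emeasure hp D < \<infinity>" using emeasure_mono[OF D(2) X] Xfin by (rule le_less_trans)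
		have Dcfin: "emeasure w D < \<infinity>" if "w \<in> configs" for w
			using configs_bounded(1)[OF that bounded_subset[OF bounded_rect D(2)] D(1)] .
		have mi: "integrable P (\<lambda>w. enn2real (emeasure w D))"
			"expectation (\<lambda>w. enn2real (emeasure w D)) = measure hp D"
			using count_moments(1,2)[OF D(1) Dfin] by (simp_all add: measure_def)
		have iA: "integrable P (indicator A :: _ => real)"
			by (rule integrable_real_indicator[OF AP]) (simp add: emeasure_eq_measure)
		have mg: "enn2real \<in> bm borel" by measurable
		have mA: "(indicator A :: _ => real) \<in> bm (hist_on C)" using A by simp
		note em = expectation_mult_count[OF D(1) CD mA iA mg mi(1)]
		have "(\<integral>\<^sup>+w. indicator A w * emeasure w D \<partial>P) =
				(\<integral>\<^sup>+w. ennreal (indicator A w * enn2real (emeasure w D)) \<partial>P)"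
			using Dcfin by (intro nn_integral_cong) (auto simp: space_P indicator_def less_top)
		also have "... = ennreal (prob A * measure hp D)"
			using em AP mi(2) by (subst nn_integral_eq_integral) auto
		also have "... = emeasure P A * emeasure hp D"
			using Dfin by (simp add: emeasure_eq_measure emeasure_eq_ennreal_measure ennreal_mult' less_top[symmetric])
		also have "... = (\<integral>\<^sup>+w. indicator A w * emeasure hp D \<partial>P)"
			using AP by (simp add: nn_integral_multc)
		finally show "(\<integral>\<^sup>+w. indicator A w * emeasure w D \<partial>P) = (\<integral>\<^sup>+w. indicator A w * emeasure hp D \<partial>P)" .
	qed
	show ?thesis using pb(3) pb(4) E'
	proof (induction E rule: sigma_sets_induct_disjoint)
		case (basic E)
		then obtain a c where Eac: "E = a \<times> {..c}" "a \<in> pred_gen T" by (auto simp: pb_gen_def)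
		from Eac(2) show ?case
		proof (cases rule: pred_gen_cases)
			case (1 A)
			define D where "D = ({0} \<times> {0..min R c} :: (real \<times> real) set)"
			have D: "D \<in> sets hp" "D \<subseteq> ?X" using T unfolding D_def by (auto intro!: half_plane_rect)
			have eq: "slice T R E w = (if w \<in> A then D else {})" for w
				using 1 Eac T by (auto simp: slice_def pt_def D_def)
			have em: "emeasure M (slice T R E w) = indicator A w * emeasure M D" for M w
				unfolding eq by (simp add: indicator_def)
			have "A \<in> sets (hist_on ({..0} \<times> UNIV))" using 1 hist_le_hist_on by blast
			moreover have AP: "A \<in> events" using 1 hist_subset by blast
			have D0: "emeasure hp D = 0" unfolding D_def by (subst emeasure_half_plane_rect) auto
			have z: "AE w in P. emeasure w D = 0"
			proof -
				have "expectation (\<lambda>w. measure w D) = 0" "integrable P (\<lambda>w. measure w D)"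
					using count_moments(1,2)[OF D(1)] D0 by (auto simp: measure_def)
				then have "AE w in P. measure w D = 0" by (subst (asm) integral_nonneg_eq_0_iff_AE) auto
				then show ?thesis using AE_space
				proof eventually_elim
					case (elim w)
					then show ?case using configs_bounded(1)[OF _ bounded_subset[OF bounded_rect D(2)] D(1), of w]
						by (auto simp: measure_def space_P enn2real_eq_0_iff)
				qed
			qed
			have "(\<integral>\<^sup>+w. indicator A w * emeasure w D \<partial>P) = (\<integral>\<^sup>+w. 0 \<partial>P)"
				using z by (intro nn_integral_cong_AE) auto
			then show ?thesis unfolding em using AP D D0 by auto
		next
			case (2 s t A)
			define D where "D = ({s<..t} \<times> {0..min R c} :: (real \<times> real) set)"
			have D: "D \<in> sets hp" "D \<subseteq> ?X" using T 2 unfolding D_def by (auto intro!: half_plane_rect)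
			have eq: "slice T R E w = (if w \<in> A then D else {})" for w
				using 2 Eac T by (auto simp: slice_def pt_def D_def)
			have em: "emeasure M (slice T R E w) = indicator A w * emeasure M D" for M w
				unfolding eq by (simp add: indicator_def)
			have "A \<in> sets (hist_on ({..s} \<times> UNIV))" using 2 hist_le_hist_on by blast
			moreover have "({..s} \<times> UNIV) Int D = {}" by (auto simp: D_def)
			ultimately show ?thesis unfolding em by (rule gen[OF D])
		qed
	next
		case empty
		then show ?case by (simp add: slice_def)
	next
		case (compl E)
		have sl: "slice T R (({0..T} \<times> configs) \<times> UNIV - E) w = ?X - slice T R E w" if "w \<in> configs" for w
			using that by (auto simp: slice_def pt_def)
		have ss: "slice T R E w \<in> sets hp" "slice T R E w \<subseteq> ?X" if "w \<in> configs" for w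
			using slice_sets[OF T' that inE[OF compl(1)]] by (auto simp: slice_def)
		have e1: "emeasure w (slice T R (({0..T} \<times> configs) \<times> UNIV - E) w) = emeasure w ?X - emeasure w (slice T R E w)"
			and f1: "emeasure w (slice T R E w) < \<infinity>" if "w \<in> configs" for w
		proof -
			show f1: "emeasure w (slice T R E w) < \<infinity>"
				using configs_bounded(1)[OF that bounded_subset[OF bounded_rect ss(2)[OF that]] ss(1)[OF that]] .
			show "emeasure w (slice T R (({0..T} \<times> configs) \<times> UNIV - E) w) = emeasure w ?X - emeasure w (slice T R E w)"
				unfolding sl[OF that] using ss[OF that] f1 X configs_sets[OF that] by (intro emeasure_Diff) auto
		qed
		have f2: "emeasure hp (slice T R E w) < \<infinity>" if "w \<in> configs" for w
			using emeasure_mono[OF ss(2)[OF that] X] Xfin by (rule le_less_trans)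
		have e2: "emeasure hp (slice T R (({0..T} \<times> configs) \<times> UNIV - E) w) =
				emeasure hp ?X - emeasure hp (slice T R E w)" if "w \<in> configs" for w
			unfolding sl[OF that] using ss[OF that] f2[OF that] X by (intro emeasure_Diff) auto
		have mX: "(\<integral>\<^sup>+w. emeasure w ?X \<partial>P) = emeasure hp ?X"
		proof -
			have "(\<integral>\<^sup>+w. emeasure w ?X \<partial>P) = (\<integral>\<^sup>+w. ennreal (measure w ?X) \<partial>P)"
				using configs_bounded(1)[OF _ bounded_rect X]
				by (intro nn_integral_cong) (auto simp: space_P emeasure_eq_ennreal_measure less_top[symmetric])
			also have "... = ennreal (measure hp ?X)"
				using count_moments(1,2)[OF X Xfin] by (subst nn_integral_eq_integral) auto
			finally show ?thesis using Xfin by (simp add: emeasure_eq_ennreal_measure less_top[symmetric])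
		qed
		note [measurable] = compl.IH[THEN conjunct1] compl.IH[THEN conjunct2, THEN conjunct1] measurable_count[OF X]
		have le1: "emeasure w (slice T R E w) <= emeasure w ?X" "emeasure hp (slice T R E w) <= emeasure hp ?X" if "w \<in> configs" for w
			using ss[OF that] X configs_sets[OF that] by (auto intro!: emeasure_mono)
		\<comment> \<open>Finiteness is what permits subtraction in \<open>ennreal\<close>.\<close>
		have fin: "(\<integral>\<^sup>+w. emeasure w (slice T R E w) \<partial>P) ~= \<infinity>"
		proof -
			have "(\<integral>\<^sup>+w. emeasure w (slice T R E w) \<partial>P) <= (\<integral>\<^sup>+w. emeasure w ?X \<partial>P)"
				using le1 by (intro nn_integral_mono) (auto simp: space_P)
			then show ?thesis using mX Xfin by (auto simp: top_unique)
		qed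
		have "(\<integral>\<^sup>+w. emeasure w ?X - emeasure w (slice T R E w) \<partial>P) =
				(\<integral>\<^sup>+w. emeasure w ?X \<partial>P) - (\<integral>\<^sup>+w. emeasure w (slice T R E w) \<partial>P)"
			using fin le1 by (intro nn_integral_diff) (auto simp: space_P)
		also have "... = (\<integral>\<^sup>+w. emeasure hp ?X \<partial>P) - (\<integral>\<^sup>+w. emeasure hp (slice T R E w) \<partial>P)"
			using mX compl.IH by (simp add: emeasure_space_1)
		also have "... = (\<integral>\<^sup>+w. emeasure hp ?X - emeasure hp (slice T R E w) \<partial>P)"
			using fin compl.IH le1 by (intro nn_integral_diff[symmetric]) (auto simp: space_P)
		finally have I: "(\<integral>\<^sup>+w. emeasure w ?X - emeasure w (slice T R E w) \<partial>P) =
			(\<integral>\<^sup>+w. emeasure hp ?X - emeasure hp (slice T R E w) \<partial>P)" .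
		show ?case
		proof (intro conjI)
			show "(\<lambda>w. emeasure w (slice T R (({0..T} \<times> configs) \<times> UNIV - E) w)) \<in> bm P"
				using e1 by (subst measurable_cong[where g = "\<lambda>w. emeasure w ?X - emeasure w (slice T R E w)"]) (auto simp: space_P)
			show "(\<lambda>w. emeasure hp (slice T R (({0..T} \<times> configs) \<times> UNIV - E) w)) \<in> bm P"
				using e2 by (subst measurable_cong[where g = "\<lambda>w. emeasure hp ?X - emeasure hp (slice T R E w)"]) (auto simp: space_P)
			show "(\<integral>\<^sup>+w. emeasure w (slice T R (({0..T} \<times> configs) \<times> UNIV - E) w) \<partial>P) =
				(\<integral>\<^sup>+w. emeasure hp (slice T R (({0..T} \<times> configs) \<times> UNIV - E) w) \<partial>P)"
				using I e1 e2 by (simp add: space_P cong: nn_integral_cong_simp)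
		qed
	next
		case (union A)
		have sl: "slice T R (\<Union>i. A i) w = (\<Union>i. slice T R (A i) w)" for w by (auto simp: slice_def)
		have dis: "disjoint_family (\<lambda>i. slice T R (A i) w)" for w
			using union(1) by (auto simp: disjoint_family_on_def slice_def)
		have ss: "slice T R (A i) w \<in> sets hp" if "w \<in> configs" for w i
			using slice_sets[OF T' that inE, of "A i" R] union(2) by blast
		have e1: "emeasure w (slice T R (\<Union>i. A i) w) = (\<Sum>i. emeasure w (slice T R (A i) w))" if "w \<in> configs" for w
			unfolding sl using ss[OF that] dis configs_sets[OF that] by (intro suminf_emeasure[symmetric]) auto
		have e2: "emeasure hp (slice T R (\<Union>i. A i) w) = (\<Sum>i. emeasure hp (slice T R (A i) w))" if "w \<in> configs" for w
			unfolding sl using ss[OF that] dis by (intro suminf_emeasure[symmetric]) auto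
		have [measurable]: "(\<lambda>w. emeasure w (slice T R (A i) w)) \<in> bm P"
			"(\<lambda>w. emeasure hp (slice T R (A i) w)) \<in> bm P" for i using union(3) by auto
		show ?case
		proof (intro conjI)
			show "(\<lambda>w. emeasure w (slice T R (\<Union>i. A i) w)) \<in> bm P"
				using e1 by (subst measurable_cong[where g = "\<lambda>w. \<Sum>i. emeasure w (slice T R (A i) w)"]) (auto simp: space_P)
			show "(\<lambda>w. emeasure hp (slice T R (\<Union>i. A i) w)) \<in> bm P"
				using e2 by (subst measurable_cong[where g = "\<lambda>w. \<Sum>i. emeasure hp (slice T R (A i) w)"]) (auto simp: space_P)
			have "(\<integral>\<^sup>+w. (\<Sum>i. emeasure w (slice T R (A i) w)) \<partial>P) = (\<integral>\<^sup>+w. (\<Sum>i. emeasure hp (slice T R (A i) w)) \<partial>P)"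
				using union(3) by (subst (1 2) nn_integral_suminf) auto
			then show "(\<integral>\<^sup>+w. emeasure w (slice T R (\<Union>i. A i) w) \<partial>P) = (\<integral>\<^sup>+w. emeasure hp (slice T R (\<Union>i. A i) w) \<partial>P)"
				using e1 e2 by (simp add: space_P cong: nn_integral_cong_simp)
		qed
	qed
qed


text \<open>A predictable integrand does not see the point at which it is evaluated, so the
  right-hand side involves no added point. Marks are unbounded here: for indicators the rectangles
  of \<open>mecke_slice\<close> exhaust the strip, and monotone limits do the rest.\<close>

lemma mecke:
	fixes f :: "(real \<times> config) \<times> real => ennreal"
	assumes T: "0 < T" and f: "f \<in> bm (PB T)"
	shows "(\<lambda>w. \<integral>\<^sup>+z\<in>strip T. f (pt w z) \<partial>w) \<in> bm P &
		(\<lambda>w. \<integral>\<^sup>+z\<in>strip T. f (pt w z) \<partial>hp) \<in> bm P &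
		(\<integral>\<^sup>+w. (ptint (strip T) w f w) \<partial>P) =
		(\<integral>\<^sup>+w. (ptint (strip T) hp f w) \<partial>P)"
		(is "?A f & ?B f & ?C f")
proof -
	have T': "0 <= T" using T by simp
	define J where "J M f w = (ptint (strip T) M f w)"
		for M and f :: "(real \<times> config) \<times> real => ennreal" and w
	have sm: "(\<lambda>z. f (pt w z) * indicator (strip T) z) \<in> bm M"
		if "w \<in> configs" "f \<in> bm (PB T)" "sets M = sets hp" for f :: "_ => ennreal" and M w
		using measurable_pt_strip[OF T' that(1,2)] measurable_cong_sets[OF that(3) refl] by blast
	have iff: "(?A f & ?B f & ?C f) \<longleftrightarrow> (\<lambda>w. J w f w) \<in> bm P & (\<lambda>w. J hp f w) \<in> bm P &
			(\<integral>\<^sup>+w. J w f w \<partial>P) = (\<integral>\<^sup>+w. J hp f w \<partial>P)" for f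
		unfolding J_def ..
	note cs = configs_sets
	have sP: "w \<in> space P \<longleftrightarrow> w \<in> configs" for w by (simp add: space_P)
	define Q where "Q f \<longleftrightarrow> (\<lambda>w. J w f w) \<in> bm P & (\<lambda>w. J hp f w) \<in> bm P &
			(\<integral>\<^sup>+w. J w f w \<partial>P) = (\<integral>\<^sup>+w. J hp f w \<partial>P)" for f
	have QI: "Q f" if "!!w. w \<in> configs ==> J w f w = a w" "!!w. w \<in> configs ==> J hp f w = b w"
		"a \<in> bm P" "b \<in> bm P" "(\<integral>\<^sup>+w. a w \<partial>P) = (\<integral>\<^sup>+w. b w \<partial>P)" for f a b
		unfolding Q_def
	proof (intro conjI)
		show "(\<lambda>w. J w f w) \<in> bm P"
			by (subst measurable_cong[of P _ a]) (simp_all add: sP that)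
		show "(\<lambda>w. J hp f w) \<in> bm P"
			by (subst measurable_cong[of P _ b]) (simp_all add: sP that)
		have "(\<integral>\<^sup>+w. J w f w \<partial>P) = (\<integral>\<^sup>+w. a w \<partial>P)" by (rule nn_integral_cong) (simp add: sP that)
		moreover have "(\<integral>\<^sup>+w. J hp f w \<partial>P) = (\<integral>\<^sup>+w. b w \<partial>P)" by (rule nn_integral_cong) (simp add: sP that)
		ultimately show "(\<integral>\<^sup>+w. J w f w \<partial>P) = (\<integral>\<^sup>+w. J hp f w \<partial>P)" using that(5) by simp
	qed
	have QD: "(\<lambda>w. J w f w) \<in> bm P" "(\<lambda>w. J hp f w) \<in> bm P"
			"(\<integral>\<^sup>+w. J w f w \<partial>P) = (\<integral>\<^sup>+w. J hp f w \<partial>P)" if "Q f" for f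
		using that unfolding Q_def by blast+
	show ?thesis unfolding iff Q_def[symmetric] using f
	proof (induction rule: borel_measurable_induct)
		case (cong f g)
		have eq: "J M f w = J M g w" if "w \<in> configs" for M w
			unfolding J_def using cong(3) that
			by (intro nn_integral_cong) (auto simp: pb_alt[OF T] pt_def indicator_def)
		show ?case using QD[OF cong(4)] by (intro QI[OF eq eq])
	next
		case (set E)
		have J: "J M (indicator E) w = (SUP n. emeasure M (slice T (real n) E w))"
			if "w \<in> configs" "sets M = sets hp" for M w
		proof -
			have sl: "slice T (real n) E w \<in> sets M" for n using slice_sets[OF T' that(1) set] that(2) by simp
			have U: "(\<Union>n. slice T (real n) E w) = {z \<in> strip T. pt w z \<in> E}"
				using real_arch_simple by (auto simp: slice_def)
			have "J M (indicator E) w = (\<integral>\<^sup>+z. indicator (\<Union>n. slice T (real n) E w) z \<partial>M)"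
				unfolding J_def U by (intro nn_integral_cong) (auto simp: indicator_def)
			also have "... = emeasure M (\<Union>n. slice T (real n) E w)" using sl by (intro nn_integral_indicator) auto
			also have "... = (SUP n. emeasure M (slice T (real n) E w))"
				using sl by (intro SUP_emeasure_incseq[symmetric]) (auto simp: incseq_def slice_def)
			finally show ?thesis .
		qed
		have inc: "incseq (\<lambda>n. emeasure M (slice T (real n) E w))"
			if "w \<in> configs" "sets M = sets hp" for M w
			using slice_sets[OF T' that(1) set] that(2) by (auto simp: incseq_def slice_def intro!: emeasure_mono)
		have m: "(\<lambda>w. emeasure w (slice T (real n) E w)) \<in> bm P"
			"(\<lambda>w. emeasure hp (slice T (real n) E w)) \<in> bm P" for n
			using mecke_slice[OF T set] by auto
		have "(\<integral>\<^sup>+w. (SUP n. emeasure w (slice T (real n) E w)) \<partial>P) = (SUP n. \<integral>\<^sup>+w. emeasure w (slice T (real n) E w) \<partial>P)"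
			using m inc cs by (intro nn_integral_monotone_convergence_SUP_AE) (auto simp: sP incseq_Suc_iff)
		also have "... = (SUP n. \<integral>\<^sup>+w. emeasure hp (slice T (real n) E w) \<partial>P)"
			using mecke_slice[OF T set] by simp
		also have "... = (\<integral>\<^sup>+w. (SUP n. emeasure hp (slice T (real n) E w)) \<partial>P)"
			using m inc by (intro nn_integral_monotone_convergence_SUP_AE[symmetric]) (auto simp: sP incseq_Suc_iff)
		finally have "(\<integral>\<^sup>+w. (SUP n. emeasure w (slice T (real n) E w)) \<partial>P) = (\<integral>\<^sup>+w. (SUP n. emeasure hp (slice T (real n) E w)) \<partial>P)" .
		moreover have "(\<lambda>w. SUP n. emeasure w (slice T (real n) E w)) \<in> bm P"
			"(\<lambda>w. SUP n. emeasure hp (slice T (real n) E w)) \<in> bm P"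
			using m by (auto intro!: borel_measurable_SUP)
		ultimately show ?case using cs by (intro QI[OF J J]) simp_all
	next
		case (mult f c)
		have J: "J M (\<lambda>x. c * f x) w = c * J M f w" if "w \<in> configs" "sets M = sets hp" for M w
			unfolding J_def mult.assoc using sm[OF that(1) mult(2) that(2)] by (rule nn_integral_cmult)
		show ?case using QD[OF mult(4)] cs by (intro QI[OF J J]) (simp_all add: nn_integral_cmult)
	next
		case (add f g)
		have J: "J M (\<lambda>x. g x + f x) w = J M g w + J M f w" if "w \<in> configs" "sets M = sets hp" for M w
			unfolding J_def distrib_right using sm[OF that(1) add(1) that(2)] sm[OF that(1) add(3) that(2)] by (intro nn_integral_add)
		have IH: "Q f" "Q g" by (fact add)+
		show ?case using QD[OF IH(1)] QD[OF IH(2)] cs by (intro QI[OF J J]) (simp_all add: nn_integral_add)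
	next
		case (seq F)
		have mono: "F m x <= F n x" if "m <= n" for m n x
			using seq(3) that unfolding incseq_def le_fun_def by blast
		have IH: "Q (F i)" for i by (fact seq)
		have J: "J M (SUP i. F i) w = (SUP i. J M (F i) w)" if "w \<in> configs" "sets M = sets hp" for M w
		proof -
			have "J M (SUP i. F i) w = (\<integral>\<^sup>+z. (SUP i. F i (pt w z) * indicator (strip T) z) \<partial>M)"
				unfolding J_def by (intro nn_integral_cong) (auto simp: image_comp indicator_def)
			also have "... = (SUP i. J M (F i) w)" unfolding J_def
				using sm[OF that(1) seq(1) that(2)]
				by (intro nn_integral_monotone_convergence_SUP) (auto simp: incseq_def le_fun_def intro!: mult_right_mono mono)
			finally show ?thesis .
		qed
		have inc: "incseq (\<lambda>i. J M (F i) w)" for M w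
			unfolding J_def by (auto simp: incseq_def intro!: nn_integral_mono mult_right_mono mono)
		have m: "(\<lambda>w. J w (F i) w) \<in> bm P" "(\<lambda>w. J hp (F i) w) \<in> bm P" for i
			using QD[OF IH] by auto
		have "(\<integral>\<^sup>+w. (SUP i. J w (F i) w) \<partial>P) = (SUP i. \<integral>\<^sup>+w. J w (F i) w \<partial>P)"
			using m inc by (intro nn_integral_monotone_convergence_SUP_AE) (auto simp: sP incseq_Suc_iff)
		also have "... = (SUP i. \<integral>\<^sup>+w. J hp (F i) w \<partial>P)" using QD[OF IH] by simp
		also have "... = (\<integral>\<^sup>+w. (SUP i. J hp (F i) w) \<partial>P)"
			using m inc by (intro nn_integral_monotone_convergence_SUP_AE[symmetric]) (auto simp: sP incseq_Suc_iff)
		finally have "(\<integral>\<^sup>+w. (SUP i. J w (F i) w) \<partial>P) = (\<integral>\<^sup>+w. (SUP i. J hp (F i) w) \<partial>P)" .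
		moreover have "(\<lambda>w. SUP i. J w (F i) w) \<in> bm P"
			"(\<lambda>w. SUP i. J hp (F i) w) \<in> bm P"
			using m by (auto intro!: borel_measurable_SUP)
		ultimately show ?case using cs by (intro QI[OF J J]) simp_all
	qed
qed

lemma measurable_pred_joint:
	assumes T: "0 <= T"
	shows "(\<lambda>x. x) \<in> measurable (restrict_space borel {0..T} \<Otimes>\<^sub>M P) (PA T)"
proof (rule measurable_sigma_sets[OF predictable_alt(2)[OF T] pred_gen_subset[OF T]])
	show "(\<lambda>x. x) \<in> space (restrict_space borel {0..T} \<Otimes>\<^sub>M P) \<rightarrow> {0..T} \<times> configs"
		by (auto simp: space_pair_measure space_restrict_space space_P)
	fix a assume "a \<in> pred_gen T"
	then have "a \<in> sets (restrict_space borel {0..T} \<Otimes>\<^sub>M P)"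
	proof (cases rule: pred_gen_cases)
		case (1 A)
		then show ?thesis using T hist_subset by (auto intro!: pair_measureI simp: sets_restrict_space_iff)
	next
		case (2 s t A)
		have "{s<..t} \<in> sets (restrict_space borel {0..T})" using 2 by (subst sets_restrict_space_iff) auto
		then show ?thesis using 2 hist_subset by (auto intro!: pair_measureI)
	qed
	then show "(\<lambda>x. x) -` a Int space (restrict_space borel {0..T} \<Otimes>\<^sub>M P) \<in> sets (restrict_space borel {0..T} \<Otimes>\<^sub>M P)"
		by auto
qed

end

section \<open>Moments of the intensity\<close>

text \<open>The set whose existence \<open>configs\<close> asserts, recovered canonically as the set
  of atoms.\<close>

definition pts :: "config => (real \<times> real) set" where
	"pts w = {z \<in> UNIV \<times> {0..}. emeasure w {z} ~= 0}"

lemma sing_half_plane: "z \<in> UNIV \<times> {0..} ==> {z} \<in> sets hp"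
	by (simp add: sets_half_plane)

lemma
	assumes w: "w \<in> configs"
	shows pts_subset: "pts w \<subseteq> UNIV \<times> {0..}"
		and pts_finite: "bounded B ==> finite (pts w Int B)"
		and pts_emeasure: "B \<in> sets hp ==> emeasure w B = emeasure (count_space UNIV) (pts w Int B)"
		and pts_sets: "pts w \<in> sets hp"
		and pts_AE: "AE z in w. z \<in> pts w"
		and pts_countable: "countable (pts w)"
proof -
	obtain S where S: "S \<subseteq> UNIV \<times> {0..}" "!!B. bounded B ==> finite (S Int B)"
		"!!B. B \<in> sets hp ==> emeasure w B = emeasure (count_space UNIV) (S Int B)"
		using w by (auto simp: configs_def)
	have p: "pts w = S"
		using S(1) S(3)[OF sing_half_plane] by (auto simp: pts_def Int_insert_right split: if_splits)
	show "pts w \<subseteq> UNIV \<times> {0..}" "bounded B ==> finite (pts w Int B)"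
		"B \<in> sets hp ==> emeasure w B = emeasure (count_space UNIV) (pts w Int B)"
		unfolding p using S by auto
	have "S \<subseteq> (\<Union>n::nat. S Int cball 0 (real n))"
	proof
		fix z assume "z \<in> S"
		obtain n :: nat where "norm z <= real n" using real_arch_simple by blast
		then show "z \<in> (\<Union>n::nat. S Int cball 0 (real n))" using \<open>z \<in> S\<close> by (auto simp: dist_norm)
	qed
	moreover have "countable (S Int cball 0 (real n))" for n
		using S(2)[OF bounded_cball] by (rule countable_finite)
	then have "countable (\<Union>n::nat. S Int cball 0 (real n))" by (rule countable_UN[OF countableI_type])
	ultimately have "countable S" by (rule countable_subset)
	then show "countable (pts w)" unfolding p .
	from \<open>countable S\<close> have Sb: "S \<in> sets borel"
		by (rule sets.countable[rotated]) (rule borel_closed, rule closed_singleton)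
	show Sh: "pts w \<in> sets hp" unfolding p using S(1) Sb by (simp add: sets_half_plane)
	have c: "UNIV \<times> {0..} - S \<in> sets hp" using Sh unfolding p by (metis sets.compl_sets space_half_plane)
	have "S Int (UNIV \<times> {0..} - S) = {}" by auto
	then have "emeasure w (UNIV \<times> {0..} - S) = 0" using S(3)[OF c] by simp
	then show "AE z in w. z \<in> pts w"
		unfolding p using c configs_sets[OF w] by (intro AE_I[of _ _ "UNIV \<times> {0..} - S"]) (auto simp: configs_space[OF w])
qed

lemma emeasure_finite_pts:
	assumes "w \<in> configs" "finite F" "F \<subseteq> pts w"
	shows "F \<in> sets hp" "emeasure w F = of_nat (card F)"
proof -
	show F: "F \<in> sets hp" using assms pts_subset[OF assms(1)] by (auto simp: sets_half_plane intro!: finite_imp_closed borel_closed)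
	show "emeasure w F = of_nat (card F)"
		using assms pts_emeasure[OF assms(1) F] by (simp add: Int_absorb1 emeasure_count_space_finite)
qed

section \<open>Predictability of counts over the strict past\<close>

lemma measurable_pred_left:
	fixes Z :: "_ => 'b::{topological_space, zero}"
	assumes T: "0 < T" and q: "0 <= q" "q < T" and Z: "Z \<in> bm (hist q)"
	shows "(\<lambda>x. if q < fst x then Z (snd x) else 0) \<in> bm (PA T)"
proof (rule measurableI)
	fix U :: "'b set" assume U: "U \<in> sets borel"
	have T': "0 <= T" using T by simp
	have gen: "a \<in> pred_gen T ==> a \<in> sets (PA T)" for a
		unfolding predictable_alt(2)[OF T'] by (rule sigma_sets.Basic)
	have "Z -` U Int space (hist q) \<in> sets (hist q)" using measurable_sets[OF Z U] .
	then have 1: "{q<..T} \<times> (Z -` U Int configs) \<in> sets (PA T)"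
		using q by (intro gen) (auto simp: pred_gen_def)
	have 2: "{0..q} \<times> configs \<in> sets (PA T)"
	proof -
		have "{x \<in> space (PA T). fst x <= q} \<in> sets (PA T)"
			using measurable_pred_fst[OF T'] by measurable
		moreover have "{x \<in> space (PA T). fst x <= q} = {0..q} \<times> configs"
			using q by (auto simp: predictable_alt[OF T'])
		ultimately show ?thesis by simp
	qed
	have "(\<lambda>x. if q < fst x then Z (snd x) else 0) -` U Int space (PA T) =
		{q<..T} \<times> (Z -` U Int configs) \<union> (if 0 \<in> U then {0..q} \<times> configs else {})"
		using q by (auto simp: predictable_alt[OF T'] split: if_splits)
	then show "(\<lambda>x. if q < fst x then Z (snd x) else 0) -` U Int space (PA T) \<in> sets (PA T)"
		using 1 2 by auto
qed simp

text \<open>A count over times strictly before \<open>fst x\<close> is the supremum, over rational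
  \<open>q < fst x\<close>, of the counts up to \<open>q\<close>. Each of these is known at time
  \<open>q\<close> and switched on afterwards, hence predictable by
  \<open>measurable_pred_left\<close>.\<close>

lemma measurable_pred_count:
	assumes T: "0 < T" and uv: "0 <= u" "u < v" "v <= T" and A: "A \<in> sets (hist u)"
	shows "(\<lambda>x. indicator A (snd x) * emeasure (snd x) (({u<..v} Int {0<..<fst x}) \<times> {0..c}))
		\<in> bm (PA T)"
proof -
	have T': "0 <= T" using T by simp
	define Z where "Z q w = (if u <= q then indicator A w * emeasure w ({u<..min v q} \<times> {0..c}) else (0::ennreal))" for q w
	have Z: "Z q \<in> bm (hist q)" for q
	proof (cases "u <= q")
		case True
		have [measurable]: "A \<in> sets (hist q)" using hist_mono[OF True] A by blast
		have [measurable]: "(\<lambda>w. emeasure w ({u<..min v q} \<times> {0..c})) \<in> bm (hist q)"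
			by (rule measurable_hist) auto
		show ?thesis using True unfolding Z_def by simp
	qed (simp add: Z_def[abs_def])
	have "(\<lambda>x. SUP q\<in>\<rat> Int {0..<T}. if q < fst x then Z q (snd x) else 0) \<in> bm (PA T)"
		using T Z by (intro borel_measurable_SUP measurable_pred_left countable_Int1 countable_rat) auto
	moreover have "(SUP q\<in>\<rat> Int {0..<T}. if q < s then Z q w else 0) =
			indicator A w * emeasure w (({u<..v} Int {0<..<s}) \<times> {0..c})" (is "?S = ?E")
		if s: "s \<in> {0..T}" and w: "w \<in> configs" for s w
	proof (rule antisym)
		have D: "(({u<..v} Int {0<..<s}) \<times> {0..c}) \<in> sets w"
			unfolding configs_sets[OF w] by (rule half_plane_rect) auto
		show "?S <= ?E"
		proof (rule SUP_least)
			fix q assume "q \<in> \<rat> Int {0..<T}"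
			show "(if q < s then Z q w else 0) <= ?E"
				unfolding Z_def using uv by (auto intro!: mult_left_mono emeasure_mono D)
		qed
		show "?E <= ?S"
		proof (cases "u < s")
			case False
			then have "(({u<..v} Int {0<..<s}) \<times> {0..c}) = {}" by auto
			then have "?E = 0" by (metis emeasure_empty mult_zero_right)
			show ?thesis unfolding \<open>?E = 0\<close> by (rule zero_le)
		next
			case True
			define e where "e n = 1 / real (Suc n)" for n
			have e0: "e n > 0" for n by (simp add: e_def)
			have edec: "e n <= e m" if "m <= n" for m n using that by (simp add: e_def frac_le)
			define D where "D n = {u<..min v (s - e n)} \<times> {0..c}" for n
			have Dm: "D n \<in> sets w" for n unfolding D_def configs_sets[OF w] by (rule half_plane_rect) auto
			have "((({u<..v} Int {0<..<s}) \<times> {0..c})) = (\<Union>n. D n)"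
			proof (intro equalityI subsetI)
				fix z assume z: "z \<in> ({u<..v} Int {0<..<s}) \<times> {0..c}"
				then have "0 < s - fst z" by auto
				then obtain n where "e n < s - fst z" unfolding e_def by (rule nat_approx_posE)
				then show "z \<in> (\<Union>n. D n)" using z by (auto simp: D_def intro!: exI[of _ n])
			next
				fix z assume "z \<in> (\<Union>n. D n)"
				then obtain n where "z \<in> D n" by blast
				then show "z \<in> ({u<..v} Int {0<..<s}) \<times> {0..c}" using uv e0[of n] by (auto simp: D_def)
			qed
			moreover have "incseq D"
			proof (rule monoI)
				fix m n :: nat assume "m <= n"
				then have "e n <= e m" by (rule edec)
				then show "D m \<subseteq> D n" by (auto simp: D_def)
			qed
			ultimately have eq: "emeasure w (({u<..v} Int {0<..<s}) \<times> {0..c}) = (SUP n. emeasure w (D n))"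
				using Dm by (simp add: SUP_emeasure_incseq image_subset_iff)
			have "indicator A w * emeasure w (D n) <= ?S" for n
			proof -
				obtain q where q: "q \<in> \<rat>" "max u (s - e n) < q" "q < s"
					using Rats_dense_in_real[of "max u (s - e n)" s] True e0[of n] by auto
				have "{u<..min v q} \<times> {0..c} \<in> sets w" unfolding configs_sets[OF w] by (rule half_plane_rect) auto
				then have "indicator A w * emeasure w (D n) <= (if q < s then Z q w else 0)"
					using q by (auto simp: Z_def D_def intro!: mult_left_mono emeasure_mono)
				also have "... <= ?S" using q uv s by (intro SUP_upper) auto
				finally show ?thesis .
			qed
			then have "(SUP n. indicator A w * emeasure w (D n)) <= ?S" by (rule SUP_least)
			then show ?thesis unfolding eq by (simp only: SUP_mult_left_ennreal)
		qed
	qed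
	ultimately show ?thesis
		by (subst measurable_cong[where g = "\<lambda>x. SUP q\<in>\<rat> Int {0..<T}. if q < fst x then Z q (snd x) else 0"])
			(auto simp: predictable_alt[OF T'])
qed

text \<open>Open on the right like the integral in the Hawkes equation; counts over it are
  predictable for this reason.\<close>

definition past :: "real => (real \<times> real) set" where
	"past s = {0<..<s} \<times> {0..}"

lemma past_sets: "past s \<in> sets hp"
	unfolding past_def by (rule half_plane_rect) auto

lemma past_strip: "s <= T ==> past s \<subseteq> strip T"
	by (auto simp: past_def)

lemma pred_slice:
	assumes T: "0 < T" and E: "E \<in> sets (PB T)"
	shows "(\<lambda>x. emeasure (snd x) (slice T R E (snd x) Int past (fst x))) \<in> bm (PA T)"
proof -
	have T': "0 <= T" using T by simp
	have X: "({0..T} \<times> {0..R}) Int past s \<in> sets hp" for s by (intro sets.Int half_plane_rect past_sets) auto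
	have mX: "(\<lambda>x. emeasure (snd x) (({0..T} \<times> {0..R}) Int past (fst x))) \<in> bm (PA T)"
	proof -
		have "(\<lambda>x. indicator configs (snd x) * emeasure (snd x) (({0<..T} Int {0<..<fst x}) \<times> {0..R})) \<in> bm (PA T)"
			using T by (intro measurable_pred_count configs_in_hist) auto
		then show ?thesis
			by (rule measurable_cong[THEN iffD1, rotated])
				(auto simp: predictable_alt[OF T'] past_def intro!: arg_cong2[where f = emeasure])
	qed
	note pb = pb_alt[OF T]
	have E': "E \<in> sigma_sets (({0..T} \<times> configs) \<times> UNIV) (pb_gen T)" using E pb by simp
	have inE: "A \<in> sets (PB T)" if "A \<in> sigma_sets (({0..T} \<times> configs) \<times> UNIV) (pb_gen T)" for A
		using that pb by simp
	show ?thesis using pb(3) pb(4) E'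
	proof (induction E rule: sigma_sets_induct_disjoint)
		case (basic E)
		then obtain a c where Eac: "E = a \<times> {..c}" "a \<in> pred_gen T" by (auto simp: pb_gen_def)
		from Eac(2) show ?case
		proof (cases rule: pred_gen_cases)
			case (1 A)
			have "slice T R E w Int past s = {}" for s w using 1 Eac by (auto simp: slice_def pt_def past_def)
			then show ?thesis by simp
		next
			case (2 s t A)
			have eq: "slice T R E w Int past r = (if w \<in> A then ({s<..t} Int {0<..<r}) \<times> {0..min R c} else {})" for w r
				using 2 Eac T by (auto simp: slice_def pt_def past_def)
			have em: "emeasure w (slice T R E w Int past r) = indicator A w * emeasure w (({s<..t} Int {0<..<r}) \<times> {0..min R c})" for r w
				unfolding eq by (simp add: indicator_def)
			show ?thesis unfolding em by (rule measurable_pred_count[OF T 2(2-5)])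
		qed
	next
		case empty
		then show ?case by (simp add: slice_def)
	next
		case (compl E)
		have e1: "emeasure w (slice T R (({0..T} \<times> configs) \<times> UNIV - E) w Int past s) =
				emeasure w (({0..T} \<times> {0..R}) Int past s) - emeasure w (slice T R E w Int past s)" if "w \<in> configs" for w s
		proof -
			have sl: "slice T R (({0..T} \<times> configs) \<times> UNIV - E) w Int past s = ({0..T} \<times> {0..R}) Int past s - slice T R E w Int past s"
				using that by (auto simp: slice_def pt_def)
			have ss: "slice T R E w Int past s \<in> sets hp" "slice T R E w Int past s \<subseteq> ({0..T} \<times> {0..R}) Int past s"
				using slice_sets[OF T' that inE[OF compl(1)]] past_sets by (auto simp: slice_def)
			have "emeasure w (slice T R E w Int past s) < \<infinity>"
				by (rule configs_bounded(1)[OF that bounded_subset[OF bounded_rect[of T R]] ss(1)]) (use ss(2) in auto)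
			then show ?thesis
				unfolding sl using ss X configs_sets[OF that] by (intro emeasure_Diff) auto
		qed
		have "(\<lambda>x. emeasure (snd x) (({0..T} \<times> {0..R}) Int past (fst x)) - emeasure (snd x) (slice T R E (snd x) Int past (fst x)))
			\<in> bm (PA T)" using mX compl(2) by measurable
		then show ?case
			by (rule measurable_cong[THEN iffD1, rotated]) (auto simp: predictable_alt[OF T'] e1)
	next
		case (union A)
		have e1: "emeasure w (slice T R (\<Union>i. A i) w Int past s) = (\<Sum>i. emeasure w (slice T R (A i) w Int past s))" if "w \<in> configs" for w s
		proof -
			have sl: "slice T R (\<Union>i. A i) w Int past s = (\<Union>i. slice T R (A i) w Int past s)" by (auto simp: slice_def)
			have "slice T R (A i) w Int past s \<in> sets hp" for i
				using slice_sets[OF T' that inE, of "A i" R] union(2) past_sets[of s] by blast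
			then show ?thesis unfolding sl using union(1) configs_sets[OF that]
				by (intro suminf_emeasure[symmetric]) (auto simp: disjoint_family_on_def slice_def)
		qed
		have "(\<lambda>x. \<Sum>i. emeasure (snd x) (slice T R (A i) (snd x) Int past (fst x))) \<in> bm (PA T)"
			using union(3) by measurable
		then show ?case
			by (rule measurable_cong[THEN iffD1, rotated]) (auto simp: predictable_alt[OF T'] e1)
	qed
qed

text \<open>Applied to the thinning set, this makes the number of thinned points before the current
  time predictable, so that it can be compared with a level inside an integrand.\<close>

lemma pred_count:
	assumes T: "0 < T" and E: "E \<in> sets (PB T)"
	shows "(\<lambda>x. emeasure (snd x) {z \<in> past (fst x). pt (snd x) z \<in> E}) \<in> bm (PA T)"
proof -
	have T': "0 <= T" using T by simp
	have "(\<lambda>x. SUP n. emeasure (snd x) (slice T (real n) E (snd x) Int past (fst x))) \<in> bm (PA T)"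
		by (intro borel_measurable_SUP pred_slice[OF T E]) auto
	moreover have "(SUP n. emeasure w (slice T (real n) E w Int past s)) = emeasure w {z \<in> past s. pt w z \<in> E}"
		if "w \<in> configs" "s \<in> {0..T}" for w s
	proof -
		have U: "{z \<in> past s. pt w z \<in> E} = (\<Union>n. slice T (real n) E w Int past s)"
			using real_arch_simple that(2) by (auto simp: slice_def past_def)
		show ?thesis unfolding U using slice_sets[OF T' that(1) E] past_sets configs_sets[OF that(1)]
			by (intro SUP_emeasure_incseq) (auto simp: incseq_def slice_def)
	qed
	ultimately show ?thesis
		by (subst measurable_cong[where g = "\<lambda>x. SUP n. emeasure (snd x) (slice T (real n) E (snd x) Int past (fst x))"])
			(auto simp: predictable_alt[OF T'])
qed

text \<open>After weighting by \<open>exp (- 2 * K * t)\<close> the integral operator contracts by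
  one half, so the weighted supremum \<open>r\<close> satisfies \<open>r \<le> c + r / 2\<close>.
  The a priori bound \<open>n\<close> makes \<open>r\<close> finite and does not enter the
  conclusion, which is therefore uniform in a truncation level.\<close>

lemma nn_gronwall:
	fixes f :: "real => ennreal"
	assumes K: "0 < K" and c: "0 <= c" and T: "0 <= T"
		and fin: "!!t. t \<in> {0..T} ==> f t <= ennreal n"
		and f: "!!t. t \<in> {0..T} ==> f t <= ennreal c + ennreal K * (\<integral>\<^sup>+s\<in>{0..t}. f s \<partial>lborel)"
		and t: "t \<in> {0..T}"
	shows "f t <= ennreal (2 * c * exp (2 * K * t))"
proof -
	define m where "m = (SUP t\<in>{0..T}. f t * ennreal (exp (- 2 * K * t)))"
	have "m <= ennreal n" unfolding m_def
	proof (rule SUP_least)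
		fix t assume t: "t \<in> {0..T}"
		have "f t * ennreal (exp (- 2 * K * t)) <= ennreal n * 1"
			using t K by (intro mult_mono fin) (auto simp: mult_nonpos_nonneg)
		then show "f t * ennreal (exp (- 2 * K * t)) <= ennreal n" by simp
	qed
	then obtain r where r: "m = ennreal r" "0 <= r" by (cases m) (auto simp: top_unique)
	have fm: "f t <= ennreal (r * exp (2 * K * t))" if "t \<in> {0..T}" for t
	proof -
		have "f t * ennreal (exp (- 2 * K * t)) <= ennreal r" unfolding r(1)[symmetric] m_def using that by (rule SUP_upper)
		then have "f t * ennreal (exp (- 2 * K * t)) * ennreal (exp (2 * K * t)) <= ennreal r * ennreal (exp (2 * K * t))"
			by (rule mult_right_mono) simp
		then show ?thesis using r(2) by (simp add: mult.assoc ennreal_mult'[symmetric] exp_add[symmetric])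
	qed
	have step: "f t <= ennreal (c + r / 2 * exp (2 * K * t))" if t: "t \<in> {0..T}" for t
	proof -
		have hi: "((\<lambda>s. r * exp (2 * K * s)) has_integral (r * exp (2 * K * t) / (2 * K) - r * exp (2 * K * 0) / (2 * K))) {0..t}"
			using t K by (intro fundamental_theorem_of_calculus)
				(auto intro!: derivative_eq_intros simp: has_real_derivative_iff_has_vector_derivative[symmetric])
		have "(\<integral>\<^sup>+s\<in>{0..t}. f s \<partial>lborel) <= (\<integral>\<^sup>+s\<in>{0..t}. ennreal (r * exp (2 * K * s)) \<partial>lborel)"
			using fm t by (intro nn_integral_mono) (auto simp: indicator_def)
		also have "... = ennreal (r * exp (2 * K * t) / (2 * K) - r * exp (2 * K * 0) / (2 * K))"
			using r(2) hi by (intro nn_integral_has_integral_lebesgue') auto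
		also have "... <= ennreal (r * exp (2 * K * t) / (2 * K))" using r(2) K by (intro ennreal_leI) auto
		finally have "ennreal K * (\<integral>\<^sup>+s\<in>{0..t}. f s \<partial>lborel) <= ennreal K * ennreal (r * exp (2 * K * t) / (2 * K))"
			by (rule mult_left_mono) simp
		also have "... = ennreal (r / 2 * exp (2 * K * t))" using K by (simp add: ennreal_mult'[symmetric])
		finally have "f t <= ennreal c + ennreal (r / 2 * exp (2 * K * t))"
			by (rule order_trans[OF f[OF t] add_left_mono])
		then show ?thesis using c r(2) by (subst ennreal_plus) auto
	qed
	have "m <= ennreal (c + r / 2)" unfolding m_def
	proof (rule SUP_least)
		fix t assume t: "t \<in> {0..T}"
		have e: "exp (- (2 * K * t)) <= 1" using t K by simp
		have "f t * ennreal (exp (- 2 * K * t)) <= ennreal (c + r / 2 * exp (2 * K * t)) * ennreal (exp (- 2 * K * t))"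
			by (intro mult_right_mono step t) simp
		also have "... = ennreal (c * exp (- (2 * K * t)) + r / 2)"
			by (simp add: ennreal_mult''[symmetric] distrib_right mult.assoc exp_add[symmetric])
		also have "... <= ennreal (c + r / 2)" using mult_left_mono[OF e c] by (intro ennreal_leI) simp
		finally show "f t * ennreal (exp (- 2 * K * t)) <= ennreal (c + r / 2)" .
	qed
	then have "r <= c + r / 2" unfolding r(1) using c r(2) by (subst (asm) ennreal_le_iff) auto
	then have "r <= 2 * c" by simp
	then have "r * exp (2 * K * t) <= 2 * c * exp (2 * K * t)" by (intro mult_right_mono) auto
	then show ?thesis using fm[OF t] ennreal_leI order_trans by blast
qed


section \<open>Thinned points and their accumulation\<close>

definition thinned :: "(real => real) => config => real => ennreal" where
	"thinned l w t = (\<integral>\<^sup>+z\<in>past t. of_bool (snd z <= l (fst z)) \<partial>w)"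

lemma hawkes_path_alt:
	"hawkes_path \<nu> \<psi> T l w \<longleftrightarrow> (\<forall>t\<in>{0..T}.
		 ennreal (l t) = ennreal \<nu> + (\<integral>\<^sup>+z\<in>past t. ennreal (\<psi> (t - fst z) * of_bool (snd z <= l (fst z))) \<partial>w))"
	unfolding hawkes_path_def past_def by (simp add: case_prod_beta')

text \<open>The translates of \<open>{\<psi> > 1/n}\<close> to infinitely many thinned points clustering from the right at
	\<open>\<tau>\<close> have a limsup of positive measure, and the intensity would be infinite there.\<close>

lemma thinned_no_descent:
	assumes w: "w \<in> configs" and path: "hawkes_path \<nu> \<psi> T l w"
		and \<psi>: "!!t. 0 <= t ==> 0 <= \<psi> t" and \<psi>m: "(\<lambda>t. indicator {0..} t * \<psi> t) \<in> bm borel"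
		and T1: "!!s. 0 <= s ==> s < T1 ==> emeasure lborel {x \<in> {0<..<T - s}. \<psi> x > 0} ~= 0"
		and B: "B \<subseteq> {z \<in> pts w. 0 < fst z & fst z < T1 & snd z <= l (fst z)}" "B ~= {}"
	shows "\<exists>z\<in>B. \<forall>z'\<in>B. fst z <= fst z'"
proof (rule ccontr)
	assume neg: "~ ?thesis"
	define \<tau> where "\<tau> = Inf (fst ` B)"
	have bdd: "bdd_below (fst ` B)" using B(1) by (intro bdd_belowI[of _ 0]) auto
	have \<tau>0: "0 <= \<tau>" unfolding \<tau>_def using B by (intro cInf_greatest) auto
	have \<tau>le: "\<tau> <= fst z" if "z \<in> B" for z unfolding \<tau>_def using bdd that by (intro cInf_lower) auto
	have \<tau>lt: "\<tau> < fst z" if "z \<in> B" for z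
	proof -
		have "~ (\<forall>z'\<in>B. fst z <= fst z')"
		proof
			assume a: "\<forall>z'\<in>B. fst z <= fst z'"
			show False by (rule notE[OF neg bexI[where P = "\<lambda>z. \<forall>z'\<in>B. fst z <= fst z'", OF a that]])
		qed
		then have "\<exists>z'\<in>B. ~ fst z <= fst z'" by simp
		then obtain z' where "z' \<in> B" "~ fst z <= fst z'" by (rule bexE)
		then show ?thesis using \<tau>le[of z'] by linarith
	qed
	have near: "\<exists>z\<in>B. fst z < \<tau> + e" if "e > 0" for e
		using cInf_lessD[of "fst ` B" "\<tau> + e"] B(2) that by (auto simp: \<tau>_def)
	obtain z0 where "z0 \<in> B" using B(2) by blast
	then have \<tau>T1: "\<tau> < T1" using B(1) \<tau>lt by fastforce
	have "\<forall>j. \<exists>z\<in>B. fst z < \<tau> + 1 / real (Suc j)" using near by simp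
	then obtain b where b: "!!j. b j \<in> B" "!!j. fst (b j) < \<tau> + 1 / real (Suc j)" by metis
	\<comment> \<open>Part of the set where the kernel exceeds \<open>1 / real (Suc n)\<close>. The
	  right end stays \<open>1 / real (Suc n)\<close> below \<open>T - \<tau>\<close>, so that the
	  translate by \<open>fst (b j)\<close> stays below \<open>T\<close> for
	  \<open>j \<ge> n\<close>.\<close>
	define E where "E n = {x \<in> {0<..<T - \<tau> - 1 / real (Suc n)}. \<psi> x > 1 / real (Suc n)}" for n
	have Em: "E n \<in> sets borel" for n
	proof -
		have "E n = {x \<in> space borel. 0 < x & x < T - \<tau> - 1 / real (Suc n) & indicator {0..} x * \<psi> x > 1 / real (Suc n)}"
			by (auto simp: E_def)
		then show ?thesis using \<psi>m by simp
	qed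
	have "\<exists>n. emeasure lborel (E n) ~= 0"
	proof (rule ccontr)
		assume "\<nexists>n. emeasure lborel (E n) ~= 0"
		then have "emeasure lborel (\<Union>n. E n) = 0" using Em by (intro emeasure_UN_eq_0) auto
		moreover have "{x \<in> {0<..<T - \<tau>}. \<psi> x > 0} \<subseteq> (\<Union>n. E n)"
		proof
			fix x assume x: "x \<in> {x \<in> {0<..<T - \<tau>}. \<psi> x > 0}"
			then have "0 < min (T - \<tau> - x) (\<psi> x)" by auto
			then obtain n where "1 / real (Suc n) < min (T - \<tau> - x) (\<psi> x)" by (rule nat_approx_posE)
			then show "x \<in> (\<Union>n. E n)" using x by (auto simp: E_def intro!: exI[of _ n])
		qed
		moreover have "(\<Union>n. E n) \<in> sets lborel" using Em by auto
		ultimately have "emeasure lborel {x \<in> {0<..<T - \<tau>}. \<psi> x > 0} = 0"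
			by (metis emeasure_mono le_zero_eq)
		then show False using T1[OF \<tau>0 \<tau>T1] by simp
	qed
	then obtain n where n: "emeasure lborel (E n) ~= 0" by blast
	define X where "X j = {t. t - fst (b j) \<in> E n}" for j
	have Xm: "X j \<in> sets borel" for j
	proof -
		have "(\<lambda>t. t - fst (b j)) \<in> bm borel" by measurable
		from measurable_sets[OF this Em[of n]] show ?thesis by (simp add: X_def vimage_def)
	qed
	have XE: "emeasure lborel (X j) = emeasure lborel (E n)" for j
	proof -
		have "emeasure lborel (E n) = emeasure (distr lborel borel ((+) (- fst (b j)))) (E n)"
			by (simp add: lborel_distr_plus)
		also have "... = emeasure lborel (X j)"
			using Em by (subst emeasure_distr) (auto simp: X_def vimage_def intro!: arg_cong2[where f = emeasure])
		finally show ?thesis by simp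
	qed
	\<comment> \<open>A time in all \<open>Y k\<close> lies in infinitely many translates of
	  \<open>E n\<close>. The tails decrease inside a bounded interval, so continuity from above gives
	  their intersection at least the measure of \<open>E n\<close>.\<close>
	define Y where "Y k = (\<Union>j\<in>{max k n..}. X j)" for k
	have Ym: "Y k \<in> sets lborel" for k unfolding Y_def using Xm by auto
	have Ysub: "Y k \<subseteq> {\<tau><..<T}" for k
	proof
		fix t assume "t \<in> Y k"
		then obtain j where j: "j >= n" "t - fst (b j) \<in> E n" by (auto simp: Y_def X_def)
		have "1 / real (Suc j) <= 1 / real (Suc n)" using j(1) by (simp add: frac_le)
		then show "t \<in> {\<tau><..<T}" using j(2) b(2)[of j] \<tau>lt[OF b(1)[of j]] by (auto simp: E_def)
	qed
	have Yfin: "emeasure lborel (Y k) ~= \<infinity>" for k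
	proof -
		have "emeasure lborel (Y k) <= emeasure lborel {\<tau>..T}" using Ysub[of k] by (intro emeasure_mono) auto
		also have "... < \<infinity>" by (simp add: emeasure_lborel_Icc_eq)
		finally show ?thesis by simp
	qed
	have "decseq Y" unfolding Y_def by (intro decseq_SucI) force
	then have "(INF k. emeasure lborel (Y k)) = emeasure lborel (\<Inter>k. Y k)"
		using Ym Yfin by (intro INF_emeasure_decseq) auto
	moreover have "emeasure lborel (E n) <= (INF k. emeasure lborel (Y k))"
	proof (rule INF_greatest)
		fix k
		have "X (max k n) \<subseteq> Y k" by (auto simp: Y_def)
		from emeasure_mono[OF this Ym] show "emeasure lborel (E n) <= emeasure lborel (Y k)" by (simp add: XE)
	qed
	ultimately have "emeasure lborel (\<Inter>k. Y k) ~= 0" using n by (metis le_zero_eq)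
	then have "(\<Inter>k. Y k) ~= {}" by (metis emeasure_empty)
	then obtain t where t: "!!k. t \<in> Y k" by blast
	have tT: "\<tau> < t" "t <= T" using Ysub[of 0] t[of 0] by auto
	define F where "F = {z \<in> B. t - fst z \<in> E n}"
	\<comment> \<open>Finitely many points of \<open>B\<close> would keep a positive distance from
	  \<open>\<tau>\<close>, whereas the points \<open>b j\<close> that act at \<open>t\<close> come
	  arbitrarily close to it.\<close>
	have "infinite F"
	proof
		assume fin: "finite F"
		have "\<exists>j. b j \<in> F" using t[of 0] b(1) by (auto simp: Y_def X_def F_def)
		then have ne: "F ~= {}" by blast
		define d where "d = Min (fst ` F) - \<tau>"
		have "d > 0" using fin ne \<tau>lt by (auto simp: d_def F_def)
		then obtain k where k: "1 / real (Suc k) < d" by (rule nat_approx_posE)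
		obtain j where j: "j >= k" "b j \<in> F" using t[of k] b(1) by (auto simp: Y_def X_def F_def)
		have "1 / real (Suc j) <= 1 / real (Suc k)" using j(1) by (simp add: frac_le)
		then have "fst (b j) < \<tau> + d" using b(2)[of j] k by linarith
		moreover have "Min (fst ` F) <= fst (b j)" using fin j(2) by auto
		ultimately show False by (simp add: d_def)
	qed
	\<comment> \<open>Any \<open>N\<close> points of \<open>F\<close> contribute at least
	  \<open>N / Suc n\<close> to the intensity at \<open>t\<close>.\<close>
	have "ennreal (1 / real (Suc n)) * of_nat N <= ennreal (l t)" for N
	proof -
		obtain G where G: "finite G" "card G = N" "G \<subseteq> F" using \<open>infinite F\<close> infinite_arbitrarily_large by metis
		have Gp: "G \<subseteq> pts w" using G(3) B(1) by (auto simp: F_def)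
		note Gm = emeasure_finite_pts[OF w G(1) Gp]
		have "ennreal (1 / real (Suc n)) * of_nat N = (\<integral>\<^sup>+z. ennreal (1 / real (Suc n)) * indicator G z \<partial>w)"
			using Gm configs_sets[OF w] G(2) by (subst nn_integral_cmult_indicator) auto
		also have "... <= (\<integral>\<^sup>+z\<in>past t. ennreal (\<psi> (t - fst z) * of_bool (snd z <= l (fst z))) \<partial>w)"
		proof (rule nn_integral_mono)
			fix z
			show "ennreal (1 / real (Suc n)) * indicator G z <=
				ennreal (\<psi> (t - fst z) * of_bool (snd z <= l (fst z))) * indicator (past t) z"
			proof (cases "z \<in> G")
				case True
				then have "z \<in> B" "t - fst z \<in> E n" using G(3) by (auto simp: F_def)
				then have "z \<in> past t" "snd z <= l (fst z)" "1 / real (Suc n) <= \<psi> (t - fst z)"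
					using B(1) pts_subset[OF w] by (auto simp: past_def E_def mem_Times_iff)
				then show ?thesis using True by (auto intro!: ennreal_leI)
			qed simp
		qed
		also have "... <= ennreal (l t)"
			using path[unfolded hawkes_path_alt, rule_format, of t] tT \<tau>0 by simp
		finally show ?thesis .
	qed
	then have le: "real N / real (Suc n) <= \<bar>l t\<bar>" for N
	proof -
		have "ennreal (real N / real (Suc n)) = ennreal (1 / real (Suc n)) * of_nat N"
			by (simp add: ennreal_of_nat_eq_real_of_nat ennreal_mult'[symmetric])
		also have "... <= ennreal (l t)" by fact
		also have "... <= ennreal \<bar>l t\<bar>" by (intro ennreal_leI) simp
		finally show ?thesis by (simp add: ennreal_le_iff)
	qed
	obtain N :: nat where "real N > \<bar>l t\<bar> * real (Suc n)" using reals_Archimedean2 by blast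
	then show False using le[of N] by (simp add: field_simps)
qed

lemma thinned_set_measurable:
	assumes w: "w \<in> configs" and A: "A \<subseteq> pts w"
	shows "A \<in> sets hp"
proof -
	have "countable (pts w)" by (rule pts_countable[OF w])
	then have "countable A" using A countable_subset by blast
	then have "A \<in> sets borel" by (rule sets.countable[rotated]) (rule borel_closed, rule closed_singleton)
	then show ?thesis using A pts_subset[OF w] by (auto simp: sets_half_plane)
qed

lemma nn_integral_pts:
	assumes w: "w \<in> configs"
	shows "(\<integral>\<^sup>+z. of_bool (Q z) \<partial>w) = emeasure w {z \<in> pts w. Q z}"
proof -
	have "(\<integral>\<^sup>+z. of_bool (Q z) \<partial>w) = (\<integral>\<^sup>+z. indicator {z \<in> pts w. Q z} z \<partial>w)"
		using pts_AE[OF w] by (intro nn_integral_cong_AE) (auto elim!: eventually_mono simp: indicator_def)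
	also have "... = emeasure w {z \<in> pts w. Q z}"
		using thinned_set_measurable[OF w, of "{z \<in> pts w. Q z}"] configs_sets[OF w] by (intro nn_integral_indicator) auto
	finally show ?thesis .
qed

lemma thinned_eq:
	"w \<in> configs ==> thinned l w t = emeasure w {z \<in> pts w. z \<in> past t & snd z <= l (fst z)}"
proof -
	assume w: "w \<in> configs"
	have "thinned l w t = (\<integral>\<^sup>+z. of_bool (z \<in> past t & snd z <= l (fst z)) \<partial>w)"
		unfolding thinned_def by (intro nn_integral_cong) (auto simp: indicator_def)
	then show ?thesis by (simp add: nn_integral_pts[OF w])
qed

text \<open>Consider the earliest thinned point with at least \<open>n\<close> thinned predecessors.
  Each predecessor has fewer than \<open>n\<close> of its own, so the right-hand side already counts
  at least \<open>n\<close>. An earliest such point exists by \<open>wf\<close>; points clustering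
  from the right would each have infinitely many predecessors, and none would be counted.\<close>

lemma thinned_truncation:
	assumes w: "w \<in> configs"
		and wf: "!!B. B \<subseteq> {z \<in> pts w. 0 < fst z & fst z < T1 & snd z <= l (fst z)} ==> B ~= {} ==> \<exists>z\<in>B. \<forall>z'\<in>B. fst z <= fst z'"
		and t: "t <= T1"
	shows "min (thinned l w t) n <= (\<integral>\<^sup>+z\<in>past t. of_bool (snd z <= l (fst z) & thinned l w (fst z) < n) \<partial>w)"
proof -
	define W where "W t = {z \<in> pts w. z \<in> past t & snd z <= l (fst z)}" for t
	have N: "thinned l w t = emeasure w (W t)" for t unfolding W_def by (rule thinned_eq[OF w])
	have I: "(\<integral>\<^sup>+z\<in>past t. of_bool (snd z <= l (fst z) & thinned l w (fst z) < n) \<partial>w) =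
			(\<integral>\<^sup>+z. of_bool (z \<in> past t & snd z <= l (fst z) & thinned l w (fst z) < n) \<partial>w)"
		by (intro nn_integral_cong) (auto simp: indicator_def)
	have R: "(\<integral>\<^sup>+z\<in>past t. of_bool (snd z <= l (fst z) & thinned l w (fst z) < n) \<partial>w) =
			emeasure w {z \<in> W t. thinned l w (fst z) < n}"
	proof -
		have "{z \<in> W t. thinned l w (fst z) < n} =
				{z \<in> pts w. z \<in> past t & snd z <= l (fst z) & thinned l w (fst z) < n}" by (auto simp: W_def)
		then show ?thesis by (simp only: I nn_integral_pts[OF w])
	qed
	have Ws: "{z \<in> W t. Q z} \<in> sets w" for Q t
		unfolding configs_sets[OF w] by (rule thinned_set_measurable[OF w]) (auto simp: W_def)
	show ?thesis
	proof (cases "\<forall>z\<in>W t. thinned l w (fst z) < n")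
		case True
		then have "{z \<in> W t. thinned l w (fst z) < n} = W t" by auto
		then show ?thesis by (simp only: R N[of t] min.cobounded1)
	next
		case False
		define B where "B = {z \<in> W t. ~ thinned l w (fst z) < n}"
		have "B \<subseteq> {z \<in> pts w. 0 < fst z & fst z < T1 & snd z <= l (fst z)}"
			using t by (auto simp: B_def W_def past_def)
		moreover have "B ~= {}" using False by (auto simp: B_def)
		ultimately have "\<exists>z\<in>B. \<forall>z'\<in>B. fst z <= fst z'" by (rule wf)
		then obtain z where "z \<in> B" "\<forall>z'\<in>B. fst z <= fst z'" by (rule bexE)
		then have z: "z \<in> B" "!!z'. z' \<in> B ==> fst z <= fst z'" by simp_all
		have "W (fst z) \<subseteq> {z \<in> W t. thinned l w (fst z) < n}"
		proof
			fix y assume y: "y \<in> W (fst z)"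
			have zt: "z \<in> past t" using z(1) by (simp add: B_def W_def)
			have yz: "y \<in> past (fst z)" using y by (simp add: W_def)
			then have lt: "fst y < fst z" by (auto simp: past_def)
			have "y \<in> past t" using zt yz by (auto simp: past_def)
			then have "y \<in> W t" using y by (simp add: W_def)
			then show "y \<in> {z \<in> W t. thinned l w (fst z) < n}" using z(2)[of y] lt unfolding B_def by fastforce
		qed
		then have "thinned l w (fst z) <= emeasure w {z \<in> W t. thinned l w (fst z) < n}"
			unfolding N[of "fst z"] using Ws by (intro emeasure_mono) (auto simp: N)
		moreover have "n <= thinned l w (fst z)" using z(1) by (auto simp: B_def)
		ultimately show ?thesis unfolding R by (auto simp: min_le_iff_disj)
	qed
qed


text \<open>Extends processes given on \<open>{0..T}\<close> to all real times, so that joint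
  measurability can be stated over the Borel line.\<close>

definition clamp :: "real => real => real" where
	"clamp T t = max 0 (min T t)"

lemma measurable_clamp: "0 <= T ==> clamp T \<in> measurable borel (restrict_space borel {0..T})"
	unfolding clamp_def by (intro measurable_restrict_space2) auto

lemma clamp_id: "t \<in> {0..T} ==> clamp T t = t"
	by (auto simp: clamp_def)

lemma (in prm) measurable_pred_clamp:
	assumes T: "0 <= T" and h: "h \<in> measurable (PA T) S"
	shows "(\<lambda>x. h (clamp T (fst x), snd x)) \<in> measurable (borel \<Otimes>\<^sub>M P) S"
proof -
	have "(\<lambda>x. (clamp T (fst x), snd x)) \<in> measurable (borel \<Otimes>\<^sub>M P) (restrict_space borel {0..T} \<Otimes>\<^sub>M P)"
		using measurable_compose[OF measurable_fst measurable_clamp[OF T]] by measurable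
	from measurable_compose[OF this measurable_pred_joint[OF T]] have
		"(\<lambda>x. (clamp T (fst x), snd x)) \<in> measurable (borel \<Otimes>\<^sub>M P) (PA T)" .
	from measurable_compose[OF this h] show ?thesis .
qed

lemma (in prm) measurable_pred_strip:
	fixes h :: "_ => ennreal"
	assumes T: "0 <= T" and h: "h \<in> bm (PA T)"
	shows "(\<lambda>x. h x * indicator {0..T} (fst x)) \<in> bm (borel \<Otimes>\<^sub>M P)"
proof -
	have "(\<lambda>x. h (clamp T (fst x), snd x) * indicator {0..T} (fst x)) \<in> bm (borel \<Otimes>\<^sub>M P)"
		using measurable_pred_clamp[OF T h] by measurable
	also have "(\<lambda>x. h (clamp T (fst x), snd x) * indicator {0..T} (fst x)) = (\<lambda>x. h x * indicator {0..T} (fst x))"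
		by (auto simp: fun_eq_iff indicator_def clamp_id)
	finally show ?thesis .
qed

section \<open>Thinning and the mean of the Hawkes intensity\<close>

locale hawkes = prm +
	fixes \<nu> T K :: real and \<psi> :: "real => real" and l :: "real => config => real"
	assumes T: "0 < T" and nu: "0 < \<nu>" and K: "0 < K"
		and psi_nonneg: "!!t. 0 <= t ==> 0 <= \<psi> t"
		and psi_le: "!!t. 0 <= t ==> t <= T ==> \<psi> t <= K"
		and psi_meas: "(\<lambda>t. indicator {0..} t * \<psi> t) \<in> bm borel"
		and intensity: "hawkes_intensity P \<nu> \<psi> T l"
begin

lemma T0: "0 <= T" using T by simp

lemma l_meas: "(\<lambda>x. l (fst x) (snd x)) \<in> bm (PA T)"
	using intensity by (simp add: hawkes_intensity_def case_prod_beta')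

lemma path_AE: "AE w in P. w \<in> configs & hawkes_path \<nu> \<psi> T (\<lambda>t. l t w) w"
	using intensity AE_space unfolding hawkes_intensity_def by (auto simp: space_P elim: eventually_elim2)

lemma hawkes_path_ge:
	assumes "hawkes_path \<nu> \<psi> T' k w" "t \<in> {0..T'}"
	shows "\<nu> <= k t"
proof -
	have "ennreal \<nu> <= ennreal (k t)" using assms by (auto simp: hawkes_path_def)
	then show ?thesis using nu by (simp add: ennreal_le_iff2)
qed

lemma l_ge: "AE w in P. \<forall>t\<in>{0..T}. \<nu> <= l t w"
	using path_AE by eventually_elim (auto intro: hawkes_path_ge)

abbreviation lx :: "(real \<times> config) \<times> real => real" where
	"lx x \<equiv> l (fst (fst x)) (snd (fst x))"

lemma thin_pred: "{x \<in> space (PB T). snd x <= lx x} \<in> sets (PB T)"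
proof -
	have [measurable]: "(\<lambda>x. lx x) \<in> bm (PB T)"
		by (rule measurable_compose[OF measurable_fst l_meas])
	show ?thesis by measurable
qed

lemma thin_meas:
	fixes g :: "_ => ennreal"
	assumes g: "g \<in> bm (PA T)"
	shows "(\<lambda>x. g (fst x) * of_bool (snd x <= lx x)) \<in> bm (PB T)"
proof -
	have "(\<lambda>x. g (fst x) * indicator {x \<in> space (PB T). snd x <= lx x} x) \<in> bm (PB T)"
		using thin_pred measurable_compose[OF measurable_fst g] by measurable
	then show ?thesis by (rule measurable_cong[THEN iffD1, rotated]) (auto simp: indicator_def)
qed

text \<open>By the Mecke formula the points may be replaced by \<open>dt d\<theta>\<close>, and
  integrating the mark over \<open>\<theta> \<le> l\<close> produces the factor \<open>l\<close>:
  the thinned points have intensity \<open>l\<close>.\<close>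

lemma thin_integral:
	fixes g :: "_ => ennreal"
	assumes g: "g \<in> bm (PA T)"
	shows "(\<integral>\<^sup>+w. (\<integral>\<^sup>+z\<in>strip T. g (fst z, w) * of_bool (snd z <= l (fst z) w) \<partial>w) \<partial>P) =
			(\<integral>\<^sup>+s\<in>{0..T}. (\<integral>\<^sup>+w. g (s, w) * ennreal (l s w) \<partial>P) \<partial>lborel)"
		and "(\<lambda>w. \<integral>\<^sup>+z\<in>strip T. g (fst z, w) * of_bool (snd z <= l (fst z) w) \<partial>w) \<in> bm P"
proof -
	let ?f = "\<lambda>x. g (fst x) * of_bool (snd x <= lx x)"
	note m = mecke[OF T thin_meas[OF g]]
	show "(\<lambda>w. \<integral>\<^sup>+z\<in>strip T. g (fst z, w) * of_bool (snd z <= l (fst z) w) \<partial>w) \<in> bm P"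
		using m by (simp add: pt_def)
	interpret pf: pair_sigma_finite lborel P ..
	have "(\<integral>\<^sup>+w. (\<integral>\<^sup>+z\<in>strip T. g (fst z, w) * of_bool (snd z <= l (fst z) w) \<partial>w) \<partial>P) =
			(\<integral>\<^sup>+w. (ptint (strip T) hp ?f w) \<partial>P)"
		using m by (simp add: pt_def)
	also have "... = (\<integral>\<^sup>+w. (\<integral>\<^sup>+s. g (s, w) * ennreal (l s w) * indicator {0..T} s \<partial>lborel) \<partial>P)"
	proof (rule nn_integral_cong)
		fix w assume "w \<in> space P"
		then have w: "w \<in> configs" by (simp add: space_P)
		have "(ptint (strip T) hp ?f w) = (\<integral>\<^sup>+s\<in>{0..T}. (\<integral>\<^sup>+\<theta>\<in>{0..}. ?f (pt w (s, \<theta>)) \<partial>lborel) \<partial>lborel)"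
			by (rule nn_integral_half_plane[OF measurable_pt_strip[OF T0 w thin_meas[OF g]]])
		also have "... = (\<integral>\<^sup>+s. g (s, w) * ennreal (l s w) * indicator {0..T} s \<partial>lborel)"
		proof (rule nn_integral_cong)
			fix s
			have "(\<integral>\<^sup>+\<theta>\<in>{0..}. ?f (pt w (s, \<theta>)) \<partial>lborel) = (\<integral>\<^sup>+\<theta>. g (s, w) * indicator {0..l s w} \<theta> \<partial>lborel)"
				by (intro nn_integral_cong) (auto simp: pt_def indicator_def)
			also have "... = g (s, w) * ennreal (l s w)"
				by (subst nn_integral_cmult_indicator) (auto simp: emeasure_lborel_Icc_eq ennreal_neg)
			finally show "(\<integral>\<^sup>+\<theta>\<in>{0..}. ?f (pt w (s, \<theta>)) \<partial>lborel) * indicator {0..T} s = g (s, w) * ennreal (l s w) * indicator {0..T} s"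
				by simp
		qed
		finally show "(ptint (strip T) hp ?f w) = (\<integral>\<^sup>+s. g (s, w) * ennreal (l s w) * indicator {0..T} s \<partial>lborel)" .
	qed
	also have "... = (\<integral>\<^sup>+s. (\<integral>\<^sup>+w. g (s, w) * ennreal (l s w) * indicator {0..T} s \<partial>P) \<partial>lborel)"
	proof (rule pf.Fubini')
		have "(\<lambda>x. (g x * ennreal (l (fst x) (snd x))) * indicator {0..T} (fst x)) \<in> bm (borel \<Otimes>\<^sub>M P)"
		proof (rule measurable_pred_strip[OF T0])
			show "(\<lambda>x. g x * ennreal (l (fst x) (snd x))) \<in> bm (PA T)"
				using g measurable_compose[OF l_meas measurable_ennreal] by (rule borel_measurable_times_ennreal)
		qed
		then show "(\<lambda>(s, w). g (s, w) * ennreal (l s w) * indicator {0..T} s) \<in> bm (lborel \<Otimes>\<^sub>M P)"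
		proof -
			assume *: "(\<lambda>x. (g x * ennreal (l (fst x) (snd x))) * indicator {0..T} (fst x)) \<in> bm (borel \<Otimes>\<^sub>M P)"
			have "sets (lborel \<Otimes>\<^sub>M P) = sets (borel \<Otimes>\<^sub>M P)" by (rule sets_pair_measure_cong) simp_all
			then show ?thesis unfolding case_prod_beta' by (subst measurable_cong_sets[OF \<open>sets (lborel \<Otimes>\<^sub>M P) = _\<close> refl]) (use * in \<open>simp only: prod.collapse\<close>)
		qed
	qed
	also have "... = (\<integral>\<^sup>+s\<in>{0..T}. (\<integral>\<^sup>+w. g (s, w) * ennreal (l s w) \<partial>P) \<partial>lborel)"
		by (intro nn_integral_cong) (auto simp: indicator_def)
	finally show "(\<integral>\<^sup>+w. (\<integral>\<^sup>+z\<in>strip T. g (fst z, w) * of_bool (snd z <= l (fst z) w) \<partial>w) \<partial>P) =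
			(\<integral>\<^sup>+s\<in>{0..T}. (\<integral>\<^sup>+w. g (s, w) * ennreal (l s w) \<partial>P) \<partial>lborel)" .
qed

definition mean :: "real => ennreal" where
	"mean t = (\<integral>\<^sup>+w. ennreal (l t w) \<partial>P)"

lemma past_in_strip: "t <= T ==> indicator (past t) z = (indicator (strip T) z * of_bool (0 < fst z & fst z < t) :: ennreal)"
	by (cases z) (auto simp: past_def indicator_def)

text \<open>Expectation of the Hawkes equation, with the points replaced through
  \<open>thin_integral\<close>. It is stated in \<open>ennreal\<close> because nothing yet excludes
  an infinite mean.\<close>

lemma mean_equation:
	assumes t: "t \<in> {0..T}"
	shows "mean t = ennreal \<nu> + (\<integral>\<^sup>+s\<in>{0<..<t}. ennreal (\<psi> (t - s)) * mean s \<partial>lborel)"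
proof -
	define h where "h s = ennreal (indicator {0..} (t - s) * \<psi> (t - s)) * of_bool (0 < s & s < t)" for s
	have hb: "h \<in> bm borel"
	proof -
		have "(\<lambda>s. ennreal (indicator {0..} (t - s) * \<psi> (t - s)) * indicator {0<..<t} s) \<in> bm borel"
			using measurable_compose[OF _ psi_meas, of "\<lambda>s. t - s"] by measurable
		also have "(\<lambda>s. ennreal (indicator {0..} (t - s) * \<psi> (t - s)) * indicator {0<..<t} s) = h"
			by (auto simp: h_def fun_eq_iff indicator_def)
		finally show ?thesis .
	qed
	have hm: "(\<lambda>x. h (fst x)) \<in> bm (PA T)"
		by (rule measurable_compose[OF measurable_pred_fst[OF T0] hb])
	have "mean t = (\<integral>\<^sup>+w. ennreal \<nu> + (\<integral>\<^sup>+z\<in>strip T. h (fst z) * of_bool (snd z <= l (fst z) w) \<partial>w) \<partial>P)"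
		unfolding mean_def
	proof (intro nn_integral_cong_AE, use path_AE in eventually_elim)
		case (elim w)
		then have "ennreal (l t w) = ennreal \<nu> + (\<integral>\<^sup>+z\<in>past t. ennreal (\<psi> (t - fst z) * of_bool (snd z <= l (fst z) w)) \<partial>w)"
			using t by (simp add: hawkes_path_alt)
		also have "(\<integral>\<^sup>+z\<in>past t. ennreal (\<psi> (t - fst z) * of_bool (snd z <= l (fst z) w)) \<partial>w) =
				(\<integral>\<^sup>+z\<in>strip T. h (fst z) * of_bool (snd z <= l (fst z) w) \<partial>w)"
			using t by (intro nn_integral_cong) (auto simp: past_in_strip h_def)
		finally show ?case .
	qed
	also have "... = ennreal \<nu> + (\<integral>\<^sup>+w. (\<integral>\<^sup>+z\<in>strip T. h (fst z) * of_bool (snd z <= l (fst z) w) \<partial>w) \<partial>P)"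
		using thin_integral(2)[OF hm] by (subst nn_integral_add) (auto simp: emeasure_space_1)
	also have "(\<integral>\<^sup>+w. (\<integral>\<^sup>+z\<in>strip T. h (fst z) * of_bool (snd z <= l (fst z) w) \<partial>w) \<partial>P) =
			(\<integral>\<^sup>+s\<in>{0..T}. (\<integral>\<^sup>+w. h s * ennreal (l s w) \<partial>P) \<partial>lborel)"
		using thin_integral(1)[OF hm] by simp
	also have "... = (\<integral>\<^sup>+s\<in>{0<..<t}. ennreal (\<psi> (t - s)) * mean s \<partial>lborel)"
	proof (rule nn_integral_cong)
		fix s
		have "(\<lambda>w. ennreal (l s w)) \<in> bm P" if "s \<in> {0..T}"
			using measurable_compose[OF _ measurable_pred_strip[OF T0 measurable_compose[OF l_meas measurable_ennreal]], of "\<lambda>w. (s, w)" P] that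
			by (simp add: indicator_def)
		then show "(\<integral>\<^sup>+w. h s * ennreal (l s w) \<partial>P) * indicator {0..T} s = ennreal (\<psi> (t - s)) * mean s * indicator {0<..<t} s"
			using t by (auto simp: mean_def nn_integral_cmult h_def indicator_def)
	qed
	finally show ?thesis .
qed

lemma l_meas_P:
	assumes "t \<in> {0..T}"
	shows "(\<lambda>w. l t w) \<in> bm P"
	using measurable_compose[OF _ measurable_pred_clamp[OF T0 l_meas], of "\<lambda>w. (t, w)" P] assms
	by (simp add: clamp_id)

lemma l_meas_t:
	assumes "w \<in> configs"
	shows "(\<lambda>t. l (clamp T t) w) \<in> bm borel"
	using measurable_compose[OF _ measurable_pred_clamp[OF T0 l_meas], of "\<lambda>t. (t, w)" borel] assms
	by (simp add: space_P)

lemma pred_nn_integral_meas: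
	fixes h :: "_ => ennreal"
	assumes h: "h \<in> bm (PA T)"
	shows "(\<lambda>s. (\<integral>\<^sup>+w. h (s, w) \<partial>P) * indicator {0..T} s) \<in> bm borel"
proof -
	have "(\<lambda>s. \<integral>\<^sup>+w. h (clamp T s, w) \<partial>P) \<in> bm borel"
		using measurable_pred_clamp[OF T0 h] by (intro borel_measurable_nn_integral) (simp add: case_prod_beta')
	then have "(\<lambda>s. (\<integral>\<^sup>+w. h (clamp T s, w) \<partial>P) * indicator {0..T} s) \<in> bm borel" by measurable
	also have "(\<lambda>s. (\<integral>\<^sup>+w. h (clamp T s, w) \<partial>P) * indicator {0..T} s) = (\<lambda>s. (\<integral>\<^sup>+w. h (s, w) \<partial>P) * indicator {0..T} s)"
		by (auto simp: fun_eq_iff indicator_def clamp_id)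
	finally show ?thesis .
qed

lemma mean_meas: "(\<lambda>s. mean s * indicator {0..T} s) \<in> bm borel"
	using pred_nn_integral_meas[OF measurable_compose[OF l_meas measurable_ennreal]] by (simp add: mean_def)

text \<open>\<open>T - T1\<close> is the dead time of the kernel, capped at \<open>T\<close>. The
  kernel of a point before \<open>T1\<close> is felt by time \<open>T\<close>, so
  \<open>thinned_no_descent\<close> controls such points. Points after \<open>T1\<close> might
  accumulate as far as the equation is concerned, but they act on almost no later time up to
  \<open>T\<close>.\<close>

lemma last_active:
	obtains T1 where "0 <= T1" "T1 <= T" "!!s. 0 <= s ==> s < T1 ==> emeasure lborel {x \<in> {0<..<T - s}. \<psi> x > 0} ~= 0"
		"AE x in lborel. 0 < x & x < T - T1 --> \<psi> x = 0"
proof -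
	let ?Z = "\<lambda>c. emeasure lborel {x \<in> {0<..<c}. \<psi> x > 0} = 0"
	have Zm: "{x \<in> {0<..<c}. \<psi> x > 0} \<in> sets lborel" for c
	proof -
		have "{x \<in> {0<..<c}. \<psi> x > 0} = {x \<in> space borel. 0 < x & x < c & indicator {0..} x * \<psi> x > 0}" by auto
		then show ?thesis using psi_meas by simp
	qed
	define C where "C = {c. 0 <= c & c <= T & ?Z c}"
	have "{x \<in> {0<..<0}. \<psi> x > 0} = {}" by auto
	then have C0: "0 \<in> C" using T by (simp add: C_def del: greaterThanLessThan_iff)
	have bdd: "bdd_above C" by (intro bdd_aboveI[of _ T]) (auto simp: C_def)
	define c0 where "c0 = Sup C"
	have c0: "0 <= c0" "c0 <= T" unfolding c0_def using C0 bdd by (auto intro!: cSup_upper cSup_least simp: C_def)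
	\<comment> \<open>The supremum is attained, because the interval up to \<open>c0\<close> is a
	  countable union of shorter ones.\<close>
	have "{x \<in> {0<..<c0}. \<psi> x > 0} \<subseteq> (\<Union>n. {x \<in> {0<..<c0 - 1 / real (Suc n)}. \<psi> x > 0})"
	proof
		fix x assume x: "x \<in> {x \<in> {0<..<c0}. \<psi> x > 0}"
		then have "0 < c0 - x" by auto
		then obtain n where "1 / real (Suc n) < c0 - x" by (rule nat_approx_posE)
		then show "x \<in> (\<Union>n. {x \<in> {0<..<c0 - 1 / real (Suc n)}. \<psi> x > 0})" using x by (auto intro!: exI[of _ n])
	qed
	moreover have "emeasure lborel (\<Union>n. {x \<in> {0<..<c0 - 1 / real (Suc n)}. \<psi> x > 0}) = 0"
	proof (rule emeasure_UN_eq_0)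
		fix n
		have "c0 - 1 / real (Suc n) < Sup C" by (simp add: c0_def)
		then obtain c where c: "c \<in> C" "c0 - 1 / real (Suc n) < c" using less_cSupE[of _ C] C0 by blast
		have "emeasure lborel {x \<in> {0<..<c0 - 1 / real (Suc n)}. \<psi> x > 0} <= emeasure lborel {x \<in> {0<..<c}. \<psi> x > 0}"
			using c(2) by (intro emeasure_mono Zm) auto
		then show "emeasure lborel {x \<in> {0<..<c0 - 1 / real (Suc n)}. \<psi> x > 0} = 0" using c(1) by (simp add: C_def)
	qed (rule image_subsetI, rule Zm)
	moreover have "(\<Union>n. {x \<in> {0<..<c0 - 1 / real (Suc n)}. \<psi> x > 0}) \<in> sets lborel"
		by (rule sets.countable_UN) (rule image_subsetI, rule Zm)
	ultimately have "emeasure lborel {x \<in> {0<..<c0}. \<psi> x > 0} <= 0"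
		using emeasure_mono[of "{x \<in> {0<..<c0}. \<psi> x > 0}" "\<Union>n. {x \<in> {0<..<c0 - 1 / real (Suc n)}. \<psi> x > 0}" lborel]
		by (simp only:)
	then have Z0: "?Z c0" by simp
	show thesis
	proof (rule that[of "T - c0"])
		show "0 <= T - c0" "T - c0 <= T" using c0 by auto
		fix s assume s: "0 <= s" "s < T - c0"
		show "emeasure lborel {x \<in> {0<..<T - s}. \<psi> x > 0} ~= 0"
		proof
			assume "?Z (T - s)"
			then have "T - s \<in> C" using s c0 by (auto simp: C_def)
			then have "T - s <= c0" unfolding c0_def using bdd by (rule cSup_upper)
			then show False using s by simp
		qed
	next
		have "AE x in lborel. x \<notin> {x \<in> {0<..<c0}. \<psi> x > 0}"
			using Z0 Zm by (intro AE_not_in) (auto simp: null_sets_def)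
		then show "AE x in lborel. 0 < x & x < T - (T - c0) --> \<psi> x = 0"
		proof eventually_elim
			case (elim x)
			then show ?case using psi_nonneg[of x] by force
		qed
	qed
qed

lemma AE_lborel_reflect:
	assumes "AE x in lborel. Q x"
	shows "AE s in lborel. Q (t - s :: real)"
proof -
	have dl: "distr lborel borel (\<lambda>s. t - s) = lborel"
		using lborel_real_affine[of "-1" t] by (simp add: density_1)
	have "AE x in distr lborel borel (\<lambda>s. t - s). Q x" unfolding dl by (rule assms)
	then show ?thesis
		by (rule AE_distrD[rotated]) simp
qed

text \<open>Gronwall's inequality cannot be applied to the mean, which might be infinite. It is
  applied to the mean of the thinned count truncated at \<open>n\<close>, up to time
  \<open>T1\<close>, with a bound uniform in \<open>n\<close>; the bounded kernel then turns counts
  into intensities, and \<open>mean_equation\<close> covers the remaining times.\<close>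

lemma mean_bounded:
	obtains B where "0 <= B" "!!t. t \<in> {0..T} ==> mean t <= ennreal B"
proof -
	obtain T1 where T1: "0 <= T1" "T1 <= T" "!!s. 0 <= s ==> s < T1 ==> emeasure lborel {x \<in> {0<..<T - s}. \<psi> x > 0} ~= 0"
		"AE x in lborel. 0 < x & x < T - T1 --> \<psi> x = 0" by (rule last_active) blast
	define N where "N t w = thinned (\<lambda>s. l s w) w t" for t w
	have Npred: "(\<lambda>x. N (fst x) (snd x)) \<in> bm (PA T)"
	proof -
		have "(\<lambda>x. emeasure (snd x) {z \<in> past (fst x). pt (snd x) z \<in> {x \<in> space (PB T). snd x <= lx x}})
				\<in> bm (PA T)"
			by (rule pred_count[OF T thin_pred])
		moreover have "emeasure w {z \<in> past t. pt w z \<in> {x \<in> space (PB T). snd x <= lx x}} = N t w"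
			if "t \<in> {0..T}" "w \<in> configs" for t w
		proof -
			have A: "{z \<in> past t. pt w z \<in> {x \<in> space (PB T). snd x <= lx x}} = {z \<in> past t. snd z <= l (fst z) w}" (is "?L = _")
				using that by (auto simp: pb_alt[OF T] pt_def past_def)
			have "?L \<in> sets hp"
			proof -
				have "pt w -` {x \<in> space (PB T). snd x <= lx x} Int space (restrict_space hp (strip T)) \<in> sets (restrict_space hp (strip T))"
					using measurable_sets[OF measurable_pt[OF T0 that(2)] thin_pred] .
				then have "pt w -` {x \<in> space (PB T). snd x <= lx x} Int strip T \<in> sets hp"
					using strip_sets[of T] by (auto simp: sets_restrict_space_iff space_restrict_space space_half_plane Int_absorb1 Times_Int_Times)
				then have "pt w -` {x \<in> space (PB T). snd x <= lx x} Int strip T Int past t \<in> sets hp"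
					using past_sets by blast
				also have "pt w -` {x \<in> space (PB T). snd x <= lx x} Int strip T Int past t = ?L"
					using past_strip[of t T] that(1) by auto
				finally show ?thesis .
			qed
			then have "(\<integral>\<^sup>+z. indicator {z \<in> past t. snd z <= l (fst z) w} z \<partial>w) = emeasure w ?L"
				unfolding A using configs_sets[OF that(2)] by (intro nn_integral_indicator) auto
			moreover have "(\<integral>\<^sup>+z. indicator {z \<in> past t. snd z <= l (fst z) w} z \<partial>w) = N t w"
				unfolding N_def thinned_def by (intro nn_integral_cong) (auto simp: indicator_def)
			ultimately show ?thesis by simp
		qed
		ultimately show ?thesis
			by (subst measurable_cong[where g = "\<lambda>x. emeasure (snd x) {z \<in> past (fst x). pt (snd x) z \<in> {x \<in> space (PB T). snd x <= lx x}}"])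
				(auto simp: predictable_alt[OF T0])
	qed
	have NP: "N t \<in> bm P" if "t \<in> {0..T}" for t
		using measurable_compose[OF _ measurable_pred_clamp[OF T0 Npred], of "\<lambda>w. (t, w)" P] that
		by (simp add: clamp_id)
	have lN: "AE w in P. \<forall>t\<in>{0..T}. ennreal (l t w) <= ennreal \<nu> + ennreal K * N t w"
	proof (use path_AE in eventually_elim, intro ballI)
		fix w t assume *: "w \<in> configs & hawkes_path \<nu> \<psi> T (\<lambda>t. l t w) w" and t: "t \<in> {0..T}"
		have "(\<integral>\<^sup>+z\<in>past t. ennreal (\<psi> (t - fst z) * of_bool (snd z <= l (fst z) w)) \<partial>w) <=
				(\<integral>\<^sup>+z. ennreal K * of_bool (z \<in> past t & snd z <= l (fst z) w) \<partial>w)"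
			using t psi_le by (intro nn_integral_mono) (auto simp: indicator_def past_def intro!: ennreal_leI)
		also have "... = (\<integral>\<^sup>+z. ennreal K * indicator {z \<in> pts w. z \<in> past t & snd z <= l (fst z) w} z \<partial>w)"
			using * pts_AE[of w] by (intro nn_integral_cong_AE) (auto elim!: eventually_mono simp: indicator_def)
		also have "... = ennreal K * N t w"
			using * thinned_set_measurable[of w "{z \<in> pts w. z \<in> past t & snd z <= l (fst z) w}"] configs_sets[of w]
			by (subst nn_integral_cmult_indicator) (auto simp: N_def thinned_eq)
		finally show "ennreal (l t w) <= ennreal \<nu> + ennreal K * N t w"
			using * t by (simp add: hawkes_path_alt add_left_mono)
	qed
	\<comment> \<open>The Gronwall bound at time \<open>T\<close> with constant term
	  \<open>\<nu> * T\<close>; it is free of \<open>n\<close>.\<close>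
	define B where "B = 2 * (\<nu> * T) * exp (2 * K * T)"
	have Nn: "(\<integral>\<^sup>+w. min (N t w) (of_nat n) \<partial>P) <= ennreal B" if t: "t \<in> {0..T1}" for t and n :: nat
	proof -
		define y where "y t = (\<integral>\<^sup>+w. min (N t w) (of_nat n) \<partial>P)" for t
		have "y t <= ennreal (2 * (\<nu> * T) * exp (2 * K * t))" using t
		proof (rule nn_gronwall[rotated -1])
			fix t assume t: "t \<in> {0..T1}"
			have "y t <= (\<integral>\<^sup>+w. of_nat n \<partial>P)" unfolding y_def by (intro nn_integral_mono) simp
			then show "y t <= ennreal (real n)" by (simp add: emeasure_space_1 ennreal_of_nat_eq_real_of_nat)
			have tT: "t \<in> {0..T}" using t T1 by auto
			\<comment> \<open>The switch \<open>N < n\<close> is predictable, so the right-hand side of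
			  \<open>thinned_truncation\<close> is a thinned integral and \<open>thin_integral\<close>
			  applies.\<close>
			define g where "g x = (of_bool (0 < fst x & fst x < t & N (fst x) (snd x) < of_nat n) :: ennreal)" for x
			have gm: "g \<in> bm (PA T)"
			proof -
				have "{x \<in> space (PA T). 0 < fst x & fst x < t & N (fst x) (snd x) < of_nat n} \<in> sets (PA T)"
					using Npred measurable_pred_fst[OF T0] by measurable
				then have "(indicator {x \<in> space (PA T). 0 < fst x & fst x < t & N (fst x) (snd x) < of_nat n} :: _ => ennreal) \<in> bm (PA T)"
					by simp
				then show ?thesis by (rule measurable_cong[THEN iffD1, rotated]) (auto simp: g_def indicator_def)
			qed
			have "y t <= (\<integral>\<^sup>+w. (\<integral>\<^sup>+z\<in>strip T. g (fst z, w) * of_bool (snd z <= l (fst z) w) \<partial>w) \<partial>P)"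
				unfolding y_def
			proof (intro nn_integral_mono_AE, use path_AE in eventually_elim)
				case (elim w)
				have "min (N t w) (of_nat n) <= (\<integral>\<^sup>+z\<in>past t. of_bool (snd z <= l (fst z) w & N (fst z) w < of_nat n) \<partial>w)"
					unfolding N_def
				proof (rule thinned_truncation[where ?T1.0 = T1])
					show "w \<in> configs" "t <= T1" using elim t by auto
					fix B assume "B \<subseteq> {z \<in> pts w. 0 < fst z & fst z < T1 & snd z <= l (fst z) w}" "B ~= {}"
					then show "\<exists>z\<in>B. \<forall>z'\<in>B. fst z <= fst z'"
						using elim psi_nonneg psi_meas T1(3) by (intro thinned_no_descent[of w \<nu> \<psi> T "\<lambda>s. l s w" T1]) auto
				qed
				also have "... = (\<integral>\<^sup>+z\<in>strip T. g (fst z, w) * of_bool (snd z <= l (fst z) w) \<partial>w)"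
					using tT by (intro nn_integral_cong) (auto simp: past_in_strip g_def)
				finally show ?case .
			qed
			also have "... = (\<integral>\<^sup>+s\<in>{0..T}. (\<integral>\<^sup>+w. g (s, w) * ennreal (l s w) \<partial>P) \<partial>lborel)"
				by (rule thin_integral(1)[OF gm])
			also have "... <= (\<integral>\<^sup>+s. ennreal \<nu> * indicator {0..T} s + ennreal K * (y s * indicator {0..t} s) \<partial>lborel)"
			proof (rule nn_integral_mono)
				fix s
				show "(\<integral>\<^sup>+w. g (s, w) * ennreal (l s w) \<partial>P) * indicator {0..T} s <=
						ennreal \<nu> * indicator {0..T} s + ennreal K * (y s * indicator {0..t} s)"
				proof (cases "0 < s & s < t")
					case True
					then have sT: "s \<in> {0..T}" using tT by auto
					\<comment> \<open>Where the switch is on, \<open>N\<close> equals its own truncation, so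
					  \<open>lN\<close> closes the inequality in terms of \<open>y\<close>.\<close>
					have "(\<integral>\<^sup>+w. g (s, w) * ennreal (l s w) \<partial>P) <= (\<integral>\<^sup>+w. ennreal \<nu> + ennreal K * min (N s w) (of_nat n) \<partial>P)"
					proof (intro nn_integral_mono_AE, use lN in eventually_elim)
						case (elim w)
						then show ?case using sT True by (auto simp: g_def min_def)
					qed
					also have "... = ennreal \<nu> + ennreal K * y s"
						using NP[OF sT] by (simp add: nn_integral_add nn_integral_cmult y_def emeasure_space_1)
					finally show ?thesis using True sT by (simp add: indicator_def)
				next
					case False
					then have "g (s, w) = 0" for w unfolding g_def by auto
					then show ?thesis by simp
				qed
			qed
			also have "... = ennreal \<nu> * ennreal T + ennreal K * (\<integral>\<^sup>+s\<in>{0..t}. y s \<partial>lborel)"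
			proof -
				have "(\<lambda>x. min (N (fst x) (snd x)) (of_nat n)) \<in> bm (PA T)"
					using Npred by measurable
				from pred_nn_integral_meas[OF this]
				have "(\<lambda>s. (y s * indicator {0..T} s) * indicator {0..t} s) \<in> bm borel"
					unfolding y_def by simp
				also have "(\<lambda>s. (y s * indicator {0..T} s) * indicator {0..t} s) = (\<lambda>s. y s * indicator {0..t} s)"
					using tT by (auto simp: fun_eq_iff indicator_def)
				finally show ?thesis using T
					by (simp add: nn_integral_add nn_integral_cmult nn_integral_cmult_indicator)
			qed
			finally show "y t <= ennreal (\<nu> * T) + ennreal K * (\<integral>\<^sup>+s\<in>{0..t}. y s \<partial>lborel)"
				using nu T by (simp add: ennreal_mult')
		qed (use K nu T T1 in auto)
		also have "... <= ennreal B" unfolding B_def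
			using t T1(2) K nu T by (intro ennreal_leI mult_left_mono) auto
		finally show ?thesis by (simp add: y_def)
	qed
	have "(\<integral>\<^sup>+w. N T1 w \<partial>P) <= ennreal B"
	proof -
		have "(\<integral>\<^sup>+w. N T1 w \<partial>P) = (\<integral>\<^sup>+w. (SUP n. min (N T1 w) (of_nat n)) \<partial>P)"
		proof (rule nn_integral_cong)
			fix w
			have "(SUP n. min (N T1 w) (of_nat n)) = min (N T1 w) (SUP n. of_nat n)"
				by (simp add: inf_min[symmetric] inf_SUP)
			then show "N T1 w = (SUP n. min (N T1 w) (of_nat n))" by (simp add: ennreal_SUP_of_nat_eq_top)
		qed
		also have "... = (SUP n. \<integral>\<^sup>+w. min (N T1 w) (of_nat n) \<partial>P)"
			using NP[of T1] T1 by (intro nn_integral_monotone_convergence_SUP) (auto simp: incseq_def le_fun_def min_le_iff_disj)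
		also have "... <= ennreal B" using Nn[of T1] T1 by (intro SUP_least) auto
		finally show ?thesis .
	qed
	moreover have "(\<integral>\<^sup>+w. N T1 w \<partial>P) = (\<integral>\<^sup>+s\<in>{0<..<T1}. mean s \<partial>lborel)"
	proof -
		define g where "g x = (of_bool (0 < fst x & fst x < T1) :: ennreal)" for x :: "real \<times> config"
		have gm: "g \<in> bm (PA T)"
			unfolding g_def[abs_def] using measurable_pred_fst[OF T0] by measurable
		have "(\<integral>\<^sup>+w. N T1 w \<partial>P) = (\<integral>\<^sup>+w. (\<integral>\<^sup>+z\<in>strip T. g (fst z, w) * of_bool (snd z <= l (fst z) w) \<partial>w) \<partial>P)"
			unfolding N_def thinned_def using T1 by (intro nn_integral_cong) (auto simp: past_in_strip g_def)
		also have "... = (\<integral>\<^sup>+s\<in>{0..T}. (\<integral>\<^sup>+w. g (s, w) * ennreal (l s w) \<partial>P) \<partial>lborel)"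
			by (rule thin_integral(1)[OF gm])
		also have "... = (\<integral>\<^sup>+s\<in>{0<..<T1}. mean s \<partial>lborel)"
			using T1 by (intro nn_integral_cong) (auto simp: g_def mean_def indicator_def)
		finally show ?thesis .
	qed
	ultimately have B: "(\<integral>\<^sup>+s\<in>{0<..<T1}. mean s \<partial>lborel) <= ennreal B" by simp
	show thesis
	proof (rule that[of "\<nu> + K * B"])
		show "0 <= \<nu> + K * B" using K nu T by (simp add: B_def)
		fix t assume t: "t \<in> {0..T}"
		\<comment> \<open>For \<open>s > T1\<close> the lag \<open>t - s\<close> lies within the dead
		  time, where the kernel vanishes almost everywhere; only the mean before \<open>T1\<close>
		  remains.\<close>
		have "(\<integral>\<^sup>+s\<in>{0<..<t}. ennreal (\<psi> (t - s)) * mean s \<partial>lborel) <= (\<integral>\<^sup>+s. ennreal K * (mean s * indicator {0<..<T1} s) \<partial>lborel)"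
		proof (intro nn_integral_mono_AE, use AE_lborel_reflect[OF T1(4), of t] AE_lborel_singleton[of T1] in eventually_elim)
			case (elim s)
			then show ?case
				using t psi_le[of "t - s"] by (auto simp: indicator_def mult_right_mono ennreal_leI)
		qed
		also have "... <= ennreal K * ennreal B"
		proof -
			have "(\<lambda>s. (mean s * indicator {0..T} s) * indicator {0<..<T1} s) \<in> bm borel"
				using mean_meas by measurable
			also have "(\<lambda>s. (mean s * indicator {0..T} s) * indicator {0<..<T1} s) = (\<lambda>s. mean s * indicator {0<..<T1} s)"
				using T1 by (auto simp: fun_eq_iff indicator_def)
			finally show ?thesis using B by (simp add: nn_integral_cmult mult_left_mono)
		qed
		finally show "mean t <= ennreal (\<nu> + K * B)"
			using mean_equation[OF t] K nu T by (simp add: B_def ennreal_mult' add_left_mono)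
	qed
qed

end

section \<open>Approximation by step functions\<close>

definition rect :: "real => real => (real \<times> real) set" where
	"rect T R = {0<..T} \<times> {0<..R}"

lemma rect_sets: "rect T R \<in> sets hp"
	unfolding rect_def by (rule half_plane_rect) auto

lemma rect_strip: "rect T R \<subseteq> strip T"
	by (auto simp: rect_def)

lemma emeasure_rect: "0 <= T ==> 0 <= R ==> emeasure hp (rect T R) = ennreal (T * R)"
	unfolding rect_def by (subst emeasure_half_plane_rect) (auto simp: ennreal_mult')

text \<open>Open on the left and below, so that cells tile \<open>rect\<close>. A coefficient known
  at the left end, inclusively, is then independent of the count in the cell.\<close>

definition cell :: "real => real => nat => nat => nat => (real \<times> real) set" where
	"cell T R N k j = {T * real k / real N<..T * real (Suc k) / real N} \<times> {R * real j / real N<..R * real (Suc j) / real N}"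

definition step_fun ::
	"real => real => nat => (nat => nat => config => real) => (real \<times> config) \<times> real => real" where
	"step_fun T R N U x = (\<Sum>k<N. \<Sum>j<N. U k j (snd (fst x)) * indicator (cell T R N k j) (fst (fst x), snd x))"

definition adapted :: "real => nat => (nat => nat => config => real) => bool" where
	"adapted T N U \<longleftrightarrow> (\<forall>k<N. \<forall>j<N. U k j \<in> bm (hist (T * real k / real N)))"

lemma grid_unique:
	assumes T: "0 < T" and N: "0 < N" and t: "0 < t" "t <= T"
	obtains k :: nat where "k < N" "T * real k / real N < t" "t <= T * real (Suc k) / real N"
		"!!k' :: nat. T * real k' / real N < t ==> t <= T * real (Suc k') / real N ==> k' = k"
proof -
	define c where "c = t * real N / T"
	have c: "0 < c" "c <= real N" using T N t by (auto simp: c_def field_simps)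
	have iff: "T * real k / real N < t & t <= T * real (Suc k) / real N \<longleftrightarrow> real k < c & c <= real k + 1" for k
		using T N by (auto simp: c_def field_simps)
	define k where "k = nat (\<lceil>c\<rceil> - 1)"
	have k: "real k = of_int \<lceil>c\<rceil> - 1" using c by (simp add: k_def)
	have b: "real k < c & c <= real k + 1" unfolding k using ceiling_correct[of c] by linarith
	have "k < N" using b c(2) by linarith
	moreover have "k' = k" if "T * real k' / real N < t" "t <= T * real (Suc k') / real N" for k'
		using iff[of k'] that b by linarith
	ultimately show thesis using b iff[of k] by (intro that[of k]) auto
qed

lemma grid_cell:
	assumes "0 < T" "0 < R" "0 < N" "z \<in> rect T R"
	obtains k j where "k < N" "j < N" "z \<in> cell T R N k j"
		"!!k' j'. z \<in> cell T R N k' j' ==> k' = k & j' = j"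
proof -
	have z: "0 < fst z" "fst z <= T" "0 < snd z" "snd z <= R" using assms(4) by (auto simp: rect_def)
	obtain k where k: "k < N" "T * real k / real N < fst z" "fst z <= T * real (Suc k) / real N"
		"!!k' :: nat. T * real k' / real N < fst z ==> fst z <= T * real (Suc k') / real N ==> k' = k"
		using grid_unique[OF assms(1,3) z(1,2)] by blast
	obtain j where j: "j < N" "R * real j / real N < snd z" "snd z <= R * real (Suc j) / real N"
		"!!j' :: nat. R * real j' / real N < snd z ==> snd z <= R * real (Suc j') / real N ==> j' = j"
		using grid_unique[OF assms(2,3) z(3,4)] by blast
	show thesis
	proof (rule that[OF k(1) j(1)])
		show "z \<in> cell T R N k j" using k(2,3) j(2,3) by (simp add: cell_def mem_Times_iff)
		show "k' = k & j' = j" if "z \<in> cell T R N k' j'" for k' j'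
		proof
			show "k' = k" using that by (intro k(4)) (auto simp: cell_def)
			show "j' = j" using that by (intro j(4)) (auto simp: cell_def)
		qed
	qed
qed

lemma grid_cell_ex:
	assumes "0 < T" "0 < R" "0 < N" "z \<in> rect T R"
	shows "\<exists>k j. k < N & j < N & z \<in> cell T R N k j"
	using grid_cell[OF assms] by metis

lemma measurable_pb_time: "0 < T ==> (\<lambda>x. fst (fst x)) \<in> bm (PB T)"
	by (rule measurable_compose[OF measurable_fst measurable_pred_fst]) simp

lemma cell_rect:
	assumes "0 < T" "0 < R" "k < N" "j < N"
	shows "cell T R N k j \<subseteq> rect T R"
proof -
	have N: "0 < real N" using assms(3) by simp
	have le: "X * real (Suc i) / real N <= X" if "i < N" "0 < X" for i and X :: real
		using that N by (simp add: divide_le_eq)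
	have ge: "0 <= X * real i / real N" if "0 < X" for i and X :: real using that N by simp
	show ?thesis
		using le[OF assms(3,1)] le[OF assms(4,2)] ge[OF assms(1), of k] ge[OF assms(2), of j]
		unfolding cell_def rect_def by (intro Sigma_mono) (auto simp del: of_nat_Suc)
qed

lemma cell_sets: "0 < R ==> cell T R N k j \<in> sets hp"
proof -
	assume "0 < R"
	then have "0 <= R * real j / real N" by simp
	then show ?thesis unfolding cell_def by (intro half_plane_rect) auto
qed

lemma cell_disjoint:
	assumes "0 < T" "0 < R" "k < N" "j < N" "(k, j) ~= (k', j')"
	shows "cell T R N k j Int cell T R N k' j' = {}"
proof (rule ccontr)
	assume "cell T R N k j Int cell T R N k' j' ~= {}"
	then obtain z where z: "z \<in> cell T R N k j" "z \<in> cell T R N k' j'" by blast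
	then have zr: "z \<in> rect T R" using cell_rect[OF assms(1-4)] by blast
	have "0 < N" using assms(3) by simp
	from grid_cell[OF assms(1,2) this zr] show False using z assms(5) by metis
qed

lemma emeasure_cell:
	assumes "0 < T" "0 < R" "0 < N"
	shows "emeasure hp (cell T R N k j) = ennreal (T * R / (real N)\<^sup>2)"
		"measure hp (cell T R N k j) = T * R / (real N)\<^sup>2"
proof -
	have d: "X * real (Suc k) / real N - X * real k / real N = X / real N" for X k
		by (simp add: diff_divide_distrib[symmetric] algebra_simps)
	have le: "X * real k / real N <= X * real (Suc k) / real N" if "0 < X" for X k
		using that by (intro divide_right_mono mult_left_mono) auto
	have R0: "0 <= R * real j / real N" using assms by simp
	have "emeasure hp (cell T R N k j) = ennreal (T / real N) * ennreal (R / real N)"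
		unfolding cell_def using R0 le[OF assms(1), of k] le[OF assms(2), of j]
		by (subst emeasure_half_plane_rect) (auto simp: d simp del: of_nat_Suc)
	also have "... = ennreal (T * R / (real N)\<^sup>2)"
		using assms by (simp add: ennreal_mult'[symmetric] power2_eq_square)
	finally show e: "emeasure hp (cell T R N k j) = ennreal (T * R / (real N)\<^sup>2)" .
	show "measure hp (cell T R N k j) = T * R / (real N)\<^sup>2"
		using assms by (simp add: measure_def e)
qed

lemma step_fun_cell:
	assumes "0 < T" "0 < R" "k < N" "j < N" "z \<in> cell T R N k j"
	shows "step_fun T R N U (pt w z) = U k j w"
proof -
	have ind: "indicator (cell T R N k' j') z = (if k' = k & j' = j then 1 else (0::real))" for k' j'
		using cell_disjoint[OF assms(1-4), of k' j'] assms(5) by (auto simp: indicator_def)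
	have "step_fun T R N U (pt w z) = (\<Sum>k'<N. \<Sum>j'<N. U k' j' w * indicator (cell T R N k' j') z)"
		by (simp add: step_fun_def pt_def)
	also have "... = (\<Sum>k'<N. \<Sum>j'<N. if k' = k then (if j' = j then U k j w else 0) else 0)"
		unfolding ind by (intro sum.cong) auto
	also have "... = (\<Sum>k'<N. if k' = k then (\<Sum>j'<N. if j' = j then U k j w else 0) else 0)"
		by (intro sum.cong) auto
	also have "... = U k j w" using assms(3,4) by (simp add: sum.delta)
	finally show ?thesis .
qed

lemma step_fun_measurable:
	assumes T: "0 < T" and U: "adapted T N U"
	shows "step_fun T R N U \<in> bm (PB T)"
proof -
	have "(\<lambda>x. U k j (snd (fst x)) * indicator (cell T R N k j) (fst (fst x), snd x)) \<in> bm (PB T)"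
		if kj: "k < N" "j < N" for k j
	proof -
		let ?q = "T * real k / real N"
		have q: "0 <= ?q" "?q < T" using T kj by (auto simp: divide_less_eq)
		have "U k j \<in> bm (hist ?q)" using U kj by (auto simp: adapted_def)
		from measurable_compose[OF measurable_fst measurable_pred_left[OF T q this]]
		have [measurable]: "(\<lambda>x. if ?q < fst (fst x) then U k j (snd (fst x)) else 0) \<in> bm (PB T)" .
		note [measurable] = measurable_pb_time[OF T]
		have "(\<lambda>x. (if ?q < fst (fst x) then U k j (snd (fst x)) else 0) *
				(indicator {..T * real (Suc k) / real N} (fst (fst x)) * indicator {R * real j / real N<..R * real (Suc j) / real N} (snd x)))
				\<in> bm (PB T)"
			by measurable
		also have "(\<lambda>x. (if ?q < fst (fst x) then U k j (snd (fst x)) else 0) *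
				(indicator {..T * real (Suc k) / real N} (fst (fst x)) * indicator {R * real j / real N<..R * real (Suc j) / real N} (snd x)))
			= (\<lambda>x. U k j (snd (fst x)) * indicator (cell T R N k j) (fst (fst x), snd x))"
			by (auto simp: fun_eq_iff cell_def indicator_def simp del: of_nat_Suc)
		finally show ?thesis .
	qed
	then show ?thesis unfolding step_fun_def[abs_def] by (intro borel_measurable_sum) auto
qed

section \<open>Density of step functions among predictable integrands\<close>

context prm begin

text \<open>The Doleans measure of \<open>dt d\<theta>\<close> on the rectangle. By the Mecke
  formula its \<open>L1\<close> distance controls both the integral against the points and the one
  against the compensator.\<close>

definition QM :: "real => real => ((real \<times> config) \<times> real) measure" where
	"QM T R = distr (P \<Otimes>\<^sub>M restrict_space hp (rect T R)) (PB T) (\<lambda>(w, z). pt w z)"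

lemma measurable_pt_joint:
	assumes T: "0 < T"
	shows "(\<lambda>(w, z). pt w z) \<in> measurable (P \<Otimes>\<^sub>M restrict_space hp (rect T R)) (PB T)"
proof -
	let ?H = "restrict_space hp (rect T R)"
	have f: "fst \<in> measurable ?H (restrict_space borel {0..T})"
		by (rule measurable_restrict_space3[OF _ ])
			 (auto simp: half_plane_def rect_def intro!: measurable_restrict_space1 borel_measurable_continuous_onI continuous_intros)
	have s: "snd \<in> bm ?H"
		by (auto simp: half_plane_def intro!: measurable_restrict_space1 borel_measurable_continuous_onI continuous_intros)
	have "(\<lambda>x. (fst (snd x), fst x)) \<in> measurable (P \<Otimes>\<^sub>M ?H) (restrict_space borel {0..T} \<Otimes>\<^sub>M P)"
		using measurable_compose[OF measurable_snd f] by measurable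
	from measurable_compose[OF this measurable_pred_joint] T
	have "(\<lambda>x. (fst (snd x), fst x)) \<in> measurable (P \<Otimes>\<^sub>M ?H) (PA T)" by simp
	then have "(\<lambda>x. ((fst (snd x), fst x), snd (snd x))) \<in> measurable (P \<Otimes>\<^sub>M ?H) (PB T)"
		using measurable_compose[OF measurable_snd s] by measurable
	then show ?thesis by (simp add: case_prod_beta' pt_def)
qed

abbreviation distQ :: "_ => _ => (_ => real) => (_ => real) => ennreal" where
	"distQ T R f g \<equiv> (\<integral>\<^sup>+x. ennreal \<bar>f x - g x\<bar> \<partial>QM T R)"

lemma sets_QM [measurable_cong, simp]: "sets (QM T R) = sets (PB T)"
	by (simp add: QM_def)

lemma space_QM: "space (QM T R) = space (PB T)"
	by (simp add: QM_def)

lemma finite_rect: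
	assumes "0 <= T" "0 <= R"
	shows "finite_measure (restrict_space hp (rect T R))"
proof (rule finite_measureI)
	have "space (restrict_space hp (rect T R)) = rect T R"
		using sets.sets_into_space[OF rect_sets[of T R]] by (simp add: space_restrict_space Int_absorb2)
	then show "emeasure (restrict_space hp (rect T R)) (space (restrict_space hp (rect T R))) ~= \<infinity>"
		using rect_sets[of T R] emeasure_rect[OF assms]
		by (simp add: emeasure_restrict_space sets.Int_space_eq2)
qed

lemma nn_integral_QM:
	fixes f :: "_ => ennreal"
	assumes T: "0 < T" and R: "0 <= R" and f: "f \<in> bm (PB T)"
	shows "(\<integral>\<^sup>+x. f x \<partial>QM T R) = (\<integral>\<^sup>+w. (ptint (rect T R) hp f w) \<partial>P)"
		"(\<integral>\<^sup>+w. (ptint (rect T R) w f w) \<partial>P) = (\<integral>\<^sup>+x. f x \<partial>QM T R)"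
		"(\<lambda>w. \<integral>\<^sup>+z\<in>rect T R. f (pt w z) \<partial>hp) \<in> bm P"
		"(\<lambda>w. \<integral>\<^sup>+z\<in>rect T R. f (pt w z) \<partial>w) \<in> bm P"
proof -
	let ?H = "restrict_space hp (rect T R)"
	interpret H: finite_measure ?H using finite_rect T R by simp
	interpret pair_sigma_finite P ?H ..
	note m = measurable_compose[OF measurable_pt_joint[OF T, of R] f]
	have m': "(\<lambda>(w, z). f (pt w z)) \<in> bm (P \<Otimes>\<^sub>M ?H)" using m by (simp add: case_prod_beta')
	have rs: "(ptint (rect T R) hp f w) = (\<integral>\<^sup>+z. f (pt w z) \<partial>?H)" for w
		using rect_sets[of T R] sets.Int_space_eq2[OF rect_sets] by (subst nn_integral_restrict_space) auto
	have "(\<integral>\<^sup>+x. f x \<partial>QM T R) = (\<integral>\<^sup>+x. f (case x of (w, z) => pt w z) \<partial>(P \<Otimes>\<^sub>M ?H))"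
		unfolding QM_def by (rule nn_integral_distr[OF measurable_pt_joint[OF T]]) (use f in simp)
	also have "... = (\<integral>\<^sup>+w. (\<integral>\<^sup>+z. f (pt w z) \<partial>?H) \<partial>P)"
		using H.nn_integral_fst[OF m'] by (simp add: case_prod_beta')
	finally show eq: "(\<integral>\<^sup>+x. f x \<partial>QM T R) = (\<integral>\<^sup>+w. (ptint (rect T R) hp f w) \<partial>P)" by (simp add: rs)
	define g where "g x = f x * of_bool (0 < fst (fst x) & 0 < snd x & snd x <= R)" for x
	have g: "g \<in> bm (PB T)"
	proof -
		note [measurable] = measurable_pb_time[OF T]
		show ?thesis unfolding g_def[abs_def] using f by measurable
	qed
	have gi: "f (pt w z) * indicator (rect T R) z = g (pt w z) * indicator (strip T) z" for w z
		by (cases z) (auto simp: g_def pt_def rect_def indicator_def)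
	show "(\<integral>\<^sup>+w. (ptint (rect T R) w f w) \<partial>P) = (\<integral>\<^sup>+x. f x \<partial>QM T R)"
		"(\<lambda>w. \<integral>\<^sup>+z\<in>rect T R. f (pt w z) \<partial>hp) \<in> bm P"
		"(\<lambda>w. \<integral>\<^sup>+z\<in>rect T R. f (pt w z) \<partial>w) \<in> bm P"
		unfolding eq gi using mecke[OF T g] by auto
qed

lemma finite_QM: "0 < T ==> 0 <= R ==> finite_measure (QM T R)"
proof (rule finite_measureI)
	assume T: "0 < T" and R: "0 <= R"
	have "emeasure (QM T R) (space (QM T R)) = (\<integral>\<^sup>+x. 1 \<partial>QM T R)" by simp
	also have "... = (\<integral>\<^sup>+w. ennreal (T * R) \<partial>P)"
		using T R rect_sets[of T R] emeasure_rect[of T R] by (subst nn_integral_QM(1)[OF T R]) auto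
	finally show "emeasure (QM T R) (space (QM T R)) ~= \<infinity>" by (simp add: emeasure_space_1)
qed

lemma AE_QM:
	assumes T: "0 < T" and R: "0 <= R"
	shows "AE x in QM T R. fst (fst x) \<in> {0<..T} & snd x \<in> {0<..R} & snd (fst x) \<in> configs"
proof -
	note [measurable] = measurable_pb_time[OF T]
	have "AE x in QM T R. fst (fst x) \<in> {0<..T} & snd x \<in> {0<..R}"
		unfolding QM_def using measurable_pt_joint[OF T]
		by (subst AE_distr_iff) (measurable, auto simp: pt_def rect_def space_pair_measure space_restrict_space)
	then show ?thesis using AE_space by eventually_elim (auto simp: space_QM pb_alt[OF T])
qed

text \<open>Approximation is asked for at every large \<open>N\<close>: two functions can then share
  one grid, and the grid may later be refined for other purposes.\<close>

definition steppable :: "real => real => ((real \<times> config) \<times> real => real) => bool" where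
	"steppable T R f \<longleftrightarrow> (\<forall>\<epsilon>>0. \<exists>N0. \<forall>N\<ge>N0. \<exists>U. adapted T N U &
		 (distQ T R f (step_fun T R N U)) < ennreal \<epsilon>)"

lemma steppable_limit:
	assumes T: "0 < T" and f: "f \<in> bm (PB T)" and g: "!!i. g i \<in> bm (PB T)" "!!i::nat. steppable T R (g i)"
		and lim: "(\<lambda>i. \<integral>\<^sup>+x. ennreal \<bar>f x - g i x\<bar> \<partial>QM T R) \<longlonglongrightarrow> 0"
	shows "steppable T R f"
	unfolding steppable_def
proof (intro allI impI)
	fix \<epsilon> :: real assume \<epsilon>: "0 < \<epsilon>"
	then obtain i where i: "(distQ T R f (g i)) < ennreal (\<epsilon> / 2)"
		using order_tendstoD(2)[OF lim, of "ennreal (\<epsilon> / 2)"] by (auto simp: eventually_sequentially)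
	obtain N0 where N0: "\<forall>N\<ge>N0. \<exists>U. adapted T N U & (distQ T R (g i) (step_fun T R N U)) < ennreal (\<epsilon> / 2)"
		using g(2)[of i] \<epsilon> unfolding steppable_def by (metis half_gt_zero)
	show "\<exists>N0. \<forall>N\<ge>N0. \<exists>U. adapted T N U & (distQ T R f (step_fun T R N U)) < ennreal \<epsilon>"
	proof (intro exI[of _ N0] allI impI)
		fix N assume "N >= N0"
		then obtain U where U: "adapted T N U" "(distQ T R (g i) (step_fun T R N U)) < ennreal (\<epsilon> / 2)"
			using N0 by blast
		have [measurable]: "f \<in> bm (QM T R)" "g i \<in> bm (QM T R)" "step_fun T R N U \<in> bm (QM T R)"
			using f g(1) step_fun_measurable[OF T U(1)] by (simp_all cong: measurable_cong_sets)
		have "(distQ T R f (step_fun T R N U)) <=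
				(\<integral>\<^sup>+x. ennreal \<bar>f x - g i x\<bar> + ennreal \<bar>g i x - step_fun T R N U x\<bar> \<partial>QM T R)"
			by (intro nn_integral_mono) (auto simp: ennreal_plus[symmetric] simp del: ennreal_plus intro!: ennreal_leI)
		also have "... = (distQ T R f (g i)) + (distQ T R (g i) (step_fun T R N U))"
			by (intro nn_integral_add) measurable
		also have "... < ennreal (\<epsilon> / 2) + ennreal (\<epsilon> / 2)" using i U(2) by (rule add_strict_mono)
		also have "... = ennreal \<epsilon>" using \<epsilon> by (subst ennreal_plus[symmetric]) auto
		finally show "\<exists>U. adapted T N U & (distQ T R f (step_fun T R N U)) < ennreal \<epsilon>" using U(1) by blast
	qed
qed

lemma nn_integral_bounded_convergence:
	assumes T: "0 < T" and R: "0 <= R" and [measurable]: "f \<in> bm (PB T)" "!!i. g i \<in> bm (PB T)"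
		and b: "!!i. AE x in QM T R. \<bar>f x - g i x\<bar> <= (B :: real)" and lim: "AE x in QM T R. (\<lambda>i. g i x) \<longlonglongrightarrow> f x"
	shows "(\<lambda>i. \<integral>\<^sup>+x. ennreal \<bar>f x - g i x\<bar> \<partial>QM T R) \<longlonglongrightarrow> 0"
proof -
	interpret Q: finite_measure "QM T R" by (rule finite_QM[OF T R])
	have "(\<lambda>i. \<integral>\<^sup>+x. ennreal \<bar>f x - g i x\<bar> \<partial>QM T R) \<longlonglongrightarrow> (\<integral>\<^sup>+x. 0 \<partial>QM T R)"
	proof (rule nn_integral_dominated_convergence[where w = "\<lambda>_. ennreal B"])
		show "AE x in QM T R. ennreal \<bar>f x - g i x\<bar> <= ennreal B" for i
			using b[of i] by eventually_elim (rule ennreal_leI)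
		show "(\<integral>\<^sup>+x. ennreal B \<partial>QM T R) < \<infinity>" using Q.emeasure_finite by (simp add: less_top[symmetric] ennreal_mult_eq_top_iff)
		show "AE x in QM T R. (\<lambda>i. ennreal \<bar>f x - g i x\<bar>) \<longlonglongrightarrow> 0"
			using lim
		proof eventually_elim
			case (elim x)
			have "(\<lambda>i. \<bar>f x - g i x\<bar>) \<longlonglongrightarrow> \<bar>f x - f x\<bar>" by (intro tendsto_intros elim)
			from tendsto_ennrealI[OF this] show ?case by simp
		qed
	qed measurable
	then show ?thesis by simp
qed

lemma steppable_linear:
	assumes T: "0 < T" and f: "f \<in> bm (PB T)" "steppable T R f" and g: "g \<in> bm (PB T)" "steppable T R g"
	shows "steppable T R (\<lambda>x. f x + c * g x)"
	unfolding steppable_def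
proof (intro allI impI)
	fix \<epsilon> :: real assume \<epsilon>: "0 < \<epsilon>"
	\<comment> \<open>Chosen so that the errors \<open>\<delta>\<close> and
	  \<open>\<bar>c\<bar> * \<delta>\<close> of the two summands add up to
	  \<open>\<epsilon>\<close>.\<close>
	define \<delta> where "\<delta> = \<epsilon> / (1 + \<bar>c\<bar>)"
	have \<delta>: "0 < \<delta>" using \<epsilon> by (simp add: \<delta>_def add_pos_nonneg)
	have e: "\<delta> + \<bar>c\<bar> * \<delta> = \<epsilon>"
	proof -
		have "1 + \<bar>c\<bar> ~= 0" by linarith
		then have "\<delta> * (1 + \<bar>c\<bar>) = \<epsilon>" by (simp add: \<delta>_def)
		then show ?thesis by (simp add: algebra_simps)
	qed
	obtain N1 where N1: "\<forall>N\<ge>N1. \<exists>U. adapted T N U & (distQ T R f (step_fun T R N U)) < ennreal \<delta>"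
		using f(2) \<delta> unfolding steppable_def by blast
	obtain N2 where N2: "\<forall>N\<ge>N2. \<exists>U. adapted T N U & (distQ T R g (step_fun T R N U)) < ennreal \<delta>"
		using g(2) \<delta> unfolding steppable_def by blast
	show "\<exists>N0. \<forall>N\<ge>N0. \<exists>U. adapted T N U & (distQ T R (\<lambda>x. f x + c * g x) (step_fun T R N U)) < ennreal \<epsilon>"
	proof (intro exI[of _ "max N1 N2"] allI impI)
		fix N assume N: "N >= max N1 N2"
		obtain U where U: "adapted T N U" "(distQ T R f (step_fun T R N U)) < ennreal \<delta>" using N1 N by auto
		obtain V where V: "adapted T N V" "(distQ T R g (step_fun T R N V)) < ennreal \<delta>" using N2 N by auto
		define W where "W k j w = U k j w + c * V k j w" for k j w
		have W: "adapted T N W" using U(1) V(1) unfolding adapted_def W_def[abs_def]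
			by (auto intro!: borel_measurable_add borel_measurable_times)
		have sW: "step_fun T R N W x = step_fun T R N U x + c * step_fun T R N V x" for x
			by (simp only: step_fun_def W_def distrib_right sum.distrib sum_distrib_left mult.assoc)
		have [measurable]: "f \<in> bm (QM T R)" "g \<in> bm (QM T R)" "step_fun T R N U \<in> bm (QM T R)"
			"step_fun T R N V \<in> bm (QM T R)"
			using f g step_fun_measurable[OF T U(1)] step_fun_measurable[OF T V(1)] by (simp_all cong: measurable_cong_sets)
		have "(distQ T R (\<lambda>x. f x + c * g x) (step_fun T R N W)) <=
				(\<integral>\<^sup>+x. ennreal \<bar>f x - step_fun T R N U x\<bar> + ennreal \<bar>c\<bar> * ennreal \<bar>g x - step_fun T R N V x\<bar> \<partial>QM T R)"
		proof (rule nn_integral_mono)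
			fix x
			have "\<bar>f x + c * g x - step_fun T R N W x\<bar> = \<bar>(f x - step_fun T R N U x) + c * (g x - step_fun T R N V x)\<bar>"
				by (simp add: sW algebra_simps)
			also have "... <= \<bar>f x - step_fun T R N U x\<bar> + \<bar>c\<bar> * \<bar>g x - step_fun T R N V x\<bar>"
				by (metis abs_mult abs_triangle_ineq)
			finally show "ennreal \<bar>f x + c * g x - step_fun T R N W x\<bar> <= ennreal \<bar>f x - step_fun T R N U x\<bar> + ennreal \<bar>c\<bar> * ennreal \<bar>g x - step_fun T R N V x\<bar>"
				by (simp add: ennreal_plus[symmetric] ennreal_mult'[symmetric] ennreal_leI del: ennreal_plus)
		qed
		also have "... = (distQ T R f (step_fun T R N U)) + ennreal \<bar>c\<bar> * (distQ T R g (step_fun T R N V))"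
			by (subst nn_integral_add) (auto simp: nn_integral_cmult)
		also have "... <= (distQ T R f (step_fun T R N U)) + ennreal \<bar>c\<bar> * ennreal \<delta>"
			using V(2) by (intro add_left_mono mult_left_mono) auto
		also have "... < ennreal \<delta> + ennreal \<bar>c\<bar> * ennreal \<delta>"
			using U(2) unfolding add.commute[of _ "ennreal \<bar>c\<bar> * ennreal \<delta>"]
			by (simp add: ennreal_add_left_cancel_less ennreal_mult_eq_top_iff)
		also have "... = ennreal \<epsilon>"
			using \<delta> by (simp add: ennreal_mult'[symmetric] ennreal_plus[symmetric] e del: ennreal_plus)
		finally show "\<exists>U. adapted T N U & (distQ T R (\<lambda>x. f x + c * g x) (step_fun T R N U)) < ennreal \<epsilon>" using W by blast
	qed
qed

text \<open>The cells containing a fixed point shrink to it, so pointwise convergence is checked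
  along their indices; bounded convergence turns it into convergence in \<open>QM\<close>, which is
  a finite measure.\<close>

lemma steppable_grid:
	assumes T: "0 < T" and R: "0 < R" and f: "f \<in> bm (PB T)"
		and U: "!!N. adapted T N (U N)" and b: "AE x in QM T R. \<bar>f x\<bar> <= 1" "!!N k j w. \<bar>U N k j w\<bar> <= 1"
		and lim: "!!w z k j. w \<in> configs ==> z \<in> rect T R ==> (!!N. 0 < N ==> k N < N & j N < N & z \<in> cell T R N (k N) (j N)) ==>
			(\<lambda>N. U N (k N) (j N) w) \<longlonglongrightarrow> f (pt w z)"
	shows "steppable T R f"
proof -
	have key: "\<exists>k j. \<forall>N>0. k N < N & j N < N & z \<in> cell T R N (k N) (j N)" if "z \<in> rect T R" for z
	proof -
		have "\<forall>N. \<exists>k j. 0 < N --> k < N & j < N & z \<in> cell T R N k j"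
			using grid_cell_ex[OF T R _ that] by blast
		then show ?thesis by metis
	qed
	have AEr: "AE x in QM T R. \<exists>w z. x = pt w z & z \<in> rect T R & w \<in> configs"
		using AE_QM[OF T less_imp_le[OF R]]
	proof eventually_elim
		case (elim x)
		then show ?case by (intro exI[of _ "snd (fst x)"] exI[of _ "(fst (fst x), snd x)"]) (auto simp: pt_def rect_def)
	qed
	have conv: "(\<lambda>i. \<integral>\<^sup>+x. ennreal \<bar>f x - step_fun T R i (U i) x\<bar> \<partial>QM T R) \<longlonglongrightarrow> 0"
	proof (rule nn_integral_bounded_convergence[OF T less_imp_le[OF R] f step_fun_measurable[OF T U], where B = 2])
		show "AE x in QM T R. \<bar>f x - step_fun T R i (U i) x\<bar> <= 2" for i
			using AEr b(1)
		proof eventually_elim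
			case (elim x)
			then obtain w z where x: "x = pt w z" "z \<in> rect T R" by blast
			have "\<bar>step_fun T R i (U i) x\<bar> <= 1"
			proof (cases "i = 0")
				case False
				then obtain k j where kj: "k < i" "j < i" "z \<in> cell T R i k j" using grid_cell_ex[OF T R _ x(2), of i] by auto
				show ?thesis unfolding x(1) step_fun_cell[OF T R kj] by (rule b(2))
			qed (simp add: step_fun_def)
			then show ?case using elim by linarith
		qed
		show "AE x in QM T R. (\<lambda>i. step_fun T R i (U i) x) \<longlonglongrightarrow> f x"
			using AEr
		proof eventually_elim
			case (elim x)
			then obtain w z where x: "x = pt w z" "z \<in> rect T R" "w \<in> configs" by blast
			obtain k j where kj: "\<forall>N>0. k N < N & j N < N & z \<in> cell T R N (k N) (j N)" using key[OF x(2)] by blast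
			have "(\<lambda>N. U N (k N) (j N) w) \<longlonglongrightarrow> f x" unfolding x(1) using kj by (intro lim x) auto
			moreover have "eventually (\<lambda>N. U N (k N) (j N) w = step_fun T R N (U N) x) sequentially"
				using eventually_gt_at_top[of 0]
			proof eventually_elim
				case (elim N)
				then have kjN: "k N < N" "j N < N" "z \<in> cell T R N (k N) (j N)" using kj by auto
				show ?case unfolding x(1) step_fun_cell[OF T R kjN] ..
			qed
			ultimately show ?case by (rule Lim_transform_eventually)
		qed
	qed
	show ?thesis unfolding steppable_def
	proof (intro allI impI)
		fix \<epsilon> :: real assume "0 < \<epsilon>"
		then have "eventually (\<lambda>i. (distQ T R f (step_fun T R i (U i))) < ennreal \<epsilon>) sequentially"
			by (intro order_tendstoD(2)[OF conv]) simp
		then show "\<exists>N0. \<forall>N\<ge>N0. \<exists>U. adapted T N U & (distQ T R f (step_fun T R N U)) < ennreal \<epsilon>"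
			using U unfolding eventually_sequentially by blast
	qed
qed

lemma grid_tendsto:
	assumes T: "0 < T" and k: "!!N. 0 < N ==> T * real (k N) / real N < t & t <= T * real (Suc (k N)) / real N"
	shows "(\<lambda>N. T * real (k N) / real N) \<longlonglongrightarrow> t"
proof (rule tendsto_sandwich)
	have b: "t - T / real N <= T * real (k N) / real N" "T * real (k N) / real N <= t" if "0 < N" for N
		using k[OF that] by (auto simp: distrib_left add_divide_distrib)
	show "eventually (\<lambda>N. t - T / real N <= T * real (k N) / real N) sequentially"
		"eventually (\<lambda>N. T * real (k N) / real N <= t) sequentially"
		using eventually_gt_at_top[of "0::nat"] by (eventually_elim, use b in blast)+
	have "(\<lambda>N. t - T / real N) \<longlonglongrightarrow> t - 0"
		by (intro tendsto_intros real_tendsto_divide_at_top[OF tendsto_const] filterlim_real_sequentially)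
	then show "(\<lambda>N. t - T / real N) \<longlonglongrightarrow> t" by simp
qed simp

lemma steppable_gen:
	assumes T: "0 < T" and R: "0 < R" and E: "E \<in> pb_gen T"
	shows "steppable T R (indicator E)"
proof -
	obtain a c where E: "E = a \<times> {..c}" "a \<in> pred_gen T" using E by (auto simp: pb_gen_def)
	have m: "(indicator E :: _ => real) \<in> bm (PB T)"
		using E pb_alt[OF T] by (intro borel_measurable_indicator) (auto simp: pb_gen_def intro!: sigma_sets.Basic)
	from E(2) show ?thesis
	proof (cases rule: pred_gen_cases)
		case (1 A)
		show ?thesis
		proof (rule steppable_grid[OF T R m, where U = "\<lambda>_ _ _ _. 0"])
			show "(\<lambda>N. 0) \<longlonglongrightarrow> indicator E (pt w z)" if "z \<in> rect T R" for w z
				using that 1 E by (auto simp: pt_def rect_def)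
		qed (auto simp: adapted_def indicator_def)
	next
		case (2 s t A)
		\<comment> \<open>The generator is tested at the lower left corner of the cell. As cells are open
		  on the left, the conditions \<open>s \<le>\<close> corner and corner \<open>< t\<close>
		  eventually amount to \<open>s < fst z\<close> and \<open>fst z \<le> t\<close>; the first one
		  also makes \<open>A\<close> known at the corner.\<close>
		define U where "U N k j w = (indicator A w * of_bool (s <= T * real k / real N & T * real k / real N < t & R * real j / real N < c) :: real)"
			for N k j :: nat and w
		show ?thesis
		proof (rule steppable_grid[OF T R m, where U = U])
			show "adapted T N (U N)" for N
				unfolding adapted_def
			proof (intro allI impI)
				fix k j
				show "U N k j \<in> bm (hist (T * real k / real N))"
				proof (cases "s <= T * real k / real N")
					case True
					then have "A \<in> sets (hist (T * real k / real N))" using 2(5) hist_mono by blast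
					then show ?thesis unfolding U_def[abs_def] by simp
				next
					case False
					then have "U N k j = (\<lambda>_. 0)" by (simp add: U_def fun_eq_iff)
					then show ?thesis by simp
				qed
			qed
			fix w z and k j :: "nat => nat"
			assume w: "w \<in> configs" and z: "z \<in> rect T R"
				and kj: "!!N. 0 < N ==> k N < N & j N < N & z \<in> cell T R N (k N) (j N)"
			have k: "T * real (k N) / real N < fst z & fst z <= T * real (Suc (k N)) / real N"
				and j: "R * real (j N) / real N < snd z & snd z <= R * real (Suc (j N)) / real N" if "0 < N" for N
				using kj[OF that] by (auto simp: cell_def)
			have lk: "(\<lambda>N. T * real (k N) / real N) \<longlonglongrightarrow> fst z" by (rule grid_tendsto[OF T k])
			have lj: "(\<lambda>N. R * real (j N) / real N) \<longlonglongrightarrow> snd z" by (rule grid_tendsto[OF R j])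
			have pos: "eventually (\<lambda>N::nat. 0 < N) sequentially" by (rule eventually_gt_at_top)
			have "eventually (\<lambda>N. (s <= T * real (k N) / real N) = (s < fst z)) sequentially"
			proof (cases "s < fst z")
				case True
				from order_tendstoD(1)[OF lk this] show ?thesis by eventually_elim (use True in auto)
			next
				case False
				from pos show ?thesis
				proof eventually_elim
					case (elim N)
					then show ?case using False k[OF elim] by auto
				qed
			qed
			moreover have "eventually (\<lambda>N. (T * real (k N) / real N < t) = (fst z <= t)) sequentially"
			proof (cases "fst z <= t")
				case True
				from pos show ?thesis
				proof eventually_elim
					case (elim N)
					then show ?case using True k[OF elim] by auto
				qed
			next
				case False
				then have "t < fst z" by simp
				from order_tendstoD(1)[OF lk this] show ?thesis by eventually_elim (use False in auto)
			qed
			moreover have "eventually (\<lambda>N. (R * real (j N) / real N < c) = (snd z <= c)) sequentially"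
			proof (cases "snd z <= c")
				case True
				from pos show ?thesis
				proof eventually_elim
					case (elim N)
					then show ?case using True j[OF elim] by auto
				qed
			next
				case False
				then have "c < snd z" by simp
				from order_tendstoD(1)[OF lj this] show ?thesis by eventually_elim (use False in auto)
			qed
			ultimately have "eventually (\<lambda>N. indicator E (pt w z) = U N (k N) (j N) w) sequentially"
				by eventually_elim (auto simp: U_def E 2 pt_def indicator_def)
			from Lim_transform_eventually[OF tendsto_const this]
			show "(\<lambda>N. U N (k N) (j N) w) \<longlonglongrightarrow> indicator E (pt w z)" .
		qed (auto simp: U_def indicator_def)
	qed
qed

lemma steppable_indicator:
	assumes T: "0 < T" and R: "0 < R" and E: "E \<in> sets (PB T)"
	shows "steppable T R (indicator E)"
proof -
	note pb = pb_alt[OF T]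
	have E': "E \<in> sigma_sets (({0..T} \<times> configs) \<times> UNIV) (pb_gen T)" using E pb by simp
	have inE: "A \<in> sets (PB T)" if "A \<in> sigma_sets (({0..T} \<times> configs) \<times> UNIV) (pb_gen T)" for A
		using that pb by simp
	have im: "(indicator A :: _ => real) \<in> bm (PB T)" if "A \<in> sigma_sets (({0..T} \<times> configs) \<times> UNIV) (pb_gen T)" for A
		using inE[OF that] by simp
	have one: "steppable T R (\<lambda>_. 1)"
		by (rule steppable_grid[OF T R, where U = "\<lambda>_ _ _ _. 1"]) (auto simp: adapted_def)
	have zero: "steppable T R (\<lambda>_. 0)"
		by (rule steppable_grid[OF T R, where U = "\<lambda>_ _ _ _. 0"]) (auto simp: adapted_def)
	show ?thesis using pb(3) pb(4) E'
	proof (induction E rule: sigma_sets_induct_disjoint)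
		case (basic E)
		then show ?case by (rule steppable_gen[OF T R])
	next
		case empty
		then show ?case using zero by (simp add: indicator_def)
	next
		case (compl E)
		have s: "steppable T R (\<lambda>x. 1 + (- 1) * indicator E x)" using compl one im by (intro steppable_linear T) auto
		show ?case
		proof (rule steppable_limit[OF T _ _ s])
			have "(distQ T R (\<lambda>x. indicator (({0..T} \<times> configs) \<times> UNIV - E) x) (\<lambda>x. (1 + (- 1) * indicator E x))) = (\<integral>\<^sup>+x. 0 \<partial>QM T R)"
				by (intro nn_integral_cong) (auto simp: space_QM pb indicator_def)
			then show "(\<lambda>i. \<integral>\<^sup>+x. ennreal \<bar>indicator (({0..T} \<times> configs) \<times> UNIV - E) x - (1 + (- 1) * indicator E x)\<bar> \<partial>QM T R) \<longlonglongrightarrow> 0" by simp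
			show "(indicator (({0..T} \<times> configs) \<times> UNIV - E) :: _ => real) \<in> bm (PB T)"
				using compl(1) by (intro im sigma_sets.Compl)
			show "(\<lambda>x. 1 + (- 1) * indicator E x :: real) \<in> bm (PB T)" using im[OF compl(1)] by measurable
		qed
	next
		case (union A)
		define g where "g n x = (\<Sum>i<n. indicator (A i) x :: real)" for n :: nat and x
		have Ai: "A i \<in> sigma_sets (({0..T} \<times> configs) \<times> UNIV) (pb_gen T)" for i using union(2) by blast
		have gm: "g n \<in> bm (PB T)" for n unfolding g_def[abs_def] using im[OF Ai] by measurable
		have gs: "steppable T R (g n)" for n
		proof (induction n)
			case 0
			then show ?case using zero by (simp add: g_def[abs_def])
		next
			case (Suc n)
			have "steppable T R (\<lambda>x. g n x + 1 * indicator (A n) x)" using Suc union(3) gm im[OF Ai] by (intro steppable_linear T) auto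
			then show ?case by (simp add: g_def[abs_def])
		qed
		have geq: "g n x = indicator (\<Union>i<n. A i) x" for n x
			unfolding g_def using union(1) by (subst indicator_UN_disjoint) (auto simp: disjoint_family_on_def)
		show ?case
		proof (rule steppable_limit[OF T _ gm gs])
			show m: "(indicator (\<Union>i. A i) :: _ => real) \<in> bm (PB T)" using Ai by (intro im sigma_sets.Union)
			show "(\<lambda>i. \<integral>\<^sup>+x. ennreal \<bar>indicator (\<Union>i. A i) x - g i x\<bar> \<partial>QM T R) \<longlonglongrightarrow> 0"
			proof (rule nn_integral_bounded_convergence[OF T less_imp_le[OF R] m gm, where B = 1])
				show "AE x in QM T R. \<bar>indicator (\<Union>i. A i) x - g i x\<bar> <= 1" for i by (simp add: geq indicator_def)
				show "AE x in QM T R. (\<lambda>i. g i x) \<longlonglongrightarrow> indicator (\<Union>i. A i) x"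
					unfolding geq by (intro AE_I2 LIMSEQ_indicator_UN)
			qed
		qed
	qed
qed

lemma steppable_bounded:
	assumes T: "0 < T" and R: "0 < R" and f: "f \<in> bm (PB T)" "!!x. 0 <= f x" and b: "!!x. f x <= b"
	shows "steppable T R f"
proof -
	have zero: "steppable T R (\<lambda>_. 0)"
		by (rule steppable_grid[OF T R, where U = "\<lambda>_ _ _ _. 0"]) (auto simp: adapted_def)
	have "(\<exists>b. \<forall>x\<in>space (PB T). f x <= b) --> steppable T R f"
		using f
	proof (induction rule: borel_measurable_induct_real)
		case (set A)
		then show ?case using steppable_indicator[OF T R] by blast
	next
		case (mult f c)
		show ?case
		proof (cases "c = 0")
			case False
			then have c: "0 < c" using mult by simp
			have "steppable T R (\<lambda>x. 0 + c * f x)" if "\<forall>x\<in>space (PB T). c * f x <= b" for b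
			proof -
				have "\<forall>x\<in>space (PB T). f x <= b / c" using that c by (simp add: field_simps)
				then show ?thesis using mult zero by (intro steppable_linear T) auto
			qed
			then show ?thesis by auto
		qed (use zero in simp)
	next
		case (add f g)
		show ?case
		proof (intro impI, elim exE)
			fix b assume b: "\<forall>x\<in>space (PB T). g x + f x <= b"
			have "f x <= b" "g x <= b" if "x \<in> space (PB T)" for x
				using b[rule_format, OF that] add(2)[of x] add(4)[of x] by linarith+
			then have "steppable T R f" "steppable T R g" using add by blast+
			then have "steppable T R (\<lambda>x. g x + 1 * f x)" using add by (intro steppable_linear T) auto
			then show "steppable T R (\<lambda>x. g x + f x)" by simp
		qed
	next
		case (seq F)
		show ?case
		proof (intro impI, elim exE)
			fix b assume b: "\<forall>x\<in>space (PB T). f x <= b"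
			have le: "F i x <= f x" if "x \<in> space (PB T)" for i x
			proof (rule incseq_le)
				show "incseq (\<lambda>i. F i x)" using seq(3) unfolding incseq_def le_fun_def by blast
				show "(\<lambda>i. F i x) \<longlonglongrightarrow> f x" by (rule seq(4)[OF that])
			qed
			have Fs: "steppable T R (F i)" for i
			proof -
				have "\<forall>x\<in>space (PB T). F i x <= b" using le b order_trans by blast
				then show ?thesis using seq(5)[of i] by blast
			qed
			have fm: "f \<in> bm (PB T)" using seq(4,1) by (rule borel_measurable_LIMSEQ_real)
			have f0: "0 <= f x" if "x \<in> space (PB T)" for x using order_trans[OF seq(2) le[OF that]] .
			show "steppable T R f"
			proof (rule steppable_limit[OF T fm seq(1) Fs])
				show "(\<lambda>i. \<integral>\<^sup>+x. ennreal \<bar>f x - F i x\<bar> \<partial>QM T R) \<longlonglongrightarrow> 0"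
				proof (rule nn_integral_bounded_convergence[OF T less_imp_le[OF R] fm seq(1), where B = b])
					show "AE x in QM T R. \<bar>f x - F i x\<bar> <= b" for i
					proof (rule AE_I2)
						fix x assume "x \<in> space (QM T R)"
						then have x: "x \<in> space (PB T)" by (simp add: space_QM)
						have "f x <= b" using b x by blast
						then show "\<bar>f x - F i x\<bar> <= b" using le[OF x, of i] seq(2)[of i x] by linarith
					qed
					show "AE x in QM T R. (\<lambda>i. F i x) \<longlonglongrightarrow> f x"
						using seq(4) by (intro AE_I2) (simp add: space_QM)
				qed
			qed
		qed
	qed
	then show ?thesis using b by blast
qed


lemma step_approx:
	assumes T: "0 < T" and R: "0 < R" and f: "f \<in> bm (PB T)" "!!x. 0 <= f x" "!!x. f x <= b" and \<epsilon>: "0 < \<epsilon>"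
	shows "\<exists>N0. \<forall>N\<ge>N0. \<exists>U. adapted T N U & (\<forall>k j w. 0 <= U k j w & U k j w <= b) &
		 (distQ T R f (step_fun T R N U)) < ennreal \<epsilon>"
proof -
	have b0: "0 <= b" using f(2,3) order_trans by blast
	obtain N0 where N0: "\<forall>N\<ge>N0. \<exists>U. adapted T N U & (distQ T R f (step_fun T R N U)) < ennreal \<epsilon>"
		using steppable_bounded[OF T R f] \<epsilon> unfolding steppable_def by blast
	show ?thesis
	proof (intro exI[of _ "max N0 1"] allI impI)
		fix N assume N: "N >= max N0 1"
		then obtain U where U: "adapted T N U" "(distQ T R f (step_fun T R N U)) < ennreal \<epsilon>" using N0 by auto
		\<comment> \<open>Clipping to the range of \<open>f\<close> does not increase the distance to
		  \<open>f\<close>, and it supplies the bounds that the moment estimates need.\<close>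
		define V where "V k j w = min b (max 0 (U k j w))" for k j w
		have V: "adapted T N V" using U(1) unfolding adapted_def V_def[abs_def]
			by (auto intro!: borel_measurable_min borel_measurable_max)
		have "(distQ T R f (step_fun T R N V)) <= (distQ T R f (step_fun T R N U))"
		proof (intro nn_integral_mono_AE, use AE_QM[OF T less_imp_le[OF R]] in eventually_elim)
			case (elim x)
			define z where "z = (fst (fst x), snd x)"
			have x: "x = pt (snd (fst x)) z" "z \<in> rect T R" using elim by (auto simp: pt_def rect_def z_def)
			obtain k j where kj: "k < N" "j < N" "z \<in> cell T R N k j" using grid_cell_ex[OF T R _ x(2), of N] N by auto
			have "step_fun T R N V x = V k j (snd (fst x))" "step_fun T R N U x = U k j (snd (fst x))"
				by (subst x(1), rule step_fun_cell[OF T R kj])+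
			then show ?case using f(2,3)[of x] by (intro ennreal_leI) (auto simp: V_def)
		qed
		then have "(distQ T R f (step_fun T R N V)) < ennreal \<epsilon>" using U(2) by simp
		then show "\<exists>U. adapted T N U & (\<forall>k j w. 0 <= U k j w & U k j w <= b) &
		 (distQ T R f (step_fun T R N U)) < ennreal \<epsilon>"
			using V b0 by (intro exI[of _ V]) (auto simp: V_def)
	qed
qed

end

section \<open>Lindeberg's method on a grid\<close>

context prm begin

lemma mult_count:
	fixes f :: "config => real" and g :: "real => real"
	assumes D: "D \<in> sets hp" "C Int D = {}" and f: "f \<in> bm (hist_on C)" "integrable P f"
		and g: "g \<in> bm borel" "integrable P (\<lambda>w. g (measure w D))"
	shows "integrable P (\<lambda>w. f w * g (measure w D))"
		"expectation (\<lambda>w. f w * g (measure w D)) = expectation f * expectation (\<lambda>w. g (measure w D))"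
	using expectation_mult_count[OF D f, of "\<lambda>x. g (enn2real x)"] g by (simp_all add: measure_def)

lemma integrable_bounded:
	fixes f :: "config => real"
	assumes "f \<in> bm P" "!!w. \<bar>f w\<bar> <= B"
	shows "integrable P f"
	using assms by (intro integrable_const_bound[of _ B]) auto

lemma integrable_lipschitz:
	fixes v :: "real => real" and Z :: "config => real"
	assumes v: "1-lipschitz_on UNIV v" and Z: "integrable P Z"
	shows "integrable P (\<lambda>w. v (Z w))"
proof (rule Bochner_Integration.integrable_bound)
	have [measurable]: "v \<in> bm borel" using lin_growth_lipschitz[OF v] by (simp add: lin_growth_def)
	have [measurable]: "Z \<in> bm P" using Z by simp
	show "(\<lambda>w. v (Z w)) \<in> bm P" by measurable
	show "integrable P (\<lambda>w. \<bar>v 0\<bar> + \<bar>Z w\<bar>)" using Z by simp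
	have "norm (v x) <= norm (\<bar>v 0\<bar> + \<bar>x\<bar>)" for x
		using lipschitz_onD[OF v, of x 0] by (simp add: dist_real_def)
	then show "AE w in P. norm (v (Z w)) <= norm (\<bar>v 0\<bar> + \<bar>Z w\<bar>)" by simp
qed

text \<open>\<open>Z\<close> and \<open>W\<close> are known outside the cell and its count is
  independent of them. The linear Taylor term vanishes by centring, the quadratic one has variance
  \<open>a\<close>, and the third absolute moment of \<open>count_moments\<close> bounds the
  remainder.\<close>

lemma cell_step:
	fixes v v1 v2 :: "real => real" and Z W :: "config => real"
	assumes v: "1-lipschitz_on UNIV v" and m: "v1 \<in> bm borel" "v2 \<in> bm borel"
		and b1: "!!x. \<bar>v1 x\<bar> <= 1" and b2: "!!x. \<bar>v2 x\<bar> <= B2"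
		and taylor: "!!x d. \<bar>v (x + d) - v x - v1 x * d - v2 x * d\<^sup>2 / 2\<bar> <= L * \<bar>d\<bar> ^ 3"
		and D: "D \<in> sets hp" "C Int D = {}" "emeasure hp D = ennreal a" and a: "0 <= a" "a <= 1"
		and Z: "Z \<in> bm (hist_on C)" "integrable P Z"
		and W: "W \<in> bm (hist_on C)" "!!w. 0 <= W w" "!!w. W w <= b"
	shows "\<bar>expectation (\<lambda>w. v (Z w + W w * (measure w D - a))) - expectation (\<lambda>w. v (Z w))
			- a / 2 * expectation (\<lambda>w. v2 (Z w) * (W w)\<^sup>2)\<bar> <= 6 * a * L * expectation (\<lambda>w. (W w) ^ 3)"
proof -
	have Dfin: "emeasure hp D < \<infinity>" and ma: "measure hp D = a"
		using D(3) a by (simp_all add: measure_def)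
	note cm = count_moments[OF D(1) Dfin, unfolded ma]
	note [measurable] = m Z(1) W(1)
	have L0: "0 <= L" using taylor[of 0 1] by simp
	have b0: "0 <= b" using W(2,3) order_trans by blast
	have B20: "0 <= B2" using b2[of 0] by linarith
	let ?X = "\<lambda>w. measure w D - a"
	have f1: "(\<lambda>w. v1 (Z w) * W w) \<in> bm (hist_on C)" by measurable
	have f2: "(\<lambda>w. v2 (Z w) * (W w)\<^sup>2) \<in> bm (hist_on C)" by measurable
	have f3: "(\<lambda>w. (W w) ^ 3) \<in> bm (hist_on C)" by measurable
	have Wb: "\<bar>W w\<bar> <= b" for w using W(2,3)[of w] by simp
	have i1: "integrable P (\<lambda>w. v1 (Z w) * W w)"
		using b1 Wb mult_mono[OF b1 Wb] by (intro integrable_bounded[OF measurable_from_hist_on[OF f1], of "1 * b"]) (simp add: abs_mult)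
	have Wp: "\<bar>(W w) ^ n\<bar> <= b ^ n" for w n unfolding power_abs using Wb by (intro power_mono) auto
	have i2: "integrable P (\<lambda>w. v2 (Z w) * (W w)\<^sup>2)"
		by (rule integrable_bounded[OF measurable_from_hist_on[OF f2], of "B2 * b\<^sup>2"])
			(unfold abs_mult, rule mult_mono[OF b2 Wp B20 abs_ge_zero])
	have i3: "integrable P (\<lambda>w. (W w) ^ 3)"
		using Wp by (intro integrable_bounded[OF measurable_from_hist_on[OF f3]])
	have iW: "integrable P W" using Wb by (intro integrable_bounded[OF measurable_from_hist_on[OF W(1)]])
	have iX: "integrable P ?X" using cm(1) by simp
	have EX: "expectation ?X = 0" using cm(1,2) by (simp add: prob_space)
	note m1 = mult_count[OF D(1,2) f1 i1, of "\<lambda>x. x - a"]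
	note m2 = mult_count[OF D(1,2) f2 i2, of "\<lambda>x. (x - a)\<^sup>2"]
	note m3 = mult_count[OF D(1,2) f3 i3, of "\<lambda>x. \<bar>x - a\<bar> ^ 3"]
	note mW = mult_count[OF D(1,2) W(1) iW, of "\<lambda>x. x - a"]
	have iZW: "integrable P (\<lambda>w. Z w + W w * ?X w)" using Z(2) mW(1) iX by simp
	define r where "r w = v (Z w + W w * ?X w) - v (Z w) - v1 (Z w) * (W w * ?X w) - v2 (Z w) * (W w * ?X w)\<^sup>2 / 2" for w
	have j1: "integrable P (\<lambda>w. v1 (Z w) * (W w * ?X w))" using m1(1) iX by (simp add: mult.assoc)
	have j2: "integrable P (\<lambda>w. v2 (Z w) * (W w * ?X w)\<^sup>2 / 2)"
		using m2(1) cm(3) by (simp add: power_mult_distrib mult.assoc)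
	have e1: "expectation (\<lambda>w. v1 (Z w) * (W w * ?X w)) = 0"
		using m1(2) iX EX by (simp add: mult.assoc)
	have e2: "expectation (\<lambda>w. v2 (Z w) * (W w * ?X w)\<^sup>2 / 2) = a / 2 * expectation (\<lambda>w. v2 (Z w) * (W w)\<^sup>2)"
		using m2(2) cm(3,4) by (simp add: power_mult_distrib mult.assoc)
	have iv: "integrable P (\<lambda>w. v (Z w + W w * ?X w))" "integrable P (\<lambda>w. v (Z w))"
		using integrable_lipschitz[OF v iZW] integrable_lipschitz[OF v Z(2)] by auto
	have ir: "integrable P r" unfolding r_def using iv j1 j2 by simp
	have "expectation r = expectation (\<lambda>w. v (Z w + W w * ?X w)) - expectation (\<lambda>w. v (Z w))
			- a / 2 * expectation (\<lambda>w. v2 (Z w) * (W w)\<^sup>2)"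
		unfolding r_def using iv j1 j2 e1 e2 by simp
	moreover have "\<bar>expectation r\<bar> <= expectation (\<lambda>w. \<bar>r w\<bar>)"
		using integral_norm_bound[of P r] by simp
	moreover have "expectation (\<lambda>w. \<bar>r w\<bar>) <= expectation (\<lambda>w. L * ((W w) ^ 3 * \<bar>?X w\<bar> ^ 3))"
	proof (rule integral_mono)
		show "integrable P (\<lambda>w. \<bar>r w\<bar>)" using ir by simp
		show "integrable P (\<lambda>w. L * ((W w) ^ 3 * \<bar>?X w\<bar> ^ 3))" using m3(1) cm(5) by simp
		fix w
		have "\<bar>r w\<bar> <= L * \<bar>W w * ?X w\<bar> ^ 3" unfolding r_def by (rule taylor)
		then show "\<bar>r w\<bar> <= L * ((W w) ^ 3 * \<bar>?X w\<bar> ^ 3)" using W(2)[of w] by (simp add: abs_mult power_mult_distrib)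
	qed
	moreover have "expectation (\<lambda>w. L * ((W w) ^ 3 * \<bar>?X w\<bar> ^ 3)) = L * (expectation (\<lambda>w. (W w) ^ 3) * expectation (\<lambda>w. \<bar>?X w\<bar> ^ 3))"
		using m3 cm(5) by simp
	moreover have "L * (expectation (\<lambda>w. (W w) ^ 3) * expectation (\<lambda>w. \<bar>?X w\<bar> ^ 3)) <= L * (expectation (\<lambda>w. (W w) ^ 3) * (6 * a))"
		using cm(6)[OF a(2)] L0 W(2) by (intro mult_left_mono integral_nonneg_AE) auto
	ultimately show ?thesis by (simp only: mult_ac)
qed

end

section \<open>The exchange argument along rows and cells\<close>

locale step_process = prm +
	fixes T R b :: real and N :: nat and U :: "nat => nat => config => real"
	assumes T: "0 < T" and R: "0 < R" and N: "0 < N" and small: "T * R / (real N)\<^sup>2 <= 1"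
		and U: "adapted T N U" "!!k j w. 0 <= U k j w" "!!k j w. U k j w <= b"
begin

definition area :: real where "area = T * R / (real N)\<^sup>2"

lemma area: "0 <= area" "area <= 1" "emeasure hp (cell T R N k j) = ennreal area"
	using T R small emeasure_cell[OF T R N] by (auto simp: area_def)

lemma b0: "0 <= b" using U(2,3) order_trans by blast

definition X :: "nat => nat => config => real" where
	"X k j w = measure w (cell T R N k j) - area"

definition rowpart :: "nat => nat => config => real" where
	"rowpart k j w = (\<Sum>j'<j. U k j' w * X k j' w)"

definition M :: "nat => config => real" where
	"M k w = (\<Sum>k'<k. rowpart k' N w)"

text \<open>What is known just before cell \<open>j\<close> of time slab \<open>k\<close> is opened:
  the closed past of the slab and the cells already opened in it. A row is a time slab, and
  \<open>j\<close> runs through the marks.\<close>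

definition explored :: "nat => nat => (real \<times> real) set" where
	"explored k j = {..T * real k / real N} \<times> UNIV \<union> (\<Union>j'<j. cell T R N k j')"

lemma explored_mono: "j <= j' ==> explored k j \<subseteq> explored k j'"
	unfolding explored_def by (intro Un_mono UN_mono) auto

lemma explored_cell: "j < N ==> k < N ==> explored k j Int cell T R N k j = {}"
proof -
	assume jk: "j < N" "k < N"
	have "cell T R N k j' Int cell T R N k j = {}" if "j' < j" for j'
		using cell_disjoint[OF T R jk(2), of j' k j] that jk by auto
	moreover have "({..T * real k / real N} \<times> UNIV) Int cell T R N k j = {}" by (auto simp: cell_def)
	ultimately show ?thesis unfolding explored_def by blast
qed

lemma cell_explored: "k' < k ==> cell T R N k' j' \<subseteq> explored k 0"
proof -
	assume "k' < k"
	then have "T * real (Suc k') / real N <= T * real k / real N"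
		using T by (intro divide_right_mono mult_left_mono) auto
	then show ?thesis by (auto simp: cell_def explored_def)
qed

lemma U_meas: "k < N ==> j' < N ==> U k j' \<in> bm (hist_on (explored k j))"
proof -
	assume "k < N" "j' < N"
	then have "U k j' \<in> bm (hist (T * real k / real N))" using U(1) by (simp add: adapted_def)
	moreover have "sets (hist (T * real k / real N)) \<subseteq> sets (hist_on (explored k j))"
		using hist_le_hist_on hist_on_mono[of "{..T * real k / real N} \<times> UNIV" "explored k j"] by (auto simp: explored_def)
	ultimately show ?thesis using measurable_mono[OF order_refl refl, of "hist (T * real k / real N)" "hist_on (explored k j)" borel] by auto
qed

lemma hist_on_measurable_mono:
	"C \<subseteq> D ==> f \<in> measurable (hist_on C) S ==> f \<in> measurable (hist_on D) S"
	using measurable_mono[OF order_refl refl hist_on_mono[of C D], of S] by auto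

lemma X_meas: "cell T R N k j \<subseteq> C ==> X k j \<in> bm (hist_on C)"
	unfolding X_def[abs_def] measure_def
	using measurable_hist_on[OF cell_sets[OF R], of T N k j C] by measurable

lemma rowpart_meas: "k < N ==> j <= N ==> rowpart k j \<in> bm (hist_on (explored k j))"
	unfolding rowpart_def[abs_def]
proof (intro borel_measurable_sum borel_measurable_times)
	fix i assume "k < N" "j <= N" "i \<in> {..<j}"
	then show "U k i \<in> bm (hist_on (explored k j))" by (intro U_meas) auto
	show "X k i \<in> bm (hist_on (explored k j))"
		using \<open>i \<in> {..<j}\<close> by (intro X_meas) (auto simp: explored_def)
qed

lemma M_meas: "k <= N ==> M k \<in> bm (hist_on (explored k j))"
	unfolding M_def[abs_def] rowpart_def
proof (intro borel_measurable_sum borel_measurable_times)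
	fix k' i assume *: "k <= N" "k' \<in> {..<k}" "i \<in> {..<N}"
	have le: "explored k' 0 \<subseteq> explored k j"
	proof -
		have "T * real k' / real N <= T * real k / real N" using T * by (intro divide_right_mono mult_left_mono) auto
		then show ?thesis by (auto simp: explored_def)
	qed
	show "U k' i \<in> bm (hist_on (explored k j))"
		using * by (intro hist_on_measurable_mono[OF le] U_meas) auto
	show "X k' i \<in> bm (hist_on (explored k j))"
		using cell_explored[of k' k i] explored_mono[of 0 j k] * by (intro X_meas) auto
qed

lemma X_moments:
	"integrable P (X k j)" "expectation (X k j) = 0"
	"integrable P (\<lambda>w. (X k j w)\<^sup>2)" "expectation (\<lambda>w. (X k j w)\<^sup>2) = area"
proof -
	have fin: "emeasure hp (cell T R N k j) < \<infinity>" and ma: "measure hp (cell T R N k j) = area"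
		using area by (simp_all add: measure_def)
	note cm = count_moments[OF cell_sets[OF R] fin, unfolded ma]
	show "integrable P (X k j)" "expectation (X k j) = 0"
		"integrable P (\<lambda>w. (X k j w)\<^sup>2)" "expectation (\<lambda>w. (X k j w)\<^sup>2) = area"
		unfolding X_def[abs_def] using cm by (simp_all add: prob_space)
qed

lemma UX:
	assumes "k < N" "j < N" and f: "f \<in> bm (hist_on (explored k j))" "integrable P f"
	shows "integrable P (\<lambda>w. f w * X k j w)" "expectation (\<lambda>w. f w * X k j w) = 0"
		"integrable P (\<lambda>w. f w * (X k j w)\<^sup>2)" "expectation (\<lambda>w. f w * (X k j w)\<^sup>2) = expectation f * area"
	using mult_count[OF cell_sets[OF R] explored_cell[OF assms(2,1)] f, of "\<lambda>x. x - area"]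
		mult_count[OF cell_sets[OF R] explored_cell[OF assms(2,1)] f, of "\<lambda>x. (x - area)\<^sup>2"] X_moments[of k j]
	by (simp_all add: X_def[abs_def])

lemma U_int: "k < N ==> j < N ==> integrable P (\<lambda>w. U k j w ^ n)"
proof -
	assume kj: "k < N" "j < N"
	have [measurable]: "U k j \<in> bm P" by (rule measurable_from_hist_on[OF U_meas[OF kj, of 0]])
	have "\<bar>U k j w ^ n\<bar> <= b ^ n" for w using U(2,3) by (simp add: power_mono)
	then show ?thesis by (intro integrable_bounded) auto
qed

lemma U_int1: "k < N ==> j < N ==> integrable P (U k j)"
	using U_int[of k j 1] by simp

lemma rowpart_int: "k < N ==> j <= N ==> integrable P (rowpart k j)"
	unfolding rowpart_def[abs_def] by (intro Bochner_Integration.integrable_sum UX U_meas U_int1) auto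

lemma M_int: "k <= N ==> integrable P (M k)"
	unfolding M_def[abs_def] by (intro Bochner_Integration.integrable_sum rowpart_int) auto

text \<open>Orthogonality of increments: the cross term is an explored quantity times the centred
  count of a new cell, so its mean is zero.\<close>

lemma rowpart_second_moment:
	"k < N ==> j <= N ==> integrable P (\<lambda>w. (rowpart k j w)\<^sup>2) & expectation (\<lambda>w. (rowpart k j w)\<^sup>2) <= real j * (b\<^sup>2 * area)"
proof (induction j)
	case 0
	then show ?case by (simp add: rowpart_def)
next
	case (Suc j)
	then have kj: "k < N" "j < N" and IH: "integrable P (\<lambda>w. (rowpart k j w)\<^sup>2)" "expectation (\<lambda>w. (rowpart k j w)\<^sup>2) <= real j * (b\<^sup>2 * area)"
		by auto
	have mR: "rowpart k j \<in> bm (hist_on (explored k j))" and mU: "U k j \<in> bm (hist_on (explored k j))"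
		using kj by (auto intro: rowpart_meas U_meas)
	have mRU: "(\<lambda>w. 2 * rowpart k j w * U k j w) \<in> bm (hist_on (explored k j))" using mR mU by measurable
	have iRU: "integrable P (\<lambda>w. 2 * rowpart k j w * U k j w)"
	proof (rule Bochner_Integration.integrable_bound)
		show "integrable P (\<lambda>w. 2 * b * rowpart k j w)" using rowpart_int[of k j] kj by simp
		show "(\<lambda>w. 2 * rowpart k j w * U k j w) \<in> bm P" by (rule measurable_from_hist_on[OF mRU])
		have "\<bar>2 * rowpart k j w * U k j w\<bar> <= \<bar>2 * b * rowpart k j w\<bar>" for w
			using U(2,3)[of k j w] b0 mult_right_mono[OF U(3)[of k j w], of "\<bar>rowpart k j w\<bar>"] by (simp add: abs_mult mult_ac)
		then show "AE w in P. norm (2 * rowpart k j w * U k j w) <= norm (2 * b * rowpart k j w)" by simp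
	qed
	have mU2: "(\<lambda>w. (U k j w)\<^sup>2) \<in> bm (hist_on (explored k j))" using mU by measurable
	note a1 = UX[OF kj mRU iRU]
	note a2 = UX[OF kj mU2 U_int[OF kj]]
	have eq: "(\<lambda>w. (rowpart k (Suc j) w)\<^sup>2) = (\<lambda>w. (rowpart k j w)\<^sup>2 + (2 * rowpart k j w * U k j w) * X k j w + (U k j w)\<^sup>2 * (X k j w)\<^sup>2)"
		by (simp add: rowpart_def fun_eq_iff power2_eq_square algebra_simps)
	have EU: "expectation (\<lambda>w. (U k j w)\<^sup>2) <= b\<^sup>2"
		using U(2,3) by (intro integral_le_const U_int kj AE_I2 power_mono)
	have "expectation (\<lambda>w. (rowpart k (Suc j) w)\<^sup>2) = expectation (\<lambda>w. (rowpart k j w)\<^sup>2) + 0 + expectation (\<lambda>w. (U k j w)\<^sup>2) * area"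
		unfolding eq using IH(1) a1 a2 by simp
	also have "... <= real j * (b\<^sup>2 * area) + 0 + b\<^sup>2 * area" using IH(2) EU area(1) by (intro add_mono mult_right_mono) auto
	finally have "expectation (\<lambda>w. (rowpart k (Suc j) w)\<^sup>2) <= real (Suc j) * (b\<^sup>2 * area)" by (simp add: algebra_simps)
	moreover have "integrable P (\<lambda>w. (rowpart k (Suc j) w)\<^sup>2)" unfolding eq using IH(1) a1 a2 by simp
	ultimately show ?case by simp
qed

lemma rowpart_abs:
	assumes "k < N" "j <= N"
	shows "expectation (\<lambda>w. \<bar>rowpart k j w\<bar>) <= b * sqrt (T * R / real N)"
proof (cases "b = 0")
	case True
	then have "rowpart k j w = 0" for w using U(2,3) unfolding rowpart_def by (intro sum.neutral) (metis antisym mult_zero_left)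
	then show ?thesis by (simp add: True)
next
	case False
	\<comment> \<open>The Cauchy-Schwarz bound in the form
	  \<open>\<bar>x\<bar> \<le> q / 2 + x\<^sup>2 / (2 * q)\<close>, with \<open>q\<close> the bound
	  for the root mean square of the row.\<close>
	define q where "q = b * sqrt (T * R / real N)"
	have q: "0 < q" using False b0 T R N by (simp add: q_def)
	note r = rowpart_second_moment[OF assms]
	have "real j * (b\<^sup>2 * area) <= real N * (b\<^sup>2 * area)" using assms area(1) by (intro mult_right_mono) auto
	also have "... = b\<^sup>2 * (T * R / real N)" using N by (simp add: area_def power2_eq_square)
	also have "... = q\<^sup>2" using T R by (simp add: q_def power_mult_distrib)
	finally have r2: "expectation (\<lambda>w. (rowpart k j w)\<^sup>2) <= q\<^sup>2" using r by simp
	have "expectation (\<lambda>w. \<bar>rowpart k j w\<bar>) <= expectation (\<lambda>w. q / 2 + (rowpart k j w)\<^sup>2 / (2 * q))"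
	proof (rule integral_mono)
		show "integrable P (\<lambda>w. \<bar>rowpart k j w\<bar>)" using rowpart_int[OF assms] by simp
		show "integrable P (\<lambda>w. q / 2 + (rowpart k j w)\<^sup>2 / (2 * q))" using r by simp
		fix w
		have "0 <= (q - \<bar>rowpart k j w\<bar>)\<^sup>2" by simp
		then have "2 * q * \<bar>rowpart k j w\<bar> <= q\<^sup>2 + (rowpart k j w)\<^sup>2" by (simp add: power2_eq_square algebra_simps)
		then show "\<bar>rowpart k j w\<bar> <= q / 2 + (rowpart k j w)\<^sup>2 / (2 * q)" using q by (simp add: field_simps power2_eq_square)
	qed
	also have "... = q / 2 + expectation (\<lambda>w. (rowpart k j w)\<^sup>2) / (2 * q)" using r by (simp add: prob_space)
	also have "... <= q / 2 + q\<^sup>2 / (2 * q)" using r2 q by (intro add_left_mono divide_right_mono) auto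
	also have "... = q" using q by (simp add: power2_eq_square)
	finally show ?thesis by (simp add: q_def)
qed

text \<open>The quadratic terms are evaluated at the start \<open>M k\<close> of the row, not at the
  running position, so that they combine to the bracket of the row. By the Lipschitz bound on
  \<open>v2\<close> the change costs order \<open>N\<close> to the power \<open>-3/2\<close> per
  row, which stays negligible after summing over \<open>N\<close> rows.\<close>

lemma row_step:
	fixes v v1 v2 :: "real => real"
	assumes k: "k < N" and v: "1-lipschitz_on UNIV v" and m: "v1 \<in> bm borel" "v2 \<in> bm borel"
		and b1: "!!x. \<bar>v1 x\<bar> <= 1" and b2: "!!x. \<bar>v2 x\<bar> <= B2"
		and taylor: "!!x d. \<bar>v (x + d) - v x - v1 x * d - v2 x * d\<^sup>2 / 2\<bar> <= L * \<bar>d\<bar> ^ 3"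
		and lip2: "!!x d. \<bar>v2 (x + d) - v2 x\<bar> <= L * \<bar>d\<bar>" and L: "0 <= L"
	shows "\<bar>expectation (\<lambda>w. v (M (Suc k) w)) - expectation (\<lambda>w. v (M k w))
			- area / 2 * (\<Sum>j<N. expectation (\<lambda>w. v2 (M k w) * (U k j w)\<^sup>2))\<bar>
		<= 6 * area * L * (\<Sum>j<N. expectation (\<lambda>w. U k j w ^ 3)) + T * R / real N * L * b ^ 3 * sqrt (T * R / real N)"
proof -
	define E where "E j = expectation (\<lambda>w. v (M k w + rowpart k j w))" for j
	define S where "S j = area / 2 * expectation (\<lambda>w. v2 (M k w) * (U k j w)\<^sup>2)" for j
	define q where "q = sqrt (T * R / real N)"
	have step: "\<bar>E (Suc j) - E j - S j\<bar> <= 6 * area * L * expectation (\<lambda>w. U k j w ^ 3) + area * L * b ^ 3 * q"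
		if j: "j < N" for j
	proof -
		note [measurable] = m
		let ?Z = "\<lambda>w. M k w + rowpart k j w"
		have mM: "M k \<in> bm (hist_on (explored k j))" using k by (intro M_meas) auto
		have mR: "rowpart k j \<in> bm (hist_on (explored k j))" using k j by (intro rowpart_meas) auto
		have mU: "U k j \<in> bm (hist_on (explored k j))" using k j by (intro U_meas)
		note [measurable] = measurable_from_hist_on[OF mM] measurable_from_hist_on[OF mR] measurable_from_hist_on[OF mU]
		have c: "\<bar>expectation (\<lambda>w. v (?Z w + U k j w * (measure w (cell T R N k j) - area))) - expectation (\<lambda>w. v (?Z w))
			- area / 2 * expectation (\<lambda>w. v2 (?Z w) * (U k j w)\<^sup>2)\<bar> <= 6 * area * L * expectation (\<lambda>w. U k j w ^ 3)"
			using M_int[of k] rowpart_int[of k j] k j U(2,3) area mM mR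
			by (intro cell_step[OF v m b1 b2 taylor cell_sets[OF R] explored_cell[OF j k] area(3) area(1,2) _ _ mU]) auto
		have e: "v (?Z w + U k j w * (measure w (cell T R N k j) - area)) = v (M k w + rowpart k (Suc j) w)" for w
			by (simp add: rowpart_def X_def add.assoc)
		have B20: "0 <= B2" using b2[of 0] by linarith
		have U2: "\<bar>(U k j w)\<^sup>2\<bar> <= b\<^sup>2" for w using U(2,3) by (simp add: power_mono)
		have i: "integrable P (\<lambda>w. v2 (?Z w) * (U k j w)\<^sup>2)" "integrable P (\<lambda>w. v2 (M k w) * (U k j w)\<^sup>2)"
			using mult_mono[OF b2 U2] B20 by (auto intro!: integrable_bounded[of _ "B2 * b\<^sup>2"] simp: abs_mult)
		have "\<bar>expectation (\<lambda>w. v2 (?Z w) * (U k j w)\<^sup>2) - expectation (\<lambda>w. v2 (M k w) * (U k j w)\<^sup>2)\<bar>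
				= \<bar>expectation (\<lambda>w. v2 (?Z w) * (U k j w)\<^sup>2 - v2 (M k w) * (U k j w)\<^sup>2)\<bar>"
			using i by simp
		also have "... <= expectation (\<lambda>w. \<bar>v2 (?Z w) * (U k j w)\<^sup>2 - v2 (M k w) * (U k j w)\<^sup>2\<bar>)"
			using integral_norm_bound[of P "\<lambda>w. v2 (?Z w) * (U k j w)\<^sup>2 - v2 (M k w) * (U k j w)\<^sup>2"] by simp
		also have "... <= expectation (\<lambda>w. L * b\<^sup>2 * \<bar>rowpart k j w\<bar>)"
		proof (rule integral_mono)
			show "integrable P (\<lambda>w. \<bar>v2 (?Z w) * (U k j w)\<^sup>2 - v2 (M k w) * (U k j w)\<^sup>2\<bar>)" using i by simp
			show "integrable P (\<lambda>w. L * b\<^sup>2 * \<bar>rowpart k j w\<bar>)" using rowpart_int[of k j] k j by simp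
			fix w
			have "\<bar>v2 (?Z w) - v2 (M k w)\<bar> * \<bar>(U k j w)\<^sup>2\<bar> <= (L * \<bar>rowpart k j w\<bar>) * b\<^sup>2"
				using lip2 U2 L by (intro mult_mono) auto
			then show "\<bar>v2 (?Z w) * (U k j w)\<^sup>2 - v2 (M k w) * (U k j w)\<^sup>2\<bar> <= L * b\<^sup>2 * \<bar>rowpart k j w\<bar>"
				unfolding left_diff_distrib[symmetric] abs_mult by (simp add: mult_ac)
		qed
		also have "... = L * b\<^sup>2 * expectation (\<lambda>w. \<bar>rowpart k j w\<bar>)" by simp
		also have "... <= L * b\<^sup>2 * (b * q)" unfolding q_def using rowpart_abs[of k j] k j L by (intro mult_left_mono) auto
		finally have "\<bar>expectation (\<lambda>w. v2 (?Z w) * (U k j w)\<^sup>2) - expectation (\<lambda>w. v2 (M k w) * (U k j w)\<^sup>2)\<bar> <= L * b\<^sup>2 * (b * q)" .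
		then have "area / 2 * \<bar>expectation (\<lambda>w. v2 (?Z w) * (U k j w)\<^sup>2) - expectation (\<lambda>w. v2 (M k w) * (U k j w)\<^sup>2)\<bar> <= area / 2 * (L * b\<^sup>2 * (b * q))"
			using area(1) by (intro mult_left_mono) auto
		also have "... <= area * (L * b\<^sup>2 * (b * q))"
			using area(1) L b0 T R N by (intro mult_right_mono) (auto simp: q_def)
		finally have d: "\<bar>area / 2 * expectation (\<lambda>w. v2 (?Z w) * (U k j w)\<^sup>2) - S j\<bar> <= area * L * b ^ 3 * q"
			using area(1) unfolding S_def right_diff_distrib[symmetric] abs_mult by (simp add: power3_eq_cube power2_eq_square mult_ac)
		show ?thesis using c d unfolding e E_def by linarith
	qed
	have "(\<Sum>j<N. E (Suc j) - E j - S j) = (\<Sum>j<N. E (Suc j) - E j) - (\<Sum>j<N. S j)" by (rule sum_subtractf)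
	then have "E N - E 0 - (\<Sum>j<N. S j) = (\<Sum>j<N. E (Suc j) - E j - S j)"
		unfolding sum_lessThan_telescope ..
	then have "\<bar>E N - E 0 - (\<Sum>j<N. S j)\<bar> <= (\<Sum>j<N. \<bar>E (Suc j) - E j - S j\<bar>)" by (simp add: sum_abs)
	also have "... <= (\<Sum>j<N. 6 * area * L * expectation (\<lambda>w. U k j w ^ 3) + area * L * b ^ 3 * q)"
		by (intro sum_mono step) auto
	also have "... = 6 * area * L * (\<Sum>j<N. expectation (\<lambda>w. U k j w ^ 3)) + T * R / real N * L * b ^ 3 * q"
		using N by (simp add: sum.distrib sum_distrib_left area_def power2_eq_square)
	finally show ?thesis
		unfolding E_def S_def q_def by (simp add: M_def rowpart_def sum_distrib_left add.commute)
qed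

text \<open>The mean deviation of the row brackets from \<open>1 / real N\<close>, the share of one
  row in a total variance of one.\<close>

definition var_defect :: real where
	"var_defect = (\<Sum>k<N. expectation (\<lambda>w. \<bar>area * (\<Sum>j<N. (U k j w)\<^sup>2) - 1 / real N\<bar>))"

text \<open>The values \<open>V k\<close> trade Gaussian variance for rows: at \<open>k = 0\<close>
  everything is Gaussian with variance \<open>1 + \<epsilon>\<^sup>2\<close>, at
  \<open>k = N\<close> only the smoothing \<open>\<epsilon>\<close> is left. The factor 18 is the 6
  of \<open>cell_step\<close> times the 3 of \<open>heat_smooth\<close> at scale
  \<open>\<sigma> (Suc k)\<close>.\<close>

lemma lindeberg_step:
	assumes h: "1-lipschitz_on UNIV h" and \<epsilon>: "0 < \<epsilon>"
	defines "\<sigma> \<equiv> \<lambda>k. sqrt (\<epsilon>\<^sup>2 + 1 - real k / real N)"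
	shows "\<bar>expectation (\<lambda>w. heat \<epsilon> h (M N w)) - heat (sqrt (1 + \<epsilon>\<^sup>2)) h 0\<bar> <=
		var_defect / \<epsilon> + 18 * area * (\<Sum>k<N. \<Sum>j<N. expectation (\<lambda>w. U k j w ^ 3) / (\<sigma> (Suc k))\<^sup>2)
		+ 3 / \<epsilon>\<^sup>2 * (T * R * b ^ 3 * sqrt (T * R) + 2) / sqrt (real N)"
proof -
	define V where "V k = expectation (\<lambda>w. heat (\<sigma> k) h (M k w))" for k
	define A where "A k = expectation (\<lambda>w. \<bar>area * (\<Sum>j<N. (U k j w)\<^sup>2) - 1 / real N\<bar>)" for k
	\<comment> \<open>The discretisation error of one row: the replacement error of
	  \<open>row_step\<close> and the Gaussian third-order term, both of order \<open>N\<close> to the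
	  power \<open>-3/2\<close>.\<close>
	define c where "c = 3 / \<epsilon>\<^sup>2 * (T * R * b ^ 3 * sqrt (T * R) + 2) / (real N * sqrt (real N))"
	have N0: "0 < real N" using N by simp
	have \<sigma>2: "(\<sigma> k)\<^sup>2 = \<epsilon>\<^sup>2 + 1 - real k / real N" "\<epsilon> <= \<sigma> k" if "k <= N" for k
	proof -
		have "real k / real N <= 1" using that N by simp
		then have 1: "\<epsilon>\<^sup>2 <= \<epsilon>\<^sup>2 + 1 - real k / real N" by simp
		then show "(\<sigma> k)\<^sup>2 = \<epsilon>\<^sup>2 + 1 - real k / real N" unfolding \<sigma>_def using order_trans[OF zero_le_power2 1] by simp
		show "\<epsilon> <= \<sigma> k" unfolding \<sigma>_def using 1 \<epsilon> by (intro real_le_rsqrt)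
	qed
	have row: "\<bar>V (Suc k) - V k\<bar> <= A k / \<epsilon> + 18 * area * (\<Sum>j<N. expectation (\<lambda>w. U k j w ^ 3) / (\<sigma> (Suc k))\<^sup>2) + c" if k: "k < N" for k
	proof -
		have kk: "Suc k <= N" "k <= N" using k by auto
		define s where "s = \<sigma> (Suc k)"
		have s: "\<epsilon> <= s" "0 < s" using \<sigma>2(2)[OF kk(1)] \<epsilon> by (auto simp: s_def)
		define L where "L = 3 / s\<^sup>2"
		have L: "0 <= L" "L <= 3 / \<epsilon>\<^sup>2" using s \<epsilon> by (auto simp: L_def intro!: divide_left_mono power_mono mult_pos_pos)
		define v where "v = heat s h"
		obtain v1 v2 where v: "v1 \<in> bm borel" "v2 \<in> bm borel"
			"!!x. \<bar>v1 x\<bar> <= 1" "!!x. \<bar>v2 x\<bar> <= 2 / s"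
			"!!x d. \<bar>v (x + d) - v x - v1 x * d - v2 x * d\<^sup>2 / 2\<bar> <= L * \<bar>d\<bar> ^ 3"
			"!!x d. \<bar>v2 (x + d) - v2 x\<bar> <= L * \<bar>d\<bar>"
			unfolding v_def L_def by (rule heat_smooth[OF h s(2)]) blast
		have vl: "1-lipschitz_on UNIV v" unfolding v_def using s by (intro heat_lipschitz(1)[OF h]) auto
		have mM: "M k \<in> bm P" using measurable_from_hist_on[OF M_meas[OF kk(2), of 0]] .
		note [measurable] = v(1,2) mM
		\<comment> \<open>The scale of the Gaussian increment that the row replaces: \<open>(\<sigma>
		  k)\<^sup>2 = \<tau>\<^sup>2 + (\<sigma> (Suc k))\<^sup>2\<close>.\<close>
		define \<tau> where "\<tau> = 1 / sqrt (real N)"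
		have \<tau>: "0 < \<tau>" "\<tau>\<^sup>2 = 1 / real N" using N by (auto simp: \<tau>_def power_divide)
		have sg: "heat (\<sigma> k) h x = heat \<tau> v x" for x
		proof -
			have "\<tau>\<^sup>2 + s\<^sup>2 = (\<sigma> k)\<^sup>2" using \<sigma>2(1)[OF kk(1)] \<sigma>2(1)[OF kk(2)] by (simp add: \<tau>(2) s_def add_divide_distrib)
			then have "sqrt (\<tau>\<^sup>2 + s\<^sup>2) = \<sigma> k" using \<sigma>2(2)[OF kk(2)] \<epsilon> by simp
			then show ?thesis using heat_semigroup[OF lin_growth_lipschitz[OF h] \<tau>(1) s(2), of x] by (simp add: v_def)
		qed
		\<comment> \<open>The same Taylor expansion with Gaussian in place of Poisson noise. The quadratic
		  terms then match up to the deviation of the row bracket from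
		  \<open>\<tau>\<^sup>2\<close>.\<close>
		have gs: "\<bar>heat \<tau> v x - v x - v2 x * \<tau>\<^sup>2 / 2\<bar> <= 2 * L * \<tau> ^ 3" for x
		proof -
			note iv = lin_growth_integrable(1)[OF lin_growth_lipschitz[OF vl] less_imp_le[OF \<tau>(1)], of x]
			have i1: "integrable gauss (\<lambda>z. v (x + \<tau> * z) - v x - v1 x * (\<tau> * z) - v2 x * (\<tau> * z)\<^sup>2 / 2)"
				using iv gauss_int_id gauss_int_pow[of 2] by (simp add: power_mult_distrib)
			have "heat \<tau> v x - v x - v2 x * \<tau>\<^sup>2 / 2 = (LINT z|gauss. v (x + \<tau> * z) - v x - v1 x * (\<tau> * z) - v2 x * (\<tau> * z)\<^sup>2 / 2)"
				unfolding heat_def using iv gauss_int_id gauss_int_pow[of 2] gauss_mean gauss_var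
				by (simp add: power_mult_distrib gauss.prob_space[simplified])
			then have "\<bar>heat \<tau> v x - v x - v2 x * \<tau>\<^sup>2 / 2\<bar> <= (LINT z|gauss. \<bar>v (x + \<tau> * z) - v x - v1 x * (\<tau> * z) - v2 x * (\<tau> * z)\<^sup>2 / 2\<bar>)"
				using integral_norm_bound[of gauss "\<lambda>z. v (x + \<tau> * z) - v x - v1 x * (\<tau> * z) - v2 x * (\<tau> * z)\<^sup>2 / 2"] by simp
			also have "... <= (LINT z|gauss. L * \<tau> ^ 3 * \<bar>z\<bar> ^ 3)"
			proof (rule integral_mono)
				show "integrable gauss (\<lambda>z. \<bar>v (x + \<tau> * z) - v x - v1 x * (\<tau> * z) - v2 x * (\<tau> * z)\<^sup>2 / 2\<bar>)" using i1 by simp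
				show "integrable gauss (\<lambda>z. L * \<tau> ^ 3 * \<bar>z\<bar> ^ 3)" using gauss_int_abs_pow by simp
				fix z
				show "\<bar>v (x + \<tau> * z) - v x - v1 x * (\<tau> * z) - v2 x * (\<tau> * z)\<^sup>2 / 2\<bar> <= L * \<tau> ^ 3 * \<bar>z\<bar> ^ 3"
					using v(5)[of x "\<tau> * z"] \<tau>(1) by (simp add: abs_mult power_mult_distrib mult.assoc)
			qed
			also have "... = L * \<tau> ^ 3 * (LINT z|gauss. \<bar>z\<bar> ^ 3)" by simp
			also have "... <= L * \<tau> ^ 3 * 2" using gauss_abs3 L(1) \<tau>(1) by (intro mult_left_mono) auto
			finally show ?thesis by simp
		qed
		define S where "S = area / 2 * (\<Sum>j<N. expectation (\<lambda>w. v2 (M k w) * (U k j w)\<^sup>2))"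
		have r: "\<bar>V (Suc k) - expectation (\<lambda>w. v (M k w)) - S\<bar>
			<= 6 * area * L * (\<Sum>j<N. expectation (\<lambda>w. U k j w ^ 3)) + T * R / real N * L * b ^ 3 * sqrt (T * R / real N)"
			unfolding V_def S_def using row_step[OF k vl v(1-6) L(1)] by (simp add: v_def s_def)
		have iv2: "integrable P (\<lambda>w. v2 (M k w))" using v(4) by (intro integrable_bounded) auto
		have iM: "integrable P (\<lambda>w. v (M k w))" "integrable P (\<lambda>w. heat \<tau> v (M k w))"
			using integrable_lipschitz[OF vl M_int[OF kk(2)]]
				integrable_lipschitz[OF heat_lipschitz(1)[OF vl less_imp_le[OF \<tau>(1)]] M_int[OF kk(2)]] by auto
		define G where "G = 1 / (2 * real N) * expectation (\<lambda>w. v2 (M k w))"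
		have g: "\<bar>V k - expectation (\<lambda>w. v (M k w)) - G\<bar> <= 2 * L * \<tau> ^ 3"
		proof -
			have eq: "V k - expectation (\<lambda>w. v (M k w)) - G = expectation (\<lambda>w. heat \<tau> v (M k w) - v (M k w) - v2 (M k w) * \<tau>\<^sup>2 / 2)"
				unfolding V_def sg G_def \<tau>(2) using iM iv2 by simp
			have "\<bar>V k - expectation (\<lambda>w. v (M k w)) - G\<bar> <= expectation (\<lambda>w. \<bar>heat \<tau> v (M k w) - v (M k w) - v2 (M k w) * \<tau>\<^sup>2 / 2\<bar>)"
				unfolding eq using integral_norm_bound[of P "\<lambda>w. heat \<tau> v (M k w) - v (M k w) - v2 (M k w) * \<tau>\<^sup>2 / 2"] by simp
			also have "... <= 2 * L * \<tau> ^ 3"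
				using gs iM iv2 by (intro integral_le_const) auto
			finally show ?thesis .
		qed
		\<comment> \<open>The common factor is half of \<open>v2\<close>, at most \<open>1 / s\<close> and
		  hence at most \<open>1 / \<epsilon>\<close>; what remains is the deviation of the
		  bracket.\<close>
		have SG: "\<bar>S - G\<bar> <= A k / \<epsilon>"
		proof -
			have mU: "U k j \<in> bm P" if "j < N" for j using measurable_from_hist_on[OF U_meas[OF k that, of 0]] .
			have U2: "\<bar>(U k j w)\<^sup>2\<bar> <= b\<^sup>2" for w j using U(2,3) by (simp add: power_mono)
			have i: "integrable P (\<lambda>w. v2 (M k w) * (U k j w)\<^sup>2)" if "j < N" for j
			proof (rule integrable_bounded[of _ "2 / s * b\<^sup>2"])
				show "(\<lambda>w. v2 (M k w) * (U k j w)\<^sup>2) \<in> bm P" using mU[OF that] by measurable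
				show "\<bar>v2 (M k w) * (U k j w)\<^sup>2\<bar> <= 2 / s * b\<^sup>2" for w
					unfolding abs_mult using v(4) U2 s by (intro mult_mono) auto
			qed
			let ?D = "\<lambda>w. area * (\<Sum>j<N. (U k j w)\<^sup>2) - 1 / real N"
			have iD: "integrable P (\<lambda>w. \<bar>?D w\<bar>)"
				by (intro integrable_abs Bochner_Integration.integrable_diff integrable_mult_right Bochner_Integration.integrable_sum U_int k) auto
			have "S - G = expectation (\<lambda>w. (\<Sum>j<N. area / 2 * (v2 (M k w) * (U k j w)\<^sup>2)) - 1 / (2 * real N) * v2 (M k w))"
			proof -
				have isum: "integrable P (\<lambda>w. \<Sum>j<N. area / 2 * (v2 (M k w) * (U k j w)\<^sup>2))"
					by (intro Bochner_Integration.integrable_sum integrable_mult_right i) auto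
				have "expectation (\<lambda>w. \<Sum>j<N. area / 2 * (v2 (M k w) * (U k j w)\<^sup>2)) =
						(\<Sum>j<N. expectation (\<lambda>w. area / 2 * (v2 (M k w) * (U k j w)\<^sup>2)))"
					by (intro Bochner_Integration.integral_sum integrable_mult_right i) auto
				also have "... = S" unfolding S_def sum_distrib_left by simp
				finally show ?thesis using isum iv2 by (subst Bochner_Integration.integral_diff) (auto simp: G_def)
			qed
			also have "... = expectation (\<lambda>w. v2 (M k w) / 2 * ?D w)"
				by (intro Bochner_Integration.integral_cong) (auto simp: sum_distrib_left right_diff_distrib mult_ac)
			finally have "\<bar>S - G\<bar> <= expectation (\<lambda>w. \<bar>v2 (M k w) / 2 * ?D w\<bar>)"
				by (simp only: integral_abs_bound)
			also have "... <= expectation (\<lambda>w. 1 / \<epsilon> * \<bar>?D w\<bar>)"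
			proof (rule integral_mono')
				show "integrable P (\<lambda>w. 1 / \<epsilon> * \<bar>?D w\<bar>)" using iD by simp
				fix w
				have "\<bar>v2 (M k w) / 2\<bar> <= 1 / s" using v(4)[of "M k w"] by simp
				also have "... <= 1 / \<epsilon>" using s \<epsilon> by (simp add: frac_le)
				finally show "\<bar>v2 (M k w) / 2 * ?D w\<bar> <= 1 / \<epsilon> * \<bar>?D w\<bar>" unfolding abs_mult by (rule mult_right_mono) simp
				show "0 <= 1 / \<epsilon> * \<bar>?D w\<bar>" using \<epsilon> by simp
			qed
			also have "... = A k / \<epsilon>" by (simp add: A_def)
			finally show ?thesis .
		qed
		have c: "T * R / real N * L * b ^ 3 * sqrt (T * R / real N) + 2 * L * \<tau> ^ 3 <= c"
		proof -
			have t3: "\<tau> ^ 3 = 1 / (real N * sqrt (real N))"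
				using N by (simp add: \<tau>_def power3_eq_cube)
			have "T * R / real N * L * b ^ 3 * sqrt (T * R / real N) + 2 * L * \<tau> ^ 3 =
					L * ((T * R * b ^ 3 * sqrt (T * R) + 2) / (real N * sqrt (real N)))"
				unfolding t3 using N by (simp add: real_sqrt_divide field_simps)
			also have "... <= 3 / \<epsilon>\<^sup>2 * ((T * R * b ^ 3 * sqrt (T * R) + 2) / (real N * sqrt (real N)))"
				using L T R b0 by (intro mult_right_mono divide_nonneg_nonneg add_nonneg_nonneg) auto
			finally show ?thesis by (simp add: c_def)
		qed
		have u3: "6 * area * L * (\<Sum>j<N. expectation (\<lambda>w. U k j w ^ 3)) = 18 * area * (\<Sum>j<N. expectation (\<lambda>w. U k j w ^ 3) / (\<sigma> (Suc k))\<^sup>2)"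
			by (simp add: L_def s_def sum_divide_distrib[symmetric])
		show ?thesis using r g SG c u3 by linarith
	qed
	have "V N - V 0 = (\<Sum>k<N. V (Suc k) - V k)" by (simp add: sum_lessThan_telescope)
	then have "\<bar>V N - V 0\<bar> <= (\<Sum>k<N. \<bar>V (Suc k) - V k\<bar>)" by (simp add: sum_abs)
	also have "... <= (\<Sum>k<N. A k / \<epsilon> + 18 * area * (\<Sum>j<N. expectation (\<lambda>w. U k j w ^ 3) / (\<sigma> (Suc k))\<^sup>2) + c)"
		by (intro sum_mono row) auto
	also have "... = var_defect / \<epsilon> + 18 * area * (\<Sum>k<N. \<Sum>j<N. expectation (\<lambda>w. U k j w ^ 3) / (\<sigma> (Suc k))\<^sup>2) + real N * c"
		by (simp add: sum.distrib sum_distrib_left sum_divide_distrib var_defect_def A_def)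
	also have "real N * c = 3 / \<epsilon>\<^sup>2 * (T * R * b ^ 3 * sqrt (T * R) + 2) / sqrt (real N)"
		using N by (simp add: c_def)
	finally have "\<bar>V N - V 0\<bar> <= var_defect / \<epsilon> + 18 * area * (\<Sum>k<N. \<Sum>j<N. expectation (\<lambda>w. U k j w ^ 3) / (\<sigma> (Suc k))\<^sup>2)
		+ 3 / \<epsilon>\<^sup>2 * (T * R * b ^ 3 * sqrt (T * R) + 2) / sqrt (real N)" .
	moreover have "V N = expectation (\<lambda>w. heat \<epsilon> h (M N w))"
		using N \<epsilon> by (simp add: V_def \<sigma>_def)
	moreover have "V 0 = heat (sqrt (1 + \<epsilon>\<^sup>2)) h 0"
		by (simp add: V_def \<sigma>_def M_def prob_space add.commute)
	ultimately show ?thesis by simp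
qed

end

section \<open>The central limit theorem for the Hawkes integral\<close>

lemma measurable_pt_cell:
	fixes f :: "_ => ennreal"
	assumes T: "0 < T" and w: "w \<in> configs" and f: "f \<in> bm (PB T)" and C: "C \<in> sets hp" "C \<subseteq> strip T"
		and M: "sets M = sets hp"
	shows "(\<lambda>z. f (pt w z) * indicator C z) \<in> bm M"
proof -
	have "(\<lambda>z. (f (pt w z) * indicator (strip T) z) * indicator C z) \<in> bm hp"
		using measurable_pt_strip[OF less_imp_le[OF T] w f] C(1) by measurable
	also have "(\<lambda>z. (f (pt w z) * indicator (strip T) z) * indicator C z) = (\<lambda>z. f (pt w z) * indicator C z)"
		using C(2) by (auto simp: fun_eq_iff indicator_def)
	finally show ?thesis using measurable_cong_sets[OF M refl] by blast
qed

lemma nn_integral_rect_cells: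
	fixes f :: "_ => ennreal"
	assumes T: "0 < T" and R: "0 < R" and N: "0 < N" and w: "w \<in> configs" and f: "f \<in> bm (PB T)"
		and M: "sets M = sets hp"
	shows "(ptint (rect T R) M f w) = (\<Sum>k<N. \<Sum>j<N. \<integral>\<^sup>+z\<in>cell T R N k j. f (pt w z) \<partial>M)"
proof -
	have cs: "cell T R N k j \<subseteq> strip T" if "k < N" "j < N" for k j
		using cell_rect[OF T R that] rect_strip by blast
	have ind: "(indicator (rect T R) z :: ennreal) = (\<Sum>k<N. \<Sum>j<N. indicator (cell T R N k j) z)" for z
	proof (cases "z \<in> rect T R")
		case True
		obtain k j where kj: "k < N" "j < N" "z \<in> cell T R N k j" using grid_cell_ex[OF T R N True] by blast
		have "indicator (cell T R N k' j') z = (if k' = k then (if j' = j then 1 else 0) else (0::ennreal))" for k' j'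
			using cell_disjoint[OF T R kj(1,2), of k' j'] kj(3) by (auto simp: indicator_def)
		then have "(\<Sum>k'<N. \<Sum>j'<N. (indicator (cell T R N k' j') z :: ennreal)) = (\<Sum>k'<N. \<Sum>j'<N. if k' = k then (if j' = j then 1 else 0) else 0)"
			by simp
		also have "... = (\<Sum>k'<N. if k' = k then (\<Sum>j'<N. if j' = j then 1 else 0) else 0)" by (intro sum.cong) auto
		also have "... = 1" using kj by (simp add: sum.delta)
		finally show ?thesis using True by simp
	next
		case False
		then have "z \<notin> cell T R N k j" if "k < N" "j < N" for k j using cell_rect[OF T R that] by blast
		then show ?thesis using False by (simp add: sum.neutral)
	qed
	have "(ptint (rect T R) M f w) = (\<integral>\<^sup>+z. (\<Sum>k<N. \<Sum>j<N. f (pt w z) * indicator (cell T R N k j) z) \<partial>M)"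
		unfolding ind sum_distrib_left ..
	also have "... = (\<Sum>k<N. \<integral>\<^sup>+z. (\<Sum>j<N. f (pt w z) * indicator (cell T R N k j) z) \<partial>M)"
		using measurable_pt_cell[OF T w f cell_sets[OF R] cs M] by (intro nn_integral_sum borel_measurable_sum) auto
	also have "... = (\<Sum>k<N. \<Sum>j<N. \<integral>\<^sup>+z\<in>cell T R N k j. f (pt w z) \<partial>M)"
		using measurable_pt_cell[OF T w f cell_sets[OF R] cs M] by (intro sum.cong nn_integral_sum) auto
	finally show ?thesis .
qed

definition comp :: "real => real => ((real \<times> config) \<times> real => real) => config => real" where
	"comp T R f w = enn2real (ptint (rect T R) w (\<lambda>x. ennreal (f x)) w) - enn2real (ptint (rect T R) hp (\<lambda>x. ennreal (f x)) w)"

lemma abs_enn2real_diff_le: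
	assumes "a <= b + c" "b <= a + c" "a < \<infinity>" "b < \<infinity>"
	shows "ennreal \<bar>enn2real a - enn2real b\<bar> <= c"
proof (cases c)
	case (real r)
	obtain x y where xy: "a = ennreal x" "0 <= x" "b = ennreal y" "0 <= y"
		using assms(3,4) by (metis ennreal_cases infinity_ennreal_def less_irrefl)
	show ?thesis using assms(1,2) real xy
		by (auto simp: ennreal_plus[symmetric] ennreal_le_iff abs_le_iff simp del: ennreal_plus)
qed simp

lemma comp_diff:
	assumes T: "0 < T" and w: "w \<in> configs"
		and f: "f \<in> bm (PB T)" "!!x. 0 <= f x" "!!x. f x <= b"
		and g: "g \<in> bm (PB T)" "!!x. 0 <= g x" "!!x. g x <= b" and R: "0 <= R"
	shows "ennreal \<bar>comp T R f w - comp T R g w\<bar> <=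
		(ptint (rect T R) w (\<lambda>x. ennreal \<bar>f x - g x\<bar>) w) + (ptint (rect T R) hp (\<lambda>x. ennreal \<bar>f x - g x\<bar>) w)"
proof -
	let ?I = "\<lambda>M f. \<integral>\<^sup>+z\<in>rect T R. ennreal (f (pt w z)) \<partial>M"
	let ?d = "\<lambda>x. \<bar>f x - g x\<bar>"
	have m: "(\<lambda>z. ennreal (q (pt w z)) * indicator (rect T R) z) \<in> bm M"
		if "q \<in> bm (PB T)" "sets M = sets hp" for q and M
		using measurable_pt_cell[OF T w measurable_compose[OF that(1) measurable_ennreal] rect_sets rect_strip that(2)] .
	have dm: "?d \<in> bm (PB T)" using f g by measurable
	have tri: "?I M f <= ?I M g + ?I M ?d" "?I M g <= ?I M f + ?I M ?d" if M: "sets M = sets hp" for M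
	proof -
		have "?I M p <= ?I M q + ?I M ?d" if "p \<in> bm (PB T)" "q \<in> bm (PB T)"
			"!!x. 0 <= p x" "!!x. 0 <= q x" "!!x. p x <= q x + ?d x" for p q
		proof -
			have "?I M p <= (\<integral>\<^sup>+z. ennreal (q (pt w z)) * indicator (rect T R) z + ennreal (?d (pt w z)) * indicator (rect T R) z \<partial>M)"
				using that(3-5) by (intro nn_integral_mono) (auto simp: indicator_def ennreal_plus[symmetric] simp del: ennreal_plus intro!: ennreal_leI)
			also have "... = ?I M q + ?I M ?d" using m[OF that(2) M] m[OF dm M] by (rule nn_integral_add)
			finally show ?thesis .
		qed
		from this[OF f(1) g(1) f(2) g(2)] this[OF g(1) f(1) g(2) f(2)]
		show "?I M f <= ?I M g + ?I M ?d" "?I M g <= ?I M f + ?I M ?d" by fastforce+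
	qed
	have fin: "?I M q < \<infinity>" if "!!x. q x <= b" "sets M = sets hp" "emeasure M (rect T R) < \<infinity>" for q M
	proof -
		have "?I M q <= (\<integral>\<^sup>+z. ennreal b * indicator (rect T R) z \<partial>M)"
			using that(1) by (intro nn_integral_mono mult_right_mono ennreal_leI) auto
		also have "... = ennreal b * emeasure M (rect T R)"
			using rect_sets that(2) by (intro nn_integral_cmult_indicator) auto
		also have "... < \<infinity>" using that(3) by (simp add: ennreal_mult_less_top)
		finally show ?thesis .
	qed
	have sw: "sets w = sets hp" by (rule configs_sets[OF w])
	have br: "bounded (rect T R)" by (rule bounded_subset[OF bounded_rect[of T R]]) (auto simp: rect_def)
	have e1: "emeasure w (rect T R) < \<infinity>" by (rule configs_bounded(1)[OF w br rect_sets])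
	have e2: "emeasure hp (rect T R) < \<infinity>" using emeasure_rect[of T R] T R by simp
	have "ennreal \<bar>enn2real (?I w f) - enn2real (?I w g)\<bar> <= ?I w ?d"
		using tri[OF sw] fin[OF f(3) sw e1] fin[OF g(3) sw e1] by (intro abs_enn2real_diff_le)
	moreover have "ennreal \<bar>enn2real (?I hp f) - enn2real (?I hp g)\<bar> <= ?I hp ?d"
		using tri[OF refl] fin[OF f(3) refl e2] fin[OF g(3) refl e2] by (intro abs_enn2real_diff_le)
	moreover have "\<bar>comp T R f w - comp T R g w\<bar> <= \<bar>enn2real (?I w f) - enn2real (?I w g)\<bar> + \<bar>enn2real (?I hp f) - enn2real (?I hp g)\<bar>"
		unfolding comp_def by linarith
	then have "ennreal \<bar>comp T R f w - comp T R g w\<bar> <= ennreal \<bar>enn2real (?I w f) - enn2real (?I w g)\<bar> + ennreal \<bar>enn2real (?I hp f) - enn2real (?I hp g)\<bar>"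
		by (simp add: ennreal_plus[symmetric] ennreal_leI del: ennreal_plus)
	ultimately show ?thesis by (meson add_mono order_trans)
qed

context prm begin

lemma comp_measurable:
	assumes T: "0 < T" and R: "0 <= R" and f: "f \<in> bm (PB T)"
	shows "comp T R f \<in> bm P"
	unfolding comp_def[abs_def]
	using nn_integral_QM(3,4)[OF T R measurable_compose[OF f measurable_ennreal]] by measurable

text \<open>One copy of the distance comes from the points and one from the compensator; by the
  Mecke formula they have the same mean.\<close>

lemma comp_diff_expectation:
	assumes T: "0 < T" and R: "0 <= R"
		and f: "f \<in> bm (PB T)" "!!x. 0 <= f x" "!!x. f x <= b"
		and g: "g \<in> bm (PB T)" "!!x. 0 <= g x" "!!x. g x <= b"
	shows "(\<integral>\<^sup>+w. ennreal \<bar>comp T R f w - comp T R g w\<bar> \<partial>P) <= 2 * (distQ T R f g)"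
proof -
	let ?d = "\<lambda>x. ennreal \<bar>f x - g x\<bar>"
	have dm: "?d \<in> bm (PB T)" using f(1) g(1) by measurable
	note q = nn_integral_QM[OF T R dm]
	have "(\<integral>\<^sup>+w. ennreal \<bar>comp T R f w - comp T R g w\<bar> \<partial>P) <=
			(\<integral>\<^sup>+w. (ptint (rect T R) w ?d w) + (ptint (rect T R) hp ?d w) \<partial>P)"
		using comp_diff[OF T _ f g R] by (intro nn_integral_mono) (simp add: space_P)
	also have "... = (\<integral>\<^sup>+w. (ptint (rect T R) w ?d w) \<partial>P) + (\<integral>\<^sup>+w. (ptint (rect T R) hp ?d w) \<partial>P)"
		using q(3,4) by (intro nn_integral_add) auto
	also have "... = 2 * (\<integral>\<^sup>+x. ?d x \<partial>QM T R)" using q(1,2) by (simp add: mult_2)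
	finally show ?thesis .
qed

lemma lipschitz_expectation_diff:
	assumes v: "1-lipschitz_on UNIV v" and i: "integrable P A" "integrable P B"
		and d: "(\<integral>\<^sup>+w. ennreal \<bar>A w - B w\<bar> \<partial>P) <= ennreal c" "0 <= c"
	shows "\<bar>expectation (\<lambda>w. v (A w)) - expectation (\<lambda>w. v (B w))\<bar> <= c"
proof -
	note iv = integrable_lipschitz[OF v i(1)] integrable_lipschitz[OF v i(2)]
	have "\<bar>expectation (\<lambda>w. v (A w)) - expectation (\<lambda>w. v (B w))\<bar> = \<bar>expectation (\<lambda>w. v (A w) - v (B w))\<bar>"
		using iv by simp
	also have "... <= expectation (\<lambda>w. \<bar>v (A w) - v (B w)\<bar>)" by (rule integral_abs_bound)
	also have "... <= expectation (\<lambda>w. \<bar>A w - B w\<bar>)"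
		using iv i lipschitz_onD[OF v] by (intro integral_mono) (auto simp: dist_real_def)
	also have "ennreal (expectation (\<lambda>w. \<bar>A w - B w\<bar>)) = (\<integral>\<^sup>+w. ennreal \<bar>A w - B w\<bar> \<partial>P)"
		using i by (intro nn_integral_eq_integral[symmetric]) auto
	then have "expectation (\<lambda>w. \<bar>A w - B w\<bar>) <= c" using d by (metis ennreal_le_iff)
	finally show ?thesis .
qed

end

context step_process begin

lemma nn_integral_step:
	assumes w: "w \<in> configs" and \<Lambda>: "sets \<Lambda> = sets hp"
	shows "(ptint (rect T R) \<Lambda> (\<lambda>x. ennreal (step_fun T R N U x ^ n)) w) = (\<Sum>k<N. \<Sum>j<N. ennreal (U k j w ^ n) * emeasure \<Lambda> (cell T R N k j))"
proof -
	have m: "(\<lambda>x. ennreal (step_fun T R N U x ^ n)) \<in> bm (PB T)"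
		using step_fun_measurable[OF T U(1)] by measurable
	have "(ptint (rect T R) \<Lambda> (\<lambda>x. ennreal (step_fun T R N U x ^ n)) w) =
			(\<Sum>k<N. \<Sum>j<N. \<integral>\<^sup>+z\<in>cell T R N k j. ennreal (step_fun T R N U (pt w z) ^ n) \<partial>\<Lambda>)"
		by (rule nn_integral_rect_cells[OF T R N w m \<Lambda>])
	also have "... = (\<Sum>k<N. \<Sum>j<N. \<integral>\<^sup>+z. ennreal (U k j w ^ n) * indicator (cell T R N k j) z \<partial>\<Lambda>)"
		by (intro sum.cong nn_integral_cong) (auto simp: step_fun_cell[OF T R] indicator_def)
	also have "... = (\<Sum>k<N. \<Sum>j<N. ennreal (U k j w ^ n) * emeasure \<Lambda> (cell T R N k j))"
		using cell_sets[OF R] \<Lambda> by (intro sum.cong nn_integral_cmult_indicator) auto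
	finally show ?thesis .
qed

lemma step_fun_nonneg: "0 <= step_fun T R N U x"
	unfolding step_fun_def using U(2) by (intro sum_nonneg mult_nonneg_nonneg) auto

lemma step_fun_le: "step_fun T R N U x <= b"
proof -
	have x: "x = pt (snd (fst x)) (fst (fst x), snd x)" by (simp add: pt_def)
	show ?thesis
	proof (cases "(fst (fst x), snd x) \<in> rect T R")
		case True
		then obtain k j where kj: "k < N" "j < N" "(fst (fst x), snd x) \<in> cell T R N k j" using grid_cell_ex[OF T R N] by blast
		show ?thesis by (subst x, subst step_fun_cell[OF T R kj]) (rule U(3))
	next
		case False
		then have "(fst (fst x), snd x) \<notin> cell T R N k j" if "k < N" "j < N" for k j using cell_rect[OF T R that] by blast
		then show ?thesis unfolding step_fun_def using b0 by (simp add: sum.neutral)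
	qed
qed

lemma comp_step: "w \<in> configs ==> comp T R (step_fun T R N U) w = M N w"
proof -
	assume w: "w \<in> configs"
	have fin: "emeasure w (cell T R N k j) = ennreal (measure w (cell T R N k j))" if "k < N" "j < N" for k j
	proof -
		have "bounded (cell T R N k j)"
			by (rule bounded_subset[OF bounded_rect[of T R]]) (use cell_rect[OF T R that] in \<open>auto simp: rect_def\<close>)
		from configs_bounded(1)[OF w this cell_sets[OF R]] show ?thesis by (simp add: emeasure_eq_ennreal_measure less_top)
	qed
	have "(ptint (rect T R) w (\<lambda>x. ennreal (step_fun T R N U x)) w) = (\<Sum>k<N. \<Sum>j<N. ennreal (U k j w) * ennreal (measure w (cell T R N k j)))"
		using nn_integral_step[OF w configs_sets[OF w], of 1] fin by simp
	also have "... = ennreal (\<Sum>k<N. \<Sum>j<N. U k j w * measure w (cell T R N k j))"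
		using U(2) by (simp add: ennreal_mult'[symmetric] sum_ennreal sum_nonneg)
	finally have 1: "enn2real (ptint (rect T R) w (\<lambda>x. ennreal (step_fun T R N U x)) w) = (\<Sum>k<N. \<Sum>j<N. U k j w * measure w (cell T R N k j))"
		using U(2) by (simp add: sum_nonneg)
	have "(ptint (rect T R) hp (\<lambda>x. ennreal (step_fun T R N U x)) w) = (\<Sum>k<N. \<Sum>j<N. ennreal (U k j w) * ennreal area)"
		using nn_integral_step[OF w refl, of 1] area(3) by simp
	also have "... = ennreal (\<Sum>k<N. \<Sum>j<N. U k j w * area)"
		using U(2) area(1) by (simp add: ennreal_mult'[symmetric] sum_ennreal sum_nonneg)
	finally have 2: "enn2real (ptint (rect T R) hp (\<lambda>x. ennreal (step_fun T R N U x)) w) = (\<Sum>k<N. \<Sum>j<N. U k j w * area)"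
		using U(2) area(1) by (simp add: sum_nonneg)
	show ?thesis unfolding comp_def 1 2 M_def rowpart_def X_def
		by (simp only: right_diff_distrib sum_subtractf)
qed

end

context prm begin

lemma comp_integrable:
	assumes T: "0 < T" and R: "0 <= R" and q: "q \<in> bm (PB T)" "!!x. 0 <= q x" "!!x. q x <= b"
	shows "integrable P (comp T R q)"
proof (rule integrableI_bounded)
	show "comp T R q \<in> bm P" by (rule comp_measurable[OF T R q(1)])
	have z: "comp T R (\<lambda>_. 0) w = 0" for w by (simp add: comp_def)
	have b0: "0 <= b" using q(2,3) order_trans by blast
	have "(\<integral>\<^sup>+w. ennreal (norm (comp T R q w)) \<partial>P) <= 2 * (distQ T R q (\<lambda>x. 0))"
		using comp_diff_expectation[OF T R q, of "\<lambda>_. 0"] b0 unfolding z by simp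
	also have "... <= 2 * (\<integral>\<^sup>+x. ennreal b \<partial>QM T R)"
		using q by (intro mult_left_mono nn_integral_mono) (auto intro!: ennreal_leI)
	also have "... < \<infinity>"
		using finite_measure.emeasure_finite[OF finite_QM[OF T R]] by (simp add: ennreal_mult_eq_top_iff less_top[symmetric])
	finally show "(\<integral>\<^sup>+w. ennreal (norm (comp T R q w)) \<partial>P) < \<infinity>" .
qed

text \<open>The integrand is replaced by a step function at \<open>QM\<close> distance
  \<open>\<delta>\<close> on a grid so fine that the discretisation error is at most
  \<open>\<delta>\<close>, and then \<open>\<delta>\<close> tends to 0. By \<open>row\<close> no
  slab exceeds its share of the bracket, and by \<open>total\<close> at most \<open>\<rho>\<close>
  is missing in the mean. A one-sided bound and a total thus control the absolute deviations in
  \<open>var_defect\<close>.\<close>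

lemma lindeberg_predictable:
	assumes T: "0 < T" and R: "0 < R" and f: "f \<in> bm (PB T)" "!!x. 0 <= f x" "!!x. f x <= b"
		and h: "1-lipschitz_on UNIV h" and \<epsilon>: "0 < \<epsilon>" and \<rho>: "0 <= \<rho>" and W: "0 <= W"
		and row: "AE w in P. \<forall>s t. 0 <= s & s <= t & t <= T -->
			(ptint ({s<..t} \<times> {0<..R}) hp (\<lambda>x. ennreal ((f x)\<^sup>2)) w) <= ennreal ((t - s) / T)"
		and total: "1 <= (\<integral>\<^sup>+x. ennreal ((f x)\<^sup>2) \<partial>QM T R) + ennreal \<rho>"
		and third: "(\<integral>\<^sup>+x. ennreal ((f x) ^ 3 / (\<epsilon>\<^sup>2 + 1 - fst (fst x) / T)) \<partial>QM T R) <= ennreal W"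
	shows "\<bar>expectation (\<lambda>w. heat \<epsilon> h (comp T R f w)) - heat (sqrt (1 + \<epsilon>\<^sup>2)) h 0\<bar> <= \<rho> / \<epsilon> + 36 * W"
proof -
	have b0: "0 <= b" using f(2,3) order_trans by blast
	have T0: "0 <= T" and R0: "0 <= R" using T R by auto
	have hl: "1-lipschitz_on UNIV (heat \<epsilon> h)" using heat_lipschitz(1)[OF h] \<epsilon> by simp
	\<comment> \<open>Collects the coefficients of \<open>\<delta>\<close>:
	  \<open>2 * b / \<epsilon>\<close> from the bracket,
	  \<open>108 * b\<^sup>2 / \<epsilon>\<^sup>2\<close> from the third-order term, 1 from the grid
	  and 2 from replacing the integrand.\<close>
	define C where "C = 2 * b / \<epsilon> + 108 * b\<^sup>2 / \<epsilon>\<^sup>2 + 3"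
	have C: "0 <= C" using b0 \<epsilon> by (simp add: C_def)
	note icomp = comp_integrable[OF T R0]
	have key: "\<bar>expectation (\<lambda>w. heat \<epsilon> h (comp T R f w)) - heat (sqrt (1 + \<epsilon>\<^sup>2)) h 0\<bar> <= \<rho> / \<epsilon> + 36 * W + C * \<delta>"
		if \<delta>: "0 < \<delta>" for \<delta>
	proof -
		obtain N0 where N0: "\<forall>N\<ge>N0. \<exists>U. adapted T N U & (\<forall>k j w. 0 <= U k j w & U k j w <= b) &
			 (distQ T R f (step_fun T R N U)) < ennreal \<delta>"
			using step_approx[OF T R f \<delta>] by blast
		define c where "c = 3 / \<epsilon>\<^sup>2 * (T * R * b ^ 3 * sqrt (T * R) + 2)"
		have c0: "0 <= c" using T R b0 by (simp add: c_def)
		\<comment> \<open>In turn: \<open>T * R\<close> makes the cell area at most one,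
		  \<open>1 / \<epsilon>\<^sup>2\<close> makes the smoothing weight comparable across a slab, and
		  \<open>(c / \<delta>)\<^sup>2\<close> bounds the discretisation error by
		  \<open>\<delta>\<close>.\<close>
		obtain N1 :: nat where N1: "real N1 > max (max 1 (T * R)) (max (1 / \<epsilon>\<^sup>2) ((c / \<delta>)\<^sup>2))" using reals_Archimedean2 by blast
		define N where "N = max N0 N1"
		have Nbig: "1 < real N" "T * R <= real N" "1 / \<epsilon>\<^sup>2 <= real N" "(c / \<delta>)\<^sup>2 <= real N"
			using N1 by (auto simp: N_def)
		have Npos: "0 < N" using Nbig(1) by simp
		have small: "T * R / (real N)\<^sup>2 <= 1"
		proof -
			have "T * R <= real N * 1" using Nbig(2) by simp
			also have "... <= (real N)\<^sup>2" unfolding power2_eq_square using Nbig(1) by (intro mult_left_mono) auto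
			finally show ?thesis using Nbig(1) by simp
		qed
		obtain U where U: "adapted T N U" "!!k j w. 0 <= U k j w" "!!k j w. U k j w <= b"
			"(distQ T R f (step_fun T R N U)) < ennreal \<delta>"
			using N0[rule_format, of N] by (auto simp: N_def)
		interpret sp: step_process P T R b N U
			using T R Npos small U(1-3) by unfold_locales auto
		let ?g = "step_fun T R N U"
		define d where "d x = \<bar>f x - ?g x\<bar>" for x
		have gm: "?g \<in> bm (PB T)" by (rule step_fun_measurable[OF T U(1)])
		have dm: "d \<in> bm (PB T)" unfolding d_def[abs_def] using f(1) gm by measurable
		have d0: "0 <= d x" for x by (simp add: d_def)
		have dQ: "(\<integral>\<^sup>+x. ennreal (d x) \<partial>QM T R) <= ennreal \<delta>" using U(4) by (simp add: d_def)
		have sq: "\<bar>(f x)\<^sup>2 - (?g x)\<^sup>2\<bar> <= 2 * b * d x" for x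
		proof -
			have "(f x)\<^sup>2 - (?g x)\<^sup>2 = (f x + ?g x) * (f x - ?g x)" by (simp add: power2_eq_square algebra_simps)
			then have "\<bar>(f x)\<^sup>2 - (?g x)\<^sup>2\<bar> = (f x + ?g x) * d x"
				using f(2)[of x] sp.step_fun_nonneg[of x] by (simp add: abs_mult d_def)
			also have "... <= 2 * b * d x" using f(3)[of x] sp.step_fun_le[of x] d0 by (intro mult_right_mono) auto
			finally show ?thesis .
		qed
		have cube: "(?g x) ^ 3 <= (f x) ^ 3 + 3 * b\<^sup>2 * d x" for x
		proof -
			have "(?g x) ^ 3 - (f x) ^ 3 = ((?g x)\<^sup>2 + ?g x * f x + (f x)\<^sup>2) * (?g x - f x)"
				by (simp add: power3_eq_cube power2_eq_square algebra_simps)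
			also have "... <= ((?g x)\<^sup>2 + ?g x * f x + (f x)\<^sup>2) * d x"
				using f(2)[of x] sp.step_fun_nonneg[of x] by (intro mult_left_mono) (auto simp: d_def)
			also have "... <= (3 * b\<^sup>2) * d x"
			proof (rule mult_right_mono)
				have "(?g x)\<^sup>2 <= b\<^sup>2" "(f x)\<^sup>2 <= b\<^sup>2" "?g x * f x <= b * b"
					using f(2,3)[of x] sp.step_fun_nonneg[of x] sp.step_fun_le[of x] b0 by (auto intro!: power_mono mult_mono)
				then show "(?g x)\<^sup>2 + ?g x * f x + (f x)\<^sup>2 <= 3 * b\<^sup>2" by (simp add: power2_eq_square)
			qed (rule d0)
			finally show ?thesis by simp
		qed
		have vd: "sp.var_defect <= \<rho> + 2 * b * \<delta>"
		proof -
			define y where "y k w = sp.area * (\<Sum>j<N. (U k j w)\<^sup>2)" for k w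
			define S where "S w = (\<Sum>k<N. \<bar>y k w - 1 / real N\<bar>)" for w
			have iS1: "integrable P (\<lambda>w. \<bar>y k w - 1 / real N\<bar>)" if "k < N" for k
				unfolding y_def
				by (intro integrable_abs Bochner_Integration.integrable_diff integrable_mult_right Bochner_Integration.integrable_sum sp.U_int that) auto
			have iS: "integrable P S" unfolding S_def[abs_def] using iS1 by (intro Bochner_Integration.integrable_sum) auto
			have vS: "sp.var_defect = expectation S"
				unfolding sp.var_defect_def S_def using iS1 by (subst Bochner_Integration.integral_sum) (auto simp: y_def)
			let ?row = "\<lambda>k. {T * real k / real N<..T * real (Suc k) / real N} \<times> {0<..R}"
			have AEb: "AE w in P. ennreal (S w) + (ptint (rect T R) hp (\<lambda>x. ennreal ((f x)\<^sup>2)) w) <=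
					ennreal (2 * b) * (ptint (rect T R) hp (\<lambda>x. ennreal (d x)) w) + 1"
				using row AE_space
			proof eventually_elim
				case (elim w)
				then have w: "w \<in> configs" by (simp add: space_P)
				let ?c = "\<lambda>q k. \<Sum>j<N. \<integral>\<^sup>+z\<in>cell T R N k j. ennreal (q (pt w z)) \<partial>hp"
				have mc: "(\<lambda>z. ennreal (q (pt w z)) * indicator (cell T R N k j) z) \<in> bm hp"
					if "q \<in> bm (PB T)" "k < N" "j < N" for q k j
					using cell_rect[OF T R that(2,3)] rect_strip[of T R]
					by (intro measurable_pt_cell[OF T w measurable_compose[OF that(1) measurable_ennreal] cell_sets[OF R]]) auto
				have f2m: "(\<lambda>x. (f x)\<^sup>2) \<in> bm (PB T)" and g2m: "(\<lambda>x. (?g x)\<^sup>2) \<in> bm (PB T)"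
					using f(1) gm by measurable
				have cy: "?c (\<lambda>x. (?g x)\<^sup>2) k = ennreal (y k w)" if "k < N" for k
				proof -
					have "?c (\<lambda>x. (?g x)\<^sup>2) k = (\<Sum>j<N. \<integral>\<^sup>+z. ennreal ((U k j w)\<^sup>2) * indicator (cell T R N k j) z \<partial>hp)"
						using that by (intro sum.cong nn_integral_cong) (auto simp: step_fun_cell[OF T R] indicator_def)
					also have "... = (\<Sum>j<N. ennreal ((U k j w)\<^sup>2) * ennreal sp.area)"
						using cell_sets[OF R] sp.area(3) by (intro sum.cong) (auto simp: nn_integral_cmult_indicator)
					also have "... = ennreal (y k w)"
						using sp.area(1) by (simp add: y_def ennreal_mult'[symmetric] sum_ennreal sum_distrib_left mult.commute)
					finally show ?thesis .
				qed
				have comb: "?c p k <= ?c q k + ennreal (2 * b) * ?c d k"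
					if k: "k < N" and pq: "q \<in> bm (PB T)" "!!x. 0 <= q x" "!!x. p x <= q x + 2 * b * d x" for p q k
				proof -
					have "?c p k <= (\<Sum>j<N. (\<integral>\<^sup>+z. ennreal (q (pt w z)) * indicator (cell T R N k j) z + ennreal (2 * b) * (ennreal (d (pt w z)) * indicator (cell T R N k j) z) \<partial>hp))"
					proof (intro sum_mono nn_integral_mono)
						fix j z
						have "ennreal (p (pt w z)) <= ennreal (q (pt w z) + 2 * b * d (pt w z))" using pq(3) by (intro ennreal_leI)
						then show "ennreal (p (pt w z)) * indicator (cell T R N k j) z <=
							ennreal (q (pt w z)) * indicator (cell T R N k j) z + ennreal (2 * b) * (ennreal (d (pt w z)) * indicator (cell T R N k j) z)"
							using pq(2) d0 b0 by (auto simp: indicator_def ennreal_plus ennreal_mult)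
					qed
					also have "... = ?c q k + ennreal (2 * b) * ?c d k"
						using mc[OF pq(1) k] mc[OF dm k] by (simp add: nn_integral_add nn_integral_cmult sum.distrib sum_distrib_left)
					finally show ?thesis .
				qed
				have frow: "?c (\<lambda>x. (f x)\<^sup>2) k <= ennreal (1 / real N)" if "k < N" for k
				proof -
					have "?c (\<lambda>x. (f x)\<^sup>2) k = (\<integral>\<^sup>+z. (\<Sum>j<N. ennreal ((f (pt w z))\<^sup>2) * indicator (cell T R N k j) z) \<partial>hp)"
						using mc[OF f2m that] by (intro nn_integral_sum[symmetric]) auto
					also have "... <= (ptint (?row k) hp (\<lambda>x. ennreal ((f x)\<^sup>2)) w)"
					proof (rule nn_integral_mono)
						fix z
						have "(\<Sum>j<N. indicator (cell T R N k j) z) <= (indicator (?row k) z :: ennreal)"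
						proof (cases "\<exists>j<N. z \<in> cell T R N k j")
							case True
							then obtain j where j: "j < N" "z \<in> cell T R N k j" by blast
							have nz: "z \<notin> cell T R N k i" if "i ~= j" for i
								using cell_disjoint[OF T R \<open>k < N\<close> j(1), of k i] j(2) that by blast
							have "(\<Sum>i<N. indicator (cell T R N k i) z) = (\<Sum>i<N. if i = j then 1 else (0::ennreal))"
								using nz j(2) by (intro sum.cong) (auto simp: indicator_def)
							also have "... = 1" using j by (simp add: sum.delta)
							also have "1 = (indicator (?row k) z :: ennreal)"
								using j cell_rect[OF T R that j(1)] by (auto simp: cell_def rect_def indicator_def)
							finally show ?thesis by simp
						qed (simp add: sum.neutral)
						then have "ennreal ((f (pt w z))\<^sup>2) * (\<Sum>j<N. indicator (cell T R N k j) z) <= ennreal ((f (pt w z))\<^sup>2) * indicator (?row k) z"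
							by (rule mult_left_mono) simp
						then show "(\<Sum>j<N. ennreal ((f (pt w z))\<^sup>2) * indicator (cell T R N k j) z) <= ennreal ((f (pt w z))\<^sup>2) * indicator (?row k) z"
							by (simp only: sum_distrib_left)
					qed
					also have "... <= ennreal ((T * real (Suc k) / real N - T * real k / real N) / T)"
					proof -
						have "T * real (Suc k) <= T * real N" using that T by (intro mult_left_mono) auto
						then have "T * real (Suc k) / real N <= T" using Npos by (simp add: divide_le_eq)
						moreover have "T * real k / real N <= T * real (Suc k) / real N"
							using T by (intro divide_right_mono mult_left_mono) auto
						moreover have "0 <= T * real k / real N" using T by simp
						ultimately show ?thesis using elim(1) by blast
					qed
					also have "(T * real (Suc k) / real N - T * real k / real N) / T = 1 / real N"
						using T Npos by (simp add: field_simps)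
					finally show ?thesis .
				qed
				\<comment> \<open>The bracket of \<open>f\<close> over the slab is at most
				  \<open>1 / real N\<close>, so its own deviation is the plain difference. Adding the bracket on
				  the left avoids a subtraction in \<open>ennreal\<close>.\<close>
				have one: "ennreal \<bar>y k w - 1 / real N\<bar> + ?c (\<lambda>x. (f x)\<^sup>2) k <= ennreal (2 * b) * ?c d k + ennreal (1 / real N)" if k: "k < N" for k
				proof -
					have y0: "0 <= y k w" using sp.area(1) by (simp add: y_def sum_nonneg)
					have a1: "ennreal (y k w) <= ?c (\<lambda>x. (f x)\<^sup>2) k + ennreal (2 * b) * ?c d k"
						unfolding cy[OF k, symmetric]
					proof (rule comb[OF k f2m])
						show "(?g x)\<^sup>2 <= (f x)\<^sup>2 + 2 * b * d x" for x using sq[of x] by (simp add: abs_le_iff)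
					qed simp
					have a2: "?c (\<lambda>x. (f x)\<^sup>2) k <= ennreal (y k w) + ennreal (2 * b) * ?c d k"
						unfolding cy[OF k, symmetric]
					proof (rule comb[OF k g2m])
						show "(f x)\<^sup>2 <= (?g x)\<^sup>2 + 2 * b * d x" for x using sq[of x] by (simp add: abs_le_iff)
					qed simp
					obtain x where x: "?c (\<lambda>x. (f x)\<^sup>2) k = ennreal x" "0 <= x" "x <= 1 / real N"
						using frow[OF k] by (cases "?c (\<lambda>x. (f x)\<^sup>2) k") (auto simp: top_unique)
					show ?thesis
					proof (cases "ennreal (2 * b) * ?c d k")
						case (real e)
						have "y k w <= x + e" "x <= y k w + e" using a1 a2 y0 x(2) real
							by (auto simp: x(1) ennreal_plus[symmetric] simp del: ennreal_plus)
						then have "\<bar>y k w - 1 / real N\<bar> + x <= e + 1 / real N" using x(3) by linarith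
						then show ?thesis using real x(2)
							by (simp add: x(1) ennreal_plus[symmetric] ennreal_leI del: ennreal_plus)
					qed simp
				qed
				have R1: "(ptint (rect T R) hp (\<lambda>x. ennreal (q x)) w) = (\<Sum>k<N. ?c q k)" if "q \<in> bm (PB T)" for q
					by (rule nn_integral_rect_cells[OF T R Npos w measurable_compose[OF that measurable_ennreal] refl])
				have "ennreal (S w) + (\<Sum>k<N. ?c (\<lambda>x. (f x)\<^sup>2) k) = (\<Sum>k<N. ennreal \<bar>y k w - 1 / real N\<bar> + ?c (\<lambda>x. (f x)\<^sup>2) k)"
					unfolding sum.distrib S_def by (simp add: sum_ennreal)
				also have "... <= (\<Sum>k<N. ennreal (2 * b) * ?c d k + ennreal (1 / real N))" using one by (intro sum_mono) auto
				also have "... = ennreal (2 * b) * (\<Sum>k<N. ?c d k) + (\<Sum>k<N. ennreal (1 / real N))"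
					by (simp only: sum.distrib sum_distrib_left)
				also have "(\<Sum>k<N. ennreal (1 / real N)) = ennreal (\<Sum>k<N. 1 / real N)" by (rule sum_ennreal) simp
				also have "(\<Sum>k<N. 1 / real N) = 1" using Npos by simp
				finally show ?case unfolding R1[OF f2m] R1[OF dm] by simp
			qed
			have S0: "0 <= S w" for w by (simp add: S_def sum_nonneg)
			have Sm: "S \<in> bm P" using iS by simp
			have f2q: "(\<lambda>x. ennreal ((f x)\<^sup>2)) \<in> bm (PB T)" and dq: "(\<lambda>x. ennreal (d x)) \<in> bm (PB T)"
				using f(1) dm by measurable
			note q1 = nn_integral_QM[OF T R0 f2q] and q2 = nn_integral_QM[OF T R0 dq]
			have "ennreal sp.var_defect + (\<integral>\<^sup>+x. ennreal ((f x)\<^sup>2) \<partial>QM T R) =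
					(\<integral>\<^sup>+w. ennreal (S w) + (ptint (rect T R) hp (\<lambda>x. ennreal ((f x)\<^sup>2)) w) \<partial>P)"
				using q1 Sm iS S0 by (subst nn_integral_add) (auto simp: vS nn_integral_eq_integral)
			also have "... <= (\<integral>\<^sup>+w. ennreal (2 * b) * (ptint (rect T R) hp (\<lambda>x. ennreal (d x)) w) + 1 \<partial>P)"
				by (rule nn_integral_mono_AE[OF AEb])
			also have "... = ennreal (2 * b) * (\<integral>\<^sup>+x. ennreal (d x) \<partial>QM T R) + 1"
				using q2 by (subst nn_integral_add) (auto simp: nn_integral_cmult emeasure_space_1)
			also have "... <= ennreal (2 * b) * ennreal \<delta> + ((\<integral>\<^sup>+x. ennreal ((f x)\<^sup>2) \<partial>QM T R) + ennreal \<rho>)"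
				using dQ total by (intro add_mono mult_left_mono) auto
			finally have e: "ennreal sp.var_defect + (\<integral>\<^sup>+x. ennreal ((f x)\<^sup>2) \<partial>QM T R) <=
					(\<integral>\<^sup>+x. ennreal ((f x)\<^sup>2) \<partial>QM T R) + (ennreal (2 * b) * ennreal \<delta> + ennreal \<rho>)" by (simp add: ac_simps)
			have fin: "(\<integral>\<^sup>+x. ennreal ((f x)\<^sup>2) \<partial>QM T R) ~= \<infinity>"
			proof -
				have "(\<integral>\<^sup>+x. ennreal ((f x)\<^sup>2) \<partial>QM T R) <= (\<integral>\<^sup>+x. ennreal (b\<^sup>2) \<partial>QM T R)"
					using f by (intro nn_integral_mono ennreal_leI power_mono)
				also have "... < \<infinity>"
					using finite_measure.emeasure_finite[OF finite_QM[OF T R0]] by (simp add: ennreal_mult_eq_top_iff less_top[symmetric])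
				finally show ?thesis by simp
			qed
			have "ennreal sp.var_defect <= ennreal (2 * b) * ennreal \<delta> + ennreal \<rho>"
				using e fin unfolding add.commute[of "ennreal sp.var_defect"] by (simp add: ennreal_add_left_cancel_le)
			also have "... = ennreal (\<rho> + 2 * b * \<delta>)" using b0 \<delta> \<rho> by (simp add: ennreal_mult'[symmetric] ennreal_plus[symmetric] add.commute del: ennreal_plus)
			finally show ?thesis using b0 \<delta> \<rho> by (subst (asm) ennreal_le_iff) auto
		qed
		define \<sigma> where "\<sigma> = (\<lambda>k. sqrt (\<epsilon>\<^sup>2 + 1 - real k / real N))"
		have th: "18 * sp.area * (\<Sum>k<N. \<Sum>j<N. expectation (\<lambda>w. U k j w ^ 3) / (\<sigma> (Suc k))\<^sup>2) <= 36 * W + 108 * b\<^sup>2 / \<epsilon>\<^sup>2 * \<delta>"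
		proof -
			define wt where "wt x = 1 / (\<epsilon>\<^sup>2 + 1 - fst (fst x) / T)" for x :: "(real \<times> config) \<times> real"
			have wm: "wt \<in> bm (PB T)" unfolding wt_def[abs_def] using measurable_pb_time[OF T] by measurable
			have wt: "0 <= wt x" "wt x <= 1 / \<epsilon>\<^sup>2" if "fst (fst x) <= T" for x
			proof -
				have "fst (fst x) / T <= 1" using that T by simp
				then have "\<epsilon>\<^sup>2 <= \<epsilon>\<^sup>2 + 1 - fst (fst x) / T" by simp
				moreover have "0 < \<epsilon>\<^sup>2" using \<epsilon> by simp
				ultimately have den: "0 < \<epsilon>\<^sup>2 + 1 - fst (fst x) / T" "\<epsilon>\<^sup>2 <= \<epsilon>\<^sup>2 + 1 - fst (fst x) / T" by linarith+
				show "0 <= wt x" unfolding wt_def using den(1) by simp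
				show "wt x <= 1 / \<epsilon>\<^sup>2" unfolding wt_def using den \<open>0 < \<epsilon>\<^sup>2\<close> by (intro frac_le) auto
			qed
			define G where "G x = wt x * (?g x) ^ 3" for x
			have Gm: "(\<lambda>x. ennreal (G x)) \<in> bm (PB T)" unfolding G_def[abs_def] using wm gm by measurable
			have s2: "(\<sigma> (Suc k))\<^sup>2 = \<epsilon>\<^sup>2 + 1 - real (Suc k) / real N" "\<epsilon>\<^sup>2 <= (\<sigma> (Suc k))\<^sup>2" if "k < N" for k
			proof -
				have "real (Suc k) / real N <= 1" using that Npos by simp
				then have 1: "\<epsilon>\<^sup>2 <= \<epsilon>\<^sup>2 + 1 - real (Suc k) / real N" by simp
				then show "(\<sigma> (Suc k))\<^sup>2 = \<epsilon>\<^sup>2 + 1 - real (Suc k) / real N" unfolding \<sigma>_def using order_trans[OF zero_le_power2 1] by simp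
				with 1 show "\<epsilon>\<^sup>2 <= (\<sigma> (Suc k))\<^sup>2" by simp
			qed
			have e2: "0 < \<epsilon>\<^sup>2" using \<epsilon> by simp
			have iU: "integrable P (\<lambda>w. sp.area * (U k j w ^ 3 / (\<sigma> (Suc k))\<^sup>2))" if "k < N" "j < N" for k j
				using sp.U_int[OF that] by simp
			define A where "A w = (\<Sum>k<N. \<Sum>j<N. sp.area * (U k j w ^ 3 / (\<sigma> (Suc k))\<^sup>2))" for w
			have iA: "integrable P A" unfolding A_def[abs_def] using iU by (intro Bochner_Integration.integrable_sum) auto
			have EA: "sp.area * (\<Sum>k<N. \<Sum>j<N. expectation (\<lambda>w. U k j w ^ 3) / (\<sigma> (Suc k))\<^sup>2) = expectation A"
				unfolding A_def[abs_def] using iU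
				by (subst Bochner_Integration.integral_sum; (intro Bochner_Integration.integrable_sum)?)
					(auto simp: Bochner_Integration.integral_sum sum_distrib_left)
			have A0: "0 <= A w" for w unfolding A_def using sp.area(1) U(2) by (intro sum_nonneg mult_nonneg_nonneg divide_nonneg_nonneg) auto
			have AG: "ennreal (A w) <= 2 * (ptint (rect T R) hp (\<lambda>x. ennreal (G x)) w)" if w: "w \<in> configs" for w
			proof -
				have "ennreal (A w) = (\<Sum>k<N. \<Sum>j<N. ennreal (sp.area * (U k j w ^ 3 / (\<sigma> (Suc k))\<^sup>2)))"
					unfolding A_def using sp.area(1) U(2) by (simp add: sum_ennreal sum_nonneg)
				also have "... <= (\<Sum>k<N. \<Sum>j<N. 2 * (ptint (cell T R N k j) hp (\<lambda>x. ennreal (G x)) w))"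
				proof (intro sum_mono)
					fix k j assume kj: "k \<in> {..<N}" "j \<in> {..<N}"
					have "ennreal (sp.area * (U k j w ^ 3 / (\<sigma> (Suc k))\<^sup>2)) = 2 * (\<integral>\<^sup>+z. ennreal (U k j w ^ 3 / (2 * (\<sigma> (Suc k))\<^sup>2)) * indicator (cell T R N k j) z \<partial>hp)"
					proof -
						have "(\<integral>\<^sup>+z. ennreal (U k j w ^ 3 / (2 * (\<sigma> (Suc k))\<^sup>2)) * indicator (cell T R N k j) z \<partial>hp) = ennreal (U k j w ^ 3 / (2 * (\<sigma> (Suc k))\<^sup>2)) * ennreal sp.area"
							using cell_sets[OF R] sp.area(3) by (simp add: nn_integral_cmult_indicator)
						then have "2 * (\<integral>\<^sup>+z. ennreal (U k j w ^ 3 / (2 * (\<sigma> (Suc k))\<^sup>2)) * indicator (cell T R N k j) z \<partial>hp) = ennreal 2 * (ennreal (U k j w ^ 3 / (2 * (\<sigma> (Suc k))\<^sup>2)) * ennreal sp.area)"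
							by simp
						also have "... = ennreal (2 * (U k j w ^ 3 / (2 * (\<sigma> (Suc k))\<^sup>2) * sp.area))"
						proof -
							have u0: "0 <= U k j w ^ 3 / (2 * (\<sigma> (Suc k))\<^sup>2)" using U(2) by simp
							show ?thesis by (simp only: ennreal_mult'[OF u0] mult.assoc ennreal_mult'[of 2, OF zero_le_numeral])
						qed
						finally show ?thesis by (simp add: mult_ac)
					qed
					also have "... <= 2 * (ptint (cell T R N k j) hp (\<lambda>x. ennreal (G x)) w)"
					proof (intro mult_left_mono nn_integral_mono)
						fix z
						show "ennreal (U k j w ^ 3 / (2 * (\<sigma> (Suc k))\<^sup>2)) * indicator (cell T R N k j) z <= ennreal (G (pt w z)) * indicator (cell T R N k j) z"
						proof (cases "z \<in> cell T R N k j")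
							case True
							have t: "T * real k / real N < fst z" "fst z <= T * real (Suc k) / real N" using True by (auto simp: cell_def)
							have zT: "fst z <= T" using cell_rect[OF T R, of k N j] kj True by (auto simp: rect_def)
							have "real k / real N < fst z / T" using t(1) T Npos by (simp add: field_simps)
							moreover have "1 / real N <= \<epsilon>\<^sup>2" using Nbig(3) e2 Npos by (simp add: field_simps)
							\<comment> \<open>Moving from \<open>fst z\<close> to the right end of the slab changes the
							  variance by less than \<open>1 / real N\<close>, at most \<open>\<epsilon>\<^sup>2\<close>.
							  The weights thus differ by a factor of at most two, which turns 18 into 36.\<close>
							ultimately have "\<epsilon>\<^sup>2 + 1 - fst z / T <= 2 * (\<sigma> (Suc k))\<^sup>2"
								using s2[of k] kj by (simp add: add_divide_distrib)
							moreover have "0 < \<epsilon>\<^sup>2 + 1 - fst z / T"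
							proof -
								have "fst z / T <= 1" using zT T by simp
								then show ?thesis using e2 by linarith
							qed
							ultimately have "1 / (2 * (\<sigma> (Suc k))\<^sup>2) <= wt (pt w z)" unfolding wt_def pt_def by (simp add: frac_le)
							then have "1 / (2 * (\<sigma> (Suc k))\<^sup>2) * U k j w ^ 3 <= wt (pt w z) * U k j w ^ 3" using U(2) by (intro mult_right_mono) auto
							moreover have "G (pt w z) = wt (pt w z) * U k j w ^ 3"
								unfolding G_def using kj step_fun_cell[OF T R _ _ True, of U w] by simp
							ultimately show ?thesis using True by (auto intro!: ennreal_leI)
						qed simp
					qed simp
					finally show "ennreal (sp.area * (U k j w ^ 3 / (\<sigma> (Suc k))\<^sup>2)) <= 2 * (ptint (cell T R N k j) hp (\<lambda>x. ennreal (G x)) w)" .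
				qed
				also have "... = 2 * (ptint (rect T R) hp (\<lambda>x. ennreal (G x)) w)"
					unfolding nn_integral_rect_cells[OF T R Npos w Gm refl] by (simp only: sum_distrib_left)
				finally show ?thesis .
			qed
			have "ennreal (expectation A) = (\<integral>\<^sup>+w. ennreal (A w) \<partial>P)" using iA A0 by (intro nn_integral_eq_integral[symmetric]) auto
			also have "... <= (\<integral>\<^sup>+w. 2 * (ptint (rect T R) hp (\<lambda>x. ennreal (G x)) w) \<partial>P)"
				using AG by (intro nn_integral_mono) (simp add: space_P)
			also have "... = 2 * (\<integral>\<^sup>+x. ennreal (G x) \<partial>QM T R)"
				using nn_integral_QM[OF T R0 Gm] by (simp add: nn_integral_cmult)
			also have "(\<integral>\<^sup>+x. ennreal (G x) \<partial>QM T R) <= (\<integral>\<^sup>+x. ennreal ((f x) ^ 3 / (\<epsilon>\<^sup>2 + 1 - fst (fst x) / T)) + ennreal (3 * b\<^sup>2 / \<epsilon>\<^sup>2) * ennreal (d x) \<partial>QM T R)"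
			proof (intro nn_integral_mono_AE, use AE_QM[OF T R0] in eventually_elim)
				case (elim x)
				then have wx: "0 <= wt x" "wt x <= 1 / \<epsilon>\<^sup>2" using wt by auto
				have "G x <= wt x * ((f x) ^ 3 + 3 * b\<^sup>2 * d x)" unfolding G_def by (intro mult_left_mono cube wx)
				also have "... = wt x * (f x) ^ 3 + wt x * (3 * b\<^sup>2 * d x)" by (simp add: distrib_left)
				also have "... <= wt x * (f x) ^ 3 + 1 / \<epsilon>\<^sup>2 * (3 * b\<^sup>2 * d x)"
					using wx d0[of x] by (intro add_left_mono mult_right_mono) auto
				finally have "G x <= (f x) ^ 3 / (\<epsilon>\<^sup>2 + 1 - fst (fst x) / T) + 3 * b\<^sup>2 / \<epsilon>\<^sup>2 * d x" by (simp add: wt_def)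
				then have "ennreal (G x) <= ennreal ((f x) ^ 3 / (\<epsilon>\<^sup>2 + 1 - fst (fst x) / T) + 3 * b\<^sup>2 / \<epsilon>\<^sup>2 * d x)" by (rule ennreal_leI)
				also have "... = ennreal ((f x) ^ 3 / (\<epsilon>\<^sup>2 + 1 - fst (fst x) / T)) + ennreal (3 * b\<^sup>2 / \<epsilon>\<^sup>2) * ennreal (d x)"
				proof -
					have "0 <= (f x) ^ 3 * wt x" using f(2)[of x] wx by simp
					moreover have "ennreal (3 * b\<^sup>2 / \<epsilon>\<^sup>2 * d x) = ennreal (3 * b\<^sup>2 / \<epsilon>\<^sup>2) * ennreal (d x)" by (rule ennreal_mult') simp
					ultimately show ?thesis using d0[of x] by (subst ennreal_plus) (auto simp: wt_def)
				qed
				finally show ?case .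
			qed
			also have "... = (\<integral>\<^sup>+x. ennreal ((f x) ^ 3 / (\<epsilon>\<^sup>2 + 1 - fst (fst x) / T)) \<partial>QM T R) + ennreal (3 * b\<^sup>2 / \<epsilon>\<^sup>2) * (\<integral>\<^sup>+x. ennreal (d x) \<partial>QM T R)"
			proof -
				have [measurable]: "f \<in> bm (QM T R)" "d \<in> bm (QM T R)" "(\<lambda>x. fst (fst x)) \<in> bm (QM T R)"
					using f(1) dm measurable_pb_time[OF T] by (simp_all cong: measurable_cong_sets)
				show ?thesis by (subst nn_integral_add) (measurable, simp add: nn_integral_cmult)
			qed
			also have "... <= ennreal W + ennreal (3 * b\<^sup>2 / \<epsilon>\<^sup>2) * ennreal \<delta>" using third dQ by (intro add_mono mult_left_mono) auto
			also have "... = ennreal (W + 3 * b\<^sup>2 / \<epsilon>\<^sup>2 * \<delta>)" using W \<delta> by (simp add: ennreal_mult'[symmetric] ennreal_plus[symmetric] del: ennreal_plus)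
			finally have "ennreal (expectation A) <= ennreal 2 * ennreal (W + 3 * b\<^sup>2 / \<epsilon>\<^sup>2 * \<delta>)"
				by (simp add: mult_left_mono)
			also have "... = ennreal (2 * (W + 3 * b\<^sup>2 / \<epsilon>\<^sup>2 * \<delta>))" by (subst ennreal_mult') auto
			finally have "expectation A <= 2 * (W + 3 * b\<^sup>2 / \<epsilon>\<^sup>2 * \<delta>)" using W \<delta> by (subst (asm) ennreal_le_iff) auto
			then have "18 * expectation A <= 18 * (2 * (W + 3 * b\<^sup>2 / \<epsilon>\<^sup>2 * \<delta>))" by simp
			also have "... = 36 * W + 108 * b\<^sup>2 / \<epsilon>\<^sup>2 * \<delta>" by (simp add: algebra_simps)
			finally have "18 * expectation A <= 36 * W + 108 * b\<^sup>2 / \<epsilon>\<^sup>2 * \<delta>" .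
			then show ?thesis by (simp only: EA[symmetric] mult.assoc)
		qed
		have "c / sqrt (real N) <= \<delta>"
		proof -
			have "c / \<delta> <= sqrt (real N)" using Nbig(4) by (rule real_le_rsqrt)
			then show ?thesis using \<delta> Npos by (simp add: field_simps)
		qed
		then have L: "\<bar>expectation (\<lambda>w. heat \<epsilon> h (sp.M N w)) - heat (sqrt (1 + \<epsilon>\<^sup>2)) h 0\<bar> <=
				(\<rho> + 2 * b * \<delta>) / \<epsilon> + (36 * W + 108 * b\<^sup>2 / \<epsilon>\<^sup>2 * \<delta>) + \<delta>"
			using sp.lindeberg_step[OF h \<epsilon>] th divide_right_mono[OF vd less_imp_le[OF \<epsilon>]] unfolding \<sigma>_def c_def by linarith
		have gn: "!!x. 0 <= ?g x" "!!x. ?g x <= b" by (rule sp.step_fun_nonneg, rule sp.step_fun_le)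
		have "(\<integral>\<^sup>+w. ennreal \<bar>comp T R f w - comp T R ?g w\<bar> \<partial>P) <= 2 * (distQ T R f ?g)"
			by (rule comp_diff_expectation[OF T R0 f gm gn])
		also have "... <= 2 * ennreal \<delta>" using dQ by (intro mult_left_mono) (auto simp: d_def)
		also have "... = ennreal (2 * \<delta>)" using \<delta> by (simp add: ennreal_mult')
		finally have cd: "(\<integral>\<^sup>+w. ennreal \<bar>comp T R f w - comp T R ?g w\<bar> \<partial>P) <= ennreal (2 * \<delta>)" .
		have "\<bar>expectation (\<lambda>w. heat \<epsilon> h (comp T R f w)) - expectation (\<lambda>w. heat \<epsilon> h (comp T R ?g w))\<bar> <= 2 * \<delta>"
			using \<delta> by (intro lipschitz_expectation_diff[OF hl icomp[OF f] icomp[OF gm gn] cd]) auto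
		moreover have "expectation (\<lambda>w. heat \<epsilon> h (comp T R ?g w)) = expectation (\<lambda>w. heat \<epsilon> h (sp.M N w))"
			by (intro Bochner_Integration.integral_cong) (auto simp: space_P sp.comp_step)
		ultimately have "\<bar>expectation (\<lambda>w. heat \<epsilon> h (comp T R f w)) - heat (sqrt (1 + \<epsilon>\<^sup>2)) h 0\<bar> <=
				(\<rho> + 2 * b * \<delta>) / \<epsilon> + (36 * W + 108 * b\<^sup>2 / \<epsilon>\<^sup>2 * \<delta>) + \<delta> + 2 * \<delta>" using L by linarith
		also have "... = \<rho> / \<epsilon> + 36 * W + C * \<delta>" by (simp add: C_def add_divide_distrib algebra_simps)
		finally show ?thesis .
	qed
	show ?thesis
	proof (rule field_le_epsilon)
		fix e :: real assume e: "0 < e"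
		have C1: "0 < C + 1" using C by simp
		then have "0 < e / (C + 1)" using e by simp
		from key[OF this] have "\<bar>expectation (\<lambda>w. heat \<epsilon> h (comp T R f w)) - heat (sqrt (1 + \<epsilon>\<^sup>2)) h 0\<bar> <= \<rho> / \<epsilon> + 36 * W + C * (e / (C + 1))" .
		also have "C * (e / (C + 1)) <= e" using C e C1 by (simp add: field_simps)
		finally show "\<bar>expectation (\<lambda>w. heat \<epsilon> h (comp T R f w)) - heat (sqrt (1 + \<epsilon>\<^sup>2)) h 0\<bar> <= \<rho> / \<epsilon> + 36 * W + e" by simp
	qed
qed

end


section \<open>Application to the Hawkes integrand\<close>

context hawkes begin

lemma pred_fubini:
	fixes g :: "_ => ennreal"
	assumes g: "g \<in> bm (PA T)"
	shows "(\<integral>\<^sup>+w. (\<integral>\<^sup>+s\<in>{0..T}. g (s, w) \<partial>lborel) \<partial>P) = (\<integral>\<^sup>+s\<in>{0..T}. (\<integral>\<^sup>+w. g (s, w) \<partial>P) \<partial>lborel)"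
proof -
	interpret pf: pair_sigma_finite lborel P ..
	have *: "(\<lambda>x. g x * indicator {0..T} (fst x)) \<in> bm (borel \<Otimes>\<^sub>M P)"
		by (rule measurable_pred_strip[OF T0 g])
	have "sets (lborel \<Otimes>\<^sub>M P) = sets (borel \<Otimes>\<^sub>M P)" by (rule sets_pair_measure_cong) simp_all
	then have m: "(\<lambda>(s, w). g (s, w) * indicator {0..T} s) \<in> bm (lborel \<Otimes>\<^sub>M P)"
		unfolding case_prod_beta' by (subst measurable_cong_sets[OF \<open>sets (lborel \<Otimes>\<^sub>M P) = _\<close> refl]) (use * in \<open>simp only: prod.collapse\<close>)
	have "(\<integral>\<^sup>+w. (\<integral>\<^sup>+s\<in>{0..T}. g (s, w) \<partial>lborel) \<partial>P) = (\<integral>\<^sup>+s. (\<integral>\<^sup>+w. g (s, w) * indicator {0..T} s \<partial>P) \<partial>lborel)"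
		by (rule pf.Fubini'[OF m])
	also have "... = (\<integral>\<^sup>+s\<in>{0..T}. (\<integral>\<^sup>+w. g (s, w) \<partial>P) \<partial>lborel)"
		by (intro nn_integral_cong) (auto simp: indicator_def)
	finally show ?thesis .
qed

text \<open>The maximum with \<open>\<nu>\<close> bounds the integrand by
  \<open>1 / sqrt (T * \<nu>)\<close> along every configuration. Almost surely
  \<open>\<nu> \<le> l\<close> on \<open>{0..T}\<close>, so the statistic is unchanged there, see
  \<open>stat_eq\<close>.\<close>

definition integrand :: "(real \<times> config) \<times> real => real" where
	"integrand x = of_bool (snd x <= lx x) / sqrt (T * max \<nu> (lx x))"

lemma l_meas_PB: "(\<lambda>x. lx x) \<in> bm (PB T)"
	by (rule measurable_compose[OF measurable_fst l_meas])

lemma integrand_meas: "integrand \<in> bm (PB T)"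
proof -
	note [measurable] = l_meas_PB thin_pred
	have "(\<lambda>x. (indicator {x \<in> space (PB T). snd x <= lx x} x :: real) / sqrt (T * max \<nu> (lx x))) \<in> bm (PB T)"
		by measurable
	then show ?thesis by (rule measurable_cong[THEN iffD1, rotated]) (auto simp: integrand_def indicator_def)
qed

lemma integrand_bounds: "0 <= integrand x" "integrand x <= 1 / sqrt (T * \<nu>)"
proof -
	have p: "0 < T * \<nu>" "T * \<nu> <= T * max \<nu> y" for y using T nu by auto
	have q: "0 < T * max \<nu> y" for y using p order.strict_trans2 by blast
	show "0 <= integrand x" unfolding integrand_def using q by (simp add: less_imp_le)
	have "integrand x <= 1 / sqrt (T * max \<nu> (lx x))"
		unfolding integrand_def using q by (intro divide_right_mono) (auto simp: less_imp_le)
	also have "... <= 1 / sqrt (T * \<nu>)" using p by (intro frac_le) auto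
	finally show "integrand x <= 1 / sqrt (T * \<nu>)" .
qed

definition tail :: "real => (real \<times> config) \<times> real => real" where
	"tail R x = integrand x * of_bool (~ (0 < fst (fst x) & 0 < snd x & snd x <= R))"

lemma tail_meas: "tail R \<in> bm (PB T)"
	unfolding tail_def[abs_def] using integrand_meas measurable_pb_time[OF T] by measurable

text \<open>Off null lines, a thinned mark above \<open>R\<close> forces \<open>l > R\<close>, so
  the integrand is at most \<open>1 / sqrt (T * R)\<close>. Integrating it over the marks up to
  \<open>l\<close> leaves the mean intensity, which is bounded by \<open>B\<close>.\<close>

lemma tail_bound:
	assumes R: "0 < R" and B: "0 <= B" "!!t. t \<in> {0..T} ==> mean t <= ennreal B"
	shows "(\<integral>\<^sup>+w. (ptint (strip T) hp (\<lambda>x. ennreal (tail R x)) w) \<partial>P) <= ennreal (B * sqrt T / sqrt R)"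
proof -
	have TR: "0 < T * R" using T R by simp
	have tm: "(\<lambda>x. ennreal (tail R x)) \<in> bm (PB T)" using tail_meas by measurable
	define c where "c = 1 / sqrt (T * R)"
	have c: "0 <= c" using TR by (simp add: c_def)
	have gm: "(\<lambda>x. ennreal c * ennreal (l (fst x) (snd x))) \<in> bm (PA T)" using l_meas by measurable
	have "(\<integral>\<^sup>+w. (ptint (strip T) hp (\<lambda>x. ennreal (tail R x)) w) \<partial>P) <=
			(\<integral>\<^sup>+w. (\<integral>\<^sup>+t\<in>{0..T}. ennreal c * ennreal (l t w) \<partial>lborel) \<partial>P)"
	proof (rule nn_integral_mono)
		fix w assume "w \<in> space P"
		then have w: "w \<in> configs" by (simp add: space_P)
		have "(ptint (strip T) hp (\<lambda>x. ennreal (tail R x)) w) = (\<integral>\<^sup>+t\<in>{0..T}. (\<integral>\<^sup>+\<theta>\<in>{0..}. ennreal (tail R (pt w (t, \<theta>))) \<partial>lborel) \<partial>lborel)"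
			by (rule nn_integral_half_plane[OF measurable_pt_strip[OF T0 w tm]])
		also have "... <= (\<integral>\<^sup>+t\<in>{0..T}. ennreal c * ennreal (l t w) \<partial>lborel)"
		proof (intro nn_integral_mono_AE, use AE_lborel_singleton[of 0] in eventually_elim)
			case (elim t)
			show ?case
			proof (cases "t \<in> {0..T}")
				case True
				have "(\<integral>\<^sup>+\<theta>\<in>{0..}. ennreal (tail R (pt w (t, \<theta>))) \<partial>lborel) <= (\<integral>\<^sup>+\<theta>. ennreal c * indicator {0..l t w} \<theta> \<partial>lborel)"
				proof (intro nn_integral_mono_AE, use AE_lborel_singleton[of 0] in eventually_elim)
					fix \<theta> :: real assume \<theta>: "\<theta> ~= 0"
					show "ennreal (tail R (pt w (t, \<theta>))) * indicator {0..} \<theta> <= ennreal c * indicator {0..l t w} \<theta>"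
					proof (cases "0 < \<theta> & R < \<theta> & \<theta> <= l t w")
						case True
						have "T * R <= T * max \<nu> (l t w)" using T True by (intro mult_left_mono) auto
						then have "1 / sqrt (T * max \<nu> (l t w)) <= c" unfolding c_def using TR by (intro frac_le) auto
						then show ?thesis using True by (auto simp: tail_def integrand_def pt_def intro!: ennreal_leI)
					next
						case False
						then show ?thesis using \<theta> True elim by (auto simp: tail_def integrand_def pt_def indicator_def)
					qed
				qed
				also have "... = ennreal c * ennreal (l t w)"
					by (subst nn_integral_cmult_indicator) (auto simp: emeasure_lborel_Icc_eq ennreal_neg)
				finally show ?thesis using True by simp
			qed simp
		qed
		finally show "(ptint (strip T) hp (\<lambda>x. ennreal (tail R x)) w) <= (\<integral>\<^sup>+t\<in>{0..T}. ennreal c * ennreal (l t w) \<partial>lborel)" .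
	qed
	also have "... = (\<integral>\<^sup>+t\<in>{0..T}. (\<integral>\<^sup>+w. ennreal c * ennreal (l t w) \<partial>P) \<partial>lborel)"
		using pred_fubini[OF gm] by simp
	also have "... <= (\<integral>\<^sup>+t. ennreal (c * B) * indicator {0..T} t \<partial>lborel)"
	proof (rule nn_integral_mono)
		fix t
		show "(\<integral>\<^sup>+w. ennreal c * ennreal (l t w) \<partial>P) * indicator {0..T} t <= ennreal (c * B) * indicator {0..T} t"
		proof (cases "t \<in> {0..T}")
			case True
			have "(\<integral>\<^sup>+w. ennreal c * ennreal (l t w) \<partial>P) = ennreal c * mean t"
				unfolding mean_def using l_meas_P[OF True] by (intro nn_integral_cmult) auto
			also have "... <= ennreal c * ennreal B" using B(2)[OF True] by (intro mult_left_mono) auto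
			finally show ?thesis using True c by (simp add: ennreal_mult')
		qed simp
	qed
	also have "... = ennreal (c * B) * ennreal T"
		by (subst nn_integral_cmult_indicator) (use T in \<open>auto simp: emeasure_lborel_Icc_eq\<close>)
	also have "... = ennreal (c * B * T)" using c B by (intro ennreal_mult'[symmetric]) simp
	also have "c * B * T = B * sqrt T / sqrt R"
	proof -
		have "T = sqrt T * sqrt T" using T by simp
		then show ?thesis using T R by (simp add: c_def real_sqrt_mult field_simps)
	qed
	finally show ?thesis .
qed

definition stat :: "config => real" where
	"stat w = compensated_integral ({0..T} \<times> {0..}) (\<lambda>(t, \<theta>). of_bool (\<theta> <= l t w) / sqrt (T * l t w)) w"

text \<open>The statistic with nonnegative integrals and the globally bounded integrand, the form to
  which the Mecke formula applies.\<close>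

definition stat' :: "config => real" where
	"stat' w = enn2real (ptint (strip T) w (\<lambda>x. ennreal (integrand x)) w) - enn2real (ptint (strip T) hp (\<lambda>x. ennreal (integrand x)) w)"

lemma stat_raw:
	fixes raw :: "(real \<times> config) \<times> real => real"
	defines "raw \<equiv> \<lambda>x. of_bool (snd x <= lx x) / sqrt (T * lx x)"
	shows "(\<lambda>x. ennreal (raw x)) \<in> bm (PB T)"
		and "!!w. w \<in> configs ==> stat w = enn2real (ptint (strip T) w (\<lambda>x. ennreal (raw x)) w) - enn2real (ptint (strip T) hp (\<lambda>x. ennreal (raw x)) w)"
proof -
	note [measurable] = l_meas_PB thin_pred
	have "(\<lambda>x. (indicator {x \<in> space (PB T). snd x <= lx x} x :: real) / sqrt (T * lx x)) \<in> bm (PB T)"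
		by measurable
	then have rm: "raw \<in> bm (PB T)" by (rule measurable_cong[THEN iffD1, rotated]) (auto simp: raw_def indicator_def)
	then show im: "(\<lambda>x. ennreal (raw x)) \<in> bm (PB T)" by measurable
	fix w :: "config" assume w: "w \<in> configs"
	have r0: "0 <= raw (pt w z)" if "z \<in> strip T" for z
		using that T by (auto simp: raw_def pt_def intro!: mult_nonneg_nonneg)
	have "(LINT z:strip T|M. (case z of (t, \<theta>) => of_bool (\<theta> <= l t w) / sqrt (T * l t w))) =
			enn2real (ptint (strip T) M (\<lambda>x. ennreal (raw x)) w)" if M: "sets M = sets hp" for M
	proof -
		have eq: "indicator (strip T) z *\<^sub>R (case z of (t, \<theta>) => of_bool (\<theta> <= l t w) / sqrt (T * l t w)) = indicator (strip T) z * raw (pt w z)" for z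
			by (cases z) (auto simp: raw_def pt_def)
		have m: "(\<lambda>z. ennreal (raw (pt w z)) * indicator (strip T) z) \<in> bm M"
			by (rule measurable_pt_cell[OF T w im strip_sets order_refl M])
		have "(\<lambda>z. enn2real (ennreal (raw (pt w z)) * indicator (strip T) z)) \<in> bm M" using m by measurable
		also have "(\<lambda>z. enn2real (ennreal (raw (pt w z)) * indicator (strip T) z)) = (\<lambda>z. indicator (strip T) z * raw (pt w z))"
			using r0 by (auto simp: fun_eq_iff indicator_def)
		finally have m': "(\<lambda>z. indicator (strip T) z * raw (pt w z)) \<in> bm M" .
		have "(LINT z:strip T|M. (case z of (t, \<theta>) => of_bool (\<theta> <= l t w) / sqrt (T * l t w))) = (LINT z|M. indicator (strip T) z * raw (pt w z))"
			unfolding set_lebesgue_integral_def eq ..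
		also have "... = enn2real (\<integral>\<^sup>+z. ennreal (indicator (strip T) z * raw (pt w z)) \<partial>M)"
			using m' r0 by (intro integral_eq_nn_integral) (auto simp: indicator_def)
		also have "(\<integral>\<^sup>+z. ennreal (indicator (strip T) z * raw (pt w z)) \<partial>M) = (ptint (strip T) M (\<lambda>x. ennreal (raw x)) w)"
			by (intro nn_integral_cong) (auto simp: indicator_def)
		finally show ?thesis .
	qed
	from this[OF configs_sets[OF w]] this[OF refl]
	show "stat w = enn2real (ptint (strip T) w (\<lambda>x. ennreal (raw x)) w) - enn2real (ptint (strip T) hp (\<lambda>x. ennreal (raw x)) w)"
		unfolding stat_def compensated_integral_def by simp
qed

lemma stat_meas: "stat \<in> bm P"
proof -
	note mk = mecke[OF T stat_raw(1)]
	have "(\<lambda>w. enn2real (ptint (strip T) w (\<lambda>x. ennreal (of_bool (snd x <= lx x) / sqrt (T * lx x))) w) -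
		enn2real (ptint (strip T) hp (\<lambda>x. ennreal (of_bool (snd x <= lx x) / sqrt (T * lx x))) w)) \<in> bm P"
		using mk[THEN conjunct1] mk[THEN conjunct2, THEN conjunct1] by (intro borel_measurable_diff) auto
	then show ?thesis by (rule measurable_cong[THEN iffD1, rotated]) (simp add: stat_raw(2) space_P)
qed

lemma stat_eq: "AE w in P. stat w = stat' w"
	using l_ge AE_space
proof eventually_elim
	case (elim w)
	then have w: "w \<in> configs" by (simp add: space_P)
	show ?case unfolding stat'_def stat_raw(2)[OF w]
		using elim(1) by (intro arg_cong2[where f = "(-)"] arg_cong[where f = enn2real] nn_integral_cong)
			(auto simp: indicator_def integrand_def pt_def max_def)
qed

lemma stat_comp:
	assumes R: "0 < R" and B: "0 <= B" "!!t. t \<in> {0..T} ==> mean t <= ennreal B"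
	shows "(\<integral>\<^sup>+w. ennreal \<bar>stat' w - comp T R integrand w\<bar> \<partial>P) <= ennreal (2 * B * sqrt T / sqrt R)"
		and "stat' \<in> bm P"
proof -
	have im: "(\<lambda>x. ennreal (integrand x)) \<in> bm (PB T)" using integrand_meas by measurable
	have tm: "(\<lambda>x. ennreal (tail R x)) \<in> bm (PB T)" using tail_meas by measurable
	note mk = mecke[OF T im] and mt = mecke[OF T tm]
	show "stat' \<in> bm P" unfolding stat'_def[abs_def]
		using mk[THEN conjunct1] mk[THEN conjunct2, THEN conjunct1] by (intro borel_measurable_diff) auto
	let ?S = "\<lambda>M w. \<integral>\<^sup>+z\<in>strip T. ennreal (integrand (pt w z)) \<partial>M"
	let ?C = "\<lambda>M w. \<integral>\<^sup>+z\<in>rect T R. ennreal (integrand (pt w z)) \<partial>M"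
	let ?t = "\<lambda>M w. \<integral>\<^sup>+z\<in>strip T. ennreal (tail R (pt w z)) \<partial>M"
	have split: "?S M w = ?C M w + ?t M w" if w: "w \<in> configs" and M: "sets M = sets hp" for M w
	proof -
		have "?S M w = (\<integral>\<^sup>+z. ennreal (integrand (pt w z)) * indicator (rect T R) z + ennreal (tail R (pt w z)) * indicator (strip T) z \<partial>M)"
			by (intro nn_integral_cong) (auto simp: indicator_def tail_def pt_def rect_def)
		also have "... = ?C M w + ?t M w"
			using measurable_pt_cell[OF T w im rect_sets rect_strip M] measurable_pt_cell[OF T w tm strip_sets order_refl M]
			by (rule nn_integral_add)
		finally show ?thesis .
	qed
	have Et: "(\<integral>\<^sup>+w. ?t hp w \<partial>P) <= ennreal (B * sqrt T / sqrt R)" by (rule tail_bound[OF R B])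
	have Et': "(\<integral>\<^sup>+w. ?t w w \<partial>P) <= ennreal (B * sqrt T / sqrt R)" using Et mt by simp
	have fin: "AE w in P. ?t hp w < \<infinity> & ?t w w < \<infinity>"
	proof -
		have "(\<integral>\<^sup>+w. ?t hp w \<partial>P) ~= \<infinity>" "(\<integral>\<^sup>+w. ?t w w \<partial>P) ~= \<infinity>" using Et Et' by (auto simp: top_unique)
		then have "AE w in P. ?t hp w ~= \<infinity>" "AE w in P. ?t w w ~= \<infinity>"
			using mt[THEN conjunct1] mt[THEN conjunct2, THEN conjunct1] nn_integral_PInf_AE by blast+
		then show ?thesis by eventually_elim (simp add: less_top)
	qed
	have "(\<integral>\<^sup>+w. ennreal \<bar>stat' w - comp T R integrand w\<bar> \<partial>P) <= (\<integral>\<^sup>+w. ?t w w + ?t hp w \<partial>P)"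
	proof (intro nn_integral_mono_AE, use fin AE_space in eventually_elim)
		case (elim w)
		then have w: "w \<in> configs" by (simp add: space_P)
		have Cfin: "?C M w < \<infinity>" if "sets M = sets hp" "emeasure M (rect T R) < \<infinity>" for M
		proof -
			have "?C M w <= (\<integral>\<^sup>+z. ennreal (1 / sqrt (T * \<nu>)) * indicator (rect T R) z \<partial>M)"
				by (intro nn_integral_mono mult_right_mono ennreal_leI integrand_bounds) auto
			also have "... = ennreal (1 / sqrt (T * \<nu>)) * emeasure M (rect T R)"
				using rect_sets that(1) by (intro nn_integral_cmult_indicator) auto
			also have "... < \<infinity>" using that(2) by (simp add: ennreal_mult_less_top)
			finally show ?thesis .
		qed
		have br: "bounded (rect T R)" by (rule bounded_subset[OF bounded_rect[of T R]]) (auto simp: rect_def)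
		have e1: "?C w w < \<infinity>" by (rule Cfin[OF configs_sets[OF w] configs_bounded(1)[OF w br rect_sets]])
		have e2: "?C hp w < \<infinity>" using emeasure_rect[of T R] T R by (intro Cfin) auto
		have d: "ennreal \<bar>enn2real (?S M w) - enn2real (?C M w)\<bar> <= ?t M w" if "sets M = sets hp" "?C M w < \<infinity>" "?t M w < \<infinity>" for M
			using split[OF w that(1)] that(2,3) by (intro abs_enn2real_diff_le) (auto simp: add_increasing2)
		have "\<bar>stat' w - comp T R integrand w\<bar> <= \<bar>enn2real (?S w w) - enn2real (?C w w)\<bar> + \<bar>enn2real (?S hp w) - enn2real (?C hp w)\<bar>"
			unfolding stat'_def comp_def by linarith
		then have "ennreal \<bar>stat' w - comp T R integrand w\<bar> <= ennreal \<bar>enn2real (?S w w) - enn2real (?C w w)\<bar> + ennreal \<bar>enn2real (?S hp w) - enn2real (?C hp w)\<bar>"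
			by (simp add: ennreal_plus[symmetric] ennreal_leI del: ennreal_plus)
		also have "... <= ?t w w + ?t hp w"
			using elim(1) by (intro add_mono d e1 e2 configs_sets[OF w] refl) auto
		finally show ?case .
	qed
	also have "... = (\<integral>\<^sup>+w. ?t w w \<partial>P) + (\<integral>\<^sup>+w. ?t hp w \<partial>P)" using mt by (intro nn_integral_add) auto
	also have "... <= ennreal (B * sqrt T / sqrt R) + ennreal (B * sqrt T / sqrt R)" using Et' Et by (rule add_mono)
	also have "... = ennreal (2 * B * sqrt T / sqrt R)"
		using B(1) T R by (subst ennreal_plus[symmetric]) auto
	finally show "(\<integral>\<^sup>+w. ennreal \<bar>stat' w - comp T R integrand w\<bar> \<partial>P) <= ennreal (2 * B * sqrt T / sqrt R)" .
qed

lemma rect_section: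
	fixes f :: "_ => ennreal"
	assumes w: "w \<in> configs" and f: "f \<in> bm (PB T)" and s: "0 <= s" "t <= T"
	shows "(ptint ({s<..t} \<times> {0<..R}) hp f w) = (\<integral>\<^sup>+r\<in>{s<..t}. (rowint R f w r) \<partial>lborel)"
proof -
	have C: "{s<..t} \<times> {0<..R} \<in> sets hp" "{s<..t} \<times> {0<..R} \<subseteq> strip T"
		using s by (auto intro!: half_plane_rect)
	let ?g = "\<lambda>z. f (pt w z) * indicator (UNIV \<times> {0<..R}) z"
	have eq: "f (pt w z) * indicator ({s<..t} \<times> {0<..R}) z = ?g z * indicator ({s<..t} \<times> {0..}) z" for z
		by (cases z) (auto simp: indicator_def)
	have "(\<integral>\<^sup>+z\<in>{s<..t} \<times> {0..}. ?g z \<partial>hp) = (\<integral>\<^sup>+r\<in>{s<..t}. (\<integral>\<^sup>+\<theta>\<in>{0..}. ?g (r, \<theta>) \<partial>lborel) \<partial>lborel)"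
		using measurable_pt_cell[OF T w f C refl] unfolding eq by (rule nn_integral_half_plane)
	also have "... = (\<integral>\<^sup>+r\<in>{s<..t}. (rowint R f w r) \<partial>lborel)"
	proof (rule nn_integral_cong)
		fix r
		have "(\<integral>\<^sup>+\<theta>\<in>{0..}. ?g (r, \<theta>) \<partial>lborel) = (rowint R f w r)"
			by (intro nn_integral_cong) (auto simp: indicator_def)
		then show "(\<integral>\<^sup>+\<theta>\<in>{0..}. ?g (r, \<theta>) \<partial>lborel) * indicator {s<..t} r = (rowint R f w r) * indicator {s<..t} r"
			by (rule arg_cong)
	qed
	finally show ?thesis unfolding eq .
qed

lemma integrand_row:
	assumes "\<nu> <= l r w" and that: "0 < n" "0 < R"
	shows "(rowint R (\<lambda>x. ennreal (integrand x ^ n)) w r) = ennreal ((1 / sqrt (T * l r w)) ^ n) * ennreal (min R (l r w))"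
proof -
	have "(rowint R (\<lambda>x. ennreal (integrand x ^ n)) w r) = (\<integral>\<^sup>+\<theta>. ennreal ((1 / sqrt (T * l r w)) ^ n) * indicator {0<..min R (l r w)} \<theta> \<partial>lborel)"
		using assms that by (intro nn_integral_cong) (auto simp: integrand_def pt_def indicator_def max_def zero_power)
	also have "... = ennreal ((1 / sqrt (T * l r w)) ^ n) * ennreal (min R (l r w))"
		using assms nu that by (subst nn_integral_cmult_indicator) auto
	finally show ?thesis .
qed

lemma integrand_row_meas: "(\<lambda>\<theta>. integrand (pt w (r, \<theta>))) \<in> bm borel"
	unfolding integrand_def pt_def by simp

lemma QM_le_rows:
	assumes R: "0 < R" and f: "f \<in> bm (PB T)" and g: "g \<in> bm borel" "u \<in> bm borel"
		and le: "!!r w. r \<in> {0<..T} ==> \<nu> <= l r w ==> (rowint R f w r) <= ennreal (g r) * ennreal (u (l r w))"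
	shows "(\<integral>\<^sup>+x. f x \<partial>QM T R) <= (\<integral>\<^sup>+t\<in>{0..T}. ennreal (g t) * (\<integral>\<^sup>+w. ennreal (u (l t w)) \<partial>P) \<partial>lborel)"
proof -
	have gm: "(\<lambda>x. ennreal (g (fst x)) * ennreal (u (l (fst x) (snd x)))) \<in> bm (PA T)"
		using measurable_compose[OF measurable_pred_fst[OF T0] g(1)] measurable_compose[OF l_meas g(2)] by measurable
	have "(\<integral>\<^sup>+x. f x \<partial>QM T R) <= (\<integral>\<^sup>+w. (\<integral>\<^sup>+t\<in>{0..T}. ennreal (g t) * ennreal (u (l t w)) \<partial>lborel) \<partial>P)"
		unfolding nn_integral_QM(1)[OF T less_imp_le[OF R] f]
	proof (intro nn_integral_mono_AE, use l_ge AE_space in eventually_elim)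
		case (elim w)
		then show ?case using le unfolding rect_def
			by (subst rect_section[OF _ f]) (auto simp: space_P indicator_def intro!: nn_integral_mono)
	qed
	also have "... = (\<integral>\<^sup>+t\<in>{0..T}. (\<integral>\<^sup>+w. ennreal (g t) * ennreal (u (l t w)) \<partial>P) \<partial>lborel)"
		using pred_fubini[OF gm] by simp
	also have "... = (\<integral>\<^sup>+t\<in>{0..T}. ennreal (g t) * (\<integral>\<^sup>+w. ennreal (u (l t w)) \<partial>P) \<partial>lborel)"
		using measurable_compose[OF l_meas_P g(2)] by (intro nn_integral_cong) (auto simp: indicator_def nn_integral_cmult)
	finally show ?thesis .
qed

text \<open>Marks are cut at \<open>R\<close>, which tends to infinity at the end. The bracket
  density is \<open>min R l / (T * l)\<close>: never above \<open>1 / T\<close>, and equal to it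
  where \<open>l \<le> R\<close>. Its deficit has mean at most \<open>B / R\<close> by a Markov
  estimate. One \<open>\<epsilon>\<close> pays for smoothing \<open>h\<close>, the other for the
  Gaussian variance \<open>1 + \<epsilon>\<^sup>2\<close> in place of 1.\<close>

lemma hawkes_clt:
	assumes h: "1-lipschitz_on UNIV h" and \<epsilon>: "0 < \<epsilon>" and W: "0 <= W"
		and third: "(\<integral>\<^sup>+t\<in>{0..T}. ennreal (1 / (T * sqrt T * (\<epsilon>\<^sup>2 + 1 - t / T))) * (\<integral>\<^sup>+w. ennreal (1 / sqrt (l t w)) \<partial>P) \<partial>lborel) <= ennreal W"
	shows "integrable P stat" "\<bar>expectation (\<lambda>w. h (stat w)) - (LINT z|gauss. h z)\<bar> <= 36 * W + 2 * \<epsilon>"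
proof -
	obtain B where B: "0 <= B" "!!t. t \<in> {0..T} ==> mean t <= ennreal B" by (rule mean_bounded) blast
	let ?b = "1 / sqrt (T * \<nu>)"
	note ib = integrand_bounds
	have hl: "1-lipschitz_on UNIV (heat \<epsilon> h)" using heat_lipschitz(1)[OF h] \<epsilon> by simp
	have icomp: "integrable P (comp T R integrand)" if "0 < R" for R
		by (rule comp_integrable[OF T less_imp_le[OF that] integrand_meas ib])
	have istat': "integrable P stat'"
	proof -
		\<comment> \<open>Any fixed rectangle serves: \<open>stat_comp\<close> handles the part outside
		  and \<open>comp_integrable\<close> the part inside.\<close>
		have "integrable P (\<lambda>w. stat' w - comp T 1 integrand w)"
		proof (rule integrableI_bounded)
			show "(\<lambda>w. stat' w - comp T 1 integrand w) \<in> bm P"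
				using stat_comp(2)[OF _ B, of 1] icomp[of 1] by auto
			show "(\<integral>\<^sup>+w. ennreal (norm (stat' w - comp T 1 integrand w)) \<partial>P) < \<infinity>"
				using order.strict_trans1[OF stat_comp(1)[OF _ B, of 1]] by simp
		qed
		from Bochner_Integration.integrable_add[OF this icomp[of 1]] show ?thesis by simp
	qed
	show istat: "integrable P stat"
	proof -
		show ?thesis using istat' stat_eq stat_meas by (subst integrable_cong_AE) auto
	qed
	have Eh: "expectation (\<lambda>w. v (stat w)) = expectation (\<lambda>w. v (stat' w))" if "1-lipschitz_on UNIV v" for v :: "real => real"
		using stat_eq integrable_lipschitz[OF that istat] integrable_lipschitz[OF that istat'] by (intro integral_cong_AE) auto
	have key: "\<bar>expectation (\<lambda>w. heat \<epsilon> h (stat' w)) - heat (sqrt (1 + \<epsilon>\<^sup>2)) h 0\<bar> <= 2 * B * sqrt T / sqrt R + B / R / \<epsilon> + 36 * W"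
		if R: "0 < R" for R
	proof -
		have R0: "0 <= R" using R by simp
		have "\<bar>expectation (\<lambda>w. heat \<epsilon> h (comp T R integrand w)) - heat (sqrt (1 + \<epsilon>\<^sup>2)) h 0\<bar> <= (B / R) / \<epsilon> + 36 * W"
		proof (rule lindeberg_predictable[OF T R integrand_meas ib h \<epsilon> _ W])
			show "0 <= B / R" using B R by simp
			have im2: "(\<lambda>x. ennreal ((integrand x)\<^sup>2)) \<in> bm (PB T)" using integrand_meas by measurable
			show "AE w in P. \<forall>s t. 0 <= s & s <= t & t <= T -->
				(ptint ({s<..t} \<times> {0<..R}) hp (\<lambda>x. ennreal ((integrand x)\<^sup>2)) w) <= ennreal ((t - s) / T)"
				using l_ge AE_space
			proof (eventually_elim, intro allI impI)
				fix w s t assume *: "\<forall>t\<in>{0..T}. \<nu> <= l t w" "w \<in> space P" "0 <= s & s <= t & t <= T"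
				then have w: "w \<in> configs" by (simp add: space_P)
				have "(ptint ({s<..t} \<times> {0<..R}) hp (\<lambda>x. ennreal ((integrand x)\<^sup>2)) w) =
						(\<integral>\<^sup>+r\<in>{s<..t}. (rowint R (\<lambda>x. ennreal ((integrand x)\<^sup>2)) w r) \<partial>lborel)"
					using * by (intro rect_section[OF w im2]) auto
				also have "... <= (\<integral>\<^sup>+r. ennreal (1 / T) * indicator {s<..t} r \<partial>lborel)"
				proof (rule nn_integral_mono)
					fix r
					show "(rowint R (\<lambda>x. ennreal ((integrand x)\<^sup>2)) w r) * indicator {s<..t} r <= ennreal (1 / T) * indicator {s<..t} r"
					proof (cases "r \<in> {s<..t}")
						case True
						then have lr: "\<nu> <= l r w" using * by auto
						have "ennreal ((1 / sqrt (T * l r w))\<^sup>2) * ennreal (min R (l r w)) <= ennreal ((1 / sqrt (T * l r w))\<^sup>2) * ennreal (l r w)"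
							by (intro mult_left_mono ennreal_leI) auto
						also have "... = ennreal (1 / T)"
							using lr nu T by (simp add: ennreal_mult'[symmetric] power_divide)
						finally show ?thesis using integrand_row[OF lr, of 2] R True by simp
					qed simp
				qed
				also have "... = ennreal (1 / T) * ennreal (t - s)" using * by (subst nn_integral_cmult_indicator) auto
				also have "... = ennreal ((t - s) / T)" using T by (simp add: ennreal_mult'[symmetric])
				finally show "(ptint ({s<..t} \<times> {0<..R}) hp (\<lambda>x. ennreal ((integrand x)\<^sup>2)) w) <= ennreal ((t - s) / T)" .
			qed
			\<comment> \<open>The Markov bound in integrand form: over the marks up to \<open>R\<close> it
			  integrates to \<open>l / (T * R)\<close>, at least \<open>1 / T\<close> wherever
			  \<open>l > R\<close>. There it makes up for the missing bracket.\<close>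
			define v where "v x = ennreal (lx x / (T * R\<^sup>2))" for x :: "(real \<times> config) \<times> real"
			have vm: "v \<in> bm (PB T)" unfolding v_def[abs_def] using l_meas_PB by measurable
			have sum_m: "(\<lambda>x. ennreal ((integrand x)\<^sup>2) + v x) \<in> bm (PB T)" using im2 vm by measurable
			let ?row = "\<lambda>w r. \<integral>\<^sup>+\<theta>\<in>{0<..R}. ennreal ((integrand (pt w (r, \<theta>)))\<^sup>2) + v (pt w (r, \<theta>)) \<partial>lborel"
			have "1 = (\<integral>\<^sup>+w. (\<integral>\<^sup>+r. ennreal (1 / T) * indicator {0<..T} r \<partial>lborel) \<partial>P)"
			proof -
				have "(\<integral>\<^sup>+r. ennreal (1 / T) * indicator {0<..T} r \<partial>lborel) = ennreal (1 / T) * ennreal T"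
					using T by (subst nn_integral_cmult_indicator) auto
				also have "... = 1" using T by (simp add: ennreal_mult'[symmetric])
				finally show ?thesis by (simp add: emeasure_space_1)
			qed
			also have "... <= (\<integral>\<^sup>+w. (ptint (rect T R) hp (\<lambda>x. ennreal ((integrand x)\<^sup>2) + v x) w) \<partial>P)"
			proof (intro nn_integral_mono_AE, use l_ge AE_space in eventually_elim)
				case (elim w)
				then have w: "w \<in> configs" by (simp add: space_P)
				have "(\<integral>\<^sup>+r. ennreal (1 / T) * indicator {0<..T} r \<partial>lborel) <=
						(\<integral>\<^sup>+r\<in>{0<..T}. ?row w r \<partial>lborel)"
				proof (rule nn_integral_mono)
					fix r
					show "ennreal (1 / T) * indicator {0<..T} r <= ?row w r * indicator {0<..T} r"
					proof (cases "r \<in> {0<..T}")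
						case True
						then have lr: "\<nu> <= l r w" using elim by auto
						show ?thesis
						proof (cases "l r w <= R")
							case True
							have "ennreal (1 / T) = (rowint R (\<lambda>x. ennreal ((integrand x)\<^sup>2)) w r)"
								using True lr nu T R by (subst integrand_row[OF lr]) (auto simp: min_def ennreal_mult'[symmetric] power_divide)
							also have "... <= ?row w r"
								by (intro nn_integral_mono mult_right_mono) auto
							finally show ?thesis using \<open>r \<in> {0<..T}\<close> by simp
						next
							case False
							have "ennreal (1 / T) <= ennreal (l r w / (T * R\<^sup>2) * R)"
								using False T R by (intro ennreal_leI) (simp add: field_simps power2_eq_square)
							also have "... = (\<integral>\<^sup>+\<theta>. ennreal (l r w / (T * R\<^sup>2)) * indicator {0<..R} \<theta> \<partial>lborel)"
								using R by (subst nn_integral_cmult_indicator) (auto intro!: ennreal_mult'' simp del: times_divide_eq_left)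
							also have "... <= ?row w r"
								by (intro nn_integral_mono mult_right_mono) (auto simp: v_def pt_def)
							finally show ?thesis using \<open>r \<in> {0<..T}\<close> by simp
						qed
					qed simp
				qed
				also have "... = (ptint (rect T R) hp (\<lambda>x. ennreal ((integrand x)\<^sup>2) + v x) w)"
					unfolding rect_def by (rule rect_section[OF w sum_m, symmetric]) auto
				finally show ?case .
			qed
			also have "... = (\<integral>\<^sup>+x. ennreal ((integrand x)\<^sup>2) + v x \<partial>QM T R)"
				by (rule nn_integral_QM(1)[OF T R0 sum_m, symmetric])
			also have "... = (\<integral>\<^sup>+x. ennreal ((integrand x)\<^sup>2) \<partial>QM T R) + (\<integral>\<^sup>+x. v x \<partial>QM T R)"
				using im2 vm by (intro nn_integral_add) (simp_all cong: measurable_cong_sets)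
			also have "(\<integral>\<^sup>+x. v x \<partial>QM T R) <= (\<integral>\<^sup>+t\<in>{0..T}. ennreal (1 / (T * R)) * (\<integral>\<^sup>+w. ennreal (l t w) \<partial>P) \<partial>lborel)"
			proof (rule QM_le_rows[OF R vm])
				fix r w
				have "(rowint R v w r) = ennreal (l r w / (T * R\<^sup>2)) * ennreal R"
					using R by (simp add: v_def pt_def nn_integral_cmult_indicator)
				also have "... = ennreal (l r w / (T * R\<^sup>2) * R)" using R by (intro ennreal_mult''[symmetric]) simp
				also have "l r w / (T * R\<^sup>2) * R = 1 / (T * R) * l r w" using R by (simp add: power2_eq_square)
				also have "ennreal ... = ennreal (1 / (T * R)) * ennreal (l r w)" using T R by (intro ennreal_mult') simp
				finally show "(rowint R v w r) <= ennreal (1 / (T * R)) * ennreal (l r w)" by simp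
			qed simp_all
			also have "... <= (\<integral>\<^sup>+t. ennreal (1 / (T * R)) * ennreal B * indicator {0..T} t \<partial>lborel)"
				using B(2) by (intro nn_integral_mono) (auto simp: mean_def indicator_def intro!: mult_left_mono)
			also have "... = ennreal (1 / (T * R)) * ennreal B * ennreal T"
				by (subst nn_integral_cmult_indicator) (use T in \<open>auto simp: emeasure_lborel_Icc_eq\<close>)
			also have "... = ennreal (1 / (T * R) * B * T)" using T R B(1) by (subst ennreal_mult', simp, subst ennreal_mult') auto
			also have "1 / (T * R) * B * T = B / R" using T by simp
			finally show "1 <= (\<integral>\<^sup>+x. ennreal ((integrand x)\<^sup>2) \<partial>QM T R) + ennreal (B / R)" by (simp add: add_left_mono)
			define wt where "wt t = 1 / (\<epsilon>\<^sup>2 + 1 - t / T)" for t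
			have w0: "0 <= wt t" if "t <= T" for t
			proof -
				have "t / T <= 1" using that T by simp
				then have "0 <= \<epsilon>\<^sup>2 + 1 - t / T" using zero_le_power2[of \<epsilon>] by linarith
				then show ?thesis by (simp add: wt_def)
			qed
			have im3: "(\<lambda>x. ennreal ((integrand x) ^ 3 / (\<epsilon>\<^sup>2 + 1 - fst (fst x) / T))) \<in> bm (PB T)"
				using integrand_meas measurable_pb_time[OF T] by measurable
			have "(\<integral>\<^sup>+x. ennreal ((integrand x) ^ 3 / (\<epsilon>\<^sup>2 + 1 - fst (fst x) / T)) \<partial>QM T R) <=
				(\<integral>\<^sup>+t\<in>{0..T}. ennreal (1 / (T * sqrt T * (\<epsilon>\<^sup>2 + 1 - t / T))) * (\<integral>\<^sup>+w. ennreal (1 / sqrt (l t w)) \<partial>P) \<partial>lborel)"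
			proof (rule QM_le_rows[OF R im3])
				fix r w assume r: "r \<in> {0<..T}" and lr: "\<nu> <= l r w"
				have l0: "0 < l r w" using lr nu by simp
				have wr: "0 <= wt r" using w0 r by auto
				have "(rowint R (\<lambda>x. ennreal ((integrand x) ^ 3 / (\<epsilon>\<^sup>2 + 1 - fst (fst x) / T))) w r) =
					(\<integral>\<^sup>+\<theta>. ennreal (wt r) * (ennreal ((integrand (pt w (r, \<theta>))) ^ 3) * indicator {0<..R} \<theta>) \<partial>lborel)"
					using wr by (intro nn_integral_cong) (auto simp: wt_def pt_def ennreal_mult'[symmetric] indicator_def)
				also have "... = ennreal (wt r) * (rowint R (\<lambda>x. ennreal ((integrand x) ^ 3)) w r)"
					using integrand_row_meas by (intro nn_integral_cmult) simp
				\<comment> \<open>The cube of \<open>1 / sqrt (T * l)\<close> is integrated over at most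
				  \<open>l\<close> marks, which leaves a multiple of \<open>1 / sqrt l\<close>.\<close>
				also have "... <= ennreal (wt r) * (ennreal ((1 / sqrt (T * l r w)) ^ 3) * ennreal (l r w))"
					using integrand_row[OF lr, of 3] R by (auto intro!: mult_left_mono ennreal_leI)
				also have "... = ennreal (wt r * ((1 / sqrt (T * l r w)) ^ 3 * l r w))"
					using wr l0 T by (simp add: ennreal_mult)
				also have "wt r * ((1 / sqrt (T * l r w)) ^ 3 * l r w) = 1 / (T * sqrt T * (\<epsilon>\<^sup>2 + 1 - r / T)) * (1 / sqrt (l r w))"
				proof -
					have "(sqrt (T * l r w)) ^ 3 = T * l r w * (sqrt T * sqrt (l r w))"
						using T l0 by (simp add: power3_eq_cube real_sqrt_mult[symmetric])
					then show ?thesis using l0 by (simp add: wt_def power_divide)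
				qed
				also have "ennreal ... = ennreal (1 / (T * sqrt T * (\<epsilon>\<^sup>2 + 1 - r / T))) * ennreal (1 / sqrt (l r w))"
					using l0 by (intro ennreal_mult'') simp
				finally show "(rowint R (\<lambda>x. ennreal ((integrand x) ^ 3 / (\<epsilon>\<^sup>2 + 1 - fst (fst x) / T))) w r)
					<= ennreal (1 / (T * sqrt T * (\<epsilon>\<^sup>2 + 1 - r / T))) * ennreal (1 / sqrt (l r w))" .
			qed simp_all
			also have "... <= ennreal W" by (rule third)
			finally show "(\<integral>\<^sup>+x. ennreal ((integrand x) ^ 3 / (\<epsilon>\<^sup>2 + 1 - fst (fst x) / T)) \<partial>QM T R) <= ennreal W" .
		qed
		moreover have "\<bar>expectation (\<lambda>w. heat \<epsilon> h (stat' w)) - expectation (\<lambda>w. heat \<epsilon> h (comp T R integrand w))\<bar> <= 2 * B * sqrt T / sqrt R"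
			using B(1) T R by (intro lipschitz_expectation_diff[OF hl istat' icomp[OF R] stat_comp(1)[OF R B]]) auto
		ultimately show ?thesis by linarith
	qed
	\<comment> \<open>Neither the left-hand side nor \<open>B\<close> depends on \<open>R\<close>, so
	  both truncation errors vanish in the limit.\<close>
	have lim: "\<bar>expectation (\<lambda>w. heat \<epsilon> h (stat' w)) - heat (sqrt (1 + \<epsilon>\<^sup>2)) h 0\<bar> <= 36 * W"
	proof (rule tendsto_lowerbound)
		have "((\<lambda>R. 2 * B * sqrt T / sqrt R + B / R / \<epsilon> + 36 * W) \<longlongrightarrow> 0 + 0 / \<epsilon> + 36 * W) at_top"
			by (intro tendsto_intros real_tendsto_divide_at_top[OF tendsto_const] sqrt_at_top filterlim_ident) (use \<epsilon> in auto)
		then show "((\<lambda>R. 2 * B * sqrt T / sqrt R + B / R / \<epsilon> + 36 * W) \<longlongrightarrow> 36 * W) at_top" by simp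
		show "eventually (\<lambda>R. \<bar>expectation (\<lambda>w. heat \<epsilon> h (stat' w)) - heat (sqrt (1 + \<epsilon>\<^sup>2)) h 0\<bar> <= 2 * B * sqrt T / sqrt R + B / R / \<epsilon> + 36 * W) at_top"
			using eventually_gt_at_top[of 0] by eventually_elim (rule key)
	qed simp
	have a1: "\<bar>expectation (\<lambda>w. heat \<epsilon> h (stat' w)) - expectation (\<lambda>w. h (stat' w))\<bar> <= \<epsilon>"
	proof -
		note i = integrable_lipschitz[OF hl istat'] integrable_lipschitz[OF h istat']
		have "\<bar>expectation (\<lambda>w. heat \<epsilon> h (stat' w)) - expectation (\<lambda>w. h (stat' w))\<bar> = \<bar>expectation (\<lambda>w. heat \<epsilon> h (stat' w) - h (stat' w))\<bar>"
			using i by simp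
		also have "... <= expectation (\<lambda>w. \<bar>heat \<epsilon> h (stat' w) - h (stat' w)\<bar>)" by (rule integral_abs_bound)
		also have "... <= \<epsilon>" using i heat_lipschitz(2)[OF h less_imp_le[OF \<epsilon>]] by (intro integral_le_const) auto
		finally show ?thesis .
	qed
	\<comment> \<open>The Gaussian of variance \<open>1 + \<epsilon>\<^sup>2\<close> is a standard one
	  smoothed once more at scale \<open>\<epsilon>\<close>, at the usual price.\<close>
	have a2: "\<bar>heat (sqrt (1 + \<epsilon>\<^sup>2)) h 0 - (LINT z|gauss. h z)\<bar> <= \<epsilon>"
	proof -
		have "heat (sqrt (1 + \<epsilon>\<^sup>2)) h 0 = heat \<epsilon> (heat 1 h) 0"
			using heat_semigroup[OF lin_growth_lipschitz[OF h] \<epsilon>, of 1 0] by (simp add: add.commute)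
		moreover have "\<bar>heat \<epsilon> (heat 1 h) 0 - heat 1 h 0\<bar> <= \<epsilon>"
			using \<epsilon> by (intro heat_lipschitz(2)[OF heat_lipschitz(1)[OF h]]) auto
		moreover have "heat 1 h 0 = (LINT z|gauss. h z)" by (simp add: heat_def)
		ultimately show ?thesis by simp
	qed
	show "\<bar>expectation (\<lambda>w. h (stat w)) - (LINT z|gauss. h z)\<bar> <= 36 * W + 2 * \<epsilon>"
		using lim a1 a2 Eh[OF h] by linarith
qed

end

section \<open>Time shifts and comparison of paths\<close>

text \<open>Points at times up to \<open>h\<close> move to nonpositive times, outside the range of
  the Hawkes integral: the shift erases the history before \<open>h\<close>.\<close>

definition shift :: "real => config => config" where
	"shift h w = distr w hp (\<lambda>z. z - (h, 0))"

lemma measurable_translate: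
	"sets M = sets hp ==> (\<lambda>z. z - (h, 0)) \<in> measurable M hp"
proof -
	assume "sets M = sets hp"
	then have M: "sets M = sets (restrict_space borel (UNIV \<times> {0..}))" by (simp add: measurable_half_plane)
	have "(\<lambda>z :: real \<times> real. z - (h, 0)) \<in> measurable (restrict_space borel (UNIV \<times> {0..})) (restrict_space borel (UNIV \<times> {0..}))"
		by (intro measurable_restrict_space3) auto
	then show ?thesis by (subst measurable_cong_sets[OF M measurable_half_plane])
qed

lemma vimage_translate:
	assumes "B \<in> sets hp"
	shows "(\<lambda>z. z - (h, 0)) -` B Int UNIV \<times> {0..} = (\<lambda>z. z - (h, 0)) -` B" "(\<lambda>z. z - (h, 0)) -` B \<in> sets hp"
		"emeasure hp ((\<lambda>z. z - (h, 0)) -` B) = emeasure hp B"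
proof -
	have B: "B \<in> sets borel" "B \<subseteq> UNIV \<times> {0..}" using assms by (auto simp: sets_half_plane)
	show *: "(\<lambda>z. z - (h, 0)) -` B Int UNIV \<times> {0..} = (\<lambda>z. z - (h, 0)) -` B" using B(2) by auto
	have "(\<lambda>z. z - (h, 0)) -` B \<in> sets borel" using measurable_sets[OF _ B(1), of "\<lambda>z. z - (h, 0)" borel] by simp
	with * show s: "(\<lambda>z. z - (h, 0)) -` B \<in> sets hp" by (intro sets_half_planeI) auto
	have "emeasure lborel B = emeasure (distr lborel borel (\<lambda>z. (- (h, 0)) + z)) B" by (simp add: lborel_distr_plus)
	also have "... = emeasure lborel ((\<lambda>z. z - (h, 0)) -` B)" using B(1) by (subst emeasure_distr) (auto simp: vimage_def intro!: arg_cong[where f = "emeasure lborel"])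
	finally show "emeasure hp ((\<lambda>z. z - (h, 0)) -` B) = emeasure hp B"
		by (simp add: emeasure_half_plane[OF assms] emeasure_half_plane[OF s])
qed

lemma emeasure_shift:
	assumes "w \<in> configs" "B \<in> sets hp"
	shows "emeasure (shift h w) B = emeasure w ((\<lambda>z. z - (h, 0)) -` B)"
	unfolding shift_def using assms vimage_translate(1)[OF assms(2), of h]
	by (subst emeasure_distr) (auto simp: configs_sets configs_space measurable_translate)

lemma shift_configs:
	assumes w: "w \<in> configs"
	shows "shift h w \<in> configs"
proof -
	let ?S = "(\<lambda>z. z - (h, 0)) ` pts w"
	have "finite (?S Int B)" if "bounded B" for B
	proof -
		have "bounded ((\<lambda>z. z + (h, 0)) ` B)" using bounded_translation[OF that, of "(h, 0)"] by (simp add: add.commute)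
		from finite_imageI[OF pts_finite[OF w this], of "\<lambda>z. z - (h, 0)"] show ?thesis
			by (rule finite_subset[rotated]) force
	qed
	moreover have "emeasure (shift h w) B = emeasure (count_space UNIV) (?S Int B)" if B: "B \<in> sets hp" for B
	proof -
		have "?S Int B = (\<lambda>z. z - (h, 0)) ` (pts w Int (\<lambda>z. z - (h, 0)) -` B)" by auto
		moreover have "emeasure (count_space UNIV) ((\<lambda>z. z - (h, 0)) ` A) = emeasure (count_space UNIV) A" for A :: "(real \<times> real) set"
		proof -
			have inj: "inj_on (\<lambda>z. z - (h, 0)) A" by (auto simp: inj_on_def)
			show ?thesis by (cases "finite A") (simp_all add: card_image[OF inj] finite_image_iff[OF inj])
		qed
		ultimately show ?thesis
			by (simp add: emeasure_shift[OF w B] pts_emeasure[OF w vimage_translate(2)[OF B]])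
	qed
	moreover have "?S \<subseteq> UNIV \<times> {0..}" using pts_subset[OF w] by auto
	moreover have "sets (shift h w) = sets hp" by (simp add: shift_def)
	ultimately show ?thesis unfolding configs_def by blast
qed

lemma nn_integral_shift:
	assumes "w \<in> configs" "f \<in> bm hp"
	shows "(\<integral>\<^sup>+z. f z \<partial>shift h w) = (\<integral>\<^sup>+z. f (z - (h, 0)) \<partial>w)"
	unfolding shift_def
	by (subst nn_integral_distr[OF measurable_translate[OF configs_sets[OF assms(1)]]]) (simp_all add: assms(2))

context prm begin

lemma measurable_into_configs:
	assumes "!!x. x \<in> space M ==> f x \<in> configs" "!!B. B \<in> sets hp ==> (\<lambda>x. emeasure (f x) B) \<in> bm M"
	shows "f \<in> measurable M P"
proof -
	have "f \<in> measurable M (hist_on UNIV)"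
		unfolding hist_on_def
	proof (rule measurable_measure_of)
		fix X assume "X \<in> {{w \<in> configs. emeasure w B \<in> U} | B U. B \<in> sets hp & B \<subseteq> UNIV & U \<in> sets borel}"
		then obtain B and U :: "ennreal set" where X: "X = {w \<in> configs. emeasure w B \<in> U}" and B: "B \<in> sets hp" and U: "U \<in> sets borel" by blast
		have "f -` X Int space M = (\<lambda>x. emeasure (f x) B) -` U Int space M" using assms(1) by (auto simp: X)
		then show "f -` X Int space M \<in> sets M" using measurable_sets[OF assms(2)[OF B] U] by simp
	qed (use assms(1) in auto)
	then show ?thesis using measurable_cong_sets[OF refl sets_P_hist_on] by blast
qed

lemma measurable_shift: "shift h \<in> measurable P P"
proof (rule measurable_into_configs)
	fix B assume B: "B \<in> sets hp"
	show "(\<lambda>w. emeasure (shift h w) B) \<in> bm P"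
		using measurable_count[OF vimage_translate(2)[OF B]]
		by (rule measurable_cong[THEN iffD1, rotated]) (simp add: emeasure_shift[OF _ B] space_P)
qed (simp add: space_P shift_configs)

lemma count_law_finite:
	assumes "A \<in> sets hp" "A' \<in> sets hp" "emeasure hp A = emeasure hp A'" "emeasure hp A < \<infinity>"
		and U: "U \<in> sets borel"
	shows "emeasure P {w \<in> space P. emeasure w A \<in> U} = emeasure P {w \<in> space P. emeasure w A' \<in> U}"
proof -
	have "emeasure P {w \<in> space P. emeasure w D \<in> U} =
			(\<Sum>k. indicator U (of_nat k) * ennreal (measure hp D ^ k / fact k * exp (- measure hp D)))"
		if D: "D \<in> sets hp" "emeasure hp D < \<infinity>" for D
	proof -
		note [measurable] = measurable_count[OF D(1)] U
		have "emeasure P {w \<in> space P. emeasure w D \<in> U} = (\<integral>\<^sup>+w. indicator {w \<in> space P. emeasure w D \<in> U} w \<partial>P)" by simp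
		also have "... = (\<integral>\<^sup>+w. (\<Sum>k. indicator U (of_nat k) * indicator {w \<in> space P. emeasure w D = of_nat k} w) \<partial>P)"
		proof (intro nn_integral_cong_AE, use count_nat_AE[OF D] AE_space in eventually_elim)
			case (elim w)
			then obtain j :: nat where j: "emeasure w D = of_nat j" by blast
			have "(\<Sum>k. indicator U (of_nat k) * indicator {w \<in> space P. emeasure w D = of_nat k} w :: ennreal) = (\<Sum>k\<in>{j}. indicator U (of_nat k) * indicator {w \<in> space P. emeasure w D = of_nat k} w)"
				by (rule suminf_finite) (auto simp: j)
			then show ?case using elim(2) by (simp add: j indicator_def)
		qed
		also have "... = (\<Sum>k. indicator U (of_nat k) * emeasure P {w \<in> space P. emeasure w D = of_nat k})"
			by (subst nn_integral_suminf) (auto simp: nn_integral_cmult)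
		finally show ?thesis by (simp add: emeasure_eq_measure prob_count[OF D])
	qed
	from this[of A] this[of A'] show ?thesis using assms by (simp add: measure_def)
qed

text \<open>The Poisson law is prescribed only for sets of finite area. A general set is exhausted
  by bounded pieces, and laws are compared on rays \<open>{c<..}\<close>, since the event that a
  count exceeds \<open>c\<close> is the increasing union of the corresponding events for the
  pieces.\<close>

lemma count_law_shift:
	assumes A: "A \<in> sets hp"
	shows "distr P borel (\<lambda>w. emeasure w A) = distr P borel (\<lambda>w. emeasure w ((\<lambda>z. z - (h, 0)) -` A))"
proof (rule measure_eqI_generator_eq)
	define R where "R n = {- real n..real n} \<times> {0..real n}" for n
	have Rm: "R n \<in> sets hp" for n unfolding R_def by (rule half_plane_rect) auto
	have fin: "emeasure hp (A Int R n) < \<infinity>" for n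
	proof -
		have "emeasure hp (A Int R n) <= emeasure hp (R n)" by (intro emeasure_mono Rm) auto
		also have "... < \<infinity>" unfolding R_def by (subst emeasure_half_plane_rect) (auto simp: ennreal_mult_less_top)
		finally show ?thesis .
	qed
	have UN: "(\<Union>n. A Int R n) = A"
	proof
		show "A \<subseteq> (\<Union>n. A Int R n)"
		proof
			fix z assume z: "z \<in> A"
			obtain n :: nat where "max \<bar>fst z\<bar> \<bar>snd z\<bar> <= real n" using real_arch_simple by blast
			moreover have "0 <= snd z" using z A by (auto simp: sets_half_plane)
			ultimately have "z \<in> A Int R n" using z by (cases z) (auto simp: R_def)
			then show "z \<in> (\<Union>n. A Int R n)" by blast
		qed
	qed auto
	let ?s = "\<lambda>A. (\<lambda>z. z - (h, 0)) -` A"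
	have inc: "incseq R" unfolding R_def incseq_def by auto
	have AR: "A Int R n \<in> sets hp" for n using A Rm by auto
	have lim: "emeasure P {w \<in> space P. c < emeasure w (\<Union>n. E n)} = (SUP n. emeasure P {w \<in> space P. c < emeasure w (E n)})"
		if E: "incseq E" "range E \<subseteq> sets hp" for E :: "nat => (real \<times> real) set" and c
	proof -
		have [measurable]: "(\<lambda>w. emeasure w (E n)) \<in> bm P" for n using E(2) by (intro measurable_count) auto
		have "{w \<in> space P. c < emeasure w (\<Union>n. E n)} = (\<Union>n. {w \<in> space P. c < emeasure w (E n)})"
		proof -
			have "emeasure w (\<Union>n. E n) = (SUP n. emeasure w (E n))" if "w \<in> space P" for w
				using E that configs_sets[of w] by (intro SUP_emeasure_incseq[symmetric]) (auto simp: space_P)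
			then show ?thesis by (auto simp: less_SUP_iff)
		qed
		moreover have "incseq (\<lambda>n. {w \<in> space P. c < emeasure w (E n)})"
		proof (rule incseq_SucI, safe)
			fix n w assume "w \<in> space P" and c: "c < emeasure w (E n)"
			then have s: "sets w = sets hp" by (simp add: space_P configs_sets)
			have "emeasure w (E n) <= emeasure w (E (Suc n))"
				using E(2) s by (intro emeasure_mono incseq_SucD[OF E(1)]) auto
			with c show "c < emeasure w (E (Suc n))" by (rule order.strict_trans2)
		qed
		ultimately show ?thesis by (subst SUP_emeasure_incseq) auto
	qed
	let ?G = "insert UNIV (range greaterThan) :: ennreal set set"
	show "Int_stable ?G"
	proof (rule Int_stableI)
		fix a b :: "ennreal set" assume "a \<in> ?G" "b \<in> ?G"
		moreover have "{c<..} Int {d<..} \<in> range greaterThan" for c d :: ennreal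
			by (intro range_eqI[of _ _ "max c d"]) auto
		ultimately show "a Int b \<in> ?G" by (elim insertE rangeE) auto
	qed
	show "emeasure (distr P borel (\<lambda>w. emeasure w A)) X = emeasure (distr P borel (\<lambda>w. emeasure w (?s A))) X"
		if XG: "X \<in> ?G" for X
	proof (cases "X = UNIV")
		case True
		then show ?thesis using A vimage_translate(2)[OF A] by (simp add: emeasure_distr emeasure_space_1)
	next
		case False
		then obtain c where X: "X = {c<..}" using XG by blast
		have "emeasure P {w \<in> space P. c < emeasure w (\<Union>n. A Int R n)} = emeasure P {w \<in> space P. c < emeasure w (\<Union>n. ?s (A Int R n))}"
		proof (subst (1 2) lim)
			show "incseq (\<lambda>n. A Int R n)" "incseq (\<lambda>n. ?s (A Int R n))" using inc by (fastforce simp: incseq_def)+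
			show "range (\<lambda>n. A Int R n) \<subseteq> sets hp" "range (\<lambda>n. ?s (A Int R n)) \<subseteq> sets hp"
				using AR vimage_translate(2)[OF AR] by auto
			show "(SUP n. emeasure P {w \<in> space P. c < emeasure w (A Int R n)}) = (SUP n. emeasure P {w \<in> space P. c < emeasure w (?s (A Int R n))})"
				using count_law_finite[OF AR vimage_translate(2)[OF AR] vimage_translate(3)[OF AR, symmetric] fin, of "{c<..}"]
				by (intro SUP_cong refl) auto
		qed
		also have "(\<Union>n. A Int R n) = A" by (rule UN)
		also have "(\<Union>n. ?s (A Int R n)) = ?s A" using UN by blast
		finally show ?thesis
			using A vimage_translate(2)[OF A] by (simp add: X emeasure_distr vimage_def Int_def conj_commute)
	qed
	have "sets borel = sigma_sets UNIV ?G"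
	proof -
		have "sigma_sets UNIV (range greaterThan) = sigma_sets UNIV ?G"
			by (rule sigma_sets_eqI) (auto intro: sigma_sets_top)
		then show ?thesis by (simp add: borel_Ioi)
	qed
	then show "sets (distr P borel (\<lambda>w. emeasure w A)) = sigma_sets UNIV ?G"
		"sets (distr P borel (\<lambda>w. emeasure w (?s A))) = sigma_sets UNIV ?G"
		by simp_all
	show "range (\<lambda>_ :: nat. UNIV) \<subseteq> ?G" "(\<Union>i::nat. UNIV) = (UNIV :: ennreal set)" "?G \<subseteq> Pow UNIV" by auto
	show "emeasure (distr P borel (\<lambda>w. emeasure w A)) UNIV ~= \<infinity>"
		using A by (simp add: emeasure_distr emeasure_space_1)
qed

text \<open>On cylinders the probability depends only on the joint law of the counts of disjoint
  atoms. That law is a product, both for the atoms and for their translates, and the factors agree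
  by \<open>count_law_shift\<close>.\<close>

lemma distr_shift: "distr P P (shift h) = P"
proof (rule sym, rule measure_eqI_generator_eq)
	let ?s = "\<lambda>A. (\<lambda>z. z - (h, 0)) -` A"
	define G where "G = {{w \<in> configs. \<forall>i<n. emeasure w (B i) \<in> U i} | (n::nat) B U.
		 \<forall>i<n. B i \<in> sets hp & B i \<subseteq> UNIV & U i \<in> sets borel}"
	note GG = hist_on_pi_generator[of UNIV, folded G_def]
	show "Int_stable G" "G \<subseteq> Pow configs" by (rule GG)+
	show "sets P = sigma_sets configs G" "sets (distr P P (shift h)) = sigma_sets configs G"
		using GG(2) by (simp_all add: sets_P_hist_on)
	show "range (\<lambda>_ :: nat. configs) \<subseteq> G" by (auto simp: G_def intro!: exI[of _ 0])
	show "(\<Union>i::nat. configs) = configs" "emeasure P configs ~= \<infinity>" by (simp_all add: emeasure_eq_measure)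
	fix X assume "X \<in> G"
	then obtain n :: nat and B and U :: "nat => ennreal set" where X: "X = {w \<in> configs. \<forall>i<n. emeasure w (B i) \<in> U i}"
		and BU: "!!i. i < n ==> B i \<in> sets hp" "!!i. i < n ==> U i \<in> sets borel" unfolding G_def by blast
	obtain m :: nat and A and K :: "nat => nat set" where A: "!!k. k < m ==> A k \<in> sets hp"
		"disjoint_family_on A {..<m}" "!!i. i < n ==> K i \<subseteq> {..<m}" "!!i. i < n ==> B i = (\<Union>k\<in>K i. A k)"
		using half_plane_atoms[of n B] BU(1) by metis
	\<comment> \<open>An empty set at index \<open>m\<close> keeps the index set nonempty even when
	  there are no atoms.\<close>
	define A' where "A' k = (if k < m then A k else {})" for k
	have A': "A' k \<in> sets hp" for k using A(1) by (simp add: A'_def)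
	have dj: "disjoint_family_on A' {..m}" using A(2) by (auto simp: A'_def disjoint_family_on_def)
	have BA: "B i = (\<Union>k\<in>K i. A' k)" if "i < n" for i using A(3,4)[OF that] by (force simp: A'_def)
	define E where "E = {f \<in> space (\<Pi>\<^sub>M k\<in>{..m}. (borel :: ennreal measure)). \<forall>i\<in>{..<n}. (\<Sum>k\<in>K i. f k) \<in> U i}"
	have Em: "E \<in> sets (\<Pi>\<^sub>M k\<in>{..m}. (borel :: ennreal measure))"
		unfolding E_def
	proof (intro sets.sets_Collect_finite_All)
		fix i assume i: "i \<in> {..<n}"
		have "(\<lambda>f. \<Sum>k\<in>K i. f k) \<in> bm (\<Pi>\<^sub>M k\<in>{..m}. (borel :: ennreal measure))"
			using A(3)[of i] i by (intro borel_measurable_sum measurable_component_singleton) auto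
		from measurable_sets[OF this BU(2)[of i]] i
		show "{f \<in> space (\<Pi>\<^sub>M k\<in>{..m}. (borel :: ennreal measure)). (\<Sum>k\<in>K i. f k) \<in> U i} \<in> sets (\<Pi>\<^sub>M k\<in>{..m}. borel)"
			by (simp add: vimage_def Int_def conj_commute)
	qed auto
	have J: "emeasure P {w \<in> space P. \<forall>i<n. emeasure w (\<Union>k\<in>K i. D k) \<in> U i} = emeasure (\<Pi>\<^sub>M k\<in>{..m}. distr P borel (\<lambda>w. emeasure w (D k))) E"
		if D: "!!k. D k \<in> sets hp" "disjoint_family_on D {..m}" for D :: "nat => (real \<times> real) set"
	proof -
		have iv: "indep_vars (\<lambda>_. borel) (\<lambda>k w. emeasure w (D k)) {..m}" using D by (intro indep_counts) auto
		have "(\<Pi>\<^sub>M k\<in>{..m}. distr P borel (\<lambda>w. emeasure w (D k))) = distr P (\<Pi>\<^sub>M k\<in>{..m}. borel) (\<lambda>w. \<lambda>k\<in>{..m}. emeasure w (D k))"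
			using iv D(1) by (subst (asm) indep_vars_iff_distr_eq_PiM') auto
		moreover have "(\<lambda>w. \<lambda>k\<in>{..m}. emeasure w (D k)) \<in> measurable P (\<Pi>\<^sub>M k\<in>{..m}. borel)"
			using D(1) by (intro measurable_restrict) auto
		moreover have "(\<lambda>w. \<lambda>k\<in>{..m}. emeasure w (D k)) -` E Int space P = {w \<in> space P. \<forall>i<n. emeasure w (\<Union>k\<in>K i. D k) \<in> U i}"
		proof -
			have "emeasure w (\<Union>k\<in>K i. D k) = (\<Sum>k\<in>K i. (\<lambda>k\<in>{..m}. emeasure w (D k)) k)" if "w \<in> space P" "i < n" for w i
			proof -
				have "finite (K i)" "K i \<subseteq> {..m}" using A(3)[OF that(2)] finite_subset[of "K i"] by auto
				moreover have "disjoint_family_on D (K i)" using D(2) calculation(2) by (rule disjoint_family_on_mono[rotated])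
				ultimately show ?thesis using that(1) D(1)
					by (subst emeasure_config_UN) (auto simp: space_P intro!: sum.cong)
			qed
			then show ?thesis by (auto simp: E_def space_PiM)
		qed
		ultimately show ?thesis using Em by (simp add: emeasure_distr)
	qed
	have "emeasure P X = emeasure P {w \<in> space P. \<forall>i<n. emeasure w (\<Union>k\<in>K i. A' k) \<in> U i}"
		by (simp add: X space_P BA)
	also have "... = emeasure P {w \<in> space P. \<forall>i<n. emeasure w (\<Union>k\<in>K i. ?s (A' k)) \<in> U i}"
	proof -
		have dj': "disjoint_family_on (\<lambda>k. ?s (A' k)) {..m}" using dj unfolding disjoint_family_on_def by blast
		show ?thesis
			unfolding J[OF A' dj] J[OF vimage_translate(2)[OF A'] dj'] by (intro arg_cong2[where f = emeasure] PiM_cong refl count_law_shift A')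
	qed
	also have "{w \<in> space P. \<forall>i<n. emeasure w (\<Union>k\<in>K i. ?s (A' k)) \<in> U i} = shift h -` X Int space P"
	proof -
		have "emeasure (shift h w) (B i) = emeasure w (\<Union>k\<in>K i. ?s (A' k))" if "w \<in> configs" "i < n" for w i
			using emeasure_shift[OF that(1) BU(1)[OF that(2)], of h] by (simp add: BA[OF that(2)] vimage_UN)
		then show ?thesis by (auto simp: X space_P shift_configs)
	qed
	also have "emeasure P ... = emeasure (distr P P (shift h)) X"
	proof -
		have "X \<in> sets P" using \<open>X \<in> G\<close> GG(2) by (auto simp: sets_P_hist_on)
		then show ?thesis by (simp add: emeasure_distr[OF measurable_shift])
	qed
	finally show "emeasure P X = emeasure (distr P P (shift h)) X" .
qed

lemma AE_shift: "(AE w in P. Q w) ==> AE w in P. Q (shift h w)"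
proof -
	assume "AE w in P. Q w"
	then have "AE w in distr P P (shift h). Q w" by (simp only: distr_shift)
	then show ?thesis by (rule AE_distrD[OF measurable_shift])
qed

end

text \<open>Induction on the number of thinned points of the smaller path: every such point before \<open>t\<close> has
	fewer of them before it, hence is also thinned by the larger path.\<close>

lemma path_compare:
	assumes w: "w \<in> configs" and \<psi>: "!!t. 0 <= t ==> 0 <= \<psi> t"
		and k: "!!t. t \<in> {0..S} ==> ennreal (k t) <= c + (\<integral>\<^sup>+z\<in>past t. ennreal (\<psi> (t - fst z) * of_bool (snd z <= k (fst z))) \<partial>w)"
		and l: "!!t. t \<in> {0..S} ==> c + (\<integral>\<^sup>+z\<in>past t. ennreal (\<psi> (t - fst z) * of_bool (snd z <= l (fst z))) \<partial>w) <= ennreal (l t)"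
			"!!t. t \<in> {0..S} ==> 0 <= l t"
		and fin: "finite {z \<in> pts w. z \<in> past S & snd z <= k (fst z)}" and t: "t \<in> {0..S}"
	shows "k t <= l t"
	using t
proof (induction "card {z \<in> pts w. z \<in> past t & snd z <= k (fst z)}" arbitrary: t rule: less_induct)
	case less
	have fin': "finite {z \<in> pts w. z \<in> past t & snd z <= k (fst z)}" using less.prems by (intro finite_subset[OF _ fin]) (auto simp: past_def)
	have le: "snd z <= l (fst z)" if z: "z \<in> pts w" "z \<in> past t" "snd z <= k (fst z)" for z
	proof -
		let ?N = "\<lambda>t. {y \<in> pts w. y \<in> past t & snd y <= k (fst y)}"
		have "?N (fst z) \<subseteq> ?N t" "z \<in> ?N t" "z \<notin> ?N (fst z)" using z by (auto simp: past_def)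
		then have "?N (fst z) \<subset> ?N t" by blast
		from less.hyps[OF psubset_card_mono[OF fin' this]] have "k (fst z) <= l (fst z)"
			using z(2) less.prems by (auto simp: past_def)
		then show ?thesis using z(3) by simp
	qed
	have "ennreal (k t) <= c + (\<integral>\<^sup>+z\<in>past t. ennreal (\<psi> (t - fst z) * of_bool (snd z <= k (fst z))) \<partial>w)" by (rule k[OF less.prems])
	also have "... <= c + (\<integral>\<^sup>+z\<in>past t. ennreal (\<psi> (t - fst z) * of_bool (snd z <= l (fst z))) \<partial>w)"
		using pts_AE[OF w] le by (intro add_left_mono nn_integral_mono_AE) (auto elim!: eventually_mono simp: indicator_def)
	also have "... <= ennreal (l t)" by (rule l(1)[OF less.prems])
	finally show ?case using l(2)[OF less.prems] by simp
qed

section \<open>Monotonicity in time of the law of the intensity\<close>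

context hawkes begin

text \<open>The mean number of thinned points is the integral of \<open>mean\<close>, which is
  bounded. This excludes accumulation up to \<open>T\<close> and supplies the induction of
  \<open>path_compare\<close>.\<close>

lemma thinned_finite: "AE w in P. finite {z \<in> pts w. z \<in> past T & snd z <= l (fst z) w}"
proof -
	obtain B where B: "0 <= B" "!!t. t \<in> {0..T} ==> mean t <= ennreal B" by (rule mean_bounded) blast
	let ?N = "\<lambda>w. \<integral>\<^sup>+z\<in>strip T. 1 * of_bool (snd z <= l (fst z) w) \<partial>w"
	have "(\<integral>\<^sup>+w. ?N w \<partial>P) = (\<integral>\<^sup>+s\<in>{0..T}. (\<integral>\<^sup>+w. 1 * ennreal (l s w) \<partial>P) \<partial>lborel)"
		by (rule thin_integral(1)) simp
	also have "... <= (\<integral>\<^sup>+s. ennreal B * indicator {0..T} s \<partial>lborel)"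
		using B(2) by (intro nn_integral_mono) (auto simp: mean_def indicator_def)
	also have "... < \<infinity>"
		by (subst nn_integral_cmult_indicator) (auto simp: emeasure_lborel_Icc_eq ennreal_mult_less_top)
	finally have "AE w in P. ?N w ~= \<infinity>"
		by (intro nn_integral_PInf_AE thin_integral(2)) auto
	with AE_space show ?thesis
	proof eventually_elim
		case (elim w)
		then have w: "w \<in> configs" by (simp add: space_P)
		let ?A = "{z \<in> pts w. z \<in> past T & snd z <= l (fst z) w}"
		have "emeasure w ?A = (\<integral>\<^sup>+z. of_bool (z \<in> past T & snd z <= l (fst z) w) \<partial>w)" by (rule nn_integral_pts[OF w, symmetric])
		also have "... <= ?N w" by (intro nn_integral_mono) (auto simp: indicator_def past_def)
		finally have "emeasure w ?A ~= \<infinity>" using elim(2) by (auto simp: top_unique)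
		moreover have "emeasure w ?A = emeasure (count_space UNIV) (pts w Int ?A)"
			by (rule pts_emeasure[OF w thinned_set_measurable[OF w]]) auto
		ultimately show ?case by (auto simp: emeasure_count_space Int_absorb1 split: if_splits)
	qed
qed

lemma path_integrand_meas:
	assumes w: "w \<in> configs" and t: "t <= T"
	shows "(\<lambda>z. ennreal (\<psi> (t - fst z) * of_bool (snd z <= l (fst z) w)) * indicator (past t) z) \<in> bm hp"
proof -
	let ?B = "borel \<Otimes>\<^sub>M borel :: config"
	have [measurable]: "(\<lambda>z. indicator {0..} (t - fst z) * \<psi> (t - fst z)) \<in> bm ?B"
		by (rule measurable_compose[OF _ psi_meas]) measurable
	have [measurable]: "(\<lambda>z. l (clamp T (fst z)) w) \<in> bm ?B"
		by (rule measurable_compose[OF _ l_meas_t[OF w]]) measurable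
	have [measurable]: "past t \<in> sets ?B" unfolding past_def by measurable
	have "(\<lambda>z. ennreal (indicator {0..} (t - fst z) * \<psi> (t - fst z)) * indicator {z \<in> space ?B. snd z <= l (clamp T (fst z)) w} z * indicator (past t) z) \<in> bm borel"
		unfolding borel_prod[symmetric] by measurable
	also have "(\<lambda>z. ennreal (indicator {0..} (t - fst z) * \<psi> (t - fst z)) * indicator {z \<in> space ?B. snd z <= l (clamp T (fst z)) w} z * indicator (past t) z) =
		(\<lambda>z. ennreal (\<psi> (t - fst z) * of_bool (snd z <= l (fst z) w)) * indicator (past t) z)"
		using t by (auto simp: fun_eq_iff past_def indicator_def clamp_id space_pair_measure)
	finally show ?thesis unfolding half_plane_def by (intro measurable_restrict_space1) simp
qed

text \<open>The path driven by the shifted points starts without history at the instant that is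
  \<open>h\<close> in the original time. The original path, continued from there, is driven by the
  same points but carries additional nonnegative excitation, so \<open>path_compare\<close>
  applies.\<close>

lemma shift_le:
	assumes h: "0 <= h" and t: "0 <= t" "t + h <= T"
	shows "AE w in P. l t (shift h w) <= l (t + h) w"
	using AE_shift[OF path_AE, of h] AE_shift[OF thinned_finite, of h] path_AE
proof eventually_elim
	case (elim w)
	then have w: "w \<in> configs" and w': "shift h w \<in> configs" by simp_all
	have path: "hawkes_path \<nu> \<psi> T (\<lambda>t. l t w) w" using elim by simp
	show ?case
	proof (rule path_compare[where S = "T - h" and c = "ennreal \<nu>" and k = "\<lambda>t. l t (shift h w)" and l = "\<lambda>t. l (t + h) w", OF w' psi_nonneg])
		fix s assume s: "s \<in> {0..T - h}"
		show "ennreal (l s (shift h w)) <= ennreal \<nu> + (\<integral>\<^sup>+z\<in>past s. ennreal (\<psi> (s - fst z) * of_bool (snd z <= l (fst z) (shift h w))) \<partial>shift h w)"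
			using elim(1) s h by (simp add: hawkes_path_alt)
		show "0 <= l (s + h) w" using hawkes_path_ge[OF path, of "s + h"] s h nu by simp
		have m: "(\<lambda>z. ennreal (\<psi> (s - fst z) * of_bool (snd z <= l (fst z + h) w)) * indicator (past s) z) \<in> bm hp"
		proof -
			have "(\<lambda>z. ennreal (\<psi> (s + h - fst (z - (-h, 0))) * of_bool (snd (z - (-h, 0)) <= l (fst (z - (-h, 0))) w)) * indicator (past (s + h)) (z - (-h, 0)) * indicator (past s) z) \<in> bm hp"
				using s by (intro borel_measurable_times_ennreal[OF measurable_compose[OF measurable_translate[OF refl] path_integrand_meas[OF w]]
					borel_measurable_indicator[OF past_sets]]) auto
			also have "(\<lambda>z. ennreal (\<psi> (s + h - fst (z - (-h, 0))) * of_bool (snd (z - (-h, 0)) <= l (fst (z - (-h, 0))) w)) * indicator (past (s + h)) (z - (-h, 0)) * indicator (past s) z) =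
				(\<lambda>z. ennreal (\<psi> (s - fst z) * of_bool (snd z <= l (fst z + h) w)) * indicator (past s) z)"
				using h by (auto simp: fun_eq_iff past_def indicator_def)
			finally show ?thesis .
		qed
		have "(\<integral>\<^sup>+z\<in>past s. ennreal (\<psi> (s - fst z) * of_bool (snd z <= l (fst z + h) w)) \<partial>shift h w) =
				(\<integral>\<^sup>+z. ennreal (\<psi> (s - fst (z - (h, 0))) * of_bool (snd (z - (h, 0)) <= l (fst (z - (h, 0)) + h) w)) * indicator (past s) (z - (h, 0)) \<partial>w)"
			by (rule nn_integral_shift[OF w m])
		\<comment> \<open>The right-hand side also collects the points at times in \<open>{0<..h}\<close>,
		  which the shift has removed from the left.\<close>
		also have "... <= (\<integral>\<^sup>+z\<in>past (s + h). ennreal (\<psi> (s + h - fst z) * of_bool (snd z <= l (fst z) w)) \<partial>w)"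
			using h by (intro nn_integral_mono) (auto simp: past_def indicator_def algebra_simps)
		finally have "ennreal \<nu> + (\<integral>\<^sup>+z\<in>past s. ennreal (\<psi> (s - fst z) * of_bool (snd z <= l (fst z + h) w)) \<partial>shift h w) <=
				ennreal \<nu> + (\<integral>\<^sup>+z\<in>past (s + h). ennreal (\<psi> (s + h - fst z) * of_bool (snd z <= l (fst z) w)) \<partial>w)" by (rule add_left_mono)
		also have "... = ennreal (l (s + h) w)" using path s h by (simp add: hawkes_path_alt)
		finally show "ennreal \<nu> + (\<integral>\<^sup>+z\<in>past s. ennreal (\<psi> (s - fst z) * of_bool (snd z <= l (fst z + h) w)) \<partial>shift h w) <= ennreal (l (s + h) w)" .
	next
		show "finite {z \<in> pts (shift h w). z \<in> past (T - h) & snd z <= l (fst z) (shift h w)}"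
			using h by (intro finite_subset[OF _ elim(2)]) (auto simp: past_def)
		show "t \<in> {0..T - h}" using t by simp
	qed
qed

text \<open>The intensity at time \<open>s\<close> along the configuration shifted by
  \<open>t - s\<close> lies below the one at time \<open>t\<close>, and by
  \<open>distr_shift\<close> it has the law of the intensity at \<open>s\<close>. Only values above
  \<open>\<nu>\<close> occur, so monotonicity is asked for there.\<close>

lemma expectation_antitone:
	fixes g :: "real => ennreal"
	assumes g: "g \<in> bm borel" "!!x y. \<nu> <= x ==> x <= y ==> g y <= g x" and s: "0 <= s" "s <= t" "t <= T"
	shows "(\<integral>\<^sup>+w. g (l t w) \<partial>P) <= (\<integral>\<^sup>+w. g (l s w) \<partial>P)"
proof -
	have le: "AE w in P. l s (shift (t - s) w) <= l t w" using shift_le[of "t - s" s] s by simp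
	have "(\<integral>\<^sup>+w. g (l t w) \<partial>P) <= (\<integral>\<^sup>+w. g (l s (shift (t - s) w)) \<partial>P)"
	proof (intro nn_integral_mono_AE, use le AE_shift[OF l_ge, of "t - s"] in eventually_elim)
		case (elim w) then show ?case using s by (intro g(2)) auto
	qed
	also have "... = (\<integral>\<^sup>+w. g (l s w) \<partial>distr P P (shift (t - s)))"
		using measurable_compose[OF l_meas_P[of s] g(1)] s by (subst nn_integral_distr[OF measurable_shift]) auto
	finally show ?thesis by (simp add: distr_shift)
qed

end

section \<open>The effect of an added point\<close>

text \<open>\<open>add_point\<close> replaces the mass at \<open>z\<close> by one instead of
  increasing it, hence the condition that \<open>z\<close> carries no mass; for a fixed point this
  holds almost surely.\<close>

lemma nn_integral_add_point:
	assumes w: "w \<in> configs" and z: "z \<in> UNIV \<times> {0..}" "emeasure w {z} = 0" and f: "f \<in> bm hp"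
	shows "(\<integral>\<^sup>+y. f y \<partial>add_point z w) = (\<integral>\<^sup>+y. f y \<partial>w) + f z"
	using f
proof (induction f rule: borel_measurable_induct)
	case (cong f g)
	have "z \<in> space hp" using z by (simp add: space_half_plane)
	then have "(\<integral>\<^sup>+y. f y \<partial>w) = (\<integral>\<^sup>+y. g y \<partial>w)" "(\<integral>\<^sup>+y. f y \<partial>add_point z w) = (\<integral>\<^sup>+y. g y \<partial>add_point z w)" "f z = g z"
		using cong(3) configs_space[OF w] configs_space[OF add_point_configs[OF w z(1)]] by (auto intro!: nn_integral_cong simp: space_half_plane)
	then show ?case using cong(4) by simp
next
	case (set A)
	have s: "A \<in> sets w" "A \<in> sets (add_point z w)" "{z} \<in> sets w"
		using set configs_sets[OF w] configs_sets[OF add_point_configs[OF w z(1)]] sing_half_plane[OF z(1)] by auto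
	then show ?case using emeasure_add_point[OF w z(1) set] z(2) by (simp add: emeasure_Diff_null_set null_setsI)
next
	case (mult u c)
	then have "u \<in> bm w" "u \<in> bm (add_point z w)"
		using configs_sets[OF w] configs_sets[OF add_point_configs[OF w z(1)]] measurable_cong_sets by blast+
	then show ?case using mult by (simp add: nn_integral_cmult distrib_left)
next
	case (add u v)
	then have "u \<in> bm w" "u \<in> bm (add_point z w)" "v \<in> bm w" "v \<in> bm (add_point z w)"
		using configs_sets[OF w] configs_sets[OF add_point_configs[OF w z(1)]] measurable_cong_sets by blast+
	then show ?case using add by (simp add: nn_integral_add algebra_simps)
next
	case (seq U)
	then have m: "U i \<in> bm w" "U i \<in> bm (add_point z w)" for i
		using configs_sets[OF w] configs_sets[OF add_point_configs[OF w z(1)]] measurable_cong_sets by blast+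
	have "(\<integral>\<^sup>+y. (SUP i. U i) y \<partial>add_point z w) = (SUP i. (\<integral>\<^sup>+y. U i y \<partial>w) + U i z)"
		using nn_integral_monotone_convergence_SUP[OF seq(3) m(2)] seq by (simp add: SUP_apply image_comp)
	also have "... = (SUP i. (\<integral>\<^sup>+y. U i y \<partial>w)) + (SUP i. U i z)"
		using seq(3) by (intro ennreal_SUP_add) (auto simp: incseq_def intro!: nn_integral_mono dest: le_funD)
	also have "(SUP i. (\<integral>\<^sup>+y. U i y \<partial>w)) = (\<integral>\<^sup>+y. (SUP i. U i) y \<partial>w)"
		using nn_integral_monotone_convergence_SUP[OF seq(3) m(1)] by (simp add: SUP_apply image_comp)
	finally show ?case by (simp add: SUP_apply image_comp)
qed

text \<open>Three estimates are chained: \<open>1 - sqrt r \<ge> (1 - r) / 2\<close>, then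
  \<open>x / y \<le> x / (x + p)\<close>, then \<open>x + p \<le> x * (1 + c / \<nu>)\<close>.
  Squaring gives the power \<open>x\<^sup>2\<close> in the denominator, the fourth power of
  \<open>sqrt x\<close>.\<close>

lemma defect_lower_bound:
	fixes x p y \<nu> c :: real
	assumes "0 < \<nu>" "\<nu> <= x" "0 <= p" "p <= c" "x + p <= y"
	shows "p\<^sup>2 / (4 * (1 + c / \<nu>)\<^sup>2 * x\<^sup>2) <= (1 - sqrt (x / y))\<^sup>2"
proof -
	have pos: "0 < x" "0 < y" "0 <= c" using assms by auto
	have "0 <= (1 - sqrt (x / y))\<^sup>2" by simp
	also have "... = 1 + x / y - 2 * sqrt (x / y)" using pos by (simp add: power2_diff)
	finally have 1: "(1 - x / y) / 2 <= 1 - sqrt (x / y)" by simp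
	have "x / y <= x / (x + p)" using assms pos by (intro divide_left_mono mult_pos_pos) auto
	moreover have "1 - x / (x + p) = p / (x + p)" using assms pos by (simp add: field_simps)
	ultimately have 2: "p / (x + p) <= 1 - x / y" by simp
	have "c * 1 <= c * (x / \<nu>)" using assms pos by (intro mult_left_mono) auto
	then have "x + p <= x * (1 + c / \<nu>)" using assms by (simp add: algebra_simps)
	then have "p / (x * (1 + c / \<nu>)) <= p / (x + p)" using assms pos by (intro divide_left_mono mult_pos_pos) (auto intro!: add_pos_nonneg)
	then have "p / (x * (1 + c / \<nu>)) / 2 <= (1 - x / y) / 2" by (rule divide_right_mono[OF order.trans[OF _ 2]]) simp
	also note 1
	finally have "p / (x * (1 + c / \<nu>)) / 2 <= 1 - sqrt (x / y)" .
	then have "(p / (x * (1 + c / \<nu>)) / 2)\<^sup>2 <= (1 - sqrt (x / y))\<^sup>2"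
		using assms pos by (intro power_mono) auto
	also have "(p / (x * (1 + c / \<nu>)) / 2)\<^sup>2 = p\<^sup>2 / (4 * (1 + c / \<nu>)\<^sup>2 * x\<^sup>2)"
		by (simp only: power_divide power_mult_distrib divide_divide_eq_left) (simp add: mult_ac)
	finally show ?thesis .
qed

lemma (in prm) measurable_add_point:
	assumes z: "z \<in> UNIV \<times> {0..}"
	shows "add_point z \<in> measurable P P"
proof (rule measurable_into_configs)
	fix B assume B: "B \<in> sets hp"
	have "B - {z} \<in> sets hp" using B sing_half_plane[OF z] by auto
	then have "(\<lambda>w. emeasure w (B - {z}) + indicator B z) \<in> bm P" by measurable
	then show "(\<lambda>w. emeasure (add_point z w) B) \<in> bm P"
		by (rule measurable_cong[THEN iffD1, rotated]) (simp add: emeasure_add_point[OF _ z B] space_P)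
qed (simp add: space_P add_point_configs[OF _ z])

lemma (in prm) no_point_AE: "0 <= \<theta> ==> AE w in P. emeasure w {(t, \<theta>)} = 0"
proof -
	assume "0 <= \<theta>"
	then have s: "{(t, \<theta>)} \<in> sets hp" by (intro sing_half_plane) simp
	have e: "emeasure hp {(t, \<theta>)} = 0" by (simp add: emeasure_half_plane[OF s])
	have "prob {w \<in> space P. emeasure w {(t, \<theta>)} = 0} = 1" using prob_count[OF s, of 0] by (simp add: e measure_def)
	from AE_prob_1[OF this] show ?thesis by eventually_elim simp
qed

section \<open>A lower bound for the first expectation\<close>

context hawkes begin

definition dominated :: "real => config => bool" where
	"dominated t w \<longleftrightarrow> w \<in> configs & (\<forall>s\<in>{0..T}. \<nu> <= l s w & l s w <= l s (add_point (t, 0) w)) &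
		 (\<forall>s\<in>{t<..T}. l s w + \<psi> (s - t) <= l s (add_point (t, 0) w))"

text \<open>More points give a larger intensity by \<open>path_compare\<close>. The added point has
  mark 0 and is therefore thinned under any nonnegative intensity, so its full kernel
  \<open>\<psi> (s - t)\<close> is added at every later time.\<close>

lemma dominated_AE:
	assumes t: "0 < t" "t <= T"
	shows "AE w in P. dominated t w"
proof -
	have "AE w in P. hawkes_path \<nu> \<psi> T (\<lambda>s. l s (add_point (t, 0) w)) (add_point (t, 0) w)"
		using intensity t by (simp add: hawkes_intensity_def)
	from this path_AE thinned_finite no_point_AE[OF order_refl, of t] show ?thesis
	proof eventually_elim
		case (elim w)
		then have w: "w \<in> configs" and path: "hawkes_path \<nu> \<psi> T (\<lambda>t. l t w) w" by simp_all
		let ?\<eta> = "add_point (t, 0) w"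
		have \<eta>: "?\<eta> \<in> configs" using add_point_configs[OF w, of "(t, 0)"] by simp
		let ?f = "\<lambda>w' s z. ennreal (\<psi> (s - fst z) * of_bool (snd z <= l (fst z) w')) * indicator (past s) z"
		have eq: "ennreal (l s ?\<eta>) = ennreal \<nu> + ((\<integral>\<^sup>+z. ?f ?\<eta> s z \<partial>w) + ?f ?\<eta> s (t, 0))" if "s \<in> {0..T}" for s
			using elim(1) that nn_integral_add_point[OF w _ elim(4) path_integrand_meas[OF \<eta>, of s]] by (simp add: hawkes_path_alt)
		have ge: "\<nu> <= l s ?\<eta>" if "s \<in> {0..T}" for s using hawkes_path_ge[OF elim(1) that] .
		have le: "l s w <= l s ?\<eta>" if "s \<in> {0..T}" for s
		proof (rule path_compare[where S = T and c = "ennreal \<nu>" and k = "\<lambda>s. l s w" and l = "\<lambda>s. l s ?\<eta>", OF w psi_nonneg])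
			fix s assume s: "s \<in> {0..T}"
			show "ennreal (l s w) <= ennreal \<nu> + (\<integral>\<^sup>+z. ?f w s z \<partial>w)" using path s by (simp add: hawkes_path_alt)
			show "ennreal \<nu> + (\<integral>\<^sup>+z. ?f ?\<eta> s z \<partial>w) <= ennreal (l s ?\<eta>)" unfolding eq[OF s] by (intro add_left_mono) simp
			show "0 <= l s ?\<eta>" using ge[OF s] nu by simp
		qed (use elim(3) that in simp_all)
		have "l s w + \<psi> (s - t) <= l s ?\<eta>" if s: "s \<in> {t<..T}" for s
		proof -
			have s': "s \<in> {0..T}" using s t by simp
			have p: "0 <= \<psi> (s - t)" using s by (intro psi_nonneg) simp
			have l0: "0 <= l s w" using hawkes_path_ge[OF path s'] nu by simp
			have "ennreal (l s w + \<psi> (s - t)) = ennreal \<nu> + ((\<integral>\<^sup>+z. ?f w s z \<partial>w) + ennreal (\<psi> (s - t)))"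
				using path s' p l0 by (simp add: hawkes_path_alt add.assoc)
			also have "... <= ennreal \<nu> + ((\<integral>\<^sup>+z. ?f ?\<eta> s z \<partial>w) + ?f ?\<eta> s (t, 0))"
			proof (intro add_left_mono add_mono nn_integral_mono_AE)
				show "AE z in w. ?f w s z <= ?f ?\<eta> s z"
				proof (rule AE_I2)
					fix z
					show "?f w s z <= ?f ?\<eta> s z"
					proof (cases "z \<in> past s")
						case True
						then have "l (fst z) w <= l (fst z) ?\<eta>" using s' by (intro le) (auto simp: past_def)
						then show ?thesis by (auto simp: of_bool_def)
					qed simp
				qed
				\<comment> \<open>Mark 0 lies below the intensity at \<open>t\<close>, which is at least
				  \<open>\<nu>\<close> along the enlarged configuration.\<close>
				show "ennreal (\<psi> (s - t)) <= ?f ?\<eta> s (t, 0)" using s t ge[of t] nu by (simp add: past_def)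
			qed
			also have "... = ennreal (l s ?\<eta>)" by (rule eq[OF s', symmetric])
			finally show ?thesis using ge[OF s'] nu by (subst (asm) ennreal_le_iff) auto
		qed
		with le show ?case using hawkes_path_ge[OF path] by (simp add: dominated_def w)
	qed
qed

text \<open>The integrand of \<open>shift_defect\<close> with clamped time, which is jointly
  measurable on the whole line.\<close>

definition defect :: "real => real => config => real" where
	"defect t s w = (1 - sqrt (l (clamp T s) w / l (clamp T s) (add_point (t, 0) w)))\<^sup>2"

lemma defect_meas: "(\<lambda>x. defect t (snd x) (fst x)) \<in> bm (P \<Otimes>\<^sub>M borel)"
proof -
	note m = measurable_pred_clamp[OF T0 l_meas]
	have [measurable]: "(\<lambda>x. l (clamp T (snd x)) (fst x)) \<in> bm (P \<Otimes>\<^sub>M borel)"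
		using measurable_compose[OF _ m, of "\<lambda>x. (snd x, fst x)" "P \<Otimes>\<^sub>M borel"] by simp
	have [measurable]: "add_point (t, 0) \<in> measurable P P" by (rule measurable_add_point) simp
	have "(\<lambda>x. (snd x, add_point (t, 0) (fst x))) \<in> measurable (P \<Otimes>\<^sub>M borel) (borel \<Otimes>\<^sub>M P)" by measurable
	from measurable_compose[OF this m] have [measurable]: "(\<lambda>x. l (clamp T (snd x)) (add_point (t, 0) (fst x))) \<in> bm (P \<Otimes>\<^sub>M borel)" by simp
	show ?thesis unfolding defect_def by measurable
qed

lemma shift_defect_alt:
	assumes "0 <= t"
	shows "shift_defect l T t w = (LBINT s. indicator {t..T} s * defect t s w)"
	unfolding shift_defect_def set_lebesgue_integral_def using assms
	by (intro Bochner_Integration.integral_cong) (auto simp: indicator_def defect_def clamp_id)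

lemma shift_defect_meas:
	assumes "0 <= t"
	shows "shift_defect l T t \<in> bm P"
proof -
	have "(\<lambda>x. indicator {t..T} (snd x) * defect t (snd x) (fst x)) \<in> bm (P \<Otimes>\<^sub>M lborel)"
		using defect_meas[of t] by measurable
	then have "(\<lambda>w. LBINT s. indicator {t..T} s * defect t s w) \<in> bm P"
		by (intro lborel.borel_measurable_lebesgue_integral) (simp add: case_prod_beta')
	then show ?thesis by (rule measurable_cong[THEN iffD1, rotated]) (simp add: shift_defect_alt[OF assms])
qed

lemma shift_defect_nn:
	assumes t: "0 <= t" "t <= T" and d: "dominated t w"
	shows "ennreal (shift_defect l T t w) = (\<integral>\<^sup>+s. ennreal (indicator {t..T} s * defect t s w) \<partial>lborel)"
		"0 <= shift_defect l T t w" "shift_defect l T t w <= T" "!!s. defect t s w <= 1"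
proof -
	have w: "w \<in> space P" using d by (simp add: dominated_def space_P)
	show le1: "defect t s w <= 1" for s
	proof -
		have "clamp T s \<in> {0..T}" using T by (simp add: clamp_def)
		then have "\<nu> <= l (clamp T s) w" "l (clamp T s) w <= l (clamp T s) (add_point (t, 0) w)" using d unfolding dominated_def by blast+
		then have "0 <= l (clamp T s) w / l (clamp T s) (add_point (t, 0) w)" "l (clamp T s) w / l (clamp T s) (add_point (t, 0) w) <= 1"
			using nu by auto
		then have "0 <= 1 - sqrt (l (clamp T s) w / l (clamp T s) (add_point (t, 0) w))" "1 - sqrt (l (clamp T s) w / l (clamp T s) (add_point (t, 0) w)) <= 1"
			by auto
		then show ?thesis unfolding defect_def by (rule power_le_one)
	qed
	have m: "(\<lambda>s. indicator {t..T} s * defect t s w) \<in> bm lborel"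
		using measurable_compose[OF measurable_Pair1'[OF w] defect_meas[of t]] by simp
	have b: "0 <= indicator {t..T} s * defect t s w" "indicator {t..T} s * defect t s w <= indicator {t..T} s" for s
		using le1[of s] by (auto simp: indicator_def defect_def)
	have i: "integrable lborel (indicator {t..T} :: real => real)" using t by (auto simp: emeasure_lborel_Icc_eq)
	have int: "integrable lborel (\<lambda>s. indicator {t..T} s * defect t s w)"
		by (rule Bochner_Integration.integrable_bound[OF i m]) (use b in \<open>auto simp: abs_of_nonneg\<close>)
	show "ennreal (shift_defect l T t w) = (\<integral>\<^sup>+s. ennreal (indicator {t..T} s * defect t s w) \<partial>lborel)"
		using b(1) by (subst nn_integral_eq_integral[OF int]) (auto simp: shift_defect_alt[OF t(1)])
	show "0 <= shift_defect l T t w" unfolding shift_defect_alt[OF t(1)] using b(1) by (intro integral_nonneg_AE) auto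
	have "shift_defect l T t w <= (LBINT s. indicator {t..T} s)"
		unfolding shift_defect_alt[OF t(1)] using b(2) by (intro integral_mono int i) auto
	also have "... <= T" using t by simp
	finally show "shift_defect l T t w <= T" .
qed

text \<open>A root admits a linear lower bound only for bounded arguments, so \<open>X\<close> is
  first capped at \<open>L\<close>. Its conditional expectation \<open>W\<close> then lies between 0
  and \<open>L\<close>, whence \<open>W / sqrt L \<le> sqrt W \<le> sqrt Y\<close>, and taking means
  removes the conditioning.\<close>

lemma sqrt_cond_exp_bound:
	assumes X: "X \<in> bm P" "AE w in P. 0 <= X w & X w <= B" and L: "0 < L" and t: "t \<in> {0..T}"
		and Y: "AE w in P. Y w = real_cond_exp P (hist t) X w"
	shows "ennreal (sqrt (\<nu> / L)) * (\<integral>\<^sup>+w. ennreal (min (X w) L) \<partial>P) <= (\<integral>\<^sup>+w. ennreal (sqrt (l t w) * sqrt (Y w)) \<partial>P)"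
proof -
	interpret finite_measure_subalgebra P "hist t"
		by unfold_locales (use subalgebra_hist[OF prm] in auto)
	define Z where "Z w = min (X w) L" for w
	have Zm: "Z \<in> bm P" unfolding Z_def[abs_def] using X(1) by measurable
	have iX: "integrable P X" using X by (intro integrable_const_bound[of _ B]) auto
	have Zb: "AE w in P. 0 <= Z w" "AE w in P. Z w <= L" "AE w in P. Z w <= X w" using X(2) L by (auto simp: Z_def)
	have iZ: "integrable P Z" using Zm Zb(1,2) by (intro integrable_const_bound[of _ L]) auto
	let ?W = "real_cond_exp P (hist t) Z"
	have W: "AE w in P. 0 <= ?W w" "AE w in P. ?W w <= L" "AE w in P. ?W w <= real_cond_exp P (hist t) X w"
		by (rule real_cond_exp_ge_c[OF iZ Zb(1)] real_cond_exp_le_c[OF iZ Zb(2)] real_cond_exp_mono[OF Zb(3) iZ iX])+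
	have "(\<integral>\<^sup>+w. ennreal (Z w) \<partial>P) = ennreal (\<integral>w. Z w \<partial>P)" using iZ Zb(1) by (rule nn_integral_eq_integral)
	also have "... = ennreal (\<integral>w. ?W w \<partial>P)" using real_cond_exp_int(2)[OF iZ] by simp
	also have "... = (\<integral>\<^sup>+w. ennreal (?W w) \<partial>P)" by (rule nn_integral_eq_integral[OF real_cond_exp_int(1)[OF iZ] W(1), symmetric])
	finally have "ennreal (sqrt (\<nu> / L)) * (\<integral>\<^sup>+w. ennreal (Z w) \<partial>P) = (\<integral>\<^sup>+w. ennreal (sqrt (\<nu> / L)) * ennreal (?W w) \<partial>P)"
		by (simp add: nn_integral_cmult)
	also have "... <= (\<integral>\<^sup>+w. ennreal (sqrt (l t w) * sqrt (Y w)) \<partial>P)"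
	proof (intro nn_integral_mono_AE, use W Y l_ge in eventually_elim)
		case (elim w)
		have "?W w = sqrt (?W w) * sqrt (?W w)" using elim by simp
		also have "... <= sqrt (Y w) * sqrt L" using elim by (intro mult_mono) auto
		finally have "?W w / sqrt L <= sqrt (Y w)" using L by (simp add: field_simps)
		moreover have "\<nu> <= l t w" using elim t by simp
		ultimately have "sqrt \<nu> * (?W w / sqrt L) <= sqrt (l t w) * sqrt (Y w)"
			using elim(1) nu L by (intro mult_mono) auto
		then show ?case using nu L by (simp add: ennreal_mult'[symmetric] real_sqrt_divide ennreal_leI)
	qed
	finally show ?thesis by (simp add: Z_def)
qed

text \<open>Only the window of length \<open>L\<close> after \<open>t\<close> is kept. The defect is
  at most one, so the window integral is at most \<open>L\<close> and bounds the capped quantity of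
  \<open>sqrt_cond_exp_bound\<close> from below.\<close>

lemma min_defect_bound:
	assumes t: "0 < t" "t + L <= T" and L: "0 < L" and c: "0 <= c" "!!r. r \<in> {0..L} ==> \<psi> r <= c" and d: "dominated t w"
	shows "(\<integral>\<^sup>+s\<in>{0..T}. ennreal (indicator {t<..t + L} s * (\<psi> (s - t))\<^sup>2) * ennreal (1 / (4 * (1 + c / \<nu>)\<^sup>2 * (l s w)\<^sup>2)) \<partial>lborel)
		<= ennreal (min (shift_defect l T t w) L)"
proof -
	have t': "0 <= t" "t <= T" using t L by auto
	let ?I = "\<integral>\<^sup>+s. ennreal (indicator {t<..t + L} s * defect t s w) \<partial>lborel"
	have "(\<integral>\<^sup>+s\<in>{0..T}. ennreal (indicator {t<..t + L} s * (\<psi> (s - t))\<^sup>2) * ennreal (1 / (4 * (1 + c / \<nu>)\<^sup>2 * (l s w)\<^sup>2)) \<partial>lborel) <= ?I"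
	proof (rule nn_integral_mono)
		fix s
		show "ennreal (indicator {t<..t + L} s * (\<psi> (s - t))\<^sup>2) * ennreal (1 / (4 * (1 + c / \<nu>)\<^sup>2 * (l s w)\<^sup>2)) * indicator {0..T} s
			<= ennreal (indicator {t<..t + L} s * defect t s w)"
		proof (cases "s \<in> {t<..t + L}")
			case True
			then have s: "s \<in> {t<..T}" "s \<in> {0..T}" using t by auto
			have "(\<psi> (s - t))\<^sup>2 / (4 * (1 + c / \<nu>)\<^sup>2 * (l s w)\<^sup>2) <= defect t s w"
				using d s True unfolding defect_def dominated_def clamp_id[OF s(2)]
				by (intro defect_lower_bound nu psi_nonneg c(2)) auto
			then show ?thesis using True s by (simp add: ennreal_mult'[symmetric] ennreal_leI)
		qed simp
	qed
	also have "?I <= ennreal (min (shift_defect l T t w) L)"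
	proof -
		have "?I <= ennreal (shift_defect l T t w)"
			unfolding shift_defect_nn(1)[OF t' d] using t by (intro nn_integral_mono) (auto simp: indicator_def)
		moreover have "?I <= (\<integral>\<^sup>+s. indicator {t<..t + L} s \<partial>lborel)"
			using shift_defect_nn(4)[OF t' d] by (intro nn_integral_mono) (auto simp: indicator_def)
		then have "?I <= ennreal L" using L by simp
		ultimately show ?thesis by (simp add: min_def)
	qed
	finally show ?thesis .
qed

text \<open>Only times \<open>t \<le> T / 4\<close> are kept. As \<open>4 * L \<le> T\<close>, the
  window after such a \<open>t\<close> ends before \<open>T / 2\<close>, where
  \<open>expectation_antitone\<close> replaces the inverse square moment by its smaller value at
  \<open>T / 2\<close>. The squared kernel then integrates over the window to at least
  \<open>\<kappa>\<close>.\<close>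

lemma first_term_lower_bound:
	assumes L: "0 < L" "4 * L <= T" and c: "0 <= c" "!!r. r \<in> {0..L} ==> \<psi> r <= c"
		and \<kappa>: "0 <= \<kappa>" "ennreal \<kappa> <= (\<integral>\<^sup>+r\<in>{0<..L}. ennreal ((\<psi> r)\<^sup>2) \<partial>lborel)"
		and Y: "cond_exp_process P T (shift_defect l T) Y"
	shows "ennreal (\<kappa> * sqrt (\<nu> / L) / (16 * (1 + c / \<nu>)\<^sup>2)) * (\<integral>\<^sup>+w. ennreal (1 / (l (T / 2) w)\<^sup>2) \<partial>P)
		<= ennreal (1 / T) * (\<integral>\<^sup>+w. (\<integral>\<^sup>+t\<in>{0..T}. ennreal (sqrt (l t w) * sqrt (Y t w)) \<partial>lborel) \<partial>P)"
proof -
	define d where "d = 1 / (4 * (1 + c / \<nu>)\<^sup>2)"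
	have d0: "0 <= d" by (simp add: d_def)
	define E where "E = (\<integral>\<^sup>+w. ennreal (1 / (l (T / 2) w)\<^sup>2) \<partial>P)"
	define J where "J t = (\<integral>\<^sup>+w. ennreal (sqrt (l t w) * sqrt (Y t w)) \<partial>P)" for t
	have Jge: "ennreal (\<kappa> * sqrt (\<nu> / L) * d) * E <= J t" if t: "0 < t" "t <= T / 4" for t
	proof -
		have t': "t + L <= T" "t + L <= T / 2" "t <= T" "t \<in> {0..T}" using t L T by auto
		have Yt: "AE w in P. Y t w = real_cond_exp P (hist t) (shift_defect l T t) w" using Y t' by (simp add: cond_exp_process_def)
		let ?wt = "\<lambda>s. ennreal (indicator {t<..t + L} s * (\<psi> (s - t))\<^sup>2)"
		have psi_m: "(\<lambda>s. indicator {t<..t + L} s * (\<psi> (s - t))\<^sup>2) \<in> bm borel"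
		proof -
			have [measurable]: "(\<lambda>s. indicator {0..} (s - t) * \<psi> (s - t)) \<in> bm borel"
				by (rule measurable_compose[OF _ psi_meas]) measurable
			have "(\<lambda>s. indicator {t<..t + L} s * (indicator {0..} (s - t) * \<psi> (s - t))\<^sup>2) \<in> bm borel" by measurable
			also have "(\<lambda>s. indicator {t<..t + L} s * (indicator {0..} (s - t) * \<psi> (s - t))\<^sup>2) = (\<lambda>s. indicator {t<..t + L} s * (\<psi> (s - t))\<^sup>2)"
				by (auto simp: fun_eq_iff indicator_def)
			finally show ?thesis .
		qed
		have gm: "(\<lambda>x. ?wt (fst x) * ennreal (d / (l (fst x) (snd x))\<^sup>2)) \<in> bm (PA T)"
		proof -
			note [measurable] = measurable_compose[OF measurable_pred_fst[OF T0] psi_m] l_meas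
			show ?thesis by measurable
		qed
		have E_le: "ennreal d * E <= (\<integral>\<^sup>+w. ennreal (d / (l s w)\<^sup>2) \<partial>P)" if s: "s \<in> {t<..t + L}" for s
		proof -
			have [measurable]: "(\<lambda>w. l (T / 2) w) \<in> bm P" using T by (intro l_meas_P) auto
			have "ennreal d * E = (\<integral>\<^sup>+w. ennreal (d / (l (T / 2) w)\<^sup>2) \<partial>P)"
				unfolding E_def using d0 by (subst nn_integral_cmult[symmetric]) (auto simp: ennreal_mult'[symmetric])
			also have "... <= (\<integral>\<^sup>+w. ennreal (d / (l s w)\<^sup>2) \<partial>P)"
			proof (rule expectation_antitone)
				fix x y assume "\<nu> <= x" "x <= y"
				then show "ennreal (d / y\<^sup>2) <= ennreal (d / x\<^sup>2)"
					using d0 nu by (intro ennreal_leI divide_left_mono power_mono mult_pos_pos) auto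
			qed (use s t t' T in auto)
			finally show ?thesis .
		qed
		have "ennreal \<kappa> * (ennreal d * E) <= (\<integral>\<^sup>+r\<in>{0<..L}. ennreal ((\<psi> r)\<^sup>2) \<partial>lborel) * (ennreal d * E)"
			by (rule mult_right_mono[OF \<kappa>(2)]) simp
		also have "(\<integral>\<^sup>+r\<in>{0<..L}. ennreal ((\<psi> r)\<^sup>2) \<partial>lborel) = (\<integral>\<^sup>+s. ?wt s \<partial>lborel)"
		proof -
			have "(\<integral>\<^sup>+s. ?wt s \<partial>lborel) = (\<integral>\<^sup>+r. ?wt (t + 1 * r) \<partial>lborel)"
				using psi_m by (subst nn_integral_real_affine[where c = 1 and t = t]) auto
			also have "... = (\<integral>\<^sup>+r\<in>{0<..L}. ennreal ((\<psi> r)\<^sup>2) \<partial>lborel)" by (intro nn_integral_cong) (auto simp: indicator_def)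
			finally show ?thesis ..
		qed
		also have "(\<integral>\<^sup>+s. ?wt s \<partial>lborel) * (ennreal d * E) = (\<integral>\<^sup>+s. ?wt s * (ennreal d * E) \<partial>lborel)"
			using psi_m by (intro nn_integral_multc[symmetric]) simp
		also have "... <= (\<integral>\<^sup>+s\<in>{0..T}. (\<integral>\<^sup>+w. ?wt s * ennreal (d / (l s w)\<^sup>2) \<partial>P) \<partial>lborel)"
		proof (rule nn_integral_mono)
			fix s
			show "?wt s * (ennreal d * E) <= (\<integral>\<^sup>+w. ?wt s * ennreal (d / (l s w)\<^sup>2) \<partial>P) * indicator {0..T} s"
			proof (cases "s \<in> {t<..t + L}")
				case True
				then have s: "s \<in> {0..T}" using t t' by auto
				have [measurable]: "(\<lambda>w. l s w) \<in> bm P" by (rule l_meas_P[OF s])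
				show ?thesis using s E_le[OF True] by (simp add: nn_integral_cmult mult_left_mono)
			qed simp
		qed
		also have "... = (\<integral>\<^sup>+w. (\<integral>\<^sup>+s\<in>{0..T}. ?wt s * ennreal (d / (l s w)\<^sup>2) \<partial>lborel) \<partial>P)" using pred_fubini[OF gm] by simp
		also have "... <= (\<integral>\<^sup>+w. ennreal (min (shift_defect l T t w) L) \<partial>P)"
		proof (intro nn_integral_mono_AE, use dominated_AE[OF t(1) t'(3)] in eventually_elim)
			case (elim w)
			from min_defect_bound[OF t(1) t'(1) L(1) c elim] show ?case by (simp add: d_def)
		qed
		finally have "ennreal (sqrt (\<nu> / L)) * (ennreal \<kappa> * (ennreal d * E)) <= ennreal (sqrt (\<nu> / L)) * (\<integral>\<^sup>+w. ennreal (min (shift_defect l T t w) L) \<partial>P)"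
			by (rule mult_left_mono) simp
		also have "... <= J t" unfolding J_def
		proof (rule sqrt_cond_exp_bound[OF shift_defect_meas _ L(1) t'(4) Yt])
			show "AE w in P. 0 <= shift_defect l T t w & shift_defect l T t w <= T"
				using dominated_AE[OF t(1) t'(3)] by eventually_elim (use t t' shift_defect_nn in auto)
		qed (use t in simp)
		also have "ennreal (sqrt (\<nu> / L)) * (ennreal \<kappa> * (ennreal d * E)) = ennreal (\<kappa> * sqrt (\<nu> / L) * d) * E"
			using \<kappa>(1) d0 nu L by (simp add: ennreal_mult mult_ac)
		finally show ?thesis .
	qed
	\<comment> \<open>The factor 16 is the 4 in \<open>d\<close> times the 4 from keeping a quarter of
	  the time interval.\<close>
	have "ennreal (\<kappa> * sqrt (\<nu> / L) / (16 * (1 + c / \<nu>)\<^sup>2)) * E = ennreal (1 / T) * (ennreal (\<kappa> * sqrt (\<nu> / L) * d) * E * ennreal (T / 4))"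
	proof -
		have "\<kappa> * sqrt (\<nu> / L) / (16 * (1 + c / \<nu>)\<^sup>2) = 1 / T * (\<kappa> * sqrt (\<nu> / L) * d * (T / 4))" using T by (simp add: d_def)
		also have "ennreal ... = ennreal (1 / T) * (ennreal (\<kappa> * sqrt (\<nu> / L) * d) * ennreal (T / 4))"
			using T \<kappa>(1) d0 nu L by (subst ennreal_mult, simp, simp, subst ennreal_mult) auto
		finally show ?thesis by (simp add: mult_ac)
	qed
	also have "... = ennreal (1 / T) * (\<integral>\<^sup>+t. ennreal (\<kappa> * sqrt (\<nu> / L) * d) * E * indicator {0<..T / 4} t \<partial>lborel)"
		using T by (subst nn_integral_cmult_indicator) auto
	also have "... <= ennreal (1 / T) * (\<integral>\<^sup>+t\<in>{0..T}. J t \<partial>lborel)"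
		using Jge T by (intro mult_left_mono nn_integral_mono) (auto simp: indicator_def)
	also have "(\<integral>\<^sup>+t\<in>{0..T}. J t \<partial>lborel) = (\<integral>\<^sup>+w. (\<integral>\<^sup>+t\<in>{0..T}. ennreal (sqrt (l t w) * sqrt (Y t w)) \<partial>lborel) \<partial>P)"
	proof -
		interpret pf: pair_sigma_finite lborel P ..
		let ?g = "\<lambda>x. ennreal (sqrt (l (fst x) (snd x)) * sqrt (Y (fst x) (snd x)))"
		have m: "(\<lambda>x. ?g x * indicator {0..T} (fst x)) \<in> bm (lborel \<Otimes>\<^sub>M P)"
		proof -
			have "(\<lambda>x. (clamp T (fst x), snd x)) \<in> measurable (borel \<Otimes>\<^sub>M P) (restrict_space borel {0..T} \<Otimes>\<^sub>M P)"
				using measurable_compose[OF measurable_fst measurable_clamp[OF T0]] by measurable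
			from measurable_compose[OF this, of "\<lambda>x. Y (fst x) (snd x)"] Y
			have [measurable]: "(\<lambda>x. Y (clamp T (fst x)) (snd x)) \<in> bm (borel \<Otimes>\<^sub>M P)"
				by (simp add: cond_exp_process_def case_prod_beta')
			have [measurable]: "(\<lambda>x. l (clamp T (fst x)) (snd x)) \<in> bm (borel \<Otimes>\<^sub>M P)"
				using measurable_pred_clamp[OF T0 l_meas] by simp
			have "(\<lambda>x. ennreal (sqrt (l (clamp T (fst x)) (snd x)) * sqrt (Y (clamp T (fst x)) (snd x))) * indicator {0..T} (fst x)) \<in> bm (borel \<Otimes>\<^sub>M P)"
				by measurable
			also have "(\<lambda>x. ennreal (sqrt (l (clamp T (fst x)) (snd x)) * sqrt (Y (clamp T (fst x)) (snd x))) * indicator {0..T} (fst x)) = (\<lambda>x. ?g x * indicator {0..T} (fst x))"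
				by (auto simp: fun_eq_iff indicator_def clamp_id)
			finally show ?thesis by simp
		qed
		have "(\<integral>\<^sup>+t\<in>{0..T}. J t \<partial>lborel) = (\<integral>\<^sup>+t. (\<integral>\<^sup>+w. ?g (t, w) * indicator {0..T} t \<partial>P) \<partial>lborel)"
			by (intro nn_integral_cong) (auto simp: J_def indicator_def)
		also have "... = (\<integral>\<^sup>+w. (\<integral>\<^sup>+t. ?g (t, w) * indicator {0..T} t \<partial>lborel) \<partial>P)"
			using pf.Fubini'[of "\<lambda>t w. ?g (t, w) * indicator {0..T} t"] m by (simp add: case_prod_beta')
		finally show ?thesis by simp
	qed
	finally show ?thesis unfolding E_def .
qed

end

section \<open>Absorbing the logarithm\<close>

text \<open>With \<open>y\<close> the eighth root of \<open>1 + T\<close> the logarithm is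
  \<open>8 * ln y\<close>, at most \<open>8 * y\<close>. The fourth power gives
  \<open>4096 * sqrt (1 + T)\<close>, and \<open>1 + T \<le> 4 * T\<close> doubles the
  constant.\<close>

lemma ln_power4_le:
	assumes "1 <= T"
	shows "(ln (1 + T)) ^ 4 <= 8192 * sqrt T"
proof -
	define y where "y = (1 + T) powr (1 / 8)"
	have y: "0 < y" using assms by (simp add: y_def)
	have "ln (1 + T) = 8 * ln y" using assms by (simp add: y_def ln_powr)
	also have "... <= 8 * y" using ln_le_minus_one[OF y] by simp
	finally have "(ln (1 + T)) ^ 4 <= (8 * y) ^ 4" using assms by (intro power_mono) auto
	also have "... = 4096 * y ^ 4" by (simp add: power_mult_distrib)
	also have "y ^ 4 = sqrt (1 + T)"
		using assms y by (simp add: y_def powr_realpow[symmetric] powr_powr powr_half_sqrt)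
	also have "sqrt (1 + T) <= sqrt (4 * T)" using assms by simp
	also have "... = 2 * sqrt T" by (simp add: real_sqrt_mult)
	finally show ?thesis by simp
qed

text \<open>Splitting at \<open>z = A / ln (1 + T)\<close>: above it the fourth power dominates, as \<open>ln\<^sup>4 (1 + T) = O(\<surd>T)\<close>.\<close>

lemma log_young:
	assumes T: "1 <= T" and z: "0 <= z" and c: "0 < c" and k: "0 <= k" and A: "1 <= A" "8192 * k <= c * A"
	shows "k * ln (1 + T) / sqrt T * z <= c * z ^ 4 + k * A / sqrt T"
proof -
	define L where "L = ln (1 + T)"
	have L: "0 < L" using T by (simp add: L_def)
	have L4: "L ^ 4 <= 8192 * sqrt T" unfolding L_def by (rule ln_power4_le[OF T])
	show ?thesis
	proof (cases "L * z <= A")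
		case True
		have "k * L / sqrt T * z = k / sqrt T * (L * z)" by simp
		also have "... <= k / sqrt T * A" using True k T by (intro mult_left_mono) auto
		finally show ?thesis using z c by (simp add: L_def add_increasing)
	next
		case False
		\<comment> \<open>\<open>A \<ge> 1\<close> allows the first power in the hypothesis on
		  \<open>A\<close> to be replaced by the cube of \<open>L * z\<close>.\<close>
		have "A * 1 <= A * A\<^sup>2" using A(1) by (intro mult_left_mono) auto
		then have "A <= A ^ 3" by (simp add: power2_eq_square power3_eq_cube)
		also have "... <= (L * z) ^ 3" using False A(1) by (intro power_mono) auto
		finally have "8192 * k <= c * (L * z) ^ 3" using A(2) c by (meson order.trans mult_left_mono less_imp_le)
		then have "8192 * k * (z / L ^ 3) <= c * (L * z) ^ 3 * (z / L ^ 3)" using z L by (intro mult_right_mono) auto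
		also have "... = c * z ^ 4" using L by (simp add: power_mult_distrib power4_eq_xxxx power3_eq_cube)
		finally have 1: "8192 * k * (z / L ^ 3) <= c * z ^ 4" .
		have "L / sqrt T <= 8192 / L ^ 3"
			using L4 L T by (simp add: field_simps power4_eq_xxxx power3_eq_cube)
		then have "k * z * (L / sqrt T) <= k * z * (8192 / L ^ 3)" using k z by (intro mult_left_mono) auto
		with 1 have "k * L / sqrt T * z <= c * z ^ 4" by (simp add: mult_ac)
		then show ?thesis using k A T by (simp add: L_def add_increasing2)
	qed
qed

context hawkes begin

text \<open>Time \<open>T / 2\<close> serves two purposes: by monotonicity the moment there
  dominates the second half of the interval, and the lower bound of the first expectation refers to
  the same time.\<close>

definition inv_moment :: real where
	"inv_moment = enn2real (\<integral>\<^sup>+w. ennreal (1 / sqrt (l (T / 2) w)) \<partial>P)"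

lemma inv_sqrt_le: "AE w in P. \<forall>t\<in>{0..T}. 0 <= 1 / sqrt (l t w) & 1 / sqrt (l t w) <= 1 / sqrt \<nu>"
	using l_ge
proof eventually_elim
	case (elim w)
	show ?case
	proof
		fix t assume "t \<in> {0..T}"
		then have "\<nu> <= l t w" using elim by simp
		then show "0 <= 1 / sqrt (l t w) & 1 / sqrt (l t w) <= 1 / sqrt \<nu>" using nu by (auto intro!: frac_le)
	qed
qed

lemma inv_sqrt_expectation_le:
	assumes "t \<in> {0..T}"
	shows "(\<integral>\<^sup>+w. ennreal (1 / sqrt (l t w)) \<partial>P) <= ennreal (1 / sqrt \<nu>)"
proof -
	have "(\<integral>\<^sup>+w. ennreal (1 / sqrt (l t w)) \<partial>P) <= (\<integral>\<^sup>+w. ennreal (1 / sqrt \<nu>) \<partial>P)"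
		by (intro nn_integral_mono_AE, use inv_sqrt_le in eventually_elim) (use assms in \<open>auto intro!: ennreal_leI\<close>)
	then show ?thesis by (simp add: emeasure_space_1)
qed

lemma inv_moment: "(\<integral>\<^sup>+w. ennreal (1 / sqrt (l (T / 2) w)) \<partial>P) = ennreal inv_moment" "0 <= inv_moment" "inv_moment <= 1 / sqrt \<nu>"
proof -
	note le = inv_sqrt_expectation_le[of "T / 2"]
	have T2: "T / 2 \<in> {0..T}" using T by simp
	show eq: "(\<integral>\<^sup>+w. ennreal (1 / sqrt (l (T / 2) w)) \<partial>P) = ennreal inv_moment"
		unfolding inv_moment_def using order.strict_trans1[OF le[OF T2] ennreal_less_top] by (simp add: less_top)
	show "0 <= inv_moment" by (simp add: inv_moment_def)
	show "inv_moment <= 1 / sqrt \<nu>" using le[OF T2] nu unfolding eq by (subst (asm) ennreal_le_iff) auto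
qed

text \<open>Smoothing at \<open>1 / sqrt T\<close> makes the weight equal to
  \<open>1 / (sqrt T * (1 + T - t))\<close>. On the first half it is at most
  \<open>2 / (T * sqrt T)\<close> and the crude bound \<open>1 / sqrt \<nu>\<close> is enough; on
  the second half its integral produces the logarithm and the moment is at most
  \<open>inv_moment\<close>.\<close>

lemma third_order_bound:
	"(\<integral>\<^sup>+t\<in>{0..T}. ennreal (1 / (T * sqrt T * ((1 / sqrt T)\<^sup>2 + 1 - t / T))) * (\<integral>\<^sup>+w. ennreal (1 / sqrt (l t w)) \<partial>P) \<partial>lborel)
		<= ennreal (1 / sqrt \<nu> / sqrt T + ln (1 + T) / sqrt T * inv_moment)"
proof -
	let ?e = "\<lambda>t. \<integral>\<^sup>+w. ennreal (1 / sqrt (l t w)) \<partial>P"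
	have wt: "1 / (T * sqrt T * ((1 / sqrt T)\<^sup>2 + 1 - t / T)) = 1 / (sqrt T * (1 + T - t))" for t
	proof -
		have "T * ((1 / sqrt T)\<^sup>2 + 1 - t / T) = 1 + T - t" using T by (simp add: power_divide algebra_simps)
		then have "T * sqrt T * ((1 / sqrt T)\<^sup>2 + 1 - t / T) = sqrt T * (1 + T - t)" by (metis mult.assoc mult.commute)
		then show ?thesis by simp
	qed
	have "(\<integral>\<^sup>+t\<in>{0..T}. ennreal (1 / (sqrt T * (1 + T - t))) * ?e t \<partial>lborel) <=
			(\<integral>\<^sup>+t. ennreal (2 / (T * sqrt T) * (1 / sqrt \<nu>)) * indicator {0..T/2} t + ennreal (inv_moment / sqrt T) * (ennreal (1 / (1 + T - t)) * indicator {T/2..T} t) \<partial>lborel)"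
	proof (rule nn_integral_mono)
		fix t
		consider "t \<in> {0..T/2}" | "t \<in> {T/2<..T}" | "t \<notin> {0..T}" by fastforce
		then show "ennreal (1 / (sqrt T * (1 + T - t))) * ?e t * indicator {0..T} t <=
			ennreal (2 / (T * sqrt T) * (1 / sqrt \<nu>)) * indicator {0..T/2} t + ennreal (inv_moment / sqrt T) * (ennreal (1 / (1 + T - t)) * indicator {T/2..T} t)"
		proof cases
			case 1
			then have t: "t \<in> {0..T}" "T / 2 <= 1 + T - t" by auto
			have "1 / (sqrt T * (1 + T - t)) <= 1 / (sqrt T * (T / 2))" using t T by (intro frac_le mult_left_mono) auto
			also have "... = 2 / (T * sqrt T)" by simp
			finally have "ennreal (1 / (sqrt T * (1 + T - t))) * ?e t <= ennreal (2 / (T * sqrt T)) * ennreal (1 / sqrt \<nu>)"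
				by (intro mult_mono ennreal_leI inv_sqrt_expectation_le t(1)) auto
			also have "... = ennreal (2 / (T * sqrt T) * (1 / sqrt \<nu>))" using T by (intro ennreal_mult'[symmetric]) simp
			finally show ?thesis using 1 t by (simp add: add_increasing2)
		next
			case 2
			have t: "0 < 1 + T - t" using 2 by simp
			have "?e t <= ?e (T / 2)"
			proof (rule expectation_antitone)
				fix x y assume "\<nu> <= x" "x <= y"
				then show "ennreal (1 / sqrt y) <= ennreal (1 / sqrt x)" using nu by (intro ennreal_leI frac_le) auto
			qed (use 2 T in auto)
			then have "ennreal (1 / (sqrt T * (1 + T - t))) * ?e t <= ennreal (1 / (sqrt T * (1 + T - t))) * ennreal inv_moment"
				unfolding inv_moment(1) by (rule mult_left_mono) simp
			also have "... = ennreal (1 / (sqrt T * (1 + T - t)) * inv_moment)" using t T by (intro ennreal_mult'[symmetric]) simp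
			also have "1 / (sqrt T * (1 + T - t)) * inv_moment = inv_moment / sqrt T * (1 / (1 + T - t))" by simp
			also have "ennreal ... = ennreal (inv_moment / sqrt T) * ennreal (1 / (1 + T - t))" using inv_moment(2) T by (intro ennreal_mult') simp
			finally show ?thesis using 2 by simp
		qed simp
	qed
	also have "... = ennreal (2 / (T * sqrt T) * (1 / sqrt \<nu>)) * ennreal (T / 2) + ennreal (inv_moment / sqrt T) * (\<integral>\<^sup>+t. ennreal (1 / (1 + T - t)) * indicator {T/2..T} t \<partial>lborel)"
		using T by (subst nn_integral_add) (auto simp: nn_integral_cmult nn_integral_cmult_indicator emeasure_lborel_Icc_eq)
	also have "(\<integral>\<^sup>+t. ennreal (1 / (1 + T - t)) * indicator {T/2..T} t \<partial>lborel) = ennreal (- ln (1 + T - T) - (- ln (1 + T - T / 2)))"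
	proof (rule nn_integral_FTC_Icc)
		fix x assume "x \<in> {T/2..T}"
		then have "0 < 1 + T - x" by simp
		then show "((\<lambda>t. - ln (1 + T - t)) has_real_derivative 1 / (1 + T - x)) (at x)" "0 <= 1 / (1 + T - x)"
			by (auto intro!: derivative_eq_intros)
	qed (use T in auto)
	also have "... <= ennreal (ln (1 + T))" using T by (intro ennreal_leI) simp
	finally have "(\<integral>\<^sup>+t\<in>{0..T}. ennreal (1 / (sqrt T * (1 + T - t))) * ?e t \<partial>lborel) <=
		ennreal (2 / (T * sqrt T) * (1 / sqrt \<nu>)) * ennreal (T / 2) + ennreal (inv_moment / sqrt T) * ennreal (ln (1 + T))"
		by (simp add: add_left_mono mult_left_mono)
	also have "... = ennreal (2 / (T * sqrt T) * (1 / sqrt \<nu>) * (T / 2)) + ennreal (inv_moment / sqrt T * ln (1 + T))"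
		using T inv_moment(2) nu by (intro arg_cong2[where f = "(+)"] ennreal_mult[symmetric]) auto
	also have "... = ennreal (2 / (T * sqrt T) * (1 / sqrt \<nu>) * (T / 2) + inv_moment / sqrt T * ln (1 + T))"
		using T inv_moment(2) nu by (intro ennreal_plus[symmetric]) auto
	also have "2 / (T * sqrt T) * (1 / sqrt \<nu>) * (T / 2) + inv_moment / sqrt T * ln (1 + T) = 1 / sqrt \<nu> / sqrt T + ln (1 + T) / sqrt T * inv_moment"
		using T by (simp add: mult.commute)
	finally show ?thesis unfolding wt .
qed

text \<open>The smoothing scale \<open>1 / sqrt T\<close> in \<open>hawkes_clt\<close> puts the
  smoothing error \<open>2 / sqrt T\<close> at the target order; 36 is the constant in front of the
  third-order term.\<close>

lemma wasserstein_bound: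
	assumes Q: "prob_space Q" "distributed Q lborel G std_normal_density"
	shows "wasserstein P stat Q G <= ennreal ((36 / sqrt \<nu> + 2) / sqrt T + 36 * ln (1 + T) / sqrt T * inv_moment)"
proof -
	interpret Q: prob_space Q by (rule Q)
	let ?W = "1 / sqrt \<nu> / sqrt T + ln (1 + T) / sqrt T * inv_moment"
	have W: "0 <= ?W" using nu T inv_moment(2) by simp
	have clt: "integrable P stat" "\<bar>expectation (\<lambda>w. h (stat w)) - (LINT z|gauss. h z)\<bar> <= 36 * ?W + 2 * (1 / sqrt T)"
		if "1-lipschitz_on UNIV h" for h :: "real => real"
		by (rule hawkes_clt[OF that _ W third_order_bound]; use T in simp)+
	have Gm: "G \<in> measurable Q lborel" and Gd: "distr Q lborel G = gauss"
		using Q(2) by (auto simp: distributed_def gauss_def)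
	have law: "(LINT y|Q. u (G y)) = (LINT z|gauss. u z)" if "u \<in> bm borel" for u :: "real => real"
		using integral_distr[OF Gm, of u] that unfolding Gd by simp
	have iG: "integrable Q G"
	proof -
		have "integrable (distr Q lborel G) (\<lambda>z. z)" unfolding Gd by (rule gauss_int_id(1))
		then show ?thesis by (rule integrable_distr[OF Gm])
	qed
	\<comment> \<open>The identity feeds \<open>clt(1)\<close>, the integrability of
	  \<open>stat\<close> that the guard in \<open>wasserstein\<close> asks for.\<close>
	have lip: "1-lipschitz_on UNIV (\<lambda>x::real. x)" by (rule lipschitz_onI) (auto simp: dist_real_def)
	have "(SUP u \<in> {u :: real => real. 1-lipschitz_on UNIV u}. ennreal \<bar>(LINT x|P. u (stat x)) - (LINT y|Q. u (G y))\<bar>)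
			<= ennreal (36 * ?W + 2 * (1 / sqrt T))"
	proof (rule SUP_least)
		fix u :: "real => real" assume "u \<in> {u. 1-lipschitz_on UNIV u}"
		then have u: "1-lipschitz_on UNIV u" by simp
		have um: "u \<in> bm borel"
			by (rule borel_measurable_continuous_onI[OF lipschitz_on_continuous_on[OF u]])
		show "ennreal \<bar>(LINT x|P. u (stat x)) - (LINT y|Q. u (G y))\<bar> <= ennreal (36 * ?W + 2 * (1 / sqrt T))"
			unfolding law[OF um] by (rule ennreal_leI[OF clt(2)[OF u]])
	qed
	also have "36 * ?W + 2 * (1 / sqrt T) = (36 / sqrt \<nu> + 2) / sqrt T + 36 * ln (1 + T) / sqrt T * inv_moment"
		by (simp add: algebra_simps add_divide_distrib)
	finally show ?thesis unfolding wasserstein_def using clt(1)[OF lip] iG by simp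
qed

text \<open>\<open>log_young\<close> is applied along each configuration with
  \<open>z = 1 / sqrt (l (T / 2) w)\<close>, whose fourth power is the inverse square of the
  intensity, and then averaged.\<close>

lemma inv_moment_young:
	assumes T1: "1 <= T" and c: "0 < c" and k: "0 <= k" and A: "1 <= A" "8192 * k <= c * A"
	shows "ennreal (k * ln (1 + T) / sqrt T * inv_moment) <= ennreal c * (\<integral>\<^sup>+w. ennreal (1 / (l (T / 2) w)\<^sup>2) \<partial>P) + ennreal (k * A / sqrt T)"
proof -
	let ?d = "k * ln (1 + T) / sqrt T"
	have [measurable]: "(\<lambda>w. l (T / 2) w) \<in> bm P" using T by (intro l_meas_P) auto
	have d: "0 <= ?d" using k T by simp
	have "ennreal (?d * inv_moment) = ennreal ?d * (\<integral>\<^sup>+w. ennreal (1 / sqrt (l (T / 2) w)) \<partial>P)"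
		unfolding inv_moment(1) by (rule ennreal_mult'[OF d])
	also have "... = (\<integral>\<^sup>+w. ennreal ?d * ennreal (1 / sqrt (l (T / 2) w)) \<partial>P)"
		by (rule nn_integral_cmult[symmetric]) measurable
	also have "... <= (\<integral>\<^sup>+w. ennreal c * ennreal (1 / (l (T / 2) w)\<^sup>2) + ennreal (k * A / sqrt T) \<partial>P)"
	proof (intro nn_integral_mono_AE, use l_ge in eventually_elim)
		case (elim w)
		then have l0: "0 < l (T / 2) w" using T nu by (intro order.strict_trans2[OF nu]) auto
		have z4: "(1 / sqrt (l (T / 2) w)) ^ 4 = 1 / (l (T / 2) w)\<^sup>2"
		proof -
			have "(sqrt (l (T / 2) w)) ^ 4 = ((sqrt (l (T / 2) w))\<^sup>2)\<^sup>2" by simp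
			then show ?thesis using l0 by (simp add: power_divide)
		qed
		have "?d * (1 / sqrt (l (T / 2) w)) <= c * (1 / (l (T / 2) w)\<^sup>2) + k * A / sqrt T"
			unfolding z4[symmetric] using l0 by (intro log_young T1 c k A) simp
		then have "ennreal (?d * (1 / sqrt (l (T / 2) w))) <= ennreal (c * (1 / (l (T / 2) w)\<^sup>2) + k * A / sqrt T)" by (rule ennreal_leI)
		also have "... = ennreal (c * (1 / (l (T / 2) w)\<^sup>2)) + ennreal (k * A / sqrt T)"
			using c k A T by (intro ennreal_plus) auto
		also have "ennreal (c * (1 / (l (T / 2) w)\<^sup>2)) = ennreal c * ennreal (1 / (l (T / 2) w)\<^sup>2)"
			using c by (intro ennreal_mult') simp
		finally show ?case unfolding ennreal_mult'[OF d] .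
	qed
	also have "... = ennreal c * (\<integral>\<^sup>+w. ennreal (1 / (l (T / 2) w)\<^sup>2) \<partial>P) + ennreal (k * A / sqrt T)"
		by (subst nn_integral_add) (auto simp: nn_integral_cmult emeasure_space_1)
	finally show ?thesis .
qed

end

section \<open>Choice of the constants and conclusion\<close>

lemma square_kernel_measurable:
	fixes \<phi> :: "real => real"
	assumes "(\<lambda>t. indicator {0..} t * \<phi> t) \<in> bm borel"
	shows "(\<lambda>r. ennreal ((\<phi> r)\<^sup>2) * indicator {0<..L} r) \<in> bm borel"
proof -
	have "(\<lambda>r. ennreal ((indicator {0..} r * \<phi> r)\<^sup>2) * indicator {0<..L} r) \<in> bm borel" using assms by measurable
	also have "(\<lambda>r. ennreal ((indicator {0..} r * \<phi> r)\<^sup>2) * indicator {0<..L} r) = (\<lambda>r. ennreal ((\<phi> r)\<^sup>2) * indicator {0<..L} r)"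
		by (auto simp: fun_eq_iff indicator_def)
	finally show ?thesis .
qed

text \<open>A kernel with nonzero integral is nonzero on a set of positive measure, and the windows
  \<open>{0<..real (Suc n)}\<close> exhaust the half line up to the null point 0.\<close>

lemma square_integral_positive:
	fixes \<phi> :: "real => real"
	assumes m: "(\<lambda>t. indicator {0..} t * \<phi> t) \<in> bm borel" and pos: "(LBINT t:{0..}. \<phi> t) ~= 0"
	obtains L \<kappa> where "0 < L" "0 < \<kappa>" "ennreal \<kappa> <= (\<integral>\<^sup>+r\<in>{0<..L}. ennreal ((\<phi> r)\<^sup>2) \<partial>lborel)"
proof -
	note m' = square_kernel_measurable[OF m]
	have "\<exists>n::nat. (\<integral>\<^sup>+r\<in>{0<..real (Suc n)}. ennreal ((\<phi> r)\<^sup>2) \<partial>lborel) ~= 0"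
	proof (rule ccontr)
		assume "~ ?thesis"
		then have "AE r in lborel. ennreal ((\<phi> r)\<^sup>2) * indicator {0<..real (Suc n)} r = 0" for n
			using m'[of "real (Suc n)"] by (subst nn_integral_0_iff_AE[symmetric]) auto
		then have "AE r in lborel. \<forall>n. ennreal ((\<phi> r)\<^sup>2) * indicator {0<..real (Suc n)} r = 0"
			unfolding AE_all_countable by (rule allI)
		then have "AE r in lborel. indicator {0..} r *\<^sub>R \<phi> r = 0"
			using AE_lborel_singleton[of 0]
		proof eventually_elim
			case (elim r)
			obtain n :: nat where "r <= real n" using real_arch_simple by blast
			then show ?case using elim(1)[rule_format, of n] elim(2) by (auto simp: indicator_def ennreal_eq_0_iff split: if_splits)
		qed
		then have "(LBINT t:{0..}. \<phi> t) = 0" unfolding set_lebesgue_integral_def by (rule integral_eq_zero_AE)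
		with pos show False by simp
	qed
	then obtain n :: nat where n: "(\<integral>\<^sup>+r\<in>{0<..real (Suc n)}. ennreal ((\<phi> r)\<^sup>2) \<partial>lborel) ~= 0" by blast
	let ?x = "\<integral>\<^sup>+r\<in>{0<..real (Suc n)}. ennreal ((\<phi> r)\<^sup>2) \<partial>lborel"
	\<comment> \<open>No bound on \<open>\<phi>\<close> is assumed here, so the integral may be
	  infinite; any positive \<open>\<kappa>\<close> serves in that case.\<close>
	have "\<exists>\<kappa>>0. ennreal \<kappa> <= ?x"
	proof (cases "?x = \<infinity>")
		case True then show ?thesis by (intro exI[of _ 1]) simp
	next
		case False
		then have "0 < enn2real ?x" "ennreal (enn2real ?x) <= ?x" using n by (auto simp: enn2real_positive_iff less_top zero_less_iff_neq_zero)
		then show ?thesis by blast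
	qed
	then obtain \<kappa> where "0 < \<kappa>" "ennreal \<kappa> <= ?x" by blast
	then show ?thesis by (intro that[of "real (Suc n)" \<kappa>]) auto
qed

theorem proposition7p4:
  fixes \<mu> m :: real and \<phi> :: "real \<Rightarrow> real"
    and P :: "(real \<times> real) measure measure"
    and Q :: "'b measure" and G :: "'b \<Rightarrow> real"
  assumes poisson: "poisson_random_measure P"
    and normal: "prob_space Q" "distributed Q lborel G std_normal_density"
    and mu: "\<mu> > 0"
    and phi_nonneg: "\<And>t. t \<ge> 0 \<Longrightarrow> \<phi> t \<ge> 0"
    and phi_locally_bounded: "\<And>b. bounded (\<phi> ` {0..b})"
    and phi_mass: "set_integrable lborel {0..} \<phi>" "(LBINT t:{0..}. \<phi> t) = 1"
    and phi_moment: "set_integrable lborel {0..} (\<lambda>t. t * \<phi> t)" "(LBINT t:{0..}. t * \<phi> t) = m"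
  shows "\<exists>C>0. \<forall>T>1. \<forall>a\<in>{0<..<1}. \<forall>l Y.
    T * (1 - a) = 1 \<longrightarrow>
    hawkes_intensity P \<mu> (\<lambda>t. a * \<phi> t) T l \<longrightarrow>
    cond_exp_process P T (shift_defect l T) Y \<longrightarrow>
    wasserstein P
      (\<lambda>\<omega>. compensated_integral ({0..T} \<times> {0..})
         (\<lambda>(t, \<theta>). of_bool (\<theta> \<le> l t \<omega>) / sqrt (T * l t \<omega>)) \<omega>) Q G
    \<le> ennreal (C / sqrt T)
      + ennreal (1 / T) *
          (\<integral>\<^sup>+\<omega>. (\<integral>\<^sup>+t\<in>{0..T}. ennreal (sqrt (l t \<omega>) * sqrt (Y t \<omega>)) \<partial>lborel) \<partial>P)
      + ennreal (1 / T powr (3/2)) *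
          (\<integral>\<^sup>+\<omega>. (\<integral>\<^sup>+t\<in>{0..T}. ennreal (sqrt (l t \<omega>) * Y t \<omega>) \<partial>lborel) \<partial>P)
      + ennreal (2 / T powr (3/2)) *
          (\<integral>\<^sup>+\<omega>. (\<integral>\<^sup>+t\<in>{0..T}. ennreal (sqrt (shift_defect l T t \<omega>)) \<partial>lborel) \<partial>P)"
proof -
	have phi_meas: "(\<lambda>t. indicator {0..} t * \<phi> t) \<in> bm borel"
		using phi_mass(1) by (simp add: set_integrable_def borel_measurable_integrable)
	have bound: "\<exists>K>0. \<forall>t. 0 <= t & t <= b --> \<phi> t <= K" for b
	proof -
		obtain K where K: "0 < K" "!!x. x \<in> \<phi> ` {0..b} ==> norm x <= K" using phi_locally_bounded[of b] bounded_pos by metis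
		have "\<phi> t <= K" if "0 <= t" "t <= b" for t using K(2)[of "\<phi> t"] that by auto
		then show ?thesis using K(1) by blast
	qed
	obtain L \<kappa> where L: "0 < L" and \<kappa>: "0 < \<kappa>" "ennreal \<kappa> <= (\<integral>\<^sup>+r\<in>{0<..L}. ennreal ((\<phi> r)\<^sup>2) \<partial>lborel)"
		using square_integral_positive[OF phi_meas] phi_mass(2) by auto
	obtain b where b: "0 < b" "!!t. 0 <= t ==> t <= L ==> \<phi> t <= b" using bound[of L] by blast
	\<comment> \<open>The threshold between small and large \<open>T\<close>. From
	  \<open>T \<ge> 2\<close> and \<open>T * (1 - a) = 1\<close> follows \<open>a \<ge> 1 / 2\<close>,
	  and \<open>T \<ge> 4 * L\<close> makes room for the window.\<close>
	define S where "S = max 2 (4 * L)"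
	\<comment> \<open>The constant of \<open>first_term_lower_bound\<close>, with
	  \<open>\<kappa> / 4\<close> because the kernel is \<open>a * \<phi>\<close> with
	  \<open>a \<ge> 1 / 2\<close>.\<close>
	define c where "c = (\<kappa> / 4) * sqrt (\<mu> / L) / (16 * (1 + b / \<mu>)\<^sup>2)"
	have "0 < 1 + b / \<mu>" using b mu by (simp add: add_pos_pos)
	then have c: "0 < c" using \<kappa> mu L by (simp add: c_def)
	\<comment> \<open>The threshold that \<open>log_young\<close> requires for \<open>k = 36\<close>,
	  the constant in \<open>wasserstein_bound\<close>. It depends on \<open>c\<close> but not on
	  \<open>T\<close>.\<close>
	define A where "A = max 1 (8192 * 36 / c)"
	have A: "1 <= A" "8192 * 36 <= c * A"
	proof -
		have "8192 * 36 / c <= A" by (simp add: A_def)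
		then show "8192 * 36 <= c * A" using c by (simp add: field_simps)
	qed (simp add: A_def)
	\<comment> \<open>The first two summands come from \<open>wasserstein_bound\<close>,
	  \<open>36 * A\<close> is the cost of removing the logarithm for large \<open>T\<close>, and the
	  last one absorbs the logarithm for \<open>T < S\<close>.\<close>
	define C where "C = 36 / sqrt \<mu> + 2 + 36 * A + 36 * ln (1 + S) / sqrt \<mu>"
	have S: "2 <= S" "4 * L <= S" by (simp_all add: S_def)
	have C: "0 < C" unfolding C_def using mu A S by (intro add_pos_nonneg add_nonneg_pos) auto
	have Smu: "0 <= 36 * ln (1 + S) / sqrt \<mu>" using S mu by simp
	have main: "wasserstein P
			(\<lambda>w. compensated_integral ({0..T} \<times> {0..}) (\<lambda>(t, \<theta>). of_bool (\<theta> <= l t w) / sqrt (T * l t w)) w) Q G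
		<= ennreal (C / sqrt T) + ennreal (1 / T) * (\<integral>\<^sup>+w. (\<integral>\<^sup>+t\<in>{0..T}. ennreal (sqrt (l t w) * sqrt (Y t w)) \<partial>lborel) \<partial>P)"
		if T1: "1 < T" and a: "a \<in> {0<..<1}" "T * (1 - a) = 1" and hi: "hawkes_intensity P \<mu> (\<lambda>t. a * \<phi> t) T l"
			and Y: "cond_exp_process P T (shift_defect l T) Y" for T a l Y
	proof -
		obtain K where K: "0 < K" "!!t. 0 <= t ==> t <= T ==> \<phi> t <= K" using bound[of T] by blast
		have a_le: "a * \<phi> t <= \<phi> t" if "0 <= t" for t using a(1) phi_nonneg[OF that] by (intro mult_left_le_one_le) auto
		interpret hawkes P \<mu> T K "\<lambda>t. a * \<phi> t" l
		proof
			show "(\<lambda>t. indicator {0..} t * (a * \<phi> t)) \<in> bm borel"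
				using borel_measurable_times[OF borel_measurable_const phi_meas, of a] by (simp add: mult.left_commute)
			show "a * \<phi> t <= K" if "0 <= t" "t <= T" for t using a_le[OF that(1)] K(2)[OF that] by linarith
		qed (use poisson T1 mu K a phi_nonneg hi in auto)
		let ?R = "ennreal (1 / T) * (\<integral>\<^sup>+w. (\<integral>\<^sup>+t\<in>{0..T}. ennreal (sqrt (l t w) * sqrt (Y t w)) \<partial>lborel) \<partial>P)"
		have "ennreal (36 * ln (1 + T) / sqrt T * inv_moment) <= ennreal ((36 * A + 36 * ln (1 + S) / sqrt \<mu>) / sqrt T) + ?R"
		proof (cases "S <= T")
			case True
			then have "1 <= T * (1 / 2)" using S by simp
			then have a2: "1 / 2 <= a"
			proof -
				have "T * (1 - a) <= T * (1 / 2)" using a(2) \<open>1 <= T * (1 / 2)\<close> by simp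
				then show ?thesis using T1 by simp
			qed
			have "ennreal (\<kappa> / 4) <= (\<integral>\<^sup>+r\<in>{0<..L}. ennreal ((a * \<phi> r)\<^sup>2) \<partial>lborel)"
			proof -
				note mm = square_kernel_measurable[OF phi_meas]
				have "ennreal (\<kappa> / 4) = ennreal (1 / 4) * ennreal \<kappa>" using \<kappa>(1) by (simp add: ennreal_mult'[symmetric])
				also have "... <= ennreal (1 / 4) * (\<integral>\<^sup>+r\<in>{0<..L}. ennreal ((\<phi> r)\<^sup>2) \<partial>lborel)" by (rule mult_left_mono[OF \<kappa>(2)]) simp
				also have "... = (\<integral>\<^sup>+r. ennreal (1 / 4) * (ennreal ((\<phi> r)\<^sup>2) * indicator {0<..L} r) \<partial>lborel)" using mm by (intro nn_integral_cmult[symmetric]) simp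
				also have "... <= (\<integral>\<^sup>+r\<in>{0<..L}. ennreal ((a * \<phi> r)\<^sup>2) \<partial>lborel)"
				proof (rule nn_integral_mono)
					fix r
					have "(1 / 2)\<^sup>2 * (\<phi> r)\<^sup>2 <= a\<^sup>2 * (\<phi> r)\<^sup>2" using a2 by (intro mult_right_mono power_mono) auto
					then have "ennreal (1 / 4) * ennreal ((\<phi> r)\<^sup>2) <= ennreal ((a * \<phi> r)\<^sup>2)"
						by (subst ennreal_mult'[symmetric]) (auto intro!: ennreal_leI simp: power_mult_distrib power_divide)
					then show "ennreal (1 / 4) * (ennreal ((\<phi> r)\<^sup>2) * indicator {0<..L} r) <= ennreal ((a * \<phi> r)\<^sup>2) * indicator {0<..L} r"
						by (auto simp: indicator_def)
				qed
				finally show ?thesis .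
			qed
			then have "ennreal c * (\<integral>\<^sup>+w. ennreal (1 / (l (T / 2) w)\<^sup>2) \<partial>P) <= ?R"
				unfolding c_def using True S b \<kappa>(1) order.trans[OF a_le b(2)]
				by (intro first_term_lower_bound L Y) auto
			note R = this
			have "ennreal (36 * ln (1 + T) / sqrt T * inv_moment) <= ennreal c * (\<integral>\<^sup>+w. ennreal (1 / (l (T / 2) w)\<^sup>2) \<partial>P) + ennreal (36 * A / sqrt T)"
				using T1 by (intro inv_moment_young c A) auto
			also have "... <= ?R + ennreal (36 * A / sqrt T)" using R by (rule add_right_mono)
			also have "... <= ?R + ennreal ((36 * A + 36 * ln (1 + S) / sqrt \<mu>) / sqrt T)"
				using Smu T1 by (intro add_left_mono ennreal_leI divide_right_mono) auto
			finally show ?thesis by (simp add: add.commute)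
		next
			case False
			\<comment> \<open>Below the threshold the logarithm is bounded, so the crude bound
			  \<open>1 / sqrt \<mu>\<close> on the moment is enough.\<close>
			have "36 * ln (1 + T) / sqrt T * inv_moment <= 36 * ln (1 + S) / sqrt T * (1 / sqrt \<mu>)"
				using False T inv_moment(2,3) by (intro mult_mono divide_right_mono) auto
			also have "... <= (36 * A + 36 * ln (1 + S) / sqrt \<mu>) / sqrt T"
			proof -
				have "36 * ln (1 + S) / sqrt T * (1 / sqrt \<mu>) = (36 * ln (1 + S) / sqrt \<mu>) / sqrt T" by simp
				also have "... <= (36 * A + 36 * ln (1 + S) / sqrt \<mu>) / sqrt T" using A T1 by (intro divide_right_mono) auto
				finally show ?thesis .
			qed
			finally show ?thesis by (intro add_increasing2 ennreal_leI) auto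
		qed
		note tail_le = this
		have "wasserstein P stat Q G <= ennreal ((36 / sqrt \<mu> + 2) / sqrt T + 36 * ln (1 + T) / sqrt T * inv_moment)"
			by (rule wasserstein_bound[OF normal])
		also have "... = ennreal ((36 / sqrt \<mu> + 2) / sqrt T) + ennreal (36 * ln (1 + T) / sqrt T * inv_moment)"
			using mu T inv_moment(2) by (intro ennreal_plus) auto
		also have "... <= ennreal ((36 / sqrt \<mu> + 2) / sqrt T) + (ennreal ((36 * A + 36 * ln (1 + S) / sqrt \<mu>) / sqrt T) + ?R)"
			by (rule add_left_mono[OF tail_le])
		also have "... = ennreal (C / sqrt T) + ?R"
		proof -
			have "C / sqrt T = (36 / sqrt \<mu> + 2) / sqrt T + (36 * A + 36 * ln (1 + S) / sqrt \<mu>) / sqrt T"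
				by (simp add: C_def add_divide_distrib)
			also have "ennreal ... = ennreal ((36 / sqrt \<mu> + 2) / sqrt T) + ennreal ((36 * A + 36 * ln (1 + S) / sqrt \<mu>) / sqrt T)"
				using mu T1 A Smu by (intro ennreal_plus) auto
			finally show ?thesis by (simp add: add.assoc)
		qed
		finally show ?thesis unfolding stat_def[abs_def] .
	qed
	show ?thesis
	proof (intro exI[of _ C] conjI C allI ballI impI)
		fix T a l Y assume "1 < (T::real)" "a \<in> {0<..<1::real}" "T * (1 - a) = 1" "hawkes_intensity P \<mu> (\<lambda>t. a * \<phi> t) T l"
			"cond_exp_process P T (shift_defect l T) Y"
		\<comment> \<open>The last two expectations enter as nonnegative summands.\<close>
		from add_increasing2[OF zero_le add_increasing2[OF zero_le main[OF this]]] show "wasserstein P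
			(\<lambda>w. compensated_integral ({0..T} \<times> {0..})
				 (\<lambda>(t, \<theta>). of_bool (\<theta> <= l t w) / sqrt (T * l t w)) w) Q G
		<= ennreal (C / sqrt T)
			+ ennreal (1 / T) *
					(\<integral>\<^sup>+w. (\<integral>\<^sup>+t\<in>{0..T}. ennreal (sqrt (l t w) * sqrt (Y t w)) \<partial>lborel) \<partial>P)
			+ ennreal (1 / T powr (3/2)) *
					(\<integral>\<^sup>+w. (\<integral>\<^sup>+t\<in>{0..T}. ennreal (sqrt (l t w) * Y t w) \<partial>lborel) \<partial>P)
			+ ennreal (2 / T powr (3/2)) *
					(\<integral>\<^sup>+w. (\<integral>\<^sup>+t\<in>{0..T}. ennreal (sqrt (shift_defect l T t w)) \<partial>lborel) \<partial>P)"
			.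
	qed
qed

end
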